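(* Let $k$ be a perfect field with algebraic closure $K=\overline{k}$, let $A$ be a finite-dimensional $k$-algebra, and let $A_K=K\otimes_k A$. If the Auslander–Reiten quiver $\Gamma_A$ has only finitely many connected components, then the Auslander–Reiten quiver $\Gamma_{A_K}$ has only finitely many connected components.
   Context: For a finite-dimensional algebra $B$ over a field, $\operatorname{mod} B$ is the category of finite-dimensional left $B$-modules. For $U,V\in\operatorname{mod} B$, the radical $\operatorname{rad}_B(U,V)$ is the set of morphisms $f:U\to V$ such that $1_U-gf$ is invertible for every $g:V\to U$; $\operatorname{rad}_B^2(U,V)$ is the subspace of $\operatorname{Hom}_B(U,V)$ spanned by all compositions $gf$ with $f\in\operatorname{rad}_B(U,W)$, $g\in\operatorname{rad}_B(W,V)$, $W\in\operatorname{mod} B$; and $\operatorname{Irr}_B(U,V)=\operatorname{rad}_B(U,V)/\operatorname{rad}_B^2(U,V)$. The Auslander–Reiten quiver $\Gamma_B$ has as vertices the isomorphism classes $[U]$ of indecomposable modules in $\operatorname{mod} B$, with an arrow from $[U]$ to $[V]$ precisely when $\operatorname{Irr}_B(U,V)\neq 0$ (valuations and multiplicities are ignored). Connected components of $\Gamma_B$ are those of the underlying unoriented graph. Here $A$ is an algebra over $k$ and $A_K$ is regarded as a finite-dimensional algebra over $K$. *)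

theory Defs
  imports "HOL-Algebra.Algebra"
begin

(* Characteristic 0, or characteristic p with surjective Frobenius map; in characteristic 0
   no prime p satisfies the premise. *)
definition perfect_field :: "('f, 'm) ring_scheme \<Rightarrow> bool" where
  "perfect_field F \<longleftrightarrow> field F \<and>
     (\<forall>p::nat. Factorial_Ring.prime p \<and> add_pow F p \<one>\<^bsub>F\<^esub> = \<zero>\<^bsub>F\<^esub> \<longrightarrow>
        (\<forall>x\<in>carrier F. \<exists>y\<in>carrier F. y [^]\<^bsub>F\<^esub> p = x))"

definition lin_span :: "('f, 'm) ring_scheme \<Rightarrow> ('f, 'v, 'n) module_scheme \<Rightarrow> 'v set \<Rightarrow> 'v set" where
  "lin_span F M S = \<Inter> {H. submodule H F M \<and> S \<subseteq> H}"

definition fin_dim :: "('f, 'm) ring_scheme \<Rightarrow> ('f, 'v, 'n) module_scheme \<Rightarrow> bool" where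
  "fin_dim F M \<longleftrightarrow> (\<exists>S. finite S \<and> S \<subseteq> carrier M \<and> lin_span F M S = carrier M)"

(* The library's locale algebra assumes commutative multiplication, and its locale module a
   commutative ring of scalars; hence the following two locales. *)

locale fin_dim_algebra = field F + module F A + A: ring A
  for F (structure) and A (structure) +
  assumes smult_mult_left:
      "\<lbrakk>c \<in> carrier F; a \<in> carrier A; b \<in> carrier A\<rbrakk> \<Longrightarrow>
        (c \<odot>\<^bsub>A\<^esub> a) \<otimes>\<^bsub>A\<^esub> b = c \<odot>\<^bsub>A\<^esub> (a \<otimes>\<^bsub>A\<^esub> b)"
    and smult_mult_right:
      "\<lbrakk>c \<in> carrier F; a \<in> carrier A; b \<in> carrier A\<rbrakk> \<Longrightarrow>
        a \<otimes>\<^bsub>A\<^esub> (c \<odot>\<^bsub>A\<^esub> b) = c \<odot>\<^bsub>A\<^esub> (a \<otimes>\<^bsub>A\<^esub> b)"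
    and fin_dim: "fin_dim F A"

locale left_module = B: ring B + abelian_group U
  for B :: "('a, 'm) ring_scheme" (structure) and U :: "('a, 'v, 'n) module_scheme" (structure) +
  assumes act_closed:
      "\<lbrakk>a \<in> carrier B; u \<in> carrier U\<rbrakk> \<Longrightarrow> a \<odot>\<^bsub>U\<^esub> u \<in> carrier U"
    and act_l_distr:
      "\<lbrakk>a \<in> carrier B; b \<in> carrier B; u \<in> carrier U\<rbrakk> \<Longrightarrow>
        (a \<oplus>\<^bsub>B\<^esub> b) \<odot>\<^bsub>U\<^esub> u = a \<odot>\<^bsub>U\<^esub> u \<oplus>\<^bsub>U\<^esub> b \<odot>\<^bsub>U\<^esub> u"
    and act_r_distr:
      "\<lbrakk>a \<in> carrier B; u \<in> carrier U; v \<in> carrier U\<rbrakk> \<Longrightarrow>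
        a \<odot>\<^bsub>U\<^esub> (u \<oplus>\<^bsub>U\<^esub> v) = a \<odot>\<^bsub>U\<^esub> u \<oplus>\<^bsub>U\<^esub> a \<odot>\<^bsub>U\<^esub> v"
    and act_assoc:
      "\<lbrakk>a \<in> carrier B; b \<in> carrier B; u \<in> carrier U\<rbrakk> \<Longrightarrow>
        (a \<otimes>\<^bsub>B\<^esub> b) \<odot>\<^bsub>U\<^esub> u = a \<odot>\<^bsub>U\<^esub> (b \<odot>\<^bsub>U\<^esub> u)"
    and act_one:
      "u \<in> carrier U \<Longrightarrow> \<one>\<^bsub>B\<^esub> \<odot>\<^bsub>U\<^esub> u = u"

(* The vector space underlying a B-module: c acts as c 1_B.
   The ring multiplication and unit of a record used as a module play no role. *)
definition underlying_space ::
    "('f, 'a, 'n) module_scheme \<Rightarrow> ('a, 'v) module \<Rightarrow> ('f, 'v) module" where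
  "underlying_space B U =
     \<lparr>carrier = carrier U, monoid.mult = monoid.mult U, one = one U,
      ring.zero = ring.zero U, ring.add = ring.add U, smult = (\<lambda>c u. (c \<odot>\<^bsub>B\<^esub> \<one>\<^bsub>B\<^esub>) \<odot>\<^bsub>U\<^esub> u)\<rparr>"

(* The objects of mod B. Their elements are taken from the type nat => 'f, where 'f is the type
   of the scalars; carriers are arbitrary subsets. This type contains a copy of F^n for every n
   (the functions with values in F vanishing off {..<n}), so every finite-dimensional B-module,
   over whatever type, is isomorphic to one in this set. *)
definition fd_mod ::
    "('f, 'm) ring_scheme \<Rightarrow> ('f, 'a, 'n) module_scheme \<Rightarrow> ('a, nat \<Rightarrow> 'f) module set" where
  "fd_mod F B = {U. left_module B U \<and> fin_dim F (underlying_space B U)}"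

(* Morphisms are extensional functions, so that equality of morphisms is equality in HOL;
   compose and restrict from FuncSet respect this. *)
definition mod_hom ::
    "('a, 'n) ring_scheme \<Rightarrow> ('a, 'v) module \<Rightarrow> ('a, 'w) module \<Rightarrow> ('v \<Rightarrow> 'w) set" where
  "mod_hom B U V = {f \<in> carrier U \<rightarrow>\<^sub>E carrier V.
     (\<forall>u\<in>carrier U. \<forall>u'\<in>carrier U. f (u \<oplus>\<^bsub>U\<^esub> u') = f u \<oplus>\<^bsub>V\<^esub> f u') \<and>
     (\<forall>a\<in>carrier B. \<forall>u\<in>carrier U. f (a \<odot>\<^bsub>U\<^esub> u) = a \<odot>\<^bsub>V\<^esub> f u)}"

definition hom_space ::
    "('f, 'a, 'n) module_scheme \<Rightarrow> ('a, 'v) module \<Rightarrow> ('a, 'w) module \<Rightarrow> ('f, 'v \<Rightarrow> 'w) module" where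
  "hom_space B U V =
     \<lparr>carrier = mod_hom B U V, monoid.mult = undefined, one = undefined,
      ring.zero = (\<lambda>u\<in>carrier U. \<zero>\<^bsub>V\<^esub>),
      ring.add = (\<lambda>f g. \<lambda>u\<in>carrier U. f u \<oplus>\<^bsub>V\<^esub> g u),
      smult = (\<lambda>c f. \<lambda>u\<in>carrier U. (c \<odot>\<^bsub>B\<^esub> \<one>\<^bsub>B\<^esub>) \<odot>\<^bsub>V\<^esub> f u)\<rparr>"

definition invertible_endo :: "('a, 'n) ring_scheme \<Rightarrow> ('a, 'v) module \<Rightarrow> ('v \<Rightarrow> 'v) \<Rightarrow> bool" where
  "invertible_endo B U h \<longleftrightarrow> h \<in> mod_hom B U U \<and>
     (\<exists>h'\<in>mod_hom B U U. compose (carrier U) h h' = (\<lambda>u\<in>carrier U. u) \<and>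
                         compose (carrier U) h' h = (\<lambda>u\<in>carrier U. u))"

definition rad ::
    "('a, 'n) ring_scheme \<Rightarrow> ('a, 'v) module \<Rightarrow> ('a, 'w) module \<Rightarrow> ('v \<Rightarrow> 'w) set" where
  "rad B U V = {f \<in> mod_hom B U V.
     \<forall>g\<in>mod_hom B V U. invertible_endo B U (\<lambda>u\<in>carrier U. u \<ominus>\<^bsub>U\<^esub> g (f u))}"

definition rad2 ::
    "('f, 'm) ring_scheme \<Rightarrow> ('f, 'a, 'n) module_scheme \<Rightarrow>
     ('a, nat \<Rightarrow> 'f) module \<Rightarrow> ('a, nat \<Rightarrow> 'f) module \<Rightarrow> ((nat \<Rightarrow> 'f) \<Rightarrow> (nat \<Rightarrow> 'f)) set" where
  "rad2 F B U V = lin_span F (hom_space B U V)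
     (\<Union>W\<in>fd_mod F B. {compose (carrier U) g f | f g. f \<in> rad B U W \<and> g \<in> rad B W V})"

(* Only the additive group of the quotient space is recorded, which suffices for Irr = 0. *)
definition Irr ::
    "('f, 'm) ring_scheme \<Rightarrow> ('f, 'a, 'n) module_scheme \<Rightarrow>
     ('a, nat \<Rightarrow> 'f) module \<Rightarrow> ('a, nat \<Rightarrow> 'f) module \<Rightarrow> ((nat \<Rightarrow> 'f) \<Rightarrow> (nat \<Rightarrow> 'f)) set monoid" where
  "Irr F B U V = (hom_space B U V)\<lparr>carrier := rad B U V\<rparr> A_Mod rad2 F B U V"

definition indecomposable :: "('a, 'n) ring_scheme \<Rightarrow> ('a, 'v) module \<Rightarrow> bool" where
  "indecomposable B U \<longleftrightarrow> carrier U \<noteq> {\<zero>\<^bsub>U\<^esub>} \<and>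
     (\<forall>P Q. submodule P B U \<and> submodule Q B U \<and>
        P <+>\<^bsub>U\<^esub> Q = carrier U \<and> P \<inter> Q = {\<zero>\<^bsub>U\<^esub>} \<longrightarrow> P = {\<zero>\<^bsub>U\<^esub>} \<or> Q = {\<zero>\<^bsub>U\<^esub>})"

definition iso_class ::
    "('f, 'm) ring_scheme \<Rightarrow> ('f, 'a, 'n) module_scheme \<Rightarrow>
     ('a, nat \<Rightarrow> 'f) module \<Rightarrow> ('a, nat \<Rightarrow> 'f) module set" where
  "iso_class F B U =
     {V \<in> fd_mod F B. \<exists>f\<in>mod_hom B U V. bij_betw f (carrier U) (carrier V)}"

(* A quiver without multiplicities is a pair (vertices, arrows). *)
type_synonym 'x quiver = "'x set \<times> ('x \<times> 'x) set"

definition AR_quiver ::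
    "('f, 'm) ring_scheme \<Rightarrow> ('f, 'a, 'n) module_scheme \<Rightarrow> ('a, nat \<Rightarrow> 'f) module set quiver" where
  "AR_quiver F B =
     (let ind = {U \<in> fd_mod F B. indecomposable B U}
      in (iso_class F B ` ind,
          {(iso_class F B U, iso_class F B V) | U V. U \<in> ind \<and> V \<in> ind \<and>
             carrier (Irr F B U V) \<noteq> {\<one>\<^bsub>Irr F B U V\<^esub>}}))"

definition connected_components :: "'x quiver \<Rightarrow> 'x set set" where
  "connected_components Q = fst Q // Restr ((snd Q \<union> (snd Q)\<inverse>)\<^sup>*) (fst Q)"

(* The tensor product of K and A over k: the free abelian group on K x A modulo the relations of
   k-balanced biadditivity. frag_of (x, a) represents the pure tensor of x and a. *)

definition tensor_relators ::
    "('f, 'm) ring_scheme \<Rightarrow> 'f set \<Rightarrow> ('f, 'a, 'n) module_scheme \<Rightarrow> (('f \<times> 'a) \<Rightarrow>\<^sub>0 int) set" where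
  "tensor_relators K k A =
     {frag_of (x \<oplus>\<^bsub>K\<^esub> y, a) - frag_of (x, a) - frag_of (y, a) | x y a.
        x \<in> carrier K \<and> y \<in> carrier K \<and> a \<in> carrier A} \<union>
     {frag_of (x, a \<oplus>\<^bsub>A\<^esub> b) - frag_of (x, a) - frag_of (x, b) | x a b.
        x \<in> carrier K \<and> a \<in> carrier A \<and> b \<in> carrier A} \<union>
     {frag_of (x \<otimes>\<^bsub>K\<^esub> c, a) - frag_of (x, c \<odot>\<^bsub>A\<^esub> a) | x c a.
        x \<in> carrier K \<and> c \<in> k \<and> a \<in> carrier A}"

definition tensor_mult ::
    "('f, 'm) ring_scheme \<Rightarrow> ('f, 'a, 'n) module_scheme \<Rightarrow>
     (('f \<times> 'a) \<Rightarrow>\<^sub>0 int) \<Rightarrow> (('f \<times> 'a) \<Rightarrow>\<^sub>0 int) \<Rightarrow> (('f \<times> 'a) \<Rightarrow>\<^sub>0 int)" where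
  "tensor_mult K A p q =
     frag_extend (\<lambda>(x, a). frag_extend (\<lambda>(y, b). frag_of (x \<otimes>\<^bsub>K\<^esub> y, a \<otimes>\<^bsub>A\<^esub> b)) q) p"

definition tensor_smult ::
    "('f, 'm) ring_scheme \<Rightarrow> 'f \<Rightarrow> (('f \<times> 'a) \<Rightarrow>\<^sub>0 int) \<Rightarrow> (('f \<times> 'a) \<Rightarrow>\<^sub>0 int)" where
  "tensor_smult K c p = frag_extend (\<lambda>(x, a). frag_of (c \<otimes>\<^bsub>K\<^esub> x, a)) p"

(* The unions over representatives are unions of equal cosets, as in the library's rcoset_mult. *)
definition scalar_extension ::
    "('f, 'm) ring_scheme \<Rightarrow> 'f set \<Rightarrow> ('f, 'a, 'n) module_scheme \<Rightarrow>
     ('f, (('f \<times> 'a) \<Rightarrow>\<^sub>0 int) set) module" where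
  "scalar_extension K k A =
     (let G = free_Abelian_group (carrier K \<times> carrier A);
          N = generate G (tensor_relators K k A)
      in \<lparr>carrier = carrier (G Mod N),
          monoid.mult = (\<lambda>P Q. \<Union>p\<in>P. \<Union>q\<in>Q. N #>\<^bsub>G\<^esub> tensor_mult K A p q),
          one = N #>\<^bsub>G\<^esub> frag_of (\<one>\<^bsub>K\<^esub>, \<one>\<^bsub>A\<^esub>),
          ring.zero = \<one>\<^bsub>G Mod N\<^esub>,
          ring.add = monoid.mult (G Mod N),
          smult = (\<lambda>c P. \<Union>p\<in>P. N #>\<^bsub>G\<^esub> tensor_smult K c p)\<rparr>)"

end

theory Submission
  imports Defs
begin

text \<open>
  Write \<open>M_K\<close> for the extension of an \<open>A\<close>-module \<open>M\<close> to \<open>A_K\<close>. Two facts carry the proof. Every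
  indecomposable \<open>A_K\<close>-module is a direct summand of \<open>M_K\<close> for an indecomposable \<open>M\<close>
  (\<open>indecomposable_summand_of_extension\<close>). And arrows lift: if there is an arrow from \<open>M\<close> to \<open>M'\<close>, then
  each indecomposable summand of \<open>M_K\<close> has an arrow to some indecomposable summand of \<open>M'_K\<close>, and each
  one of \<open>M'_K\<close> receives an arrow from one of \<open>M_K\<close> (\<open>arrow_from_summand\<close>, \<open>arrow_to_summand\<close>). So
  walks lift, and each component of the quiver of \<open>A_K\<close> meets the finite set of classes of
  indecomposable summands of \<open>M_K\<close>, where \<open>M\<close> runs through one module for each component of the quiver
  of \<open>A\<close>.

  Homomorphisms over \<open>A_K\<close> are compared with those over \<open>A\<close> by coefficients. A \<open>k\<close>-linear functional
  \<open>\<phi>\<close> on \<open>K\<close> induces an \<open>A\<close>-linear map from \<open>M_K\<close> to \<open>M\<close>, and thereby turns a homomorphism from \<open>M_K\<close>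
  to \<open>M'_K\<close> into one from \<open>M\<close> to \<open>M'\<close>; finitely many \<open>\<phi>\<close> suffice to recover the homomorphism. The decisive
  statement is that coefficients of radical homomorphisms out of or into \<open>M_K\<close> are radical if \<open>M\<close> is
  indecomposable (\<open>rad_coefficients_from\<close>, \<open>rad_coefficients_to\<close>). It implies that homomorphisms in
  the square of the radical, between extensions of indecomposable modules, have coefficients there. If
  then an arrow \<open>f\<close> from \<open>M\<close> to \<open>M'\<close> did not lift at a summand of \<open>M_K\<close> with projection \<open>e\<close>, the composition of \<open>f\<close> with every coefficient of \<open>e\<close> would lie in the square of the
  radical; but \<open>e\<close> is not nilpotent, hence has an invertible coefficient.

  The decisive statement amounts to the claim that \<open>D \<otimes> K\<close> has no nonzero nil ideals for the division ring
  \<open>D = End M / rad\<close>. In characteristic \<open>p\<close> a shortest element of a nil ideal has central coefficients, one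
  of them \<open>1\<close>, and stays nonzero under all powers of the Frobenius map, because over a perfect field this
  map carries linearly independent families to linearly independent families
  (\<open>nil_ideal_subset_coeff_ideal\<close>). In characteristic zero the trace of an element with a coefficient \<open>1\<close>
  is not zero (\<open>nilpotent_identity_coefficient\<close>). The same two arguments show that \<open>L \<otimes> K\<close> is reduced for
  a finite extension \<open>L\<close> of \<open>k\<close>. Since every \<open>A_K\<close>-module \<open>W\<close> is defined over such an \<open>L\<close>, it follows that
  \<open>W\<close> is a direct summand of the extension of its \<open>L\<close>-form (\<open>extended_summand\<close>).
\<close>

section \<open>Linear algebra over a field\<close>

text \<open>Operations of algebraic structures, with the structure as a subscript.\<close>

abbreviation add_in ("(_ +'__ _)" [65, 1000, 66] 65) where "x +_G y \<equiv> ring.add G x y"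
abbreviation mult_in ("(_ *'__ _)" [70, 1000, 71] 70) where "x *_G y \<equiv> monoid.mult G x y"
abbreviation minus_in ("(_ -'__ _)" [65, 1000, 66] 65) where "x -_G y \<equiv> a_minus G x y"
abbreviation neg_in ("(-'__ _)" [1000, 81] 80) where "-_G y \<equiv> a_inv G y"
abbreviation smult_in ("(_ \<odot>'__ _)" [70, 1000, 71] 70) where "x \<odot>_G y \<equiv> smult G x y"
abbreviation zero_in ("0'__" [1000] 1000) where "0_G \<equiv> ring.zero G"
abbreviation one_in ("1'__" [1000] 1000) where "1_G \<equiv> one G"

definition lin_func ::
  "('f, 'm) ring_scheme => ('f, 'v, 'n) module_scheme => ('v => 'f) set" where
 "lin_func F V = {\<phi>. \<phi> : carrier V \<rightarrow> carrier F \<and>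
  (ALL x:carrier V. ALL y:carrier V. \<phi> (x +_V y) = \<phi> x +_F \<phi> y) \<and>
  (ALL c:carrier F. ALL x:carrier V. \<phi> (c \<odot>_V x) = c *_F \<phi> x)}"

lemma lin_funcI:
 assumes "!!x. x : carrier V ==> \<phi> x : carrier F"
  and "!!x y. [|x : carrier V; y : carrier V|] ==> \<phi> (x +_V y) = \<phi> x +_F \<phi> y"
  and "!!c x. [|c : carrier F; x : carrier V|] ==> \<phi> (c \<odot>_V x) = c *_F \<phi> x"
 shows "\<phi> : lin_func F V"
 using assms unfolding lin_func_def by auto

lemma lin_func_closed: "[|\<phi> : lin_func F V; x : carrier V|] ==> \<phi> x : carrier F"
 and lin_func_add: "[|\<phi> : lin_func F V; x : carrier V; y : carrier V|] ==>
  \<phi> (x +_V y) = \<phi> x +_F \<phi> y"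
 and lin_func_smult: "[|\<phi> : lin_func F V; c : carrier F; x : carrier V|] ==>
  \<phi> (c \<odot>_V x) = c *_F \<phi> x"
 unfolding lin_func_def by auto

lemma (in abelian_group) a_inv_zero [simp]: "\<ominus> \<zero> = \<zero>"
 using r_neg[OF zero_closed] by simp

lemma (in abelian_group) a_minus_eq_zero_iff:
 assumes "x : carrier G" "y : carrier G"
 shows "x \<ominus> y = \<zero> \<longleftrightarrow> x = y"
 using assms unfolding minus_eq by (metis a_inv_closed minus_equality minus_minus r_neg)

lemma (in module) submodule_iff:
 "submodule H R M \<longleftrightarrow> H <= carrier M \<and> 0_M : H \<and> (ALL x:H. ALL y:H. x +_M y : H) \<and>
  (ALL c:carrier R. ALL x:H. c \<odot>_M x : H)"
proof
 assume H: "submodule H R M"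
 note E = submoduleE[OF H]
 obtain x where x: "x : H" using E(2) by blast
 then have "0_M = \<zero> \<odot>_M x" using E(1) by auto
 then have "0_M : H" using E(4) x by auto
 then show "H <= carrier M \<and> 0_M : H \<and> (ALL x:H. ALL y:H. x +_M y : H) \<and>
  (ALL c:carrier R. ALL x:H. c \<odot>_M x : H)"
  using E by blast
next
 assume H: "H <= carrier M \<and> 0_M : H \<and> (ALL x:H. ALL y:H. x +_M y : H) \<and>
  (ALL c:carrier R. ALL x:H. c \<odot>_M x : H)"
 have "-_M x : H" if "x : H" for x
 proof -
  have "-_M x = (\<ominus> \<one>) \<odot>_M x" using H that by (subst smult_l_minus) auto
  then show ?thesis using H that by auto
 qed
 then show "submodule H R M" using H by (intro submoduleI) auto
qed

lemma (in module) submodule_finsum: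
 assumes "submodule H R M" "!!i. i : I ==> f i : H" "finite I"
 shows "finsum M f I : H"
 using assms(3,2)
proof (induction I rule: finite_induct)
 case empty
 then show ?case using assms(1) by (simp add: submodule_iff)
next
 case (insert i I)
 have "f : I \<rightarrow> carrier M" "f i : carrier M"
  using insert assms(1) by (auto simp: submodule_iff)
 then show ?case using insert assms(1) by (auto simp: submodule_iff)
qed

locale vspace = R?: field F + module F V for F (structure) and V (structure)
begin

lemmas lf_closed = lin_func_closed[where F = F and V = V]
 and lf_add = lin_func_add[where F = F and V = V]
 and lf_smult = lin_func_smult[where F = F and V = V]

lemma lin_func_zero: "\<phi> : lin_func F V ==> \<phi> 0_V = \<zero>"
 using lf_smult[of \<phi> \<zero> "0_V"] lf_closed[of \<phi> "0_V"] by simp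

lemma lin_func_minus:
 assumes "\<phi> : lin_func F V" "x : carrier V"
 shows "\<phi> (-_V x) = \<ominus> \<phi> x"
proof -
 have "-_V x = (\<ominus> \<one>) \<odot>_V x" using assms by (subst smult_l_minus) auto
 then show ?thesis using assms lf_smult[OF assms(1), of "\<ominus> \<one>" x] lf_closed[OF assms]
  by (simp add: l_minus)
qed

lemma lin_func_finsum:
 assumes "\<phi> : lin_func F V" "finite I" "f : I \<rightarrow> carrier V"
 shows "\<phi> (finsum V f I) = finsum F (%i. \<phi> (f i)) I"
 using assms(2,3)
proof (induction I rule: finite_induct)
 case empty
 then show ?case using lin_func_zero assms by simp
next
 case (insert i I)
 then have "f : I \<rightarrow> carrier V" "f i : carrier V" by auto
 then show ?case using insert lf_closed[OF assms(1)]
  by (simp add: lf_add[OF assms(1)] Pi_iff)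
qed

text \<open>The coordinate of \<open>x\<close> along \<open>r\<close> with respect to a complement of the line of \<open>r\<close>; a subspace
 that is maximal among those avoiding \<open>r\<close> is such a complement.\<close>

lemma lin_func_separates:
 assumes r: "r : carrier V" "r ~= 0_V"
 obtains \<phi> where "\<phi> : lin_func F V" "\<phi> r = \<one>"
proof -
 let ?A = "{H. submodule H F V \<and> r \<notin> H}"
 have "EX M:?A. ALL H:?A. M <= H --> H = M"
 proof (rule subset_Zorn_nonempty)
  have "submodule {0_V} F V" unfolding submodule_iff by auto
  then show "?A ~= {}" using r by blast
  fix C assume C: "C ~= {}" "subset.chain ?A C"
  then have CA: "!!H. H : C ==> submodule H F V \<and> r \<notin> H" 
   and lin: "!!H H'. [|H : C; H' : C|] ==> H <= H' \<or> H' <= H"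
   unfolding subset_chain_def by auto
  have "submodule (\<Union>C) F V" unfolding submodule_iff
  proof (intro conjI ballI)
   show "\<Union>C <= carrier V" using CA unfolding submodule_iff by blast
   show "0_V : \<Union>C" using CA C(1) unfolding submodule_iff by blast
   fix x y assume "x : \<Union>C" "y : \<Union>C"
   then obtain H where "H : C" "x : H" "y : H" using lin by blast
   then show "x +_V y : \<Union>C" using CA unfolding submodule_iff by blast
  next
   fix c x assume "c : carrier F" "x : \<Union>C"
   then show "c \<odot>_V x : \<Union>C" using CA unfolding submodule_iff by blast
  qed
  then show "\<Union>C : ?A" using CA by blast
 qed
 then obtain H where H: "submodule H F V" "r \<notin> H"
  and max: "!!H'. [|submodule H' F V; r \<notin> H'; H <= H'|] ==> H' = H" by blast
 note HE = H(1)[unfolded submodule_iff]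
 have HX: "!!x. x : H ==> x : carrier V" using HE by blast
 have Hneg: "!!x. x : H ==> -_V x : H" using submoduleE(3)[OF H(1)] .
 have ex: "EX c:carrier F. x -_V c \<odot>_V r : H" if x: "x : carrier V" for x
 proof (cases "x : H")
  case True
  then have "x -_V \<zero> \<odot>_V r : H" using r x by (simp add: M.minus_eq)
  then show ?thesis by blast
 next
  case False
  let ?H = "{h +_V c \<odot>_V x | h c. h : H \<and> c : carrier F}"
  have "submodule ?H F V" unfolding submodule_iff
  proof (intro conjI ballI)
   show "?H <= carrier V" using HX x by auto
   have "0_V = 0_V +_V \<zero> \<odot>_V x" using x by simp
   then show "0_V : ?H" using HE by blast
   fix u v assume "u : ?H" "v : ?H"
   then obtain h c h' c' where *: "u = h +_V c \<odot>_V x" "v = h' +_V c' \<odot>_V x"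
    "h : H" "h' : H" "c : carrier F" "c' : carrier F" by blast
   then have "u +_V v = (h +_V h') +_V (c \<oplus> c') \<odot>_V x"
    using HX x by (simp add: smult_l_distr M.a_ac)
   moreover have "h +_V h' : H" "c \<oplus> c' : carrier F" using * HE by auto
   ultimately show "u +_V v : ?H" by blast
  next
   fix d u assume d: "d : carrier F" and "u : ?H"
   then obtain h c where *: "u = h +_V c \<odot>_V x" "h : H" "c : carrier F" by blast
   then have "d \<odot>_V u = d \<odot>_V h +_V (d \<otimes> c) \<odot>_V x"
    using HX x d by (simp add: smult_r_distr smult_assoc1)
   moreover have "d \<odot>_V h : H" "d \<otimes> c : carrier F" using * HE d by auto
   ultimately show "d \<odot>_V u : ?H" by blast
  qed
  moreover have "H <= ?H"
  proof
   fix h assume "h : H"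
   moreover have "h = h +_V \<zero> \<odot>_V x" using x HX \<open>h : H\<close> by simp
   ultimately show "h : ?H" by blast
  qed
  moreover have "x : ?H"
  proof -
   have "x = 0_V +_V \<one> \<odot>_V x" using x by simp
   then show ?thesis using HE by blast
  qed
  ultimately have "r : ?H" using max False by blast
  then obtain h c where *: "r = h +_V c \<odot>_V x" "h : H" "c : carrier F" by blast
  have "c ~= \<zero>" using * H(2) HX x by auto
  then have c: "c : Units F" using * by (simp add: field_Units)
  have "inv c \<odot>_V r = inv c \<odot>_V h +_V x"
   using * HX x c by (simp add: smult_r_distr smult_assoc1[symmetric])
  then have "x -_V inv c \<odot>_V r = -_V (inv c \<odot>_V h)"
   using * HX x c by (simp add: M.minus_eq M.minus_add M.a_ac M.r_neg1 M.r_neg2)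
  then show ?thesis using * HE Hneg c by (metis Units_inv_closed)
 qed
 have uniq: "c = c'" if "c : carrier F" "c' : carrier F" "x : carrier V"
   "x -_V c \<odot>_V r : H" "x -_V c' \<odot>_V r : H" for x c c'
 proof (rule ccontr)
  assume "c ~= c'"
  then have d: "c \<ominus> c' : Units F" using that by (simp add: field_Units)
  have "(x -_V c' \<odot>_V r) +_V (-_V (x -_V c \<odot>_V r)) : H" using that HE Hneg by blast
  also have "(x -_V c' \<odot>_V r) +_V (-_V (x -_V c \<odot>_V r)) = (c \<ominus> c') \<odot>_V r"
   using that r by (simp add: M.minus_eq M.minus_add M.a_ac smult_l_distr smult_l_minus R.minus_eq M.r_neg1 M.r_neg2)
  finally have "inv (c \<ominus> c') \<odot>_V ((c \<ominus> c') \<odot>_V r) : H" using HE d by (metis Units_inv_closed)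
  then have "r : H" using d r that by (simp add: smult_assoc1[symmetric])
  then show False using H by blast
 qed
 define \<phi> where "\<phi> = (%x. THE c. c : carrier F \<and> x -_V c \<odot>_V r : H)"
 have \<phi>1: "\<phi> x = c" if "x : carrier V" "c : carrier F" "x -_V c \<odot>_V r : H" for x c
  unfolding \<phi>_def using that uniq by blast
 have \<phi>2: "\<phi> x : carrier F \<and> x -_V \<phi> x \<odot>_V r : H" if "x : carrier V" for x
  using ex[OF that] \<phi>1[OF that] by auto
 have "\<phi> : lin_func F V"
 proof (rule lin_funcI)
  show "!!x. x : carrier V ==> \<phi> x : carrier F" using \<phi>2 by blast
  fix x y assume xy: "x : carrier V" "y : carrier V"
  have "(x -_V \<phi> x \<odot>_V r) +_V (y -_V \<phi> y \<odot>_V r) : H" using xy \<phi>2 HE by blast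
  also have "(x -_V \<phi> x \<odot>_V r) +_V (y -_V \<phi> y \<odot>_V r) = (x +_V y) -_V (\<phi> x \<oplus> \<phi> y) \<odot>_V r"
   using xy r \<phi>2 by (simp add: M.minus_eq M.minus_add M.a_ac smult_l_distr)
  finally show "\<phi> (x +_V y) = \<phi> x \<oplus> \<phi> y" using \<phi>1 xy \<phi>2 by simp
 next
  fix c x assume cx: "c : carrier F" "x : carrier V"
  have "c \<odot>_V (x -_V \<phi> x \<odot>_V r) : H" using cx \<phi>2 HE by blast
  also have "c \<odot>_V (x -_V \<phi> x \<odot>_V r) = (c \<odot>_V x) -_V (c \<otimes> \<phi> x) \<odot>_V r"
   using cx r \<phi>2 by (simp add: M.minus_eq smult_r_distr smult_assoc1 smult_r_minus)
  finally show "\<phi> (c \<odot>_V x) = c \<otimes> \<phi> x" using \<phi>1 cx \<phi>2 by simp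
 qed
 moreover have "\<phi> r = \<one>" using r HE by (intro \<phi>1) (auto simp: M.r_neg M.minus_eq)
 ultimately show thesis using that by blast
qed

text \<open>Dual families replace bases. They make sense in spaces of infinite dimension too, such as \<open>K\<close> over
 \<open>k\<close>, and their projections are defined everywhere.\<close>

definition dual_family :: "nat => (nat => 'c) => (nat => 'c => 'a) => bool" where
 "dual_family n w c \<longleftrightarrow> (ALL i<n. w i : carrier V \<and> c i : lin_func F V) \<and>
  (ALL i<n. ALL j<n. c i (w j) = (if i = j then \<one> else \<zero>))"

definition dual_proj :: "nat => (nat => 'c) => (nat => 'c => 'a) => 'c => 'c" where
 "dual_proj n w c x = (finsum V (%i. c i x \<odot>_V w i) {..<n})"

lemma dual_familyD:
 assumes "dual_family n w c" "i < n"
 shows "w i : carrier V" "c i : lin_func F V" "j < n ==> c i (w j) = (if i = j then \<one> else \<zero>)"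
 using assms unfolding dual_family_def by auto

lemma dual_proj_terms:
 assumes "dual_family n w c" "x : carrier V"
 shows "(%i. c i x \<odot>_V w i) : {..<n} \<rightarrow> carrier V"
 using assms dual_familyD[OF assms(1)] lf_closed by fastforce

lemma dual_proj_closed:
 "[|dual_family n w c; x : carrier V|] ==> dual_proj n w c x : carrier V"
 unfolding dual_proj_def using dual_proj_terms by (intro M.finsum_closed)

lemma dual_proj_add:
 assumes "dual_family n w c" "x : carrier V" "y : carrier V"
 shows "dual_proj n w c (x +_V y) = dual_proj n w c x +_V dual_proj n w c y"
proof -
 have "dual_proj n w c (x +_V y) = (finsum V (%i. c i x \<odot>_V w i +_V c i y \<odot>_V w i) {..<n})"
  unfolding dual_proj_def using assms dual_familyD[OF assms(1)]
  by (intro M.finsum_cong') (auto simp: lf_add lf_closed smult_l_distr)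
 then show ?thesis unfolding dual_proj_def
  using M.finsum_addf[OF dual_proj_terms[OF assms(1,2)] dual_proj_terms[OF assms(1,3)]] by simp
qed

lemma dual_proj_smult:
 assumes "dual_family n w c" "d : carrier F" "x : carrier V"
 shows "dual_proj n w c (d \<odot>_V x) = d \<odot>_V dual_proj n w c x"
proof -
 have "dual_proj n w c (d \<odot>_V x) = (finsum V (%i. d \<odot>_V (c i x \<odot>_V w i)) {..<n})"
  unfolding dual_proj_def using assms dual_familyD[OF assms(1)]
  by (intro M.finsum_cong') (auto simp: lf_smult lf_closed smult_assoc1)
 then show ?thesis unfolding dual_proj_def
  using finsum_smult_ldistr[OF _ assms(2) dual_proj_terms[OF assms(1,3)]] by simp
qed

lemma dual_proj_zero: "dual_family n w c ==> dual_proj n w c 0_V = 0_V"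
 using dual_proj_smult[of n w c \<zero> "0_V"] dual_proj_closed[of n w c "0_V"] by simp

lemma dual_proj_coord:
 assumes "dual_family n w c" "j < n" "x : carrier V"
 shows "c j (dual_proj n w c x) = c j x"
proof -
 note D = dual_familyD[OF assms(1)]
 have "c j (dual_proj n w c x) = (\<Oplus>i\<in>{..<n}. c j (c i x \<odot>_V w i))"
  unfolding dual_proj_def
  by (rule lin_func_finsum) (use D assms dual_proj_terms[OF assms(1,3)] in auto)
 also have "... = (\<Oplus>i\<in>{..<n}. if j = i then c i x else \<zero>)"
  using assms D lf_closed[OF D(2)]
  by (intro R.finsum_cong') (auto simp: lf_smult)
 also have "... = c j x"
  using R.finsum_singleton[of j "{..<n}" "%i. c i x"] assms lf_closed[OF D(2)] by auto
 finally show ?thesis .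
qed

lemma dual_proj_fixed_submodule:
 assumes "dual_family n w c"
 shows "submodule {x : carrier V. dual_proj n w c x = x} F V"
 unfolding submodule_iff using dual_proj_add[OF assms] dual_proj_smult[OF assms] dual_proj_zero[OF assms]
 by auto

lemma finsum_lessThan_Suc:
 assumes "abelian_monoid G" "f : {..<Suc n} \<rightarrow> carrier G"
 shows "finsum G f {..<Suc n} = f n +_G finsum G f {..<n}"
proof -
 interpret G: abelian_monoid G by fact
 show ?thesis unfolding lessThan_Suc using assms by (intro G.finsum_insert) auto
qed

text \<open>Vectors are added one at a time: if \<open>x\<close> is not reproduced, its defect is a new vector, and a
 functional that is \<open>\<one>\<close> there becomes dual to it after composition with the complementary
 projection.\<close>

lemma dual_family_exists:
 assumes "finite S" "S <= carrier V"
 obtains n w c where "dual_family n w c" "n <= card S"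
  "!!x. x : S ==> dual_proj n w c x = x"
  "!!H i. [|submodule H F V; S <= H; i < n|] ==> w i : H"
proof -
 have "EX n w c. dual_family n w c \<and> n <= card S \<and> (ALL x:S. dual_proj n w c x = x) \<and>
   (ALL H. submodule H F V --> S <= H --> (ALL i<n. w i : H))"
  using assms
 proof (induction S rule: finite_induct)
  case empty
  have "dual_family 0 (%_. 0_V) (%_ _. \<zero>)" unfolding dual_family_def by simp
  then show ?case by (intro exI[of _ 0]) auto
 next
  case (insert x S)
  then obtain n w c where D: "dual_family n w c" and n: "n <= card S"
   and fx: "!!y. y : S ==> dual_proj n w c y = y"
   and sp: "!!H i. [|submodule H F V; S <= H; i < n|] ==> w i : H" by auto
  have x: "x : carrier V" and S: "S <= carrier V" using insert by auto
  define P where "P = dual_proj n w c"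
  note DD = dual_familyD[OF D]
  note Pc = dual_proj_closed[OF D, folded P_def]
  define r where "r = x -_V P x"
  show ?case
  proof (cases "P x = x")
   case True
   then show ?thesis using D n fx sp insert(1,2) unfolding P_def
    by (intro exI[of _ n] exI[of _ w] exI[of _ c]) auto
  next
   case False
   have r: "r : carrier V" unfolding r_def using x Pc by simp
   have rx: "x = r +_V P x" unfolding r_def using x Pc
    by (simp add: M.minus_eq M.a_assoc M.l_neg)
   have "r ~= 0_V" using rx False Pc x by auto
   then obtain \<psi> where \<psi>: "\<psi> : lin_func F V" "\<psi> r = \<one>" using lin_func_separates r by blast
   note \<psi>c = lf_closed[OF \<psi>(1)]
   have Pr: "c i r = \<zero>" if "i < n" for i
   proof -
    note L = DD(2)[OF that]
    have "c i r \<oplus> c i x = \<zero> \<oplus> c i x"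
     using rx dual_proj_coord[OF D that x, folded P_def] lf_add[OF L r Pc[OF x]]
      lf_closed[OF L] x r by simp
    then show ?thesis using lf_closed[OF L] x r by (metis R.add.r_cancel R.zero_closed)
   qed
   define \<chi> where "\<chi> = (%y. \<psi> y \<ominus> \<psi> (P y))"
   have \<chi>: "\<chi> : lin_func F V"
   proof (rule lin_funcI)
    show "!!y. y : carrier V ==> \<chi> y : carrier F" unfolding \<chi>_def using \<psi>c Pc by simp
    show "!!y z. [|y : carrier V; z : carrier V|] ==> \<chi> (y +_V z) = \<chi> y \<oplus> \<chi> z"
     unfolding \<chi>_def using \<psi>c Pc dual_proj_add[OF D, folded P_def]
     by (simp add: lf_add[OF \<psi>(1)] R.minus_eq R.minus_add R.a_ac)
    show "!!d y. [|d : carrier F; y : carrier V|] ==> \<chi> (d \<odot>_V y) = d \<otimes> \<chi> y"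
     unfolding \<chi>_def using \<psi>c Pc dual_proj_smult[OF D, folded P_def]
     by (simp add: lf_smult[OF \<psi>(1)] R.minus_eq r_distr r_minus)
   qed
   have Pr0: "P r = 0_V"
   proof -
    have "P r = (finsum V (%i. 0_V) {..<n})" unfolding P_def dual_proj_def
     using Pr DD by (intro M.finsum_cong') auto
    then show ?thesis using M.finsum_zero by simp
   qed
   have \<chi>r: "\<chi> r = \<one>" unfolding \<chi>_def using Pr0 \<psi> lin_func_zero[OF \<psi>(1)] by (simp add: R.minus_eq)
   have Pfix: "P y = y ==> y : carrier V ==> \<chi> y = \<zero>" for y
    unfolding \<chi>_def using \<psi>c by (simp add: R.minus_eq R.r_neg)
   have Pw: "P (w j) = w j" if "j < n" for j
   proof -
    have "P (w j) = (finsum V (%i. if j = i then w i else 0_V) {..<n})" unfolding P_def dual_proj_def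
     using DD that by (intro M.finsum_cong') auto
    also have "... = w j" using M.finsum_singleton[of j "{..<n}" w] that DD by auto
    finally show ?thesis .
   qed
   define w' c' where "w' = w(n := r)" and "c' = c(n := \<chi>)"
   then have n': "w' n = r" "c' n = \<chi>" and i': "!!i. i < n ==> w' i = w i" "!!i. i < n ==> c' i = c i"
    by auto
   have D': "dual_family (Suc n) w' c'"
    unfolding dual_family_def
   proof (intro conjI allI impI)
    show "w' i : carrier V" "c' i : lin_func F V" if "i < Suc n" for i
     using that DD r \<chi> n' i' by (auto simp: less_Suc_eq)
    show "c' i (w' j) = (if i = j then \<one> else \<zero>)" if ij: "i < Suc n" "j < Suc n" for i j
    proof -
     consider "i < n" "j < n" | "i < n" "j = n" | "i = n" "j < n" | "i = n" "j = n"
      using ij unfolding less_Suc_eq by blast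
     then show ?thesis
     proof cases
      case 1
      then show ?thesis using DD(3) i' by simp
     next
      case 2
      then show ?thesis using Pr n' i' by simp
     next
      case 3
      then show ?thesis using Pfix[OF Pw DD(1)] n' i' by simp
     next
      case 4
      then show ?thesis using n' \<chi>r by simp
     qed
    qed
   qed
   have pr: "dual_proj (Suc n) w' c' y = \<chi> y \<odot>_V r +_V P y" if "y : carrier V" for y
   proof -
    have "(finsum V (%i. c' i y \<odot>_V w' i) {..<n}) = P y" unfolding P_def dual_proj_def
     using dual_proj_terms[OF D that] i' by (intro M.finsum_cong') auto
    then show ?thesis
     unfolding dual_proj_def
     using finsum_lessThan_Suc[OF M.abelian_monoid_axioms dual_proj_terms[OF D' that]] n' by simp
   qed
   have "\<chi> x = \<one>"
   proof -
    have "\<chi> x = \<chi> r \<oplus> \<chi> (P x)" using rx lf_add[OF \<chi> r Pc[OF x]] by simp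
    moreover have "P (P x) = P x" 
     unfolding P_def dual_proj_def[of n w c "dual_proj n w c x"]
     by (subst dual_proj_def[of n w c x], rule M.finsum_cong')
      (use dual_proj_coord[OF D _ x] dual_proj_terms[OF D x] in auto)
    ultimately show ?thesis using Pfix[OF _ Pc[OF x]] \<chi>r by simp
   qed
   then have px: "dual_proj (Suc n) w' c' x = x" using pr[OF x] rx r by simp
   have py: "dual_proj (Suc n) w' c' y = y" if "y : S" for y
    using pr[of y] fx[OF that, folded P_def] Pfix[of y] that S r by auto
   have "w' i : H" if "submodule H F V" "insert x S <= H" "i < Suc n" for H i
   proof (cases "i = n")
    case True
    have "P x : H" unfolding P_def dual_proj_def
     using sp[OF that(1)] that(2) lf_closed[OF DD(2) x] that(1)
     by (intro submodule_finsum[OF that(1)]) (auto simp: submodule_iff)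
    then have "r : H" unfolding r_def M.minus_eq 
     using that(2) submoduleE(5)[OF that(1), of x "-_V P x"] submoduleE(3)[OF that(1)] by blast
    then show ?thesis using True n' by simp
   next
    case False
    then show ?thesis using sp[OF that(1)] that i' by simp
   qed
   then have "ALL H. submodule H F V --> insert x S <= H --> (ALL i<Suc n. w' i : H)" by blast
   moreover have "Suc n <= card (insert x S)" using n insert(1,2) by simp
   moreover have "ALL y:insert x S. dual_proj (Suc n) w' c' y = y" using px py by blast
   ultimately show ?thesis using D' by (intro exI conjI)
  qed
 qed
 then obtain n w c where "dual_family n w c" "n <= card S" "ALL x:S. dual_proj n w c x = x"
   "ALL H. submodule H F V --> S <= H --> (ALL i<n. w i : H)" by (elim exE conjE)
 then show thesis using that[of n w c] by blast
qed

lemma fin_dim_dual_basis: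
 assumes "fin_dim F V"
 obtains n w c where "dual_family n w c" "!!x. x : carrier V ==> dual_proj n w c x = x"
proof -
 obtain S where S: "finite S" "S <= carrier V" "lin_span F V S = carrier V"
  using assms unfolding fin_dim_def by blast
 obtain n w c where D: "dual_family n w c" and fx: "!!x. x : S ==> dual_proj n w c x = x"
   and "n <= card S" "!!H i. [|submodule H F V; S <= H; i < n|] ==> w i : H"
  by (rule dual_family_exists[OF S(1,2)]) blast
 have "lin_span F V S <= {x : carrier V. dual_proj n w c x = x}"
  unfolding lin_span_def using dual_proj_fixed_submodule[OF D] fx S(2) by blast
 then show thesis using S(3) by (intro that[OF D]) blast
qed

text \<open>Finite dimension enters mostly through chain conditions. For these it is enough that finitely
 many functionals separate points: the positions at which the elements of a subspace can have
 their first nonzero value (the pivots of an echelon form) determine the subspace among the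
 subspaces that contain it.\<close>

definition fin_separated :: bool where
 "fin_separated \<longleftrightarrow> (EX N \<gamma>. (ALL i<(N::nat). \<gamma> i : lin_func F V) \<and>
  (ALL x:carrier V. (ALL i<N. \<gamma> i x = \<zero>) --> x = 0_V))"

lemma fin_dim_imp_fin_separated: "fin_dim F V ==> fin_separated"
proof -
 assume "fin_dim F V"
 from fin_dim_dual_basis[OF this]
 obtain n w c where D: "dual_family n w c" and fx: "!!x. x : carrier V ==> dual_proj n w c x = x"
  by blast
 have "x = 0_V" if "x : carrier V" "ALL i<n. c i x = \<zero>" for x
 proof -
  have "dual_proj n w c x = (finsum V (%i. 0_V) {..<n})" unfolding dual_proj_def
   using that dual_familyD[OF D] by (intro M.finsum_cong') auto
  then show ?thesis using M.finsum_zero fx that by simp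
 qed
 then show ?thesis unfolding fin_separated_def using dual_familyD(2)[OF D] by blast
qed

lemma subspace_rank:
 assumes fin_separated
 obtains rk :: "'c set => nat" and N where
  "!!H H'. [|submodule H F V; submodule H' F V; H \<subset> H'|] ==> rk H < rk H'"
  "!!H. rk H <= N"
proof -
 obtain N :: nat and \<gamma> where \<gamma>: "!!i. i < N ==> \<gamma> i : lin_func F V"
  and sep: "!!x. [|x : carrier V; ALL i<N. \<gamma> i x = \<zero>|] ==> x = 0_V"
  using assms unfolding fin_separated_def by blast
 define piv where "piv H = {j. j < N \<and> (EX h:H. \<gamma> j h = \<one> \<and> (ALL i<j. \<gamma> i h = \<zero>))}" for H
 have fin: "piv H <= {..<N}" "finite (piv H)" for H unfolding piv_def by auto
 have eq: "H' <= H" if H: "submodule H F V" "submodule H' F V" "H <= H'" and p: "piv H' <= piv H" for H H'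
 proof
  fix x assume x: "x : H'"
  note E = H(1)[unfolded submodule_iff] and E' = H(2)[unfolded submodule_iff]
  have xV: "x : carrier V" using x E' by blast
  have "EX h:H. ALL i<j. \<gamma> i (x -_V h) = \<zero>" if "j <= N" for j
   using that
  proof (induction j)
   case 0
   then show ?case using E by blast
  next
   case (Suc j)
   then obtain h where h: "h : H" "!!i. i < j ==> \<gamma> i (x -_V h) = \<zero>" by auto
   define y where "y = x -_V h"
   have hV: "h : carrier V" using h E by blast
   have y: "y : carrier V" unfolding y_def using hV xV by simp
   have yH: "y : H'" unfolding y_def M.minus_eq using h(1) x H(3) E' submoduleE(3)[OF H(2)] by blast
   have jN: "j < N" using Suc by simp
   show ?case
   proof (cases "\<gamma> j y = \<zero>")
    case True
    then show ?thesis using h less_Suc_eq unfolding y_def by auto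
   next
    case False
    define a where "a = \<gamma> j y"
    have a: "a : Units F" "a : carrier F"
     unfolding a_def using False lf_closed[OF \<gamma>[OF jN] y] by (auto simp: field_Units)
    have "inv a \<odot>_V y : H'" using a yH E' by (metis Units_inv_closed)
    moreover have "\<gamma> j (inv a \<odot>_V y) = \<one>"
     using lf_smult[OF \<gamma>[OF jN]] a y unfolding a_def[symmetric]
     by (metis Units_inv_closed Units_l_inv a_def)
    moreover have "\<gamma> i (inv a \<odot>_V y) = \<zero>" if "i < j" for i
     using lf_smult[OF \<gamma>, of i "inv a" y] h(2)[OF that] a y jN that unfolding y_def[symmetric]
     by simp
    ultimately have "j : piv H'" unfolding piv_def using jN by blast
    then obtain g where g: "g : H" "\<gamma> j g = \<one>" "!!i. i < j ==> \<gamma> i g = \<zero>" using p unfolding piv_def by blast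
    have gV: "g : carrier V" using g E by blast
    have e: "x -_V (h +_V a \<odot>_V g) = y +_V (\<ominus> a) \<odot>_V g"
     unfolding y_def using xV hV gV a by (simp add: M.minus_eq M.minus_add M.a_ac smult_l_minus)
    have v: "\<gamma> i (y +_V (\<ominus> a) \<odot>_V g) = \<gamma> i y \<oplus> (\<ominus> a) \<otimes> \<gamma> i g" if "i < N" for i
     using lf_add[OF \<gamma>[OF that]] lf_smult[OF \<gamma>[OF that]] y gV a by simp
    have "\<gamma> i (x -_V (h +_V a \<odot>_V g)) = \<zero>" if "i < Suc j" for i
    proof (cases "i = j")
     case True
     then show ?thesis unfolding e using v[OF jN] g a unfolding a_def[symmetric] by (simp add: R.r_neg)
    next
     case False
     then show ?thesis unfolding e using v[of i] that jN g h(2)[of i, folded y_def] a by simp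
    qed
    moreover have "h +_V a \<odot>_V g : H" using h g E a by blast
    ultimately show ?thesis by blast
   qed
  qed
  then obtain h where h: "h : H" "ALL i<N. \<gamma> i (x -_V h) = \<zero>" by blast
  then have "h : carrier V" using E by blast
  then have "x = h" using sep[of "x -_V h"] h xV M.a_minus_eq_zero_iff by simp
  then show "x : H" using h by simp
 qed
 show thesis
 proof (rule that[of "%H. card (piv H)" N])
  show "card (piv H) <= N" for H using card_mono[OF _ fin(1)] by simp
  fix H H' assume H: "submodule H F V" "submodule H' F V" "H \<subset> H'"
  then have "piv H <= piv H'" unfolding piv_def by blast
  moreover have "\<not> piv H' <= piv H" using eq[OF H(1,2)] H(3) by blast
  ultimately have "piv H \<subset> piv H'" by blast
  then show "card (piv H) < card (piv H')" using fin by (intro psubset_card_mono) auto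
 qed
qed

lemma descending_subspaces_stabilize:
 assumes fin_separated "!!n::nat. submodule (H n) F V" "!!n. H (Suc n) <= H n"
 obtains n where "H (Suc n) = H n"
proof -
 obtain rk :: "'c set => nat" and N where
  rk: "!!H H'. [|submodule H F V; submodule H' F V; H \<subset> H'|] ==> rk H < rk H'"
  and "!!H. rk H <= N"
  by (rule subspace_rank[OF assms(1)]) blast
 have "EX n. H (Suc n) = H n"
 proof (rule ccontr)
  assume "\<nexists>n. H (Suc n) = H n"
  then have "rk (H (Suc n)) < rk (H n)" for n using rk[OF assms(2) assms(2), of "Suc n" n] assms(3)[of n] by blast
  note step = this
  have "rk (H n) + n <= rk (H 0)" for n
  proof (induction n)
   case (Suc n)
   then show ?case using step[of n] by linarith
  qed simp
  from this[of "Suc (rk (H 0))"] show False by simp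
 qed
 then show thesis using that by blast
qed

end

lemma additive_zero:
 assumes "abelian_group V" "abelian_group W" "f : carrier V \<rightarrow> carrier W"
  "!!x y. [|x : carrier V; y : carrier V|] ==> f (x +_V y) = f x +_W f y"
 shows "f 0_V = 0_W"
proof -
 interpret V: abelian_group V by fact
 interpret W: abelian_group W by fact
 have c: "f 0_V : carrier W" using assms(3) by auto
 have "f 0_V +_W f 0_V = f 0_V" using assms(4)[of "0_V" "0_V"] by simp
 then show ?thesis using c W.add.l_cancel_one' by metis
qed

lemma additive_finsum:
 assumes "abelian_group V" "abelian_group W" "f : carrier V \<rightarrow> carrier W"
  "!!x y. [|x : carrier V; y : carrier V|] ==> f (x +_V y) = f x +_W f y"
  "finite I" "g : I \<rightarrow> carrier V"
 shows "f (finsum V g I) = finsum W (%i. f (g i)) I"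
proof -
 interpret V: abelian_group V by fact
 interpret W: abelian_group W by fact
 show ?thesis
  using assms(5,6)
 proof (induction I rule: finite_induct)
  case empty
  show ?case using additive_zero[OF assms(1-4)] by simp
 next
  case (insert i I)
  then have g: "g : I \<rightarrow> carrier V" "g i : carrier V" by auto
  have fg: "(%i. f (g i)) : I \<rightarrow> carrier W" "f (g i) : carrier W" using g assms(3) by auto
  have "f (finsum V g (insert i I)) = f (g i) +_W f (finsum V g I)"
   using insert(1,2) g V.finsum_closed[OF g(1)] by (simp add: assms(4))
  then show ?case using insert(1,2) insert.IH[OF g(1)] fg by simp
 qed
qed

lemma (in abelian_monoid) finsum_swap:
 assumes "finite I" "finite J" "!!i j. [|i : I; j : J|] ==> f i j : carrier G"
 shows "(\<Oplus>i\<in>I. \<Oplus>j\<in>J. f i j) = (\<Oplus>j\<in>J. \<Oplus>i\<in>I. f i j)"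
 using assms(1,3)
proof (induction I rule: finite_induct)
 case empty
 then show ?case by simp
next
 case (insert i I)
 have c: "(%j. f i j) : J \<rightarrow> carrier G" "(%j. \<Oplus>i\<in>I. f i j) : J \<rightarrow> carrier G"
  "(%i. \<Oplus>j\<in>J. f i j) : I \<rightarrow> carrier G"
  using insert.prems by (auto intro!: finsum_closed)
 have "(\<Oplus>j\<in>J. \<Oplus>i\<in>insert i I. f i j) = (\<Oplus>j\<in>J. f i j \<oplus> (\<Oplus>i\<in>I. f i j))"
  using insert c by (intro finsum_cong') (auto simp: Pi_iff)
 also have "... = (\<Oplus>j\<in>J. f i j) \<oplus> (\<Oplus>j\<in>J. \<Oplus>i\<in>I. f i j)" by (rule finsum_addf[OF c(1,2)])
 also have "... = (\<Oplus>i\<in>insert i I. \<Oplus>j\<in>J. f i j)"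
  using insert c finsum_closed[OF c(1)] by simp
 finally show ?case by simp
qed

text \<open>The trace of a nilpotent operator \<open>f\<close> equals the trace of its restriction to its image, because
 \<open>f\<close> factors through its image; the claim follows by induction on the dimension.\<close>

lemma (in vspace) trace_nilpotent:
 assumes fs: fin_separated and f: "f : carrier V \<rightarrow> carrier V"
  and fadd: "!!x y. [|x : carrier V; y : carrier V|] ==> f (x +_V y) = f x +_V f y"
  and fsm: "!!d x. [|d : carrier F; x : carrier V|] ==> f (d \<odot>_V x) = d \<odot>_V f x"
  and nil: "!!x. x : carrier V ==> (f ^^ m) x = 0_V"
  and H: "submodule H F V" "f ` H <= H"
  and D: "dual_family n w c" "!!i. i < n ==> w i : H" "!!h. h : H ==> dual_proj n w c h = h"
 shows "(\<Oplus>i\<in>{..<n}. c i (f (w i))) = \<zero>"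
proof -
 obtain rk :: "'c set => nat" and N where
  rk: "!!H H'. [|submodule H F V; submodule H' F V; H \<subset> H'|] ==> rk H < rk H'"
  and "!!H. rk H <= N"
  by (rule subspace_rank[OF fs]) blast
 note f0 = additive_zero[OF M.abelian_group_axioms M.abelian_group_axioms f fadd]
 show ?thesis
  using H D
 proof (induction "rk H" arbitrary: H n w c rule: less_induct)
  case less
  note H = less.prems(1)[unfolded submodule_iff] and fH = less.prems(2) and D = less.prems(3-5)
  note DD = dual_familyD[OF D(1)]
  have HV: "!!h. h : H ==> h : carrier V" using H by blast
  have sub: "submodule (f ` H) F V" unfolding submodule_iff
  proof (intro conjI ballI)
   show "f ` H <= carrier V" using H f by blast
   show "0_V : f ` H" using f0 H by force
   fix x y assume "x : f ` H" "y : f ` H"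
   then obtain a b where ab: "x = f a" "y = f b" "a : H" "b : H" by blast
   then have "x +_V y = f (a +_V b)" using HV fadd by simp
   then show "x +_V y : f ` H" using ab H by blast
  next
   fix d x assume d: "d : carrier F" and "x : f ` H"
   then obtain a where a: "x = f a" "a : H" by blast
   then have "d \<odot>_V x = f (d \<odot>_V a)" using HV fsm d by simp
   then show "d \<odot>_V x : f ` H" using a d H by blast
  qed
  show ?case
  proof (cases "f ` H = H")
   case True
   have "(f ^^ j) ` H = H" for j
   proof (induction j)
    case (Suc j)
    have "(f ^^ Suc j) ` H = f ` ((f ^^ j) ` H)" by auto
    then show ?case using True Suc by simp
   qed simp
   from this[of m] have "H <= {0_V}" using nil HV by fastforce
   have "n = 0"
   proof (rule ccontr)
    assume "n ~= 0"
    then have "w 0 = 0_V" "c 0 (w 0) = \<one>" "c 0 : lin_func F V"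
     using \<open>H <= {0_V}\<close> D(2) DD by auto
    then show False using lin_func_zero[of "c 0"] by simp
   qed
   then show ?thesis by simp
  next
   case False
   then have lt: "rk (f ` H) < rk H" using rk[OF sub less.prems(1)] fH by blast
   let ?S = "(%i. f (w i)) ` {..<n}"
   have wV: "!!i. i < n ==> w i : carrier V" using DD(1) .
   have fwV: "!!i. i < n ==> f (w i) : carrier V" using wV f by auto
   have S: "finite ?S" "?S <= carrier V" using fwV by auto
   obtain r v q where E: "dual_family r v q" and "r <= card ?S"
    and fx: "!!x. x : ?S ==> dual_proj r v q x = x"
    and sp: "!!H i. [|submodule H F V; ?S <= H; i < r|] ==> v i : H"
    by (rule dual_family_exists[OF S]) blast
   note EE = dual_familyD[OF E]
   have vH: "v i : f ` H" if "i < r" for i using sp[OF sub _ that] D(2) by blast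
   note fix_sub = dual_proj_fixed_submodule[OF E]
   have fixed: "dual_proj r v q y = y" if "y : f ` H" for y
   proof -
    obtain h where h: "h : H" "y = f h" using \<open>y : f ` H\<close> by blast
    have "f h = f (dual_proj n w c h)" using D(3)[OF h(1)] by simp
    also have "... = (finsum V (%i. f (c i h \<odot>_V w i)) {..<n})" unfolding dual_proj_def
     by (rule additive_finsum[OF M.abelian_group_axioms M.abelian_group_axioms f fadd])
      (use dual_proj_terms[OF D(1) HV[OF h(1)]] in auto)
    finally have e: "f h = (finsum V (%i. f (c i h \<odot>_V w i)) {..<n})" .
    have "f h : {x : carrier V. dual_proj r v q x = x}" unfolding e
    proof (rule submodule_finsum[OF fix_sub])
     fix i assume i: "i : {..<n}"
     then have ci: "c i h : carrier F" using lf_closed[OF DD(2) HV[OF h(1)]] by simp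
     have "f (w i) : {x : carrier V. dual_proj r v q x = x}" using fx fwV i by auto
     then have "c i h \<odot>_V f (w i) : {x : carrier V. dual_proj r v q x = x}"
      using fix_sub ci unfolding submodule_iff by blast
     then show "f (c i h \<odot>_V w i) : {x : carrier V. dual_proj r v q x = x}"
      using fsm[OF ci] wV i by simp
    qed simp
    then show ?thesis using h by simp
   qed
   have IH: "(\<Oplus>j\<in>{..<r}. q j (f (v j))) = \<zero>"
    using less.hyps[OF lt sub _ E vH fixed] fH by blast
   have vV: "!!j. j < r ==> v j : carrier V" using EE(1) .
   have vHH: "!!j. j < r ==> v j : H" using vH fH by blast
   have cc: "c i (v j) : carrier F" "q j (f (w i)) : carrier F" if "i < n" "j < r" for i j
    using lf_closed[OF DD(2)] lf_closed[OF EE(2)] vV fwV that by auto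
   have 1: "c i (f (w i)) = (\<Oplus>j\<in>{..<r}. q j (f (w i)) \<otimes> c i (v j))" if i: "i < n" for i
   proof -
    have "c i (f (w i)) = c i (dual_proj r v q (f (w i)))" using fx i by simp
    also have "... = (\<Oplus>j\<in>{..<r}. c i (q j (f (w i)) \<odot>_V v j))" unfolding dual_proj_def
     by (rule lin_func_finsum[OF DD(2)[OF i]]) (use dual_proj_terms[OF E fwV[OF i]] in auto)
    also have "... = (\<Oplus>j\<in>{..<r}. q j (f (w i)) \<otimes> c i (v j))"
     using cc[OF i] vV by (intro R.finsum_cong') (auto simp: lf_smult[OF DD(2)[OF i]])
    finally show ?thesis .
   qed
   have 2: "(\<Oplus>i\<in>{..<n}. q j (f (w i)) \<otimes> c i (v j)) = q j (f (v j))" if j: "j < r" for j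
   proof -
    have "q j (f (v j)) = q j (f (dual_proj n w c (v j)))" using D(3)[OF vHH[OF j]] by simp
    also have "f (dual_proj n w c (v j)) = (finsum V (%i. f (c i (v j) \<odot>_V w i)) {..<n})"
     unfolding dual_proj_def
     by (rule additive_finsum[OF M.abelian_group_axioms M.abelian_group_axioms f fadd])
      (use dual_proj_terms[OF D(1) vV[OF j]] in auto)
    also have "q j ... = (\<Oplus>i\<in>{..<n}. q j (f (c i (v j) \<odot>_V w i)))"
     by (rule lin_func_finsum[OF EE(2)[OF j]]) (use dual_proj_terms[OF D(1) vV[OF j]] f in auto)
    also have "... = (\<Oplus>i\<in>{..<n}. q j (f (w i)) \<otimes> c i (v j))"
     using cc[OF _ j] wV fwV
     by (intro R.finsum_cong') (auto simp: fsm lf_smult[OF EE(2)[OF j]] R.m_comm)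
    finally show ?thesis by simp
   qed
   have "(\<Oplus>i\<in>{..<n}. c i (f (w i))) = (\<Oplus>i\<in>{..<n}. \<Oplus>j\<in>{..<r}. q j (f (w i)) \<otimes> c i (v j))"
    using 1 cc by (intro R.finsum_cong') (auto intro!: R.finsum_closed)
   also have "... = (\<Oplus>j\<in>{..<r}. \<Oplus>i\<in>{..<n}. q j (f (w i)) \<otimes> c i (v j))"
    using cc by (intro R.finsum_swap) auto
   also have "... = (\<Oplus>j\<in>{..<r}. q j (f (v j)))"
    using 2 lf_closed[OF EE(2)] vV funcset_mem[OF f] by (intro R.finsum_cong') auto
   finally show ?thesis using IH by simp
  qed
 qed
qed

section \<open>Modules and homomorphisms\<close>

lemma (in left_module) act_zero: "a : carrier B ==> a \<odot>_U 0_U = 0_U"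
 by (rule additive_zero[OF abelian_group_axioms abelian_group_axioms])
  (auto simp: act_r_distr act_closed)

lemma (in left_module) zero_act: "u : carrier U ==> 0_B \<odot>_U u = 0_U"
 by (rule additive_zero[OF B.abelian_group_axioms abelian_group_axioms])
  (auto simp: act_l_distr act_closed)

lemma (in left_module) act_neg:
 assumes "a : carrier B" "u : carrier U"
 shows "a \<odot>_U (-_U u) = -_U (a \<odot>_U u)"
 using act_r_distr[OF assms(1,2), of "-_U u"] assms act_zero act_closed
 by (metis a_inv_closed minus_equality r_neg a_comm)

lemma (in left_module) neg_act:
 assumes "a : carrier B" "u : carrier U"
 shows "(-_B a) \<odot>_U u = -_U (a \<odot>_U u)"
 using act_l_distr[OF assms(1) B.a_inv_closed[OF assms(1)] assms(2)] assms zero_act act_closed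
 by (metis B.a_inv_closed minus_equality B.r_neg a_comm)

lemma (in left_module) submodule_iff:
 "submodule P B U \<longleftrightarrow> P <= carrier U \<and> 0_U : P \<and> (ALL x:P. ALL y:P. x +_U y : P) \<and>
  (ALL a:carrier B. ALL x:P. a \<odot>_U x : P)"
proof
 assume "submodule P B U"
 then interpret P: submodule P B U .
 show "P <= carrier U \<and> 0_U : P \<and> (ALL x:P. ALL y:P. x +_U y : P) \<and>
  (ALL a:carrier B. ALL x:P. a \<odot>_U x : P)"
  using P.subset P.one_closed P.m_closed P.smult_closed by auto
next
 assume P: "P <= carrier U \<and> 0_U : P \<and> (ALL x:P. ALL y:P. x +_U y : P) \<and>
  (ALL a:carrier B. ALL x:P. a \<odot>_U x : P)"
 have "-_U x : P" if "x : P" for x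
 proof -
  have "(-_B 1_B) \<odot>_U x = -_U x" using neg_act[OF B.one_closed] act_one P that by auto
  then show ?thesis using P that by (metis B.a_inv_closed B.one_closed)
 qed
 then show "submodule P B U" using P
  unfolding submodule_def submodule_axioms_def subgroup_def by (auto simp: a_inv_def)
qed

lemma homI:
 assumes "f : extensional (carrier U)" "!!u. u : carrier U ==> f u : carrier V"
  "!!u v. [|u : carrier U; v : carrier U|] ==> f (u +_U v) = f u +_V f v"
  "!!a u. [|a : carrier B; u : carrier U|] ==> f (a \<odot>_U u) = a \<odot>_V f u"
 shows "f : mod_hom B U V"
 using assms unfolding mod_hom_def by (auto simp: PiE_def)

lemma hom_closed: "[|f : mod_hom B U V; u : carrier U|] ==> f u : carrier V"
 and hom_add: "[|f : mod_hom B U V; u : carrier U; v : carrier U|] ==>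
  f (u +_U v) = f u +_V f v"
 and hom_act: "[|f : mod_hom B U V; a : carrier B; u : carrier U|] ==>
  f (a \<odot>_U u) = a \<odot>_V f u"
 and hom_ext: "f : mod_hom B U V ==> f : extensional (carrier U)"
 unfolding mod_hom_def by (auto simp: PiE_def)

lemma hom_eqI:
 "[|f : mod_hom B U V; g : mod_hom B U W; !!u. u : carrier U ==> f u = g u|] ==> f = g"
 using hom_ext by (metis extensionalityI)

text \<open>An algebra over a field as far as its modules are concerned: a ring with a homomorphism from
 the field to its centre.\<close>

locale scalar_algebra = F?: field F + B?: ring B
 for F :: "('f, 'm) ring_scheme" (structure) and B :: "('f, 'a, 'n) module_scheme" (structure) +
 assumes sc_closed: "c : carrier F ==> c \<odot>_B 1_B : carrier B"
  and sc_add: "[|c : carrier F; d : carrier F|] ==>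
   (c +_F d) \<odot>_B 1_B = c \<odot>_B 1_B +_B d \<odot>_B 1_B"
  and sc_mult: "[|c : carrier F; d : carrier F|] ==>
   (c *_F d) \<odot>_B 1_B = (c \<odot>_B 1_B) *_B (d \<odot>_B 1_B)"
  and sc_one: "1_F \<odot>_B 1_B = 1_B"
  and sc_central: "[|c : carrier F; b : carrier B|] ==>
   (c \<odot>_B 1_B) *_B b = b *_B (c \<odot>_B 1_B)"
begin

definition scl :: "('a, 'v) module => 'f => 'v => 'v" where
 "scl U c u = (c \<odot>_B 1_B) \<odot>_U u"

lemma underlying_simps [simp]:
 "carrier (underlying_space B U) = carrier U"
 "ring.add (underlying_space B U) = ring.add U"
 "ring.zero (underlying_space B U) = ring.zero U"
 "smult (underlying_space B U) = scl U"
 "a_inv (underlying_space B U) = a_inv U"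
 by (auto simp: underlying_space_def a_inv_def m_inv_def scl_def fun_eq_iff)

lemma hom_space_simps [simp]:
 "carrier (hom_space B U V) = mod_hom B U V"
 "ring.zero (hom_space B U V) = (\<lambda>u\<in>carrier U. 0_V)"
 "ring.add (hom_space B U V) = (%f g. \<lambda>u\<in>carrier U. f u +_V g u)"
 "smult (hom_space B U V) = (%c f. \<lambda>u\<in>carrier U. scl V c (f u))"
 by (auto simp: hom_space_def scl_def fun_eq_iff)

context
 fixes U :: "('a, 'v) module"
 assumes U: "left_module B U"
begin

interpretation U: left_module B U by (rule U)

lemma scl_closed: "[|c : carrier F; u : carrier U|] ==> scl U c u : carrier U"
 and scl_add: "[|c : carrier F; d : carrier F; u : carrier U|] ==>
  scl U (c +_F d) u = scl U c u +_U scl U d u"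
 and scl_add_right: "[|c : carrier F; u : carrier U; v : carrier U|] ==>
  scl U c (u +_U v) = scl U c u +_U scl U c v"
 and scl_mult: "[|c : carrier F; d : carrier F; u : carrier U|] ==>
  scl U (c *_F d) u = scl U c (scl U d u)"
 and scl_one: "u : carrier U ==> scl U 1_F u = u"
 unfolding scl_def
 by (simp_all add: sc_closed sc_add sc_mult sc_one U.act_closed U.act_l_distr U.act_r_distr U.act_assoc U.act_one)

lemma scl_act: "[|c : carrier F; a : carrier B; u : carrier U|] ==>
  scl U c (a \<odot>_U u) = a \<odot>_U scl U c u"
 unfolding scl_def using sc_central[of c a] by (simp add: U.act_assoc[symmetric] sc_closed)

lemma underlying_vspace: "vspace F (underlying_space B U)"
proof -
 have "abelian_group (underlying_space B U)"
  by (rule abelian_groupI) (auto simp: U.a_ac intro: U.l_neg)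
 moreover have "module F (underlying_space B U)"
  by (rule moduleI)
   (use \<open>abelian_group (underlying_space B U)\<close> F.is_cring in
    \<open>auto simp: scl_closed scl_add scl_add_right scl_mult scl_one\<close>)
 ultimately show ?thesis unfolding vspace_def by (simp add: F.field_axioms)
qed

lemma submodule_imp_subspace: "submodule P B U ==> submodule P F (underlying_space B U)"
proof -
 assume P: "submodule P B U"
 interpret S: vspace F "underlying_space B U" by (rule underlying_vspace)
 show ?thesis using P unfolding S.submodule_iff U.submodule_iff 
  by (auto simp: scl_def sc_closed)
qed

lemma id_hom: "(\<lambda>u\<in>carrier U. u) : mod_hom B U U"
 by (rule homI) (auto simp: U.act_closed)

lemma scl_hom: "c : carrier F ==> (\<lambda>u\<in>carrier U. scl U c u) : mod_hom B U U"
 by (rule homI) (auto simp: U.act_closed scl_closed scl_add_right scl_act)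

end

lemma compose_hom:
 assumes "f : mod_hom B U V" "g : mod_hom B V W" "left_module B U"
 shows "compose (carrier U) g f : mod_hom B U W"
proof -
 interpret U: left_module B U by fact
 show ?thesis
  by (rule homI) (use assms in "auto simp: compose_def U.act_closed hom_closed hom_add hom_act")
qed

context
 fixes U :: "('a, 'v) module" and V :: "('a, 'w) module"
 assumes U: "left_module B U" and V: "left_module B V"
begin

interpretation U: left_module B U by (rule U)
interpretation V: left_module B V by (rule V)

lemma hom_zero: "f : mod_hom B U V ==> f 0_U = 0_V"
 by (rule additive_zero[OF U.abelian_group_axioms V.abelian_group_axioms]) (auto simp: hom_closed hom_add)

lemma hom_neg: "[|f : mod_hom B U V; u : carrier U|] ==> f (-_U u) = -_V f u"
 using hom_add[of f B U V u "-_U u"] hom_zero[of f] 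
 by (metis U.a_inv_closed U.r_neg V.minus_equality V.a_comm hom_closed)

lemma hom_minus: "[|f : mod_hom B U V; u : carrier U; v : carrier U|] ==>
  f (u -_U v) = f u -_V f v"
 by (simp add: U.minus_eq V.minus_eq hom_add[of f B U V] hom_neg)

lemma hom_scl: "[|f : mod_hom B U V; c : carrier F; u : carrier U|] ==> f (scl U c u) = scl V c (f u)"
 unfolding scl_def using hom_act[of f B U V] sc_closed by blast

lemma hom_finsum: "[|f : mod_hom B U V; finite I; g : I \<rightarrow> carrier U|] ==>
  f (finsum U g I) = finsum V (%i. f (g i)) I"
 by (rule additive_finsum[OF U.abelian_group_axioms V.abelian_group_axioms])
  (auto simp: hom_closed[of f B U V] hom_add[of f B U V])

lemma hom_inj_iff:
 assumes "f : mod_hom B U V"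
 shows "inj_on f (carrier U) \<longleftrightarrow> (ALL u:carrier U. f u = 0_V --> u = 0_U)"
proof
 assume "inj_on f (carrier U)"
 then show "ALL u:carrier U. f u = 0_V --> u = 0_U" using hom_zero[OF assms]
  by (metis U.zero_closed inj_onD)
next
 assume *: "ALL u:carrier U. f u = 0_V --> u = 0_U"
 show "inj_on f (carrier U)"
 proof (rule inj_onI)
  fix u v assume uv: "u : carrier U" "v : carrier U" "f u = f v"
  then have "f (u -_U v) = 0_V" using hom_minus[OF assms] hom_closed[OF assms] V.a_minus_eq_zero_iff by simp
  then have "u -_U v = 0_U" using * uv(1,2) by blast
  then show "u = v" using uv(1,2) by (simp only: U.a_minus_eq_zero_iff)
 qed
qed

lemma zero_hom: "(\<lambda>u\<in>carrier U. 0_V) : mod_hom B U V"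
 by (rule homI) (auto simp: U.act_closed V.act_zero)

lemma add_hom:
 "[|f : mod_hom B U V; g : mod_hom B U V|] ==> (\<lambda>u\<in>carrier U. f u +_V g u) : mod_hom B U V"
 by (rule homI)
  (auto simp: U.act_closed hom_closed[of _ B U V] hom_add[of _ B U V] hom_act[of _ B U V]
    V.act_r_distr V.a_ac)

lemma neg_hom:
 "f : mod_hom B U V ==> (\<lambda>u\<in>carrier U. -_V f u) : mod_hom B U V"
 by (rule homI)
  (auto simp: U.act_closed hom_closed[of _ B U V] hom_add[of _ B U V] hom_act[of _ B U V]
    V.act_neg V.minus_add)

lemma diff_hom:
 assumes "f : mod_hom B U V" "g : mod_hom B U V"
 shows "(\<lambda>u\<in>carrier U. f u -_V g u) : mod_hom B U V"
proof -
 have "(\<lambda>u\<in>carrier U. f u -_V g u) = (\<lambda>u\<in>carrier U. f u +_V (\<lambda>u\<in>carrier U. -_V g u) u)"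
  by (auto simp: V.minus_eq fun_eq_iff)
 then show ?thesis using add_hom[OF assms(1) neg_hom[OF assms(2)]] by simp
qed

lemma scale_hom:
 assumes "f : mod_hom B U V" "c : carrier F"
 shows "(\<lambda>u\<in>carrier U. scl V c (f u)) : mod_hom B U V"
proof -
 have "(\<lambda>u\<in>carrier U. scl V c (f u)) = compose (carrier U) (\<lambda>v\<in>carrier V. scl V c v) f"
  using hom_closed[OF assms(1)] by (auto simp: compose_def fun_eq_iff)
 then show ?thesis using compose_hom[OF assms(1) scl_hom[OF V assms(2)] U] by simp
qed

lemma hom_space_vspace: "vspace F (hom_space B U V)"
proof -
 note c = hom_closed[of _ B U V]
 have ag: "abelian_group (hom_space B U V)"
 proof (rule abelian_groupI)
  fix f assume f: "f : carrier (hom_space B U V)"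
  have "(\<lambda>u\<in>carrier U. (\<lambda>u\<in>carrier U. -_V f u) u +_V f u) = (\<lambda>u\<in>carrier U. 0_V)"
   using f c by (auto simp: fun_eq_iff V.l_neg)
  then show "EX g:carrier (hom_space B U V). g \<oplus>\<^bsub>hom_space B U V\<^esub> f = \<zero>\<^bsub>hom_space B U V\<^esub>"
   using neg_hom f by (intro bexI[of _ "\<lambda>u\<in>carrier U. -_V f u"]) auto
  show "\<zero>\<^bsub>hom_space B U V\<^esub> \<oplus>\<^bsub>hom_space B U V\<^esub> f = f"
   using f c hom_ext[of f B U V] by (auto simp: fun_eq_iff extensional_def)
 qed (auto simp: add_hom zero_hom c fun_eq_iff V.a_ac)
 have "module F (hom_space B U V)"
 proof (rule moduleI)
  fix f assume f: "f : carrier (hom_space B U V)"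
  show "1_F \<odot>\<^bsub>hom_space B U V\<^esub> f = f"
   using f c hom_ext[of f B U V] by (auto simp: fun_eq_iff extensional_def scl_one[OF V])
 qed (use ag F.is_cring in "auto simp: scale_hom c fun_eq_iff scl_add[OF V] scl_add_right[OF V] scl_mult[OF V]")
 then show ?thesis unfolding vspace_def by (simp add: F.field_axioms)
qed

end

end

lemma (in module) lin_span_submodule:
 assumes "S <= carrier M"
 shows "submodule (lin_span R M S) R M"
proof -
 let ?C = "{H. submodule H R M \<and> S <= H}"
 have C: "carrier M : ?C" using carrier_is_submodule assms by simp
 have mem: "x : lin_span R M S \<longleftrightarrow> (ALL H:?C. x : H)" for x unfolding lin_span_def by simp
 have H: "0_M : H" "!!x y. [|x : H; y : H|] ==> x +_M y : H"
  "!!c x. [|c : carrier R; x : H|] ==> c \<odot>_M x : H" if "H : ?C" for H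
  using that unfolding submodule_iff by auto
 show ?thesis unfolding submodule_iff
 proof (intro conjI ballI)
  show "lin_span R M S <= carrier M" using C mem by blast
  show "0_M : lin_span R M S" using H(1) mem by blast
  show "x +_M y : lin_span R M S" if "x : lin_span R M S" "y : lin_span R M S" for x y
   using H(2) that mem by meson
  show "c \<odot>_M x : lin_span R M S" if "c : carrier R" "x : lin_span R M S" for c x
   using H(3) that mem by meson
 qed
qed

section \<open>The radical\<close>

context scalar_algebra
begin

lemma fd_mod_left: "U : fd_mod F B ==> left_module B U"
 unfolding fd_mod_def by auto

lemma hom_inverse:
 assumes U: "left_module B U" and V: "left_module B V"
  and f: "f : mod_hom B U V" "bij_betw f (carrier U) (carrier V)"
 obtains k where "k : mod_hom B V U" "!!u. u : carrier U ==> k (f u) = u"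
  "!!v. v : carrier V ==> f (k v) = v" "bij_betw k (carrier V) (carrier U)"
proof -
 interpret U: left_module B U by fact
 interpret V: left_module B V by fact
 define k where "k = (\<lambda>v\<in>carrier V. inv_into (carrier U) f v)"
 have kf: "k (f u) = u" if "u : carrier U" for u
  unfolding k_def using that f hom_closed[OF f(1)] by (simp add: bij_betw_inv_into_left)
 have fk: "f (k v) = v" and kc: "k v : carrier U" if "v : carrier V" for v
  unfolding k_def using that f by (auto simp: bij_betw_inv_into_right bij_betw_def inv_into_into)
 have "k : mod_hom B V U"
 proof (rule homI)
  show "k : extensional (carrier V)" unfolding k_def by simp
  show "!!v. v : carrier V ==> k v : carrier U" by (rule kc)
  show "k (v +_V w) = k v +_U k w" if "v : carrier V" "w : carrier V" for v w
   using kf[of "k v +_U k w"] that fk kc hom_add[OF f(1)] by simp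
  show "k (a \<odot>_V v) = a \<odot>_U k v" if "a : carrier B" "v : carrier V" for a v
   using kf[of "a \<odot>_U k v"] that fk kc hom_act[OF f(1)] U.act_closed by simp
 qed
 moreover have "bij_betw k (carrier V) (carrier U)"
  by (rule bij_betw_byWitness[of _ f]) (use kf fk kc hom_closed[OF f(1)] in auto)
 ultimately show thesis using that kf fk by blast
qed

lemma invertible_endo_iff:
 assumes U: "left_module B U"
 shows "invertible_endo B U h \<longleftrightarrow> h : mod_hom B U U \<and> bij_betw h (carrier U) (carrier U)"
proof
 assume "invertible_endo B U h"
 then obtain k where h: "h : mod_hom B U U" and k: "k : mod_hom B U U"
  and e: "compose (carrier U) h k = (\<lambda>u\<in>carrier U. u)" "compose (carrier U) k h = (\<lambda>u\<in>carrier U. u)"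
  unfolding invertible_endo_def by blast
 have "h (k u) = u" "k (h u) = u" if "u : carrier U" for u
  using fun_cong[OF e(1), of u] fun_cong[OF e(2), of u] that by (simp_all add: compose_def)
 then have "bij_betw h (carrier U) (carrier U)"
  by (intro bij_betw_byWitness[of _ k]) (use hom_closed[OF h] hom_closed[OF k] in auto)
 then show "h : mod_hom B U U \<and> bij_betw h (carrier U) (carrier U)" using h by blast
next
 assume h: "h : mod_hom B U U \<and> bij_betw h (carrier U) (carrier U)"
 then obtain k where k: "k : mod_hom B U U" "!!u. u : carrier U ==> k (h u) = u"
  "!!v. v : carrier U ==> h (k v) = v" using hom_inverse[OF U U, of h] by metis
 then show "invertible_endo B U h" unfolding invertible_endo_def
  using h by (intro conjI bexI[OF _ k(1)]) (auto simp: compose_def fun_eq_iff)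
qed

lemma one_minus_hom:
 assumes U: "left_module B U" and h: "h : mod_hom B U U"
 shows "(\<lambda>u\<in>carrier U. u -_U h u) : mod_hom B U U"
proof -
 have "(\<lambda>u\<in>carrier U. u -_U h u) = (\<lambda>u\<in>carrier U. (\<lambda>u\<in>carrier U. u) u -_U h u)" by auto
 then show ?thesis using diff_hom[OF U U id_hom[OF U] h] by simp
qed

lemma one_minus_bij_iff:
 assumes U: "left_module B U" and h: "h : mod_hom B U U"
 shows "bij_betw (\<lambda>u\<in>carrier U. u -_U h u) (carrier U) (carrier U) \<longleftrightarrow>
  (ALL u:carrier U. h u = u --> u = 0_U) \<and> (ALL v:carrier U. EX u:carrier U. u -_U h u = v)"
proof -
 interpret U: left_module B U by fact
 let ?f = "\<lambda>u\<in>carrier U. u -_U h u"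
 have "inj_on ?f (carrier U) \<longleftrightarrow> (ALL u:carrier U. h u = u --> u = 0_U)"
 proof -
  have "?f u = 0_U \<longleftrightarrow> h u = u" if "u : carrier U" for u
   using U.a_minus_eq_zero_iff[OF that hom_closed[OF h that]] that by auto
  then show ?thesis unfolding hom_inj_iff[OF U U one_minus_hom[OF U h]] by simp
 qed
 moreover have "?f ` carrier U = carrier U \<longleftrightarrow> (ALL v:carrier U. EX u:carrier U. u -_U h u = v)"
 proof
  assume *: "?f ` carrier U = carrier U"
  show "ALL v:carrier U. EX u:carrier U. u -_U h u = v"
  proof
   fix v assume "v : carrier U"
   then have "v : ?f ` carrier U" using * by simp
   then show "EX u:carrier U. u -_U h u = v" by force
  qed
 next
  assume *: "ALL v:carrier U. EX u:carrier U. u -_U h u = v"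
  have "?f ` carrier U <= carrier U" using hom_closed[OF h] by auto
  moreover have "carrier U <= ?f ` carrier U"
  proof
   fix v assume "v : carrier U"
   then obtain u where "u : carrier U" "u -_U h u = v" using * by blast
   then show "v : ?f ` carrier U" by (intro image_eqI[of _ _ u]) auto
  qed
  ultimately show "?f ` carrier U = carrier U" by blast
 qed
 ultimately show ?thesis unfolding bij_betw_def by blast
qed

lemma rad_iff:
 assumes U: "left_module B U" and V: "left_module B V"
 shows "f : rad B U V \<longleftrightarrow> f : mod_hom B U V \<and>
  (ALL g:mod_hom B V U. bij_betw (\<lambda>u\<in>carrier U. u -_U g (f u)) (carrier U) (carrier U))"
proof -
 have "invertible_endo B U (\<lambda>u\<in>carrier U. u -_U g (f u)) \<longleftrightarrow>
   bij_betw (\<lambda>u\<in>carrier U. u -_U g (f u)) (carrier U) (carrier U)"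
  if "f : mod_hom B U V" "g : mod_hom B V U" for g
 proof -
  have "(\<lambda>u\<in>carrier U. u -_U g (f u)) = (\<lambda>u\<in>carrier U. u -_U compose (carrier U) g f u)"
   by (auto simp: compose_def)
  then show ?thesis unfolding invertible_endo_iff[OF U]
   using one_minus_hom[OF U compose_hom[OF that U]] by simp
 qed
 then show ?thesis unfolding rad_def by blast
qed

lemma rad_bij: "[|left_module B U; left_module B V; f : rad B U V; g : mod_hom B V U|] ==>
  bij_betw (\<lambda>u\<in>carrier U. u -_U g (f u)) (carrier U) (carrier U)"
 using rad_iff by blast

lemma rad_hom: "f : rad B U V ==> f : mod_hom B U V"
 unfolding rad_def by blast

lemma one_minus_swap:
 assumes U: "left_module B U" and V: "left_module B V"
  and f: "f : mod_hom B U V" and g: "g : mod_hom B V U"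
  and bij: "bij_betw (\<lambda>u\<in>carrier U. u -_U g (f u)) (carrier U) (carrier U)"
 shows "bij_betw (\<lambda>v\<in>carrier V. v -_V f (g v)) (carrier V) (carrier V)"
proof -
 interpret U: left_module B U by fact
 interpret V: left_module B V by fact
 note fc = hom_closed[OF f] and gc = hom_closed[OF g]
 have gf: "compose (carrier U) g f : mod_hom B U U" and fg: "compose (carrier V) f g : mod_hom B V V"
  using compose_hom f g U V by blast+
 have "(\<lambda>u\<in>carrier U. u -_U compose (carrier U) g f u) = (\<lambda>u\<in>carrier U. u -_U g (f u))"
  "(\<lambda>v\<in>carrier V. v -_V compose (carrier V) f g v) = (\<lambda>v\<in>carrier V. v -_V f (g v))"
  by (auto simp: compose_def)
 note * = one_minus_bij_iff[OF U gf, unfolded this] one_minus_bij_iff[OF V fg, unfolded this]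
 have inj: "!!u. [|u : carrier U; g (f u) = u|] ==> u = 0_U"
  and surj: "!!v. v : carrier U ==> EX u:carrier U. u -_U g (f u) = v"
  using bij unfolding * by (auto simp: compose_def)
 have "v = 0_V" if "v : carrier V" "f (g v) = v" for v
  using inj[of "g v"] that gc hom_zero[OF U V f] by metis
 moreover have "EX w:carrier V. w -_V f (g w) = v" if v: "v : carrier V" for v
 proof -
  obtain u where u: "u : carrier U" "u -_U g (f u) = g v" using surj gc[OF v] by blast
  have "f (g v) = f u -_V f (g (f u))" using u fc gc hom_minus[OF U V f] by metis
  moreover have "g (v +_V f u) = g v +_U g (f u)" using hom_add[OF g] v u fc by simp
  ultimately have "(v +_V f u) -_V f (g (v +_V f u)) = v"
   using v u fc gc by (simp add: hom_add[OF f] V.minus_eq V.minus_add V.a_ac V.r_neg1 V.r_neg2 V.r_neg)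
  then show ?thesis using v u fc by blast
 qed
 ultimately show ?thesis unfolding * by (simp add: compose_def)
qed

lemma rad_left:
 assumes "left_module B U" "left_module B V" "left_module B W"
  and f: "f : rad B U V" and a: "a : mod_hom B V W"
 shows "compose (carrier U) a f : rad B U W"
proof -
 note fh = rad_hom[OF f]
 have "bij_betw (\<lambda>u\<in>carrier U. u -_U g (compose (carrier U) a f u)) (carrier U) (carrier U)"
  if g: "g : mod_hom B W U" for g
 proof -
  have "bij_betw (\<lambda>u\<in>carrier U. u -_U (compose (carrier V) g a) (f u)) (carrier U) (carrier U)"
   using f compose_hom[OF a g assms(2)] rad_iff[OF assms(1,2)] by blast
  moreover have "(\<lambda>u\<in>carrier U. u -_U (compose (carrier V) g a) (f u)) =
    (\<lambda>u\<in>carrier U. u -_U g (compose (carrier U) a f u))"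
   using hom_closed[OF fh] by (auto simp: compose_def)
  ultimately show ?thesis by simp
 qed
 then show ?thesis unfolding rad_iff[OF assms(1,3)] using compose_hom[OF fh a assms(1)] by blast
qed

lemma rad_right:
 assumes T: "left_module B T" and U: "left_module B U" and V: "left_module B V"
  and f: "f : rad B U V" and b: "b : mod_hom B T U"
 shows "compose (carrier T) f b : rad B T V"
proof -
 note fh = rad_hom[OF f]
 have "bij_betw (\<lambda>u\<in>carrier T. u -_T g (compose (carrier T) f b u)) (carrier T) (carrier T)"
  if g: "g : mod_hom B V T" for g
 proof -
  have "bij_betw (\<lambda>u\<in>carrier U. u -_U (compose (carrier V) b g) (f u)) (carrier U) (carrier U)"
   using f compose_hom[OF g b V] rad_iff[OF U V] by blast
  moreover have "(\<lambda>u\<in>carrier U. u -_U (compose (carrier V) b g) (f u)) =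
    (\<lambda>u\<in>carrier U. u -_U b (compose (carrier U) g f u))"
   using hom_closed[OF fh] by (auto simp: compose_def)
  ultimately have "bij_betw (\<lambda>u\<in>carrier U. u -_U b (compose (carrier U) g f u)) (carrier U) (carrier U)"
   by simp
  from one_minus_swap[OF U T compose_hom[OF fh g U] b this]
  have "bij_betw (\<lambda>v\<in>carrier T. v -_T compose (carrier U) g f (b v)) (carrier T) (carrier T)" .
  moreover have "(\<lambda>v\<in>carrier T. v -_T compose (carrier U) g f (b v)) = (\<lambda>u\<in>carrier T. u -_T g (compose (carrier T) f b u))"
   using hom_closed[OF b] by (auto simp: compose_def)
  ultimately show ?thesis by simp
 qed
 then show ?thesis unfolding rad_iff[OF T V] using compose_hom[OF b fh T] by blast
qed

lemma rad_add:
 assumes U: "left_module B U" and V: "left_module B V" and f: "f : rad B U V" and f': "f' : rad B U V"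
 shows "(\<lambda>u\<in>carrier U. f u +_V f' u) : rad B U V"
proof -
 interpret U: left_module B U by fact
 interpret V: left_module B V by fact
 note fh = rad_hom[OF f] and fh' = rad_hom[OF f']
 have "bij_betw (\<lambda>u\<in>carrier U. u -_U g ((\<lambda>u\<in>carrier U. f u +_V f' u) u)) (carrier U) (carrier U)"
  if g: "g : mod_hom B V U" for g
 proof -
  note c = hom_closed[OF g] hom_closed[OF fh] hom_closed[OF fh']
  define h where "h = (\<lambda>u\<in>carrier U. u -_U g (f u))"
  have hb: "bij_betw h (carrier U) (carrier U)"
   unfolding h_def by (rule rad_bij[OF U V f g])
  have hh: "h : mod_hom B U U"
  proof -
   have "h = (\<lambda>u\<in>carrier U. u -_U compose (carrier U) g f u)"
    unfolding h_def by (auto simp: compose_def)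
   then show ?thesis using one_minus_hom[OF U compose_hom[OF fh g U]] by simp
  qed
  obtain k where k: "k : mod_hom B U U" "!!v. v : carrier U ==> h (k v) = v"
   by (rule hom_inverse[OF U U hh hb]) blast
  have 2: "bij_betw (\<lambda>u\<in>carrier U. u -_U compose (carrier V) k g (f' u)) (carrier U) (carrier U)"
   by (rule rad_bij[OF U V f' compose_hom[OF g k(1) V]])
  have 3: "bij_betw (h \<circ> (\<lambda>u\<in>carrier U. u -_U compose (carrier V) k g (f' u))) (carrier U) (carrier U)"
   by (rule bij_betw_trans[OF 2 hb])
  have 4: "(h \<circ> (\<lambda>u\<in>carrier U. u -_U compose (carrier V) k g (f' u))) u =
    (\<lambda>u\<in>carrier U. u -_U g ((\<lambda>u\<in>carrier U. f u +_V f' u) u)) u" if u: "u : carrier U" for u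
  proof -
   have kc: "k (g (f' u)) : carrier U" by (intro hom_closed[OF k(1)] c u)
   have "h (u -_U k (g (f' u))) = h u -_U g (f' u)"
    using hom_minus[OF U U hh u kc] k(2) c u by simp
   also have "... = u -_U (g (f u) +_U g (f' u))" unfolding h_def using u c
    by (simp add: U.minus_eq U.minus_add U.a_ac)
   finally show ?thesis using u c by (simp add: compose_def hom_add[OF g])
  qed
  show ?thesis by (rule iffD1[OF bij_betw_cong 3]) (rule 4)
 qed
 then show ?thesis unfolding rad_iff[OF U V] using add_hom[OF U V fh fh'] by simp
qed

lemma rad_zero:
 assumes U: "left_module B U" and V: "left_module B V"
 shows "(\<lambda>u\<in>carrier U. 0_V) : rad B U V"
proof -
 interpret U: left_module B U by fact
 interpret V: left_module B V by fact
 have "bij_betw (\<lambda>u\<in>carrier U. u -_U g ((\<lambda>u\<in>carrier U. 0_V) u)) (carrier U) (carrier U)"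
  if g: "g : mod_hom B V U" for g
  by (rule bij_betwI[of _ _ _ id]) (use hom_zero[OF V U g] in "auto simp: U.minus_eq")
 then show ?thesis unfolding rad_iff[OF U V] using zero_hom[OF U V] by blast
qed

lemma rad_submodule:
 assumes U: "left_module B U" and V: "left_module B V"
 shows "submodule (rad B U V) F (hom_space B U V)"
proof -
 interpret H: vspace F "hom_space B U V" by (rule hom_space_vspace[OF U V])
 have "(\<lambda>u\<in>carrier U. scl V c (f u)) : rad B U V" if "c : carrier F" "f : rad B U V" for c f
 proof -
  have "(\<lambda>u\<in>carrier U. scl V c (f u)) = compose (carrier U) (\<lambda>v\<in>carrier V. scl V c v) f"
   using hom_closed[OF rad_hom[OF that(2)]] by (auto simp: compose_def fun_eq_iff)
  then show ?thesis using rad_left[OF U V V that(2) scl_hom[OF V that(1)]] by simp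
 qed
 then show ?thesis unfolding H.submodule_iff using rad_zero[OF U V] rad_add[OF U V] rad_hom by auto
qed

subsection \<open>The square of the radical\<close>

definition rad_products ::
  "('a, nat => 'f) module => ('a, nat => 'f) module => ((nat => 'f) => (nat => 'f)) set" where
 "rad_products U V =
  (\<Union>W\<in>fd_mod F B. {compose (carrier U) g f | f g. f : rad B U W \<and> g : rad B W V})"

lemma rad_products_subset:
 assumes U: "left_module B U" and V: "left_module B V"
 shows "rad_products U V <= mod_hom B U V"
 unfolding rad_products_def using compose_hom[OF rad_hom rad_hom U] by blast

lemma rad2_submodule:
 assumes U: "left_module B U" and V: "left_module B V"
 shows "submodule (rad2 F B U V) F (hom_space B U V)"
proof -
 interpret H: vspace F "hom_space B U V" by (rule hom_space_vspace[OF U V])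
 show ?thesis unfolding rad2_def rad_products_def[symmetric]
  using H.lin_span_submodule rad_products_subset[OF U V] by simp
qed

lemma rad2I:
 "[|W : fd_mod F B; f : rad B U W; g : rad B W V|] ==> compose (carrier U) g f : rad2 F B U V"
 unfolding rad2_def lin_span_def by blast

lemma rad2_least:
 assumes "submodule H F (hom_space B U V)"
  "!!W f g. [|W : fd_mod F B; f : rad B U W; g : rad B W V|] ==> compose (carrier U) g f : H"
 shows "rad2 F B U V <= H"
 unfolding rad2_def lin_span_def using assms by blast

lemma rad2_left:
 assumes U: "left_module B U" and V: "left_module B V" and W: "left_module B W"
  and a: "a : mod_hom B V W" and f: "f : rad2 F B U V"
 shows "compose (carrier U) a f : rad2 F B U W"
proof -
 interpret U: left_module B U by fact
 interpret W: left_module B W by fact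
 interpret V: left_module B V by fact
 interpret H: vspace F "hom_space B U V" by (rule hom_space_vspace[OF U V])
 interpret H': vspace F "hom_space B U W" by (rule hom_space_vspace[OF U W])
 note R = rad2_submodule[OF U W, unfolded H'.submodule_iff]
 let ?H = "{h : mod_hom B U V. compose (carrier U) a h : rad2 F B U W}"
 have "submodule ?H F (hom_space B U V)" unfolding H.submodule_iff
 proof (intro conjI ballI)
  have "compose (carrier U) a (\<lambda>u\<in>carrier U. 0_V) = (\<lambda>u\<in>carrier U. 0_W)"
   using hom_zero[OF V W a] by (auto simp: compose_def)
  then show "\<zero>\<^bsub>hom_space B U V\<^esub> : ?H" using zero_hom[OF U V] R by simp
  fix h h' assume h: "h : ?H" "h' : ?H"
  have "compose (carrier U) a (\<lambda>u\<in>carrier U. h u +_V h' u) =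
    (\<lambda>u\<in>carrier U. compose (carrier U) a h u +_W compose (carrier U) a h' u)"
   using h hom_add[OF a] hom_closed[of _ B U V] by (auto simp: compose_def)
  then show "h \<oplus>\<^bsub>hom_space B U V\<^esub> h' : ?H" using h add_hom[OF U V] R by auto
 next
  fix c h assume h: "c : carrier F" "h : ?H"
  have "compose (carrier U) a (\<lambda>u\<in>carrier U. scl V c (h u)) =
    (\<lambda>u\<in>carrier U. scl W c (compose (carrier U) a h u))"
   using h hom_scl[OF V W a] hom_closed[of _ B U V] by (auto simp: compose_def)
  then show "c \<odot>\<^bsub>hom_space B U V\<^esub> h : ?H" using h scale_hom[OF U V] R by auto
 qed auto
 moreover have "compose (carrier U) g f : ?H" if "T : fd_mod F B" "f : rad B U T" "g : rad B T V" for T f g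
 proof -
  have "compose (carrier U) a (compose (carrier U) g f) = compose (carrier U) (compose (carrier T) a g) f"
   using hom_closed[OF rad_hom[OF that(2)]] by (auto simp: compose_def)
  then show ?thesis
   using rad2I[OF that(1,2) rad_left[OF fd_mod_left[OF that(1)] V W that(3) a]]
    compose_hom[OF rad_hom[OF that(2)] rad_hom[OF that(3)] U] by simp
 qed
 ultimately show ?thesis using rad2_least f by blast
qed

lemma rad2_right:
 assumes T: "left_module B T" and U: "left_module B U" and V: "left_module B V"
  and b: "b : mod_hom B T U" and f: "f : rad2 F B U V"
 shows "compose (carrier T) f b : rad2 F B T V"
proof -
 interpret T: left_module B T by fact
 interpret V: left_module B V by fact
 interpret U: left_module B U by fact
 interpret H: vspace F "hom_space B U V" by (rule hom_space_vspace[OF U V])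
 interpret H': vspace F "hom_space B T V" by (rule hom_space_vspace[OF T V])
 note R = rad2_submodule[OF T V, unfolded H'.submodule_iff]
 let ?H = "{h : mod_hom B U V. compose (carrier T) h b : rad2 F B T V}"
 note bc = hom_closed[OF b]
 have "submodule ?H F (hom_space B U V)" unfolding H.submodule_iff
 proof (intro conjI ballI)
  have "compose (carrier T) (\<lambda>u\<in>carrier U. 0_V) b = (\<lambda>u\<in>carrier T. 0_V)"
   using bc by (auto simp: compose_def)
  then show "\<zero>\<^bsub>hom_space B U V\<^esub> : ?H" using zero_hom[OF U V] R by simp
  fix h h' assume h: "h : ?H" "h' : ?H"
  have "compose (carrier T) (\<lambda>u\<in>carrier U. h u +_V h' u) b =
    (\<lambda>u\<in>carrier T. compose (carrier T) h b u +_V compose (carrier T) h' b u)"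
   using bc by (auto simp: compose_def)
  then show "h \<oplus>\<^bsub>hom_space B U V\<^esub> h' : ?H" using h add_hom[OF U V] R by auto
 next
  fix c h assume h: "c : carrier F" "h : ?H"
  have "compose (carrier T) (\<lambda>u\<in>carrier U. scl V c (h u)) b =
    (\<lambda>u\<in>carrier T. scl V c (compose (carrier T) h b u))"
   using bc by (auto simp: compose_def)
  then show "c \<odot>\<^bsub>hom_space B U V\<^esub> h : ?H" using h scale_hom[OF U V] R by auto
 qed auto
 moreover have "compose (carrier U) g f : ?H" if "W : fd_mod F B" "f : rad B U W" "g : rad B W V" for W f g
 proof -
  have "compose (carrier T) (compose (carrier U) g f) b = compose (carrier T) g (compose (carrier T) f b)"
   using bc by (auto simp: compose_def)
  then show ?thesis
   using rad2I[OF that(1) rad_right[OF T U fd_mod_left[OF that(1)] that(2) b] that(3)]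
    compose_hom[OF rad_hom[OF that(2)] rad_hom[OF that(3)] U] by simp
 qed
 ultimately show ?thesis using rad2_least f by blast
qed

lemma irr_nonzero_iff:
 assumes U: "left_module B U" and V: "left_module B V"
 shows "carrier (Defs.Irr F B U V) ~= {\<one>\<^bsub>Defs.Irr F B U V\<^esub>} \<longleftrightarrow> \<not> rad B U V <= rad2 F B U V"
proof -
 interpret H: vspace F "hom_space B U V" by (rule hom_space_vspace[OF U V])
 note R = rad2_submodule[OF U V] rad_submodule[OF U V]
 note R' = R[unfolded H.submodule_iff]
 let ?add = "%f g. \<lambda>u\<in>carrier U. f u +_V g u"
 have one: "\<one>\<^bsub>Defs.Irr F B U V\<^esub> = rad2 F B U V" unfolding Defs.Irr_def A_FactGroup_def FactGroup_def by simp
 have car: "carrier (Defs.Irr F B U V) = (%x. (%h. ?add h x) ` rad2 F B U V) ` rad B U V"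
  unfolding Defs.Irr_def A_FactGroup_def FactGroup_def RCOSETS_def r_coset_def
  by (simp add: UNION_singleton_eq_range)
 have cos: "(%h. ?add h x) ` rad2 F B U V = rad2 F B U V \<longleftrightarrow> x : rad2 F B U V" if x: "x : rad B U V" for x
 proof
  have xc: "x : carrier (hom_space B U V)" by (rule subsetD[OF H.submoduleE(1)[OF R(2)] x])
  assume *: "(%h. ?add h x) ` rad2 F B U V = rad2 F B U V"
  have "\<zero>\<^bsub>hom_space B U V\<^esub> : rad2 F B U V" using R'(1) by (elim conjE)
  then have "?add \<zero>\<^bsub>hom_space B U V\<^esub> x : (%h. ?add h x) ` rad2 F B U V" by (rule imageI)
  then have "?add \<zero>\<^bsub>hom_space B U V\<^esub> x : rad2 F B U V" unfolding * .
  moreover have "?add \<zero>\<^bsub>hom_space B U V\<^esub> x = x" using H.M.l_zero[OF xc] by simp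
  ultimately show "x : rad2 F B U V" by simp
 next
  assume x2: "x : rad2 F B U V"
  have xc: "x : carrier (hom_space B U V)" by (rule subsetD[OF H.submoduleE(1)[OF R(2)] x])
  show "(%h. ?add h x) ` rad2 F B U V = rad2 F B U V"
  proof
   show "(%h. ?add h x) ` rad2 F B U V <= rad2 F B U V"
    using H.submoduleE(5)[OF R(1) _ x2] by (intro image_subsetI) simp
   show "rad2 F B U V <= (%h. ?add h x) ` rad2 F B U V"
   proof
    fix h assume h: "h : rad2 F B U V"
    have hc: "h : carrier (hom_space B U V)" by (rule subsetD[OF H.submoduleE(1)[OF R(1)] h])
    let ?d = "h \<oplus>\<^bsub>hom_space B U V\<^esub> (\<ominus>\<^bsub>hom_space B U V\<^esub> x)"
    have "?d : rad2 F B U V" by (rule H.submoduleE(5)[OF R(1) h H.submoduleE(3)[OF R(1) x2]])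
    moreover have "?d \<oplus>\<^bsub>hom_space B U V\<^esub> x = h"
     using hc xc by (simp only: H.M.a_assoc H.M.a_inv_closed H.M.l_neg H.M.r_zero)
    ultimately show "h : (%h. ?add h x) ` rad2 F B U V" by (intro image_eqI[of _ _ ?d]) simp_all
   qed
  qed
 qed
 show ?thesis
 proof (cases "rad B U V <= rad2 F B U V")
  case True
  have zr: "\<zero>\<^bsub>hom_space B U V\<^esub> : rad B U V" using R'(2) by (elim conjE)
  moreover have "(%h. ?add h x) ` rad2 F B U V = rad2 F B U V" if "x : rad B U V" for x
   using cos[OF that] subsetD[OF True that] by simp
  ultimately have "carrier (Defs.Irr F B U V) = (%x. rad2 F B U V) ` rad B U V"
   unfolding car by (intro image_cong) simp_all
  then have "carrier (Defs.Irr F B U V) = {rad2 F B U V}" unfolding image_constant[OF zr] .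
  then show ?thesis using True one by simp
 next
  case False
  then obtain x where x: "x : rad B U V" "x \<notin> rad2 F B U V" by blast
  then have "(%h. ?add h x) ` rad2 F B U V ~= rad2 F B U V" using cos by simp
  moreover have "(%h. ?add h x) ` rad2 F B U V : carrier (Defs.Irr F B U V)"
   unfolding car using x(1) by (rule imageI)
  ultimately have "carrier (Defs.Irr F B U V) ~= {rad2 F B U V}" by (intro notI) simp
  then show ?thesis using False one by simp
 qed
qed

end

section \<open>Endomorphisms of indecomposable modules\<close>

context scalar_algebra
begin

lemma pow_hom:
 assumes U: "left_module B U" and f: "f : mod_hom B U U"
 shows "(\<lambda>u\<in>carrier U. (f ^^ n) u) : mod_hom B U U"
proof (induction n)
 case 0
 have "(\<lambda>u\<in>carrier U. (f ^^ 0) u) = (\<lambda>u\<in>carrier U. u)" by (rule restrict_ext) simp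
 then show ?case using id_hom[OF U] by (simp only:)
next
 case (Suc n)
 have "(\<lambda>u\<in>carrier U. (f ^^ Suc n) u) = compose (carrier U) f (\<lambda>u\<in>carrier U. (f ^^ n) u)"
  by (auto simp: compose_def)
 then show ?case using compose_hom[OF Suc f U] by (simp only:)
qed

lemma pow_closed:
 assumes "left_module B U" "f : mod_hom B U U" "u : carrier U"
 shows "(f ^^ n) u : carrier U"
 using hom_closed[OF pow_hom[OF assms(1,2), of n] assms(3)] assms(3) by simp

lemma pow_zero:
 assumes "left_module B U" "f : mod_hom B U U"
 shows "(f ^^ n) 0_U = 0_U"
proof -
 interpret U: left_module B U by fact
 show ?thesis using hom_zero[OF assms(1,1) pow_hom[OF assms, of n]] by simp
qed

lemma pow_minus:
 assumes "left_module B U" "f : mod_hom B U U" "u : carrier U" "v : carrier U"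
 shows "(f ^^ n) (u -_U v) = (f ^^ n) u -_U (f ^^ n) v"
proof -
 interpret U: left_module B U by fact
 show ?thesis using hom_minus[OF assms(1,1) pow_hom[OF assms(1,2), of n] assms(3,4)] assms(3,4) by simp
qed

lemma nilpotent_one_minus_bij:
 assumes U: "left_module B U" and z: "z : mod_hom B U U"
  and nil: "!!u. u : carrier U ==> (z ^^ n) u = 0_U"
 shows "bij_betw (\<lambda>u\<in>carrier U. u -_U z u) (carrier U) (carrier U)"
 unfolding one_minus_bij_iff[OF U z]
proof (intro conjI ballI impI)
 interpret U: left_module B U by fact
 fix u assume u: "u : carrier U" "z u = u"
 have "(z ^^ j) u = u" for j by (induction j) (auto simp: u)
 then show "u = 0_U" using nil[OF u(1)] by simp
next
 interpret U: left_module B U by fact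
 fix v assume v: "v : carrier U"
 have "EX w:carrier U. w -_U z w = v -_U (z ^^ j) v" for j
 proof (induction j)
  case 0
  have "0_U -_U z 0_U = v -_U (z ^^ 0) v" using hom_zero[OF U U z] v
   by (simp add: U.minus_eq U.r_neg)
  then show ?case by blast
 next
  case (Suc j)
  then obtain w where w: "w : carrier U" "w -_U z w = v -_U (z ^^ j) v" by blast
  note pc = pow_closed[OF U z v]
  note zc = hom_closed[OF z]
  let ?p = "(z ^^ j) v"
  have "(w +_U ?p) -_U z (w +_U ?p) = (w -_U z w) +_U (?p -_U z ?p)"
   using w(1) pc[of j] zc by (simp add: hom_add[OF z] U.minus_eq U.minus_add U.a_ac)
  also have "... = v -_U z ?p"
   unfolding w(2) using v pc[of j] zc by (simp add: U.minus_eq U.a_ac U.r_neg1 U.r_neg2)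
  finally show ?case using w(1) pc[of j] by (intro bexI[of _ "w +_U ?p"]) auto
 qed
 then obtain w where "w : carrier U" "w -_U z w = v -_U (z ^^ n) v" by blast
 then show "EX u:carrier U. u -_U z u = v" using nil[OF v] v by (auto simp: U.minus_eq)
qed

lemma fd_mod_fin_dim: "U : fd_mod F B ==> fin_dim F (underlying_space B U)"
 unfolding fd_mod_def by auto

lemma hom_space_fin_separated:
 assumes U: "U : fd_mod F B" and V: "V : fd_mod F B"
 shows "vspace.fin_separated F (hom_space B U V)"
proof -
 note LU = fd_mod_left[OF U] and LV = fd_mod_left[OF V]
 interpret U: left_module B U by (rule LU)
 interpret V: left_module B V by (rule LV)
 interpret SU: vspace F "underlying_space B U" by (rule underlying_vspace[OF LU])
 interpret SV: vspace F "underlying_space B V" by (rule underlying_vspace[OF LV])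
 interpret H: vspace F "hom_space B U V" by (rule hom_space_vspace[OF LU LV])
 obtain n w c where D: "SU.dual_family n w c"
  and fx: "!!x. x : carrier (underlying_space B U) ==> SU.dual_proj n w c x = x"
  by (rule SU.fin_dim_dual_basis[OF fd_mod_fin_dim[OF U]]) blast
 have w: "!!i. i < n ==> w i : carrier U" using SU.dual_familyD(1)[OF D] by simp
 obtain N :: nat and \<gamma> where N: "ALL i<N. \<gamma> i : lin_func F (underlying_space B V)"
  "ALL x:carrier (underlying_space B V). (ALL i<N. \<gamma> i x = 0_F) --> x = \<zero>\<^bsub>underlying_space B V\<^esub>"
  using SV.fin_dim_imp_fin_separated[OF fd_mod_fin_dim[OF V]] unfolding SV.fin_separated_def by blast
 have \<gamma>: "\<gamma> i : lin_func F (underlying_space B V)" if "i < N" for i using N(1) that by simp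
 have sep: "x = 0_V" if "x : carrier V" "ALL i<N. \<gamma> i x = 0_F" for x using N(2) that by simp
 define \<delta> where "\<delta> = (%k f. \<gamma> (k mod N) (f (w (k div N))))"
 have idx: "k mod N < N" "k div N < n" if "k < n * N" for k
  using that by (cases "N = 0"; simp add: less_mult_imp_div_less)+
 have lin: "\<delta> k : lin_func F (hom_space B U V)" if "k < n * N" for k
 proof (rule lin_funcI)
  note g = \<gamma>[OF idx(1)[OF that]] and wk = w[OF idx(2)[OF that]]
  show "\<delta> k f : carrier F" if "f : carrier (hom_space B U V)" for f
   unfolding \<delta>_def using that hom_closed[of f B U V] wk by (intro lin_func_closed[OF g]) simp
  show "\<delta> k (f \<oplus>\<^bsub>hom_space B U V\<^esub> f') = \<delta> k f +_F \<delta> k f'"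
   if "f : carrier (hom_space B U V)" "f' : carrier (hom_space B U V)" for f f'
   unfolding \<delta>_def using that hom_closed[of _ B U V] wk lin_func_add[OF g] by simp
  show "\<delta> k (d \<odot>\<^bsub>hom_space B U V\<^esub> f) = d *_F \<delta> k f"
   if "d : carrier F" "f : carrier (hom_space B U V)" for d f
   unfolding \<delta>_def using that hom_closed[of _ B U V] wk lin_func_smult[OF g] by simp
 qed
 have sep': "f = \<zero>\<^bsub>hom_space B U V\<^esub>"
  if f: "f : carrier (hom_space B U V)" and z: "ALL k<n * N. \<delta> k f = 0_F" for f
 proof -
  have fh: "f : mod_hom B U V" using f by simp
  have fw: "f (w i) = 0_V" if i: "i < n" for i
  proof (rule sep)
   show "f (w i) : carrier V" by (rule hom_closed[OF fh w[OF i]])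
   show "ALL j<N. \<gamma> j (f (w i)) = 0_F"
   proof (intro allI impI)
    fix j assume j: "j < N"
    have "i * N + j < Suc i * N" using j by simp
    also have "... <= n * N" using i by (intro mult_le_mono1) simp
    finally have "\<delta> (i * N + j) f = 0_F" using z by simp
    then show "\<gamma> j (f (w i)) = 0_F" unfolding \<delta>_def using j by simp
   qed
  qed
  let ?K = "{u : carrier U. f u = 0_V}"
  have s0: "scl V d 0_V = 0_V" if "d : carrier F" for d
   unfolding scl_def using V.act_zero sc_closed that by simp
  have K: "submodule ?K F (underlying_space B U)" unfolding SU.submodule_iff
   using hom_zero[OF LU LV fh] hom_add[OF fh] hom_scl[OF LU LV fh] scl_closed[OF LU] s0 by auto
  have "f u = 0_V" if u: "u : carrier U" for u
  proof -
   have "SU.dual_proj n w c u : ?K" unfolding SU.dual_proj_def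
   proof (rule SU.submodule_finsum[OF K])
    fix i assume "i : {..<n}"
    then have "w i : ?K" "c i u : carrier F"
     using w fw lin_func_closed[OF SU.dual_familyD(2)[OF D]] u by auto
    then show "c i u \<odot>\<^bsub>underlying_space B U\<^esub> w i : ?K"
     using K unfolding SU.submodule_iff by blast
   qed simp
   then show ?thesis using fx u by simp
  qed
  then show ?thesis using hom_ext[OF fh] by (auto simp: extensional_def)
 qed
 show ?thesis unfolding H.fin_separated_def
  using lin sep' by (intro exI[of _ "n * N"] exI[of _ \<delta>]) blast
qed

text \<open>The descending chain condition, applied to the subspaces \<open>f\<^sup>n C\<close> of an algebra of endomorphisms.\<close>

lemma power_stabilizes:
 assumes U: "U : fd_mod F B" and f: "f : mod_hom B U U"
  and C: "submodule C F (hom_space B U U)" "(\<lambda>u\<in>carrier U. u) : C"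
   "!!g. g : C ==> compose (carrier U) f g : C"
 shows "EX n. EX g:C. ALL u:carrier U. (f ^^ n) u = (f ^^ n) (f (g u))"
proof -
 note LU = fd_mod_left[OF U]
 interpret U: left_module B U by (rule LU)
 interpret H: vspace F "hom_space B U U" by (rule hom_space_vspace[OF LU LU])
 note C1 = C(1)[unfolded H.submodule_iff]
 have CH: "!!g. g : C ==> g : mod_hom B U U" using H.submoduleE(1)[OF C(1)] by auto
 define p where "p n = (\<lambda>u\<in>carrier U. (f ^^ n) u)" for n
 have p: "p n : mod_hom B U U" for n unfolding p_def by (rule pow_hom[OF LU f])
 have pu: "p n u = (f ^^ n) u" if "u : carrier U" for n u unfolding p_def using that by simp
 define Hn where "Hn n = (%g. compose (carrier U) (p n) g) ` C" for n
 have sub: "submodule (Hn n) F (hom_space B U U)" for n unfolding H.submodule_iff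
 proof (intro conjI ballI)
  show "Hn n <= carrier (hom_space B U U)" unfolding Hn_def using compose_hom[OF CH p LU] by (intro image_subsetI) simp
  have "compose (carrier U) (p n) \<zero>\<^bsub>hom_space B U U\<^esub> = \<zero>\<^bsub>hom_space B U U\<^esub>"
   using hom_zero[OF LU LU p] by (auto simp: compose_def)
  then show "\<zero>\<^bsub>hom_space B U U\<^esub> : Hn n" unfolding Hn_def
   using C1 by (intro image_eqI[of _ _ "\<zero>\<^bsub>hom_space B U U\<^esub>"]) simp_all
  fix x y assume "x : Hn n" "y : Hn n"
  then obtain a b where ab: "a : C" "b : C" "x = compose (carrier U) (p n) a" "y = compose (carrier U) (p n) b"
   unfolding Hn_def by blast
  have "x \<oplus>\<^bsub>hom_space B U U\<^esub> y = compose (carrier U) (p n) (a \<oplus>\<^bsub>hom_space B U U\<^esub> b)"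
   using ab hom_closed[OF CH] hom_add[OF p] by (auto simp: compose_def)
  moreover have "a \<oplus>\<^bsub>hom_space B U U\<^esub> b : C" using ab(1,2) C1 by simp
  ultimately show "x \<oplus>\<^bsub>hom_space B U U\<^esub> y : Hn n" unfolding Hn_def by (rule image_eqI)
 next
  fix d x assume d: "d : carrier F" and "x : Hn n"
  then obtain a where a: "a : C" "x = compose (carrier U) (p n) a" unfolding Hn_def by blast
  have "d \<odot>\<^bsub>hom_space B U U\<^esub> x = compose (carrier U) (p n) (d \<odot>\<^bsub>hom_space B U U\<^esub> a)"
   using a d hom_closed[OF CH] hom_scl[OF LU LU p] by (auto simp: compose_def)
  moreover have "d \<odot>\<^bsub>hom_space B U U\<^esub> a : C" using a(1) d C1 by simp
  ultimately show "d \<odot>\<^bsub>hom_space B U U\<^esub> x : Hn n" unfolding Hn_def by (rule image_eqI)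
 qed
 have dec: "Hn (Suc n) <= Hn n" for n
 proof
  fix x assume "x : Hn (Suc n)"
  then obtain a where a: "a : C" "x = compose (carrier U) (p (Suc n)) a" unfolding Hn_def by blast
  have x: "x = compose (carrier U) (p n) (compose (carrier U) f a)"
   unfolding a(2) using hom_closed[OF CH[OF a(1)]] hom_closed[OF f]
   by (auto simp: compose_def pu funpow_swap1)
  show "x : Hn n" unfolding Hn_def using x C(3)[OF a(1)] by (rule image_eqI)
 qed
 obtain n where n: "Hn (Suc n) = Hn n"
  using H.descending_subspaces_stabilize[of Hn, OF hom_space_fin_separated[OF U U] sub dec] by blast
 have "compose (carrier U) (p n) (\<lambda>u\<in>carrier U. u) : Hn n" unfolding Hn_def by (rule imageI[OF C(2)])
 then have "compose (carrier U) (p n) (\<lambda>u\<in>carrier U. u) : Hn (Suc n)" using n by simp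
 then obtain g where g: "g : C"
  "compose (carrier U) (p n) (\<lambda>u\<in>carrier U. u) = compose (carrier U) (p (Suc n)) g"
  unfolding Hn_def by blast
 show ?thesis
 proof (intro exI bexI[OF _ g(1)] ballI)
  fix u assume u: "u : carrier U"
  show "(f ^^ n) u = (f ^^ n) (f (g u))"
   using fun_cong[OF g(2), of u] u hom_closed[OF CH[OF g(1)] u]
   by (simp add: compose_def pu funpow_swap1)
 qed
qed

text \<open>A relation \<open>f\<^sup>n = f\<^sup>n f g\<close> gives \<open>f\<^sup>n (1 - f g) = 0\<close>, and \<open>1 - f g\<close> is invertible.\<close>

lemma rad_nilpotent:
 assumes U: "U : fd_mod F B" and f: "f : rad B U U"
 shows "EX n. ALL u:carrier U. (f ^^ n) u = 0_U"
proof -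
 note LU = fd_mod_left[OF U] and fh = rad_hom[OF f]
 interpret U: left_module B U by (rule LU)
 interpret H: vspace F "hom_space B U U" by (rule hom_space_vspace[OF LU LU])
 have C: "submodule (mod_hom B U U) F (hom_space B U U)" using H.carrier_is_submodule by simp
 obtain n g where g: "g : mod_hom B U U" and n: "ALL u:carrier U. (f ^^ n) u = (f ^^ n) (f (g u))"
  using power_stabilizes[OF U fh C id_hom[OF LU] compose_hom[OF _ fh LU]] by blast
 note g = g bspec[OF n]
 have fg: "compose (carrier U) f g : mod_hom B U U" by (rule compose_hom[OF g(1) fh LU])
 have "bij_betw (\<lambda>v\<in>carrier U. v -_U f (g v)) (carrier U) (carrier U)"
  by (rule one_minus_swap[OF LU LU fh g(1)]) (rule rad_bij[OF LU LU f g(1)])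
 moreover have "(\<lambda>v\<in>carrier U. v -_U f (g v)) = (\<lambda>v\<in>carrier U. v -_U compose (carrier U) f g v)"
  by (auto simp: compose_def)
 ultimately have s: "ALL v:carrier U. EX u:carrier U. u -_U compose (carrier U) f g u = v"
  using one_minus_bij_iff[OF LU fg] by simp
 have "(f ^^ n) v = 0_U" if v: "v : carrier U" for v
 proof -
  obtain u where u: "u : carrier U" "u -_U compose (carrier U) f g u = v" using s v by blast
  have uu: "f (g u) : carrier U" using hom_closed[OF fh hom_closed[OF g(1) u(1)]] .
  have "v = u -_U f (g u)" using u by (simp add: compose_def)
  then have "(f ^^ n) v = (f ^^ n) u -_U (f ^^ n) (f (g u))"
   using pow_minus[OF LU fh u(1) uu] by simp
  then show ?thesis using g(2)[OF u(1)] pow_closed[OF LU fh uu, of n] by (simp add: U.minus_eq U.r_neg)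
 qed
 then show ?thesis by blast
qed

lemma indecomposableD:
 "[|indecomposable B U; submodule P B U; submodule Q B U; P <+>\<^bsub>U\<^esub> Q = carrier U;
  P \<inter> Q = {0_U}|] ==> P = {0_U} \<or> Q = {0_U}"
 unfolding indecomposable_def by simp

lemma indecomposable_nonzero:
 assumes "left_module B U" "indecomposable B U"
 obtains u where "u : carrier U" "u ~= 0_U"
proof -
 interpret U: left_module B U by fact
 have "carrier U ~= {0_U}" using assms(2) unfolding indecomposable_def by simp
 then show thesis using that U.zero_closed by auto
qed

lemma indecomposable_idempotent:
 assumes U: "left_module B U" and ind: "indecomposable B U" and e: "e : mod_hom B U U"
  and idem: "!!u. u : carrier U ==> e (e u) = e u"
 shows "(ALL u:carrier U. e u = 0_U) \<or> (ALL u:carrier U. e u = u)"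
proof -
 interpret U: left_module B U by fact
 note ec = hom_closed[OF e] and e0 = hom_zero[OF U U e]
 let ?P = "e ` carrier U" and ?Q = "{u : carrier U. e u = 0_U}"
 have P: "submodule ?P B U" unfolding U.submodule_iff
 proof (intro conjI ballI)
  show "?P <= carrier U" using ec by blast
  show "0_U : ?P" by (rule image_eqI[of _ _ "0_U"]) (simp_all add: e0)
  fix x y assume "x : ?P" "y : ?P"
  then obtain a b where "x = e a" "y = e b" "a : carrier U" "b : carrier U" by blast
  then show "x +_U y : ?P" by (intro image_eqI[of _ _ "a +_U b"]) (auto simp: hom_add[OF e])
 next
  fix a x assume a: "a : carrier B" and "x : ?P"
  then obtain b where "x = e b" "b : carrier U" by blast
  then show "a \<odot>_U x : ?P" using a by (intro image_eqI[of _ _ "a \<odot>_U b"]) (auto simp: hom_act[OF e] U.act_closed)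
 qed
 have Q: "submodule ?Q B U" unfolding U.submodule_iff
  using e0 by (auto simp: hom_add[OF e] hom_act[OF e] U.act_closed U.act_zero)
 have "?P <+>\<^bsub>U\<^esub> ?Q = carrier U"
 proof
  show "?P <+>\<^bsub>U\<^esub> ?Q <= carrier U" unfolding set_add_def' using ec by auto
  show "carrier U <= ?P <+>\<^bsub>U\<^esub> ?Q"
  proof
   fix u assume u: "u : carrier U"
   have "e (u -_U e u) = 0_U" using hom_minus[OF U U e u ec[OF u]] idem[OF u] ec[OF u]
    by (simp add: U.minus_eq U.r_neg)
   then have "u -_U e u : ?Q" using u ec by simp
   moreover have "u = e u +_U (u -_U e u)" using u ec[OF u] by (simp add: U.minus_eq U.a_ac U.r_neg1 U.r_neg2 U.r_neg)
   moreover have "e u : ?P" using u by blast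
   ultimately show "u : ?P <+>\<^bsub>U\<^esub> ?Q" unfolding set_add_def' by (intro UN_I[of "e u"] UN_I[of "u -_U e u"]) simp_all
  qed
 qed
 moreover have "?P \<inter> ?Q = {0_U}"
 proof
  show "?P \<inter> ?Q <= {0_U}" using idem by auto
  have "0_U : ?P" by (rule image_eqI[of _ _ "0_U"]) (simp_all add: e0)
  then show "{0_U} <= ?P \<inter> ?Q" using e0 by simp
 qed
 ultimately have "?P = {0_U} \<or> ?Q = {0_U}" by (rule indecomposableD[OF ind P Q])
 then show ?thesis
 proof
  assume P0: "?P = {0_U}"
  have "e u = 0_U" if "u : carrier U" for u using imageI[OF that, of e] unfolding P0 by simp
  then show ?thesis by blast
 next
  assume Q0: "?Q = {0_U}"
  have "e u = u" if u: "u : carrier U" for u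
  proof -
   have "e (u -_U e u) = 0_U" using hom_minus[OF U U e u ec[OF u]] idem[OF u] ec[OF u]
    by (simp add: U.minus_eq U.r_neg)
   then have "u -_U e u : ?Q" using u ec by simp
   then have "u -_U e u = 0_U" using Q0 by simp
   then show ?thesis using U.a_minus_eq_zero_iff[OF u ec[OF u]] by simp
  qed
  then show ?thesis by blast
 qed
qed

lemma funpow_commute_on:
 assumes "!!u. u : S ==> f u : S" "!!u. u : S ==> f (g u) = g (f u)" "!!u. u : S ==> g u : S" "u : S"
 shows "(f ^^ n) (g u) = g ((f ^^ n) u) \<and> (f ^^ n) u : S"
 using assms by (induction n) auto

text \<open>Fitting's lemma. The chain condition is applied to the double centralizer of \<open>f\<close>, so that the
 resulting relation \<open>f\<^sup>n = f\<^sup>n f g\<close> has \<open>g\<close> commuting with \<open>f\<close>; then \<open>(f g)\<^sup>m\<close> is idempotent.\<close>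

lemma indecomposable_endo:
 assumes U: "U : fd_mod F B" and ind: "indecomposable B U" and f: "f : mod_hom B U U"
 shows "bij_betw f (carrier U) (carrier U) \<or> (EX n. ALL u:carrier U. (f ^^ n) u = 0_U)"
proof -
 note LU = fd_mod_left[OF U]
 interpret U: left_module B U by (rule LU)
 interpret H: vspace F "hom_space B U U" by (rule hom_space_vspace[OF LU LU])
 let ?Z = "{h : mod_hom B U U. ALL u:carrier U. h (f u) = f (h u)}"
 let ?C = "{g : mod_hom B U U. ALL h:?Z. ALL u:carrier U. g (h u) = h (g u)}"
 have C: "submodule ?C F (hom_space B U U)" unfolding H.submodule_iff
 proof (intro conjI ballI)
  show "\<zero>\<^bsub>hom_space B U U\<^esub> : ?C" using zero_hom[OF LU LU] hom_closed[of _ B U U] hom_zero[OF LU LU]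
   by auto
  show "x \<oplus>\<^bsub>hom_space B U U\<^esub> y : ?C" if "x : ?C" "y : ?C" for x y
   using that add_hom[OF LU LU, of x y] hom_closed[of _ B U U] hom_add[of _ B U U] by auto
  show "d \<odot>\<^bsub>hom_space B U U\<^esub> x : ?C" if "d : carrier F" "x : ?C" for d x
   using that scale_hom[OF LU LU, of x d] hom_closed[of _ B U U] hom_scl[OF LU LU] by auto
 qed auto
 have idC: "(\<lambda>u\<in>carrier U. u) : ?C" using id_hom[OF LU] hom_closed[of _ B U U] by auto
 have fC: "compose (carrier U) f g : ?C" if "g : ?C" for g
  using that compose_hom[OF _ f LU, of g] hom_closed[of _ B U U] by (auto simp: compose_def)
 obtain n g where g: "g : ?C" and n: "ALL u:carrier U. (f ^^ n) u = (f ^^ n) (f (g u))"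
  using power_stabilizes[OF U f C idC fC] by blast
 note g = g bspec[OF n]
 have gh: "g : mod_hom B U U" using g by simp
 note fc = hom_closed[OF f] and gc = hom_closed[OF gh]
 have comm: "f (g u) = g (f u)" if "u : carrier U" for u using g(1) f that by auto
 define t where "t = compose (carrier U) f g"
 have t: "t : mod_hom B U U" unfolding t_def by (rule compose_hom[OF gh f LU])
 have tu: "t u = f (g u)" if "u : carrier U" for u unfolding t_def using that by (simp add: compose_def)
 define m where "m = Suc n"
 have ft: "(f ^^ m) (t u) = (f ^^ m) u" if "u : carrier U" for u
  unfolding m_def using g(2)[OF that] tu[OF that] by simp
 have ftk: "(f ^^ m) ((t ^^ k) u) = (f ^^ m) u" if "u : carrier U" for u k
 proof (induction k)
  case (Suc k)
  then show ?case using ft[OF pow_closed[OF LU t that]] by simp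
 qed simp
 have tk: "(t ^^ k) u = (g ^^ k) ((f ^^ k) u)" if "u : carrier U" for u k
  using that
 proof (induction k arbitrary: u)
  case (Suc k)
  have "(t ^^ Suc k) u = (t ^^ k) (t u)" by (simp add: funpow_swap1)
  also have "... = (g ^^ k) ((f ^^ k) (g (f u)))" 
   using Suc.IH[of "t u"] tu[OF Suc.prems] comm[OF Suc.prems] fc gc Suc.prems by simp
  also have "(f ^^ k) (g (f u)) = g ((f ^^ k) (f u))"
   using funpow_commute_on[of "carrier U" f g "f u" k] fc gc comm Suc.prems by simp
  finally show ?case by (simp add: funpow_swap1)
 qed simp
 define e where "e = (\<lambda>u\<in>carrier U. (t ^^ m) u)"
 have e: "e : mod_hom B U U" unfolding e_def by (rule pow_hom[OF LU t])
 have eu: "e u = (t ^^ m) u" if "u : carrier U" for u unfolding e_def using that by simp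
 have "e (e u) = e u" if u: "u : carrier U" for u
 proof -
  have "e (e u) = (t ^^ m) ((t ^^ m) u)" using eu pow_closed[OF LU t u] u by simp
  also have "... = (g ^^ m) ((f ^^ m) ((t ^^ m) u))" by (rule tk[OF pow_closed[OF LU t u]])
  also have "... = e u" using ftk[OF u] tk[OF u] eu[OF u] by simp
  finally show ?thesis .
 qed
 then consider "ALL u:carrier U. e u = 0_U" | "ALL u:carrier U. e u = u"
  using indecomposable_idempotent[OF LU ind e] by blast
 then show ?thesis
 proof cases
  case 1
  have "(f ^^ m) u = 0_U" if u: "u : carrier U" for u
   using ftk[OF u, of m] 1 eu u pow_zero[OF LU f] by simp
  then show ?thesis by blast
 next
  case 2
  have "inj_on f (carrier U)" unfolding hom_inj_iff[OF LU LU f]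
  proof (intro ballI impI)
   fix u assume u: "u : carrier U" "f u = 0_U"
   then have "t u = 0_U" using tu comm hom_zero[OF LU LU gh] by simp
   then have "(t ^^ m) u = 0_U" unfolding m_def using pow_zero[OF LU t] by (simp add: funpow_swap1)
   then show "u = 0_U" using 2 eu u by simp
  qed
  moreover have "carrier U <= f ` carrier U"
  proof
   fix u assume u: "u : carrier U"
   have c: "(t ^^ n) u : carrier U" by (rule pow_closed[OF LU t u])
   have "u = t ((t ^^ n) u)" using 2 eu u unfolding m_def by simp
   then have "u = f (g ((t ^^ n) u))" using tu[OF c] by simp
   then show "u : f ` carrier U" using gc[OF c] by blast
  qed
  moreover have "f ` carrier U <= carrier U" using fc by blast
  ultimately show ?thesis unfolding bij_betw_def by blast
 qed
qed

text \<open>The endomorphism ring of an indecomposable module is local, with maximal ideal the radical.\<close>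

lemma indecomposable_rad_or_bij:
 assumes U: "U : fd_mod F B" and ind: "indecomposable B U" and f: "f : mod_hom B U U"
 shows "f : rad B U U \<or> bij_betw f (carrier U) (carrier U)"
proof (rule disjCI)
 note LU = fd_mod_left[OF U]
 interpret U: left_module B U by (rule LU)
 assume nb: "\<not> bij_betw f (carrier U) (carrier U)"
 then obtain n where n: "ALL u:carrier U. (f ^^ n) u = 0_U" using indecomposable_endo[OF U ind f] by blast
 obtain u where u: "u : carrier U" "u ~= 0_U" by (rule indecomposable_nonzero[OF LU ind])
 have ninj: "EX v:carrier U. v ~= 0_U \<and> f v = 0_U"
 proof (rule ccontr)
  assume *: "\<not> ?thesis"
  have "(f ^^ j) u ~= 0_U" for j
  proof (induction j)
   case (Suc j)
   then show ?case using * pow_closed[OF LU f u(1), of j] by auto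
  qed (simp add: u)
  then show False using n u by blast
 qed
 then obtain v where v: "v : carrier U" "v ~= 0_U" "f v = 0_U" by blast
 have "bij_betw (\<lambda>u\<in>carrier U. u -_U g (f u)) (carrier U) (carrier U)" if g: "g : mod_hom B U U" for g
 proof -
  let ?h = "compose (carrier U) g f"
  have h: "?h : mod_hom B U U" by (rule compose_hom[OF f g LU])
  have "?h v = ?h 0_U" using v hom_zero[OF LU LU f] hom_zero[OF LU LU g] by (simp add: compose_def)
  then have "\<not> bij_betw ?h (carrier U) (carrier U)"
   using v U.zero_closed unfolding bij_betw_def inj_on_def by blast
  then obtain m where m: "ALL u:carrier U. (?h ^^ m) u = 0_U"
   using indecomposable_endo[OF U ind h] by blast
  have "bij_betw (\<lambda>u\<in>carrier U. u -_U ?h u) (carrier U) (carrier U)"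
   by (rule nilpotent_one_minus_bij[OF LU h]) (use m in blast)
  moreover have "(\<lambda>u\<in>carrier U. u -_U ?h u) = (\<lambda>u\<in>carrier U. u -_U g (f u))"
   by (auto simp: compose_def)
  ultimately show ?thesis by simp
 qed
 then show "f : rad B U U" unfolding rad_iff[OF LU LU] using f by blast
qed

lemma rad_not_bij:
 assumes U: "U : fd_mod F B" and ind: "indecomposable B U" and f: "f : rad B U U"
 shows "\<not> bij_betw f (carrier U) (carrier U)"
proof
 note LU = fd_mod_left[OF U]
 interpret U: left_module B U by (rule LU)
 assume b: "bij_betw f (carrier U) (carrier U)"
 obtain n where n: "ALL u:carrier U. (f ^^ n) u = 0_U" using rad_nilpotent[OF U f] by blast
 obtain u where u: "u : carrier U" "u ~= 0_U" by (rule indecomposable_nonzero[OF LU ind])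
 have "(f ^^ j) u ~= 0_U" for j
 proof (induction j)
  case (Suc j)
  have "f ((f ^^ j) u) ~= f 0_U"
   using Suc b pow_closed[OF LU rad_hom[OF f] u(1), of j] U.zero_closed unfolding bij_betw_def inj_on_def by blast
  then show ?case using hom_zero[OF LU LU rad_hom[OF f]] by simp
 qed (simp add: u)
 then show False using n u by blast
qed

end

section \<open>Direct summands\<close>

context scalar_algebra
begin

lemma hom_inverse_ex:
 assumes "left_module B U" "left_module B V" "f : mod_hom B U V" "bij_betw f (carrier U) (carrier V)"
 shows "EX k:mod_hom B V U. bij_betw k (carrier V) (carrier U) \<and>
  (ALL u:carrier U. k (f u) = u) \<and> (ALL v:carrier V. f (k v) = v)"
 by (rule hom_inverse[OF assms]) (intro bexI conjI ballI)

definition summand :: "('a, 'v) module => ('a, 'w) module => bool" where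
 "summand N U \<longleftrightarrow> (EX i:mod_hom B N U. EX p:mod_hom B U N. ALL x:carrier N. p (i x) = x)"

definition splits :: "('a, 'v) module => ('a, 'v) module => ('a, 'v) module =>
  ('v => 'v) => ('v => 'v) => ('v => 'v) => ('v => 'v) => bool" where
 "splits U P Q i p j q \<longleftrightarrow> i : mod_hom B P U \<and> p : mod_hom B U P \<and> j : mod_hom B Q U \<and> q : mod_hom B U Q \<and>
  (ALL x:carrier P. p (i x) = x) \<and> (ALL x:carrier Q. q (j x) = x) \<and>
  (ALL u:carrier U. i (p u) +_U j (q u) = u)"

lemma splits_summand: "splits U P Q i p j q ==> summand P U" "splits U P Q i p j q ==> summand Q U"
 unfolding splits_def summand_def by blast+

lemma summand_refl: "left_module B U ==> summand U U"
 unfolding summand_def by (rule bexI[OF _ id_hom], rule bexI[OF _ id_hom]) auto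

lemma summand_trans:
 assumes "left_module B N" "left_module B W" and 1: "summand N U" and 2: "summand U W"
 shows "summand N W"
proof -
 obtain i p where a: "i : mod_hom B N U" "p : mod_hom B U N" "ALL x:carrier N. p (i x) = x"
  using 1 unfolding summand_def by blast
 obtain j q where b: "j : mod_hom B U W" "q : mod_hom B W U" "ALL x:carrier U. q (j x) = x"
  using 2 unfolding summand_def by blast
 have "compose (carrier N) j i : mod_hom B N W" by (rule compose_hom[OF a(1) b(1) assms(1)])
 moreover have "compose (carrier W) p q : mod_hom B W N" by (rule compose_hom[OF b(2) a(2) assms(2)])
 moreover have "ALL x:carrier N. compose (carrier W) p q (compose (carrier N) j i x) = x"
  using a(3) b(3) hom_closed[OF a(1)] hom_closed[OF b(1)] by (auto simp: compose_def)
 ultimately show ?thesis unfolding summand_def by blast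
qed

text \<open>If \<open>\<one> = a + b\<close> in a local ring then \<open>a\<close> or \<open>b\<close> is a unit; applied to the two compositions
 of \<open>N\<close> through \<open>P\<close> and \<open>Q\<close>.\<close>

lemma indecomposable_summand_of_split:
 fixes U :: "('a, nat => 'f) module"
 assumes N: "N : fd_mod F B" "indecomposable B N" and U: "left_module B U"
  and P: "left_module B P" and Q: "left_module B Q"
  and sp: "splits U P Q i p j q" and s: "summand N U"
 shows "summand N P \<or> summand N Q"
proof -
 note LN = fd_mod_left[OF N(1)]
 interpret N: left_module B N by (rule LN)
 interpret U: left_module B U by (rule U)
 have h: "i : mod_hom B P U" "p : mod_hom B U P" "j : mod_hom B Q U" "q : mod_hom B U Q"
  and one: "!!u. u : carrier U ==> i (p u) +_U j (q u) = u"
  using sp unfolding splits_def by auto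
 obtain \<iota> \<pi> where \<iota>: "\<iota> : mod_hom B N U" and \<pi>: "\<pi> : mod_hom B U N" and \<pi>\<iota>: "ALL x:carrier N. \<pi> (\<iota> x) = x"
  using s unfolding summand_def by blast
 have key: "summand N R" if R: "left_module B R" and r: "r : mod_hom B U R" "k : mod_hom B R U"
  and bij: "bij_betw (\<lambda>x\<in>carrier N. \<pi> (k (r (\<iota> x)))) (carrier N) (carrier N)" for R :: "('a, nat => 'f) module" and r k
 proof -
  have c1: "compose (carrier N) r \<iota> : mod_hom B N R" by (rule compose_hom[OF \<iota> r(1) LN])
  have c2: "compose (carrier R) \<pi> k : mod_hom B R N" by (rule compose_hom[OF r(2) \<pi> R])
  have "(\<lambda>x\<in>carrier N. \<pi> (k (r (\<iota> x)))) = compose (carrier N) (compose (carrier R) \<pi> k) (compose (carrier N) r \<iota>)"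
   using hom_closed[OF \<iota>] hom_closed[OF r(1)] by (auto simp: compose_def)
  then have ah: "(\<lambda>x\<in>carrier N. \<pi> (k (r (\<iota> x)))) : mod_hom B N N" using compose_hom[OF c1 c2 LN] by simp
  obtain l where l: "l : mod_hom B N N" "ALL x:carrier N. l ((\<lambda>x\<in>carrier N. \<pi> (k (r (\<iota> x)))) x) = x"
   using hom_inverse_ex[OF LN LN ah bij] by (elim bexE conjE)
  have c3: "compose (carrier R) l (compose (carrier R) \<pi> k) : mod_hom B R N" by (rule compose_hom[OF c2 l(1) R])
  have "ALL x:carrier N. compose (carrier R) l (compose (carrier R) \<pi> k) (compose (carrier N) r \<iota> x) = x"
   using l(2) hom_closed[OF \<iota>] hom_closed[OF r(1)] by (simp add: compose_def)
  then show ?thesis unfolding summand_def by (intro bexI[OF _ c1] bexI[OF _ c3])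
 qed
 let ?a = "\<lambda>x\<in>carrier N. \<pi> (i (p (\<iota> x)))" and ?b = "\<lambda>x\<in>carrier N. \<pi> (j (q (\<iota> x)))"
 have "?a = compose (carrier N) \<pi> (compose (carrier N) i (compose (carrier N) p \<iota>))"
  by (auto simp: compose_def)
 then have a: "?a : mod_hom B N N"
  using compose_hom[OF compose_hom[OF compose_hom[OF \<iota> h(2) LN] h(1) LN] \<pi> LN] by simp
 have sum: "?a x +_N ?b x = x" if x: "x : carrier N" for x
 proof -
  note ux = hom_closed[OF \<iota> x]
  have "\<pi> (i (p (\<iota> x))) +_N \<pi> (j (q (\<iota> x))) = \<pi> (i (p (\<iota> x)) +_U j (q (\<iota> x)))"
   by (rule hom_add[OF \<pi>, symmetric])
    (intro hom_closed[OF h(1)] hom_closed[OF h(2)] hom_closed[OF h(3)] hom_closed[OF h(4)] ux)+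
  then show ?thesis using one[OF ux] \<pi>\<iota> x by simp
 qed
 from indecomposable_rad_or_bij[OF N a] show ?thesis
 proof
  assume ar: "?a : rad B N N"
  have bij: "bij_betw (\<lambda>u\<in>carrier N. u -_N (\<lambda>u\<in>carrier N. u) (?a u)) (carrier N) (carrier N)"
   by (rule rad_bij[OF LN LN ar id_hom[OF LN]])
  have "(\<lambda>u\<in>carrier N. u -_N (\<lambda>u\<in>carrier N. u) (?a u)) = ?b"
  proof (rule restrict_ext)
   fix u assume u: "u : carrier N"
   have ac: "?a u : carrier N" by (rule hom_closed[OF a u])
   have bc: "?b u : carrier N"
    using u hom_closed[OF \<pi> hom_closed[OF h(3) hom_closed[OF h(4) hom_closed[OF \<iota> u]]]] by simp
   have "u -_N ?a u = (?a u +_N ?b u) -_N ?a u" using sum[OF u] by simp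
   also have "... = (?b u +_N ?a u) -_N ?a u" by (simp only: N.a_comm[OF ac bc])
   also have "... = ?b u"
    by (simp only: N.minus_eq N.a_assoc[OF bc ac N.a_inv_closed[OF ac]] N.r_neg[OF ac] N.r_zero[OF bc])
   finally show "u -_N (\<lambda>u\<in>carrier N. u) (?a u) = \<pi> (j (q (\<iota> u)))" using u ac by simp
  qed
  then have "bij_betw ?b (carrier N) (carrier N)" using bij by simp
  then show ?thesis using key[OF Q h(4,3)] by blast
 next
  assume "bij_betw ?a (carrier N) (carrier N)"
  then show ?thesis using key[OF P h(2,1)] by blast
 qed
qed

lemma iso_class_eqI:
 assumes U: "U : fd_mod F B" and V: "V : fd_mod F B"
  and f: "f : mod_hom B U V" "bij_betw f (carrier U) (carrier V)"
 shows "iso_class F B U = iso_class F B V"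
proof -
 have sub: "iso_class F B V' <= iso_class F B U'"
  if "U' : fd_mod F B" "V' : fd_mod F B" "g : mod_hom B U' V'" "bij_betw g (carrier U') (carrier V')" for U' V' g
 proof
  fix W assume "W : iso_class F B V'"
  then obtain h where h: "W : fd_mod F B" "h : mod_hom B V' W" "bij_betw h (carrier V') (carrier W)"
   unfolding iso_class_def by blast
  have "bij_betw (compose (carrier U') h g) (carrier U') (carrier W)"
   using bij_betw_trans[OF that(4) h(3)] bij_betw_cong[of "carrier U'" "compose (carrier U') h g" "h \<circ> g"]
   by (simp add: compose_def)
  then show "W : iso_class F B U'"
   unfolding iso_class_def using h(1) compose_hom[OF that(3) h(2) fd_mod_left[OF that(1)]] by blast
 qed
 obtain k where k: "k : mod_hom B V U" "bij_betw k (carrier V) (carrier U)"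
  using hom_inverse_ex[OF fd_mod_left[OF U] fd_mod_left[OF V] f] by (elim bexE conjE)
 show ?thesis using sub[OF U V f] sub[OF V U k] by blast
qed

lemma iso_class_self: "U : fd_mod F B ==> U : iso_class F B U"
 unfolding iso_class_def using id_hom[OF fd_mod_left[of U]] by (auto intro!: bexI[of _ "\<lambda>u\<in>carrier U. u"] simp: bij_betw_def inj_on_def)

lemma iso_class_eq_summand:
 assumes U: "U : fd_mod F B" and V: "V : fd_mod F B" and e: "iso_class F B U = iso_class F B V"
 shows "summand U V"
proof -
 have "V : iso_class F B U" using iso_class_self[OF V] e by simp
 then obtain f where f: "f : mod_hom B U V" "bij_betw f (carrier U) (carrier V)" unfolding iso_class_def by blast
 obtain k where k: "k : mod_hom B V U" "ALL u:carrier U. k (f u) = u"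
  using hom_inverse_ex[OF fd_mod_left[OF U] fd_mod_left[OF V] f] by (elim bexE conjE)
 show ?thesis unfolding summand_def by (intro bexI[OF _ f(1)] bexI[OF _ k(1)] k(2))
qed

lemma indecomposable_summand_iso:
 assumes N: "N : fd_mod F B" "indecomposable B N" and U: "U : fd_mod F B" "indecomposable B U"
  and s: "summand N U"
 shows "iso_class F B N = iso_class F B U"
proof -
 note LN = fd_mod_left[OF N(1)] and LU = fd_mod_left[OF U(1)]
 interpret N: left_module B N by (rule LN)
 interpret U: left_module B U by (rule LU)
 obtain i p where i: "i : mod_hom B N U" and p: "p : mod_hom B U N" and pi: "!!x. x : carrier N ==> p (i x) = x"
  using s unfolding summand_def by blast
 let ?e = "compose (carrier U) i p"
 have e: "?e : mod_hom B U U" by (rule compose_hom[OF p i LU])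
 have "?e (?e u) = ?e u" if "u : carrier U" for u
  using that pi hom_closed[OF p] hom_closed[OF i] by (simp add: compose_def)
 from indecomposable_idempotent[OF LU U(2) e this]
 show ?thesis
 proof
  assume z: "ALL u:carrier U. ?e u = 0_U"
  obtain x where x: "x : carrier N" "x ~= 0_N" by (rule indecomposable_nonzero[OF LN N(2)])
  have "?e (i x) = i x" using x pi hom_closed[OF i] by (simp add: compose_def)
  then have "i x = 0_U" using z hom_closed[OF i x(1)] by simp
  then show ?thesis using pi[OF x(1)] hom_zero[OF LU LN p] x(2) by simp
 next
  assume o: "ALL u:carrier U. ?e u = u"
  have "bij_betw i (carrier N) (carrier U)"
  proof (rule bij_betw_byWitness[of _ p])
   show "ALL x:carrier N. p (i x) = x" using pi by blast
   show "ALL u:carrier U. i (p u) = u" using o by (simp add: compose_def)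
   show "i ` carrier N <= carrier U" using hom_closed[OF i] by blast
   show "p ` carrier U <= carrier N" using hom_closed[OF p] by blast
  qed
  then show ?thesis by (rule iso_class_eqI[OF N(1) U(1) i])
 qed
qed

subsection \<open>Decomposition into indecomposable modules\<close>

lemma submodule_left_module:
 assumes U: "left_module B U" and P: "submodule P B U"
 shows "left_module B (U(|carrier := P|))"
proof -
 interpret U: left_module B U by fact
 note E = P[unfolded U.submodule_iff]
 have PU: "!!x. x : P ==> x : carrier U" using E by blast
 have neg: "-_U x : P" if "x : P" for x
  using U.neg_act[OF B.one_closed PU[OF that]] U.act_one[OF PU[OF that]] E that
  by (metis B.a_inv_closed B.one_closed)
 have ag: "abelian_group (U(|carrier := P|))"
 proof (rule abelian_groupI)
  fix x assume "x : carrier (U(|carrier := P|))"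
  then show "EX y:carrier (U(|carrier := P|)). y \<oplus>\<^bsub>U(|carrier := P|)\<^esub> x = \<zero>\<^bsub>U(|carrier := P|)\<^esub>"
   using neg PU U.l_neg by (intro bexI[of _ "-_U x"]) simp_all
 qed (use E PU in "simp_all add: U.a_ac")
 show ?thesis
  by (intro left_module.intro left_module_axioms.intro ag B.ring_axioms)
   (use E PU in "simp_all add: U.act_l_distr U.act_r_distr U.act_assoc U.act_one")
qed

lemma fin_dim_image:
 assumes U: "left_module B U" and V: "left_module B V" and f: "f : mod_hom B U V"
  and surj: "carrier V <= f ` carrier U" and fd: "fin_dim F (underlying_space B U)"
 shows "fin_dim F (underlying_space B V)"
proof -
 interpret SU: vspace F "underlying_space B U" by (rule underlying_vspace[OF U])
 interpret SV: vspace F "underlying_space B V" by (rule underlying_vspace[OF V])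
 obtain S where S: "finite S" "S <= carrier (underlying_space B U)"
  "lin_span F (underlying_space B U) S = carrier (underlying_space B U)" using fd unfolding fin_dim_def by blast
 have SU: "S <= carrier U" using S(2) by simp
 have fS: "f ` S <= carrier (underlying_space B V)" using hom_closed[OF f] SU by auto
 have sm: "submodule (lin_span F (underlying_space B V) (f ` S)) F (underlying_space B V)"
  by (rule SV.lin_span_submodule[OF fS])
 note L = sm[unfolded SV.submodule_iff]
 let ?H = "{u : carrier U. f u : lin_span F (underlying_space B V) (f ` S)}"
 have H: "submodule ?H F (underlying_space B U)" unfolding SU.submodule_iff
  using L hom_zero[OF U V f] hom_add[OF f] hom_scl[OF U V f] scl_closed[OF U]
   abelian_group.axioms(1)[OF left_module.axioms(2)[OF U]]
  by (auto intro: abelian_monoid.zero_closed abelian_monoid.a_closed)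
 have "f ` S <= lin_span F (underlying_space B V) (f ` S)" unfolding lin_span_def by blast
 then have "S <= ?H" using SU by blast
 then have "lin_span F (underlying_space B U) S <= ?H" using H unfolding lin_span_def by (intro Inter_lower) simp
 then have "carrier V <= lin_span F (underlying_space B V) (f ` S)" using S(3) surj by auto
 then have "lin_span F (underlying_space B V) (f ` S) = carrier (underlying_space B V)"
  using SV.submoduleE(1)[OF sm] by auto
 then show ?thesis unfolding fin_dim_def using S(1) fS by blast
qed

lemma internal_direct_sum_splits:
 assumes W: "W : fd_mod F B" and P: "submodule P B W" and Q: "submodule Q B W"
  and sum: "P <+>\<^bsub>W\<^esub> Q = carrier W" and int: "P \<inter> Q = {0_W}"
 shows "EX i p j q. splits W (W(|carrier := P|)) (W(|carrier := Q|)) i p j q"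
  and "W(|carrier := P|) : fd_mod F B" and "W(|carrier := Q|) : fd_mod F B"
proof -
 note LW = fd_mod_left[OF W]
 interpret W: left_module B W by (rule LW)
 note LP = submodule_left_module[OF LW P] and LQ = submodule_left_module[OF LW Q]
 note EP = P[unfolded W.submodule_iff] and EQ = Q[unfolded W.submodule_iff]
 have PW: "!!x. x : P ==> x : carrier W" and QW: "!!x. x : Q ==> x : carrier W" using EP EQ by auto
 have neg: "-_W x : R" if "submodule R B W" "x : R" for x R
 proof -
  note ER = that(1)[unfolded W.submodule_iff]
  have "x : carrier W" using ER that(2) by blast
  then have "-_W x = (-_B 1_B) \<odot>_W x" using W.neg_act[OF B.one_closed] W.act_one by simp
  then show ?thesis using ER that(2) by simp
 qed
 have uniq: "x = x' \<and> y = y'" if "x : P" "x' : P" "y : Q" "y' : Q" "x +_W y = x' +_W y'" for x x' y y'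
 proof -
  note c = PW[OF that(1)] PW[OF that(2)] QW[OF that(3)] QW[OF that(4)]
  have aux: "(a +_W c) -_W (b +_W c) = a -_W b"
   if "a : carrier W" "b : carrier W" "c : carrier W" for a b c
   using that by (simp add: W.minus_eq W.minus_add W.a_ac W.r_neg1 W.r_neg2 W.r_neg)
  have e: "x -_W x' = y' -_W y"
   using aux[OF c(1,2,3)] aux[OF c(4,3,2)] that(5) W.a_comm[OF c(2,4)] W.a_comm[OF c(2,3)] by simp
  have "x -_W x' : P" unfolding W.minus_eq using EP that(1) neg[OF P that(2)] by blast
  moreover have "y' -_W y : Q" unfolding W.minus_eq using EQ that(4) neg[OF Q that(3)] by blast
  ultimately have "x -_W x' : P \<inter> Q" using e by simp
  then have "x -_W x' = 0_W" "y' -_W y = 0_W" using int e by auto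
  then show ?thesis using c by (simp add: W.a_minus_eq_zero_iff)
 qed
 have ex: "EX x:P. EX y:Q. w = x +_W y" if "w : carrier W" for w
  using that unfolding sum[symmetric] set_add_def' by blast
 define p where "p = (\<lambda>w\<in>carrier W. THE x. x : P \<and> (EX y:Q. w = x +_W y))"
 define q where "q = (\<lambda>w\<in>carrier W. THE y. y : Q \<and> (EX x:P. w = x +_W y))"
 have pq: "p (x +_W y) = x" "q (x +_W y) = y" if "x : P" "y : Q" for x y
 proof -
  have c: "x +_W y : carrier W" using PW[OF that(1)] QW[OF that(2)] by simp
  have "(THE x'. x' : P \<and> (EX y':Q. x +_W y = x' +_W y')) = x"
   by (rule the_equality) (use that uniq in blast)+
  then show "p (x +_W y) = x" unfolding p_def using c by simp
  have "(THE y'. y' : Q \<and> (EX x':P. x +_W y = x' +_W y')) = y"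
   by (rule the_equality) (use that uniq in blast)+
  then show "q (x +_W y) = y" unfolding q_def using c by simp
 qed
 have dec: "p w : P \<and> q w : Q \<and> w = p w +_W q w" if "w : carrier W" for w
  using ex[OF that] pq by force
 have add: "p (w +_W w') = p w +_W p w' \<and> q (w +_W w') = q w +_W q w'"
  if w: "w : carrier W" "w' : carrier W" for w w'
 proof -
  note d = dec[OF w(1)] dec[OF w(2)]
  have "w +_W w' = (p w +_W q w) +_W (p w' +_W q w')" using d by simp
  also have "... = (p w +_W p w') +_W (q w +_W q w')"
  proof -
   have "p w : carrier W" "p w' : carrier W" "q w : carrier W" "q w' : carrier W" using d PW QW by blast+
   then show ?thesis by (simp add: W.a_ac)
  qed
  finally show ?thesis using pq[of "p w +_W p w'" "q w +_W q w'"] d EP EQ by simp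
 qed
 have act: "p (a \<odot>_W w) = a \<odot>_W p w \<and> q (a \<odot>_W w) = a \<odot>_W q w"
  if a: "a : carrier B" and w: "w : carrier W" for a w
 proof -
  note d = dec[OF w]
  have "a \<odot>_W w = a \<odot>_W (p w +_W q w)" using d by simp
  also have "... = a \<odot>_W p w +_W a \<odot>_W q w" by (rule W.act_r_distr[OF a]) (use d PW QW in blast)+
  finally show ?thesis using pq[of "a \<odot>_W p w" "a \<odot>_W q w"] d EP EQ a by simp
 qed
 have ph: "p : mod_hom B W (W(|carrier := P|))" by (rule homI) (use dec add act p_def in auto)
 have qh: "q : mod_hom B W (W(|carrier := Q|))" by (rule homI) (use dec add act q_def in auto)
 let ?i = "\<lambda>x\<in>P. x" and ?j = "\<lambda>x\<in>Q. x"
 have ih: "?i : mod_hom B (W(|carrier := P|)) W" by (rule homI) (use EP in auto)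
 have jh: "?j : mod_hom B (W(|carrier := Q|)) W" by (rule homI) (use EQ in auto)
 have pP: "p x = x" if "x : P" for x using pq(1)[of x "0_W"] that EQ PW by simp
 have qQ: "q x = x" if "x : Q" for x using pq(2)[of "0_W" x] that EP QW by simp
 have "splits W (W(|carrier := P|)) (W(|carrier := Q|)) ?i p ?j q" unfolding splits_def
 proof (intro conjI ballI ph qh ih jh)
  show "p (?i x) = x" if "x : carrier (W(|carrier := P|))" for x using that pP by simp
  show "q (?j x) = x" if "x : carrier (W(|carrier := Q|))" for x using that qQ by simp
  show "?i (p w) +_W ?j (q w) = w" if "w : carrier W" for w using dec[OF that] by simp
 qed
 then show "EX i p j q. splits W (W(|carrier := P|)) (W(|carrier := Q|)) i p j q" by blast
 have sP: "carrier (W(|carrier := P|)) <= p ` carrier W"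
 proof
  fix x assume "x : carrier (W(|carrier := P|))"
  then show "x : p ` carrier W" using pP PW by (intro image_eqI[of _ _ x]) simp_all
 qed
 have sQ: "carrier (W(|carrier := Q|)) <= q ` carrier W"
 proof
  fix x assume "x : carrier (W(|carrier := Q|))"
  then show "x : q ` carrier W" using qQ QW by (intro image_eqI[of _ _ x]) simp_all
 qed
 show "W(|carrier := P|) : fd_mod F B" unfolding fd_mod_def
  using LP fin_dim_image[OF LW LP ph sP fd_mod_fin_dim[OF W]] by simp
 show "W(|carrier := Q|) : fd_mod F B" unfolding fd_mod_def
  using LQ fin_dim_image[OF LW LQ qh sQ fd_mod_fin_dim[OF W]] by simp
qed

lemma fd_mod_induct [consumes 1, case_names zero indec split]:
 assumes U: "U : fd_mod F B"
  and zero: "!!U. [|U : fd_mod F B; carrier U = {0_U}|] ==> \<Phi> U"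
  and indec: "!!U. [|U : fd_mod F B; indecomposable B U|] ==> \<Phi> U"
  and split: "!!U P Q i p j q. [|U : fd_mod F B; P : fd_mod F B; Q : fd_mod F B;
   splits U P Q i p j q; \<Phi> P; \<Phi> Q|] ==> \<Phi> U"
 shows "\<Phi> U"
proof -
 note LU = fd_mod_left[OF U]
 interpret U: left_module B U by (rule LU)
 interpret S: vspace F "underlying_space B U" by (rule underlying_vspace[OF LU])
 obtain rk :: "(nat => 'f) set => nat" and N where
  rk: "!!H H'. [|submodule H F (underlying_space B U); submodule H' F (underlying_space B U); H \<subset> H'|] ==> rk H < rk H'"
  and "!!H. rk H <= N"
  by (rule S.subspace_rank[OF S.fin_dim_imp_fin_separated[OF fd_mod_fin_dim[OF U]]]) blast
 have "\<Phi> (U(|carrier := P|))" if "submodule P B U" "U(|carrier := P|) : fd_mod F B" for P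
  using that
 proof (induction "rk P" arbitrary: P rule: less_induct)
  case less
  let ?W = "U(|carrier := P|)"
  note W = less.prems(2) and EP = less.prems(1)[unfolded U.submodule_iff]
  interpret W: left_module B ?W by (rule fd_mod_left[OF W])
  show ?case
  proof (cases "carrier ?W = {0_?W} \<or> indecomposable B ?W")
   case True
   then show ?thesis using zero[OF W] indec[OF W] by blast
  next
   case False
   then obtain P1 P2 where P12: "submodule P1 B ?W" "submodule P2 B ?W" "P1 <+>\<^bsub>?W\<^esub> P2 = carrier ?W"
    "P1 \<inter> P2 = {0_?W}" "P1 ~= {0_?W}" "P2 ~= {0_?W}"
    unfolding indecomposable_def by auto
   note E1 = P12(1)[unfolded W.submodule_iff] and E2 = P12(2)[unfolded W.submodule_iff]
   have s1: "submodule P1 B U" and s2: "submodule P2 B U"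
    unfolding U.submodule_iff using E1 E2 EP by auto
   have ss: "P1 \<subset> P" "P2 \<subset> P" using E1 E2 P12(4-6) by auto
   note sub = submodule_imp_subspace[OF LU]
   have lt: "rk P1 < rk P" "rk P2 < rk P"
    using rk[OF sub[OF s1] sub[OF less.prems(1)] ss(1)] rk[OF sub[OF s2] sub[OF less.prems(1)] ss(2)] .
   note D = internal_direct_sum_splits[OF W P12(1-4)]
   have fd: "U(|carrier := P1|) : fd_mod F B" "U(|carrier := P2|) : fd_mod F B" using D(2,3) by simp_all
   obtain i p j q where "splits ?W (U(|carrier := P1|)) (U(|carrier := P2|)) i p j q" using D(1) by auto
   then show ?thesis
    using split[OF W fd] less.hyps[OF lt(1) s1 fd(1)] less.hyps[OF lt(2) s2 fd(2)] by blast
  qed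
 qed
 moreover have "submodule (carrier U) B U" unfolding U.submodule_iff by (auto simp: U.act_closed)
 moreover have "U(|carrier := carrier U|) = U" by simp
 ultimately show ?thesis using U by metis
qed

text \<open>By decomposition: an indecomposable summand of a direct sum is a summand of one of the terms.\<close>

lemma finitely_many_indecomposable_summands:
 assumes "U : fd_mod F B"
 shows "EX \<N>. finite \<N> \<and> (ALL N. N : fd_mod F B --> indecomposable B N --> summand N U --> iso_class F B N : \<N>)"
 using assms
proof (induction rule: fd_mod_induct)
 case (zero U)
 have "\<not> summand N U" if N: "N : fd_mod F B" "indecomposable B N" for N
 proof
  note LN = fd_mod_left[OF N(1)]
  obtain x where x: "x : carrier N" "x ~= 0_N" by (rule indecomposable_nonzero[OF LN N(2)])
  assume "summand N U"
  then obtain i p where i: "i : mod_hom B N U" "p : mod_hom B U N" "ALL x:carrier N. p (i x) = x"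
   unfolding summand_def by blast
  have "i x = 0_U" using hom_closed[OF i(1) x(1)] zero(2) by simp
  then show False using i(3) x hom_zero[OF fd_mod_left[OF zero(1)] LN i(2)] by auto
 qed
 then show ?case by (intro exI[of _ "{}"]) auto
next
 case (indec U)
 then show ?case using indecomposable_summand_iso[OF _ _ indec] by (intro exI[of _ "{iso_class F B U}"]) auto
next
 case (split U P Q i p j q)
 obtain \<N>1 \<N>2 where "finite \<N>1" "finite \<N>2"
  and n: "!!N. [|N : fd_mod F B; indecomposable B N; summand N P|] ==> iso_class F B N : \<N>1"
   "!!N. [|N : fd_mod F B; indecomposable B N; summand N Q|] ==> iso_class F B N : \<N>2"
  using split.IH by metis
 moreover have "iso_class F B N : \<N>1 \<union> \<N>2" if N: "N : fd_mod F B" "indecomposable B N" "summand N U" for N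
  using indecomposable_summand_of_split[OF N(1,2) _ _ _ split(4) N(3)] split(1-3) fd_mod_left n N by blast
 ultimately show ?case by (intro exI[of _ "\<N>1 \<union> \<N>2"]) auto
qed

text \<open>The square of the radical is compatible with decompositions of \<open>U\<close>.\<close>

lemma rad_subset_rad2_into:
 assumes N: "N : fd_mod F B" and U: "U : fd_mod F B"
  and "!!N'. [|N' : fd_mod F B; indecomposable B N'; summand N' U|] ==> rad B N N' <= rad2 F B N N'"
 shows "rad B N U <= rad2 F B N U"
 using U assms(3)
proof (induction rule: fd_mod_induct)
 case (zero U)
 note LU = fd_mod_left[OF zero(1)] and LN = fd_mod_left[OF N]
 interpret H: vspace F "hom_space B N U" by (rule hom_space_vspace[OF LN LU])
 show ?case
 proof
  fix f assume f: "f : rad B N U"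
  have "f = (\<lambda>u\<in>carrier N. 0_U)"
   by (rule hom_eqI[OF rad_hom[OF f] zero_hom[OF LN LU]]) (use hom_closed[OF rad_hom[OF f]] zero(2) in auto)
  then show "f : rad2 F B N U" using rad2_submodule[OF LN LU] unfolding H.submodule_iff by simp
 qed
next
 case (indec U)
 then show ?case using summand_refl[OF fd_mod_left[OF indec(1)]] by blast
next
 case (split U P Q i p j q)
 note LN = fd_mod_left[OF N] and LU = fd_mod_left[OF split(1)] and LP = fd_mod_left[OF split(2)] and LQ = fd_mod_left[OF split(3)]
 interpret H: vspace F "hom_space B N U" by (rule hom_space_vspace[OF LN LU])
 note s = splits_summand[OF split(4)]
 have h: "i : mod_hom B P U" "p : mod_hom B U P" "j : mod_hom B Q U" "q : mod_hom B U Q"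
  and one: "!!u. u : carrier U ==> i (p u) +_U j (q u) = u"
  using split(4) unfolding splits_def by auto
 have IH1: "rad B N P <= rad2 F B N P"
 proof (rule split.IH(1))
  fix N' assume *: "N' : fd_mod F B" "indecomposable B N'" "summand N' P"
  show "rad B N N' <= rad2 F B N N'"
   by (rule split.prems[OF *(1,2) summand_trans[OF fd_mod_left[OF *(1)] LU *(3) s(1)]])
 qed
 have IH2: "rad B N Q <= rad2 F B N Q"
 proof (rule split.IH(2))
  fix N' assume *: "N' : fd_mod F B" "indecomposable B N'" "summand N' Q"
  show "rad B N N' <= rad2 F B N N'"
   by (rule split.prems[OF *(1,2) summand_trans[OF fd_mod_left[OF *(1)] LU *(3) s(2)]])
 qed
 show ?case
 proof
  fix f assume f: "f : rad B N U"
  note fc = hom_closed[OF rad_hom[OF f]]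
  have 1: "compose (carrier N) i (compose (carrier N) p f) : rad2 F B N U"
   by (rule rad2_left[OF LN LP LU h(1) subsetD[OF IH1 rad_left[OF LN LU LP f h(2)]]])
  have 2: "compose (carrier N) j (compose (carrier N) q f) : rad2 F B N U"
   by (rule rad2_left[OF LN LQ LU h(3) subsetD[OF IH2 rad_left[OF LN LU LQ f h(4)]]])
  have "f = compose (carrier N) i (compose (carrier N) p f) \<oplus>\<^bsub>hom_space B N U\<^esub>
    compose (carrier N) j (compose (carrier N) q f)"
   using fc one hom_ext[OF rad_hom[OF f]] by (auto simp: compose_def extensional_def)
  then show "f : rad2 F B N U" using H.submoduleE(5)[OF rad2_submodule[OF LN LU] 1 2] by simp
 qed
qed

lemma rad_subset_rad2_from:
 assumes N: "N : fd_mod F B" and U: "U : fd_mod F B"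
  and "!!N'. [|N' : fd_mod F B; indecomposable B N'; summand N' U|] ==> rad B N' N <= rad2 F B N' N"
 shows "rad B U N <= rad2 F B U N"
 using U assms(3)
proof (induction rule: fd_mod_induct)
 case (zero U)
 note LU = fd_mod_left[OF zero(1)] and LN = fd_mod_left[OF N]
 interpret H: vspace F "hom_space B U N" by (rule hom_space_vspace[OF LU LN])
 show ?case
 proof
  fix f assume f: "f : rad B U N"
  have "f = (\<lambda>u\<in>carrier U. 0_N)"
   by (rule hom_eqI[OF rad_hom[OF f] zero_hom[OF LU LN]]) (use hom_zero[OF LU LN rad_hom[OF f]] zero(2) in auto)
  then show "f : rad2 F B U N" using rad2_submodule[OF LU LN] unfolding H.submodule_iff by simp
 qed
next
 case (indec U)
 then show ?case using summand_refl[OF fd_mod_left[OF indec(1)]] by blast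
next
 case (split U P Q i p j q)
 note LN = fd_mod_left[OF N] and LU = fd_mod_left[OF split(1)] and LP = fd_mod_left[OF split(2)] and LQ = fd_mod_left[OF split(3)]
 interpret U: left_module B U by (rule LU)
 interpret H: vspace F "hom_space B U N" by (rule hom_space_vspace[OF LU LN])
 note s = splits_summand[OF split(4)]
 have h: "i : mod_hom B P U" "p : mod_hom B U P" "j : mod_hom B Q U" "q : mod_hom B U Q"
  and one: "!!u. u : carrier U ==> i (p u) +_U j (q u) = u"
  using split(4) unfolding splits_def by auto
 have IH1: "rad B P N <= rad2 F B P N"
 proof (rule split.IH(1))
  fix N' assume *: "N' : fd_mod F B" "indecomposable B N'" "summand N' P"
  show "rad B N' N <= rad2 F B N' N"
   by (rule split.prems[OF *(1,2) summand_trans[OF fd_mod_left[OF *(1)] LU *(3) s(1)]])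
 qed
 have IH2: "rad B Q N <= rad2 F B Q N"
 proof (rule split.IH(2))
  fix N' assume *: "N' : fd_mod F B" "indecomposable B N'" "summand N' Q"
  show "rad B N' N <= rad2 F B N' N"
   by (rule split.prems[OF *(1,2) summand_trans[OF fd_mod_left[OF *(1)] LU *(3) s(2)]])
 qed
 show ?case
 proof
  fix f assume f: "f : rad B U N"
  note fh = rad_hom[OF f]
  have 1: "compose (carrier U) (compose (carrier P) f i) p : rad2 F B U N"
   by (rule rad2_right[OF LU LP LN h(2) subsetD[OF IH1 rad_right[OF LP LU LN f h(1)]]])
  have 2: "compose (carrier U) (compose (carrier Q) f j) q : rad2 F B U N"
   by (rule rad2_right[OF LU LQ LN h(4) subsetD[OF IH2 rad_right[OF LQ LU LN f h(3)]]])
  have "f u = f (i (p u)) +_N f (j (q u))" if u: "u : carrier U" for u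
   using one[OF u] hom_add[OF fh hom_closed[OF h(1) hom_closed[OF h(2) u]] hom_closed[OF h(3) hom_closed[OF h(4) u]]]
   by simp
  then have "f = compose (carrier U) (compose (carrier P) f i) p \<oplus>\<^bsub>hom_space B U N\<^esub>
    compose (carrier U) (compose (carrier Q) f j) q"
   using hom_closed[OF h(2)] hom_closed[OF h(4)] hom_ext[OF fh] by (auto simp: compose_def extensional_def)
  then show "f : rad2 F B U N" using H.submoduleE(5)[OF rad2_submodule[OF LU LN] 1 2] by simp
 qed
qed

end

section \<open>The scalar extension of an algebra\<close>

lemma frag_extend_fun_add:
 "frag_extend (%i. f i + g i) p = frag_extend f p + frag_extend g p"
 unfolding frag_extend_def by (simp add: frag_cmul_distrib2 sum.distrib)

lemma frag_extend_fun_neg: "frag_extend (%i. - f i) p = - frag_extend f p"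
proof -
 have "frag_extend (%i. - f i) p + frag_extend f p = 0"
  unfolding frag_extend_fun_add[symmetric] by (simp add: frag_extend_def)
 then show ?thesis by (simp add: eq_neg_iff_add_eq_0)
qed

lemma frag_extend_fun_diff:
 "frag_extend (%i. f i - g i) p = frag_extend f p - frag_extend g p"
 using frag_extend_fun_add[of f "%i. - g i" p] by (simp add: frag_extend_fun_neg)

locale scalar_ext = K?: field K + A: fin_dim_algebra "K(|carrier := k|)" A
 for K :: "'f ring" and k :: "'f set" and A :: "('f, 'a) module" +
 assumes k_subfield: "subfield k K"
begin

lemma kK: "c : k ==> c : carrier K"
 using subfieldE(3)[OF k_subfield] by blast

lemma A_smult_closed: "[|c : k; a : carrier A|] ==> c \<odot>_A a : carrier A"
 using A.smult_closed by simp

lemma A_smult_left: "[|c : k; a : carrier A; b : carrier A|] ==> (c \<odot>_A a) *_A b = c \<odot>_A (a *_A b)"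
 using A.smult_mult_left by simp

lemma A_smult_right: "[|c : k; a : carrier A; b : carrier A|] ==> a *_A (c \<odot>_A b) = c \<odot>_A (a *_A b)"
 using A.smult_mult_right by simp

abbreviation "G \<equiv> free_Abelian_group (carrier K \<times> carrier A)"
abbreviation "Rel \<equiv> tensor_relators K k A"
abbreviation "N \<equiv> generate G Rel"
abbreviation "tm \<equiv> tensor_mult K A"
abbreviation "ts \<equiv> tensor_smult K"
abbreviation "AK \<equiv> scalar_extension K k A"

definition cls where "cls p = N #>\<^bsub>G\<^esub> p"

text \<open>Pure tensors.\<close>

definition t where "t x a = cls (frag_of (x, a))"

lemma frag_G: "[|x : carrier K; a : carrier A|] ==> frag_of (x, a) : carrier G"
 by simp

lemma G_closed:
 "[|p : carrier G; q : carrier G|] ==> p + q : carrier G"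
 "[|p : carrier G; q : carrier G|] ==> p - q : carrier G"
 "p : carrier G ==> - p : carrier G" "0 : carrier G"
 using keys_add[of p q] keys_diff[of p q] by auto

lemma G_induct [consumes 1, case_names zero diff gen]:
 assumes "p : carrier G" "P 0"
  "!!p q. [|p : carrier G; q : carrier G; P p; P q|] ==> P (p - q)"
  "!!x a. [|x : carrier K; a : carrier A|] ==> P (frag_of (x, a))"
 shows "P p"
 by (rule free_Abelian_group_induct[of p "carrier K \<times> carrier A"]) (use assms in auto)

lemma Rel_G: "Rel <= carrier G"
proof -
 have 1: "frag_of (x +_K y, a) - frag_of (x, a) - frag_of (y, a) : carrier G"
  if "x : carrier K" "y : carrier K" "a : carrier A" for x y a
  using that by (intro G_closed(2) frag_G) auto
 have 2: "frag_of (x, a +_A b) - frag_of (x, a) - frag_of (x, b) : carrier G"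
  if "x : carrier K" "a : carrier A" "b : carrier A" for x a b
  using that by (intro G_closed(2) frag_G) auto
 have 3: "frag_of (x *_K c, a) - frag_of (x, c \<odot>_A a) : carrier G"
  if "x : carrier K" "c : k" "a : carrier A" for x c a
  using that kK A_smult_closed by (intro G_closed(2) frag_G) auto
 show ?thesis unfolding tensor_relators_def
  apply (intro Un_least subsetI; elim CollectE exE conjE; hypsubst)
   apply (rule 1; assumption)
  apply (rule 2; assumption)
  apply (rule 3; assumption)
  done
qed

lemma N_subgroup: "subgroup N G"
 by (rule group.generate_is_subgroup[OF group_free_Abelian_group Rel_G])

lemma N_G: "n : N ==> n : carrier G"
 using subgroup.subset[OF N_subgroup] by blast

lemma N_add: "[|m : N; n : N|] ==> m + n : N"
 using subgroup.m_closed[OF N_subgroup, of m n] by simp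

lemma N_neg: "n : N ==> - n : N"
 using subgroup.m_inv_closed[OF N_subgroup, of n] N_G[of n] by simp

lemma N_zero: "0 : N"
 using subgroup.one_closed[OF N_subgroup] by simp

lemma N_diff: "[|m : N; n : N|] ==> m - n : N"
 using N_add[of m "- n"] N_neg[of n] by simp

lemma Rel_N: "r : Rel ==> r : N"
 by (rule generate.incl)

text \<open>Well-definedness on classes is thus checked on relators.\<close>

lemma N_preserved:
 assumes f0: "f 0 = 0" and fadd: "!!p q. f (p + q) = f p + f q"
  and R: "!!r. r : Rel ==> f r : N" and n: "n : N"
 shows "f n : N"
 using n
proof (induction n rule: generate.induct)
 case one
 then show ?case using f0 N_zero by simp
next
 case (incl h)
 then show ?case by (rule R)
next
 case (inv h)
 have "inv\<^bsub>G\<^esub> h = - h" using subsetD[OF Rel_G inv] by simp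
 moreover have "f (- h) = - f h" using fadd[of "- h" h] f0 by (simp add: eq_neg_iff_add_eq_0)
 ultimately show ?case using R[OF inv] N_neg by simp
next
 case (eng g h)
 then show ?case using fadd N_add by simp
qed

lemma cls_mem: "q : cls p \<longleftrightarrow> q - p : N"
proof -
 have "q : cls p \<longleftrightarrow> (EX n:N. q = n + p)" unfolding cls_def r_coset_def by auto
 also have "... \<longleftrightarrow> q - p : N" by (metis add_diff_cancel_right' diff_add_cancel)
 finally show ?thesis .
qed

lemma cls_eq_iff: "cls p = cls q \<longleftrightarrow> p - q : N"
proof
 assume "cls p = cls q"
 moreover have "p : cls p" using N_zero by (simp add: cls_mem)
 ultimately show "p - q : N" by (simp add: cls_mem)
next
 assume pq: "p - q : N"
 have "x - p : N \<longleftrightarrow> x - q : N" for x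
  using N_add[OF _ pq, of "x - p"] N_diff[OF _ pq, of "x - q"] by auto
 then show "cls p = cls q" by (auto simp: cls_mem)
qed

lemma cls_self: "p : cls p"
 using N_zero by (simp add: cls_mem)

lemma cls_G: "[|p : carrier G; q : cls p|] ==> q : carrier G"
 using N_G[of "q - p"] G_closed(1)[of "q - p" p] by (simp add: cls_mem)

lemma tm_gen: "tm (frag_of (x, a)) q = frag_extend (%(y, b). frag_of (x *_K y, a *_A b)) q"
 unfolding tensor_mult_def by simp

lemma tm_gen_gen [simp]: "tm (frag_of (x, a)) (frag_of (y, b)) = frag_of (x *_K y, a *_A b)"
 unfolding tm_gen by simp

lemma tm_left: "tm 0 q = 0" "tm (p + p') q = tm p q + tm p' q" "tm (p - p') q = tm p q - tm p' q"
 unfolding tensor_mult_def by (simp_all add: frag_extend_add frag_extend_diff)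

lemma tm_right: "tm p 0 = 0" "tm p (q + q') = tm p q + tm p q'" "tm p (q - q') = tm p q - tm p q'"
proof -
 show "tm p 0 = 0" unfolding tensor_mult_def frag_extend_def by (simp add: case_prod_beta)
 show "tm p (q + q') = tm p q + tm p q'"
  unfolding tensor_mult_def frag_extend_add frag_extend_fun_add[symmetric] by (simp add: case_prod_unfold)
 show "tm p (q - q') = tm p q - tm p q'"
  unfolding tensor_mult_def frag_extend_diff frag_extend_fun_diff[symmetric] by (simp add: case_prod_unfold)
qed

lemma tm_closed: "[|p : carrier G; q : carrier G|] ==> tm p q : carrier G"
proof (induction p rule: G_induct)
 case zero
 then show ?case using G_closed(4) by (simp add: tm_left)
next
 case (diff p p')
 then show ?case unfolding tm_left by (intro G_closed(2))
next
 case (gen x a)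
 then have "q : carrier G" by simp
 then show ?case
 proof (induction q rule: G_induct)
  case zero
  then show ?case using G_closed(4) by (simp add: tm_right)
 next
  case (diff q q')
  then show ?case unfolding tm_right by (intro G_closed(2))
 next
  case (gen y b)
  then show ?case using \<open>x : carrier K\<close> \<open>a : carrier A\<close> unfolding tm_gen_gen by (intro frag_G) auto
 qed
qed

lemma Rel1: "[|x : carrier K; y : carrier K; a : carrier A|] ==>
  frag_of (x +_K y, a) - frag_of (x, a) - frag_of (y, a) : N"
 and Rel2: "[|x : carrier K; a : carrier A; b : carrier A|] ==>
  frag_of (x, a +_A b) - frag_of (x, a) - frag_of (x, b) : N"
 and Rel3: "[|x : carrier K; c : k; a : carrier A|] ==>
  frag_of (x *_K c, a) - frag_of (x, c \<odot>_A a) : N"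
 apply (rule Rel_N, unfold tensor_relators_def, rule UnI1, rule UnI1, rule CollectI, intro exI conjI, rule refl; assumption)
 apply (rule Rel_N, unfold tensor_relators_def, rule UnI1, rule UnI2, rule CollectI, intro exI conjI, rule refl; assumption)
 apply (rule Rel_N, unfold tensor_relators_def, rule UnI2, rule CollectI, intro exI conjI, rule refl; assumption)
 done

lemma Rel_cases:
 assumes "r : Rel"
  "!!x y a. [|x : carrier K; y : carrier K; a : carrier A|] ==>
   P (frag_of (x +_K y, a) - frag_of (x, a) - frag_of (y, a))"
  "!!x a b. [|x : carrier K; a : carrier A; b : carrier A|] ==>
   P (frag_of (x, a +_A b) - frag_of (x, a) - frag_of (x, b))"
  "!!x c a. [|x : carrier K; c : k; a : carrier A|] ==>
   P (frag_of (x *_K c, a) - frag_of (x, c \<odot>_A a))"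
 shows "P r"
 by (insert assms(1), unfold tensor_relators_def, elim UnE CollectE exE conjE; hypsubst; (rule assms(2) | rule assms(3) | rule assms(4)); assumption)

lemma tm_N_right:
 assumes "p : carrier G" "n : N"
 shows "tm p n : N"
 using assms(1)
proof (induction p rule: G_induct)
 case zero
 then show ?case using N_zero by (simp add: tm_left)
next
 case (diff p p')
 then show ?case unfolding tm_left by (intro N_diff)
next
 case (gen x a)
 show ?case
 proof (rule N_preserved[OF _ _ _ assms(2)])
  show "tm (frag_of (x, a)) r : N" if "r : Rel" for r
   using that
  proof (rule Rel_cases)
   show "tm (frag_of (x, a)) (frag_of (y +_K z, b) - frag_of (y, b) - frag_of (z, b)) : N"
    if "y : carrier K" "z : carrier K" "b : carrier A" for y z b
    using that gen Rel1[of "x *_K y" "x *_K z" "a *_A b"] by (simp add: tm_right K.r_distr)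
   show "tm (frag_of (x, a)) (frag_of (y, b +_A d) - frag_of (y, b) - frag_of (y, d)) : N"
    if "y : carrier K" "b : carrier A" "d : carrier A" for y b d
    using that gen Rel2[of "x *_K y" "a *_A b" "a *_A d"] by (simp add: tm_right A.A.r_distr)
   show "tm (frag_of (x, a)) (frag_of (y *_K c, b) - frag_of (y, c \<odot>_A b)) : N"
    if "y : carrier K" "c : k" "b : carrier A" for y c b
    using that gen Rel3[of "x *_K y" c "a *_A b"]
    by (simp add: tm_right A_smult_right kK K.m_assoc)
  qed
 qed (simp_all add: tm_right)
qed

lemma tm_N_left:
 assumes "q : carrier G" "n : N"
 shows "tm n q : N"
 using assms(1)
proof (induction q rule: G_induct)
 case zero
 then show ?case using N_zero by (simp add: tm_right)
next
 case (diff p p')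
 then show ?case unfolding tm_right by (intro N_diff)
next
 case (gen y b)
 show ?case
 proof (rule N_preserved[OF _ _ _ assms(2)])
  show "tm r (frag_of (y, b)) : N" if "r : Rel" for r
   using that
  proof (rule Rel_cases)
   show "tm (frag_of (x +_K z, a) - frag_of (x, a) - frag_of (z, a)) (frag_of (y, b)) : N"
    if "x : carrier K" "z : carrier K" "a : carrier A" for x z a
    using that gen Rel1[of "x *_K y" "z *_K y" "a *_A b"] by (simp add: tm_left K.l_distr)
   show "tm (frag_of (x, a +_A d) - frag_of (x, a) - frag_of (x, d)) (frag_of (y, b)) : N"
    if "x : carrier K" "a : carrier A" "d : carrier A" for x a d
    using that gen Rel2[of "x *_K y" "a *_A b" "d *_A b"] by (simp add: tm_left A.A.l_distr)
   show "tm (frag_of (x *_K c, a) - frag_of (x, c \<odot>_A a)) (frag_of (y, b)) : N"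
    if "x : carrier K" "c : k" "a : carrier A" for x c a
   proof -
    have "(x *_K y) *_K c = (x *_K c) *_K y" using that gen kK by (simp add: K.m_ac)
    then show ?thesis using that gen Rel3[of "x *_K y" c "a *_A b"]
     by (simp add: tm_left A_smult_left)
   qed
  qed
 qed (simp_all add: tm_left)
qed

lemma ts_gen: "ts c (frag_of (x, a)) = frag_of (c *_K x, a)"
 and ts_add: "ts c 0 = 0" "ts c (p + q) = ts c p + ts c q" "ts c (p - q) = ts c p - ts c q"
 unfolding tensor_smult_def by (simp_all add: frag_extend_add frag_extend_diff)

lemma ts_N:
 assumes "c : carrier K" "n : N"
 shows "ts c n : N"
proof (rule N_preserved[OF _ _ _ assms(2)])
 show "ts c r : N" if "r : Rel" for r
  using that
 proof (rule Rel_cases)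
  show "ts c (frag_of (x +_K z, a) - frag_of (x, a) - frag_of (z, a)) : N"
   if "x : carrier K" "z : carrier K" "a : carrier A" for x z a
   using that assms(1) Rel1[of "c *_K x" "c *_K z" a] by (simp add: ts_add ts_gen K.r_distr)
  show "ts c (frag_of (x, a +_A d) - frag_of (x, a) - frag_of (x, d)) : N"
   if "x : carrier K" "a : carrier A" "d : carrier A" for x a d
   using that assms(1) Rel2[of "c *_K x" a d] by (simp add: ts_add ts_gen)
  show "ts c (frag_of (x *_K d, a) - frag_of (x, d \<odot>_A a)) : N"
   if "x : carrier K" "d : k" "a : carrier A" for x d a
   using that assms(1) kK Rel3[of "c *_K x" d a] by (simp add: ts_add ts_gen K.m_assoc)
 qed
qed (simp_all add: ts_add)

lemma AK_carrier: "carrier AK = cls ` carrier G"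
 unfolding scalar_extension_def Let_def FactGroup_def RCOSETS_def cls_def by auto

lemma AK_zero: "\<zero>\<^bsub>AK\<^esub> = cls 0"
proof -
 have "\<zero>\<^bsub>AK\<^esub> = N" unfolding scalar_extension_def Let_def FactGroup_def by simp
 moreover have "cls 0 = N" by (auto simp: cls_mem)
 ultimately show ?thesis by simp
qed

lemma AK_one: "\<one>\<^bsub>AK\<^esub> = t 1_K 1_A"
 unfolding scalar_extension_def Let_def t_def cls_def by simp

lemma AK_add: "cls p \<oplus>\<^bsub>AK\<^esub> cls q = cls (p + q)"
proof -
 have "cls p \<oplus>\<^bsub>AK\<^esub> cls q = {x + y | x y. x : cls p \<and> y : cls q}"
  unfolding scalar_extension_def Let_def FactGroup_def set_mult_def by auto
 also have "... = cls (p + q)"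
 proof (intro equalityI subsetI)
  fix z assume "z : {x + y | x y. x : cls p \<and> y : cls q}"
  then obtain x y where "z = x + y" "x - p : N" "y - q : N" by (auto simp: cls_mem)
  then show "z : cls (p + q)" using N_add[of "x - p" "y - q"] by (simp add: cls_mem algebra_simps)
 next
  fix z assume "z : cls (p + q)"
  then have "z - q : cls p" by (simp add: cls_mem algebra_simps)
  moreover have "z = (z - q) + q" by simp
  ultimately show "z : {x + y | x y. x : cls p \<and> y : cls q}" using cls_self[of q] by blast
 qed
 finally show ?thesis .
qed

lemma AK_mult:
 assumes "p : carrier G" "q : carrier G"
 shows "cls p \<otimes>\<^bsub>AK\<^esub> cls q = cls (tm p q)"
proof -
 have e: "cls (tm p' q') = cls (tm p q)" if "p' : cls p" "q' : cls q" for p' q'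
 proof -
  have "tm (p' - p) q' + tm p (q' - q) : N"
   using that assms cls_G by (intro N_add tm_N_left tm_N_right) (auto simp: cls_mem)
  then show ?thesis by (simp add: cls_eq_iff tm_left tm_right)
 qed
 have "cls p \<otimes>\<^bsub>AK\<^esub> cls q = (\<Union>p'\<in>cls p. \<Union>q'\<in>cls q. cls (tm p' q'))"
  unfolding scalar_extension_def Let_def cls_def by simp
 also have "... = cls (tm p q)"
 proof
  show "(\<Union>p'\<in>cls p. \<Union>q'\<in>cls q. cls (tm p' q')) <= cls (tm p q)"
   by (intro UN_least) (simp add: e)
  show "cls (tm p q) <= (\<Union>p'\<in>cls p. \<Union>q'\<in>cls q. cls (tm p' q'))"
   by (rule subsetI, rule UN_I[OF cls_self], rule UN_I[OF cls_self])
 qed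
 finally show ?thesis .
qed

lemma AK_smult:
 assumes "c : carrier K" "p : carrier G"
 shows "c \<odot>\<^bsub>AK\<^esub> cls p = cls (ts c p)"
proof -
 have e: "cls (ts c p') = cls (ts c p)" if "p' : cls p" for p'
  using ts_N[OF assms(1), of "p' - p"] that by (simp add: cls_eq_iff cls_mem ts_add)
 have "c \<odot>\<^bsub>AK\<^esub> cls p = (\<Union>p'\<in>cls p. cls (ts c p'))"
  unfolding scalar_extension_def Let_def cls_def by simp
 also have "... = cls (ts c p)"
 proof
  show "(\<Union>p'\<in>cls p. cls (ts c p')) <= cls (ts c p)" by (intro UN_least) (simp add: e)
  show "cls (ts c p) <= (\<Union>p'\<in>cls p. cls (ts c p'))" by (rule subsetI, rule UN_I[OF cls_self])
 qed
 finally show ?thesis .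
qed

lemma t_closed: "[|x : carrier K; a : carrier A|] ==> t x a : carrier AK"
 unfolding t_def AK_carrier using frag_G by (intro imageI)

lemma t_add_left: "[|x : carrier K; y : carrier K; a : carrier A|] ==> t (x +_K y) a = t x a \<oplus>\<^bsub>AK\<^esub> t y a"
 unfolding t_def AK_add cls_eq_iff using Rel1[of x y a] by (simp add: algebra_simps)

lemma t_add_right: "[|x : carrier K; a : carrier A; b : carrier A|] ==> t x (a +_A b) = t x a \<oplus>\<^bsub>AK\<^esub> t x b"
 unfolding t_def AK_add cls_eq_iff using Rel2[of x a b] by (simp add: algebra_simps)

lemma t_balanced: "[|x : carrier K; c : k; a : carrier A|] ==> t (x *_K c) a = t x (c \<odot>_A a)"
 unfolding t_def cls_eq_iff by (rule Rel3)

lemma t_mult: "[|x : carrier K; a : carrier A; y : carrier K; b : carrier A|] ==>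
  t x a \<otimes>\<^bsub>AK\<^esub> t y b = t (x *_K y) (a *_A b)"
 unfolding t_def by (simp add: AK_mult)

lemma tm_assoc:
 "[|p : carrier G; q : carrier G; r : carrier G|] ==> tm (tm p q) r = tm p (tm q r)"
proof (induction p rule: G_induct)
 case (gen x a)
 note x = gen(1,2)
 from gen(3,4) show ?case
 proof (induction q rule: G_induct)
  case (gen y b)
  note y = gen(1,2)
  from gen(3) show ?case
  proof (induction r rule: G_induct)
   case (gen z d)
   then show ?case using x y by (simp add: K.m_assoc A.A.m_assoc)
  qed (simp_all add: tm_right)
 qed (simp_all add: tm_right tm_left)
qed (simp_all add: tm_left)

lemma tm_one_left: "p : carrier G ==> tm (frag_of (1_K, 1_A)) p = p"
 by (induction p rule: G_induct) (simp_all add: tm_right)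

lemma tm_one_right: "p : carrier G ==> tm p (frag_of (1_K, 1_A)) = p"
 by (induction p rule: G_induct) (simp_all add: tm_left)

lemma AK_ring: "ring AK"
proof (rule ringI)
 show "abelian_group AK"
 proof (rule abelian_groupI)
  show "x \<oplus>\<^bsub>AK\<^esub> y : carrier AK" if "x : carrier AK" "y : carrier AK" for x y
   using that G_closed(1) unfolding AK_carrier by (auto simp: AK_add simp del: carrier_free_Abelian_group_iff)
  show "\<zero>\<^bsub>AK\<^esub> : carrier AK" unfolding AK_carrier AK_zero by (rule imageI[OF G_closed(4)])
  show "x \<oplus>\<^bsub>AK\<^esub> y \<oplus>\<^bsub>AK\<^esub> z = x \<oplus>\<^bsub>AK\<^esub> (y \<oplus>\<^bsub>AK\<^esub> z)" if "x : carrier AK" "y : carrier AK" "z : carrier AK" for x y z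
   using that unfolding AK_carrier by (auto simp: AK_add add.assoc)
  show "x \<oplus>\<^bsub>AK\<^esub> y = y \<oplus>\<^bsub>AK\<^esub> x" if "x : carrier AK" "y : carrier AK" for x y
   using that unfolding AK_carrier by (auto simp: AK_add add.commute)
  show "\<zero>\<^bsub>AK\<^esub> \<oplus>\<^bsub>AK\<^esub> x = x" if "x : carrier AK" for x
   using that unfolding AK_carrier AK_zero by (auto simp: AK_add)
  show "EX y:carrier AK. y \<oplus>\<^bsub>AK\<^esub> x = \<zero>\<^bsub>AK\<^esub>" if x: "x : carrier AK" for x
  proof -
   obtain p where p: "p : carrier G" "x = cls p" using x unfolding AK_carrier by blast
   show ?thesis unfolding AK_carrier AK_zero using p G_closed(3)[OF p(1)]
    by (intro bexI[of _ "cls (- p)"] imageI) (simp_all add: AK_add)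
  qed
 qed
 have car: "EX p:carrier G. x = cls p" if "x : carrier AK" for x using that unfolding AK_carrier by blast
 note o = frag_G[OF K.one_closed A.A.one_closed]
 show "Group.monoid AK"
 proof (rule Group.monoidI)
  show "x \<otimes>\<^bsub>AK\<^esub> y : carrier AK" if xy: "x : carrier AK" "y : carrier AK" for x y
  proof -
   obtain p q where "p : carrier G" "x = cls p" "q : carrier G" "y = cls q" using car[OF xy(1)] car[OF xy(2)] by blast
   then show ?thesis unfolding AK_carrier using tm_closed by (simp add: AK_mult del: carrier_free_Abelian_group_iff)
  qed
  show "\<one>\<^bsub>AK\<^esub> : carrier AK" unfolding AK_one by (rule t_closed) auto
  show "x \<otimes>\<^bsub>AK\<^esub> y \<otimes>\<^bsub>AK\<^esub> z = x \<otimes>\<^bsub>AK\<^esub> (y \<otimes>\<^bsub>AK\<^esub> z)"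
   if xyz: "x : carrier AK" "y : carrier AK" "z : carrier AK" for x y z
  proof -
   obtain p q r where p: "p : carrier G" "x = cls p" and q: "q : carrier G" "y = cls q" and r: "r : carrier G" "z = cls r"
    using car[OF xyz(1)] car[OF xyz(2)] car[OF xyz(3)] by blast
   show ?thesis unfolding p(2) q(2) r(2)
    by (simp only: AK_mult p(1) q(1) r(1) tm_closed tm_assoc)
  qed
  show "\<one>\<^bsub>AK\<^esub> \<otimes>\<^bsub>AK\<^esub> x = x" if x: "x : carrier AK" for x
  proof -
   obtain p where p: "p : carrier G" "x = cls p" using car[OF x] by blast
   show ?thesis unfolding AK_one t_def p(2) by (simp only: AK_mult p(1) o tm_one_left)
  qed
  show "x \<otimes>\<^bsub>AK\<^esub> \<one>\<^bsub>AK\<^esub> = x" if x: "x : carrier AK" for x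
  proof -
   obtain p where p: "p : carrier G" "x = cls p" using car[OF x] by blast
   show ?thesis unfolding AK_one t_def p(2) by (simp only: AK_mult p(1) o tm_one_right)
  qed
 qed
 show "(x \<oplus>\<^bsub>AK\<^esub> y) \<otimes>\<^bsub>AK\<^esub> z = x \<otimes>\<^bsub>AK\<^esub> z \<oplus>\<^bsub>AK\<^esub> y \<otimes>\<^bsub>AK\<^esub> z"
  if xyz: "x : carrier AK" "y : carrier AK" "z : carrier AK" for x y z
 proof -
  obtain p q r where p: "p : carrier G" "x = cls p" and q: "q : carrier G" "y = cls q" and r: "r : carrier G" "z = cls r"
   using car[OF xyz(1)] car[OF xyz(2)] car[OF xyz(3)] by blast
  show ?thesis unfolding p(2) q(2) r(2)
   by (simp only: AK_mult AK_add p(1) q(1) r(1) G_closed(1) tm_left)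
 qed
 show "z \<otimes>\<^bsub>AK\<^esub> (x \<oplus>\<^bsub>AK\<^esub> y) = z \<otimes>\<^bsub>AK\<^esub> x \<oplus>\<^bsub>AK\<^esub> z \<otimes>\<^bsub>AK\<^esub> y"
  if xyz: "x : carrier AK" "y : carrier AK" "z : carrier AK" for x y z
 proof -
  obtain p q r where p: "p : carrier G" "x = cls p" and q: "q : carrier G" "y = cls q" and r: "r : carrier G" "z = cls r"
   using car[OF xyz(1)] car[OF xyz(2)] car[OF xyz(3)] by blast
  show ?thesis unfolding p(2) q(2) r(2)
   by (simp only: AK_mult AK_add p(1) q(1) r(1) G_closed(1) tm_right)
 qed
qed

lemma AK_minus: "[|p : carrier G; q : carrier G|] ==> cls (p - q) = cls p \<ominus>\<^bsub>AK\<^esub> cls q"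
proof -
 assume pq: "p : carrier G" "q : carrier G"
 interpret AK: ring AK by (rule AK_ring)
 have c: "cls (p - q) : carrier AK" "cls p : carrier AK" "cls q : carrier AK"
  unfolding AK_carrier using pq G_closed(2) by blast+
 have "cls (p - q) \<oplus>\<^bsub>AK\<^esub> cls q = cls p" by (simp add: AK_add)
 then show ?thesis using c by (metis AK.add.inv_solve_right AK.minus_eq)
qed

lemma AK_induct [consumes 1, case_names zero diff gen]:
 assumes b: "b : carrier AK" and "P \<zero>\<^bsub>AK\<^esub>"
  "!!b b'. [|b : carrier AK; b' : carrier AK; P b; P b'|] ==> P (b \<ominus>\<^bsub>AK\<^esub> b')"
  "!!x a. [|x : carrier K; a : carrier A|] ==> P (t x a)"
 shows "P b"
proof -
 obtain p where p: "p : carrier G" "b = cls p" using b unfolding AK_carrier by blast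
 have "P (cls p)" using p(1)
 proof (induction p rule: G_induct)
  case zero
  then show ?case using assms(2) by (simp add: AK_zero)
 next
  case (diff p q)
  have "cls p : carrier AK" "cls q : carrier AK" unfolding AK_carrier by (intro imageI diff)+
  then show ?case unfolding AK_minus[OF diff(1,2)] by (rule assms(3)[OF _ _ diff(3,4)])
 next
  case (gen x a)
  then show ?case using assms(4) unfolding t_def by blast
 qed
 then show ?thesis using p by simp
qed

lemma AK_smult_one: "c : carrier K ==> c \<odot>\<^bsub>AK\<^esub> \<one>\<^bsub>AK\<^esub> = t c 1_A"
 unfolding AK_one t_def using AK_smult[of c "frag_of (1_K, 1_A)"] by (simp add: ts_gen)

lemma AK_scalar_algebra: "scalar_algebra K AK"
proof -
 interpret AK: ring AK by (rule AK_ring)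
 have "t c 1_A \<otimes>\<^bsub>AK\<^esub> b = b \<otimes>\<^bsub>AK\<^esub> t c 1_A" if c: "c : carrier K" and b: "b : carrier AK" for c b
  using b
 proof (induction b rule: AK_induct)
  case zero
  then show ?case using t_closed[OF c A.A.one_closed] by simp
 next
  case (diff b b')
  then show ?case using t_closed[OF c A.A.one_closed] by (simp add: AK.minus_eq AK.l_distr AK.r_distr AK.l_minus AK.r_minus)
 next
  case (gen x a)
  then show ?case using c by (simp add: t_mult K.m_comm)
 qed
 then show ?thesis
  by (intro scalar_algebra.intro scalar_algebra_axioms.intro K.field_axioms AK_ring)
   (simp_all add: AK_smult_one t_closed t_add_left t_mult AK_one[symmetric])
qed

lemma A_scalar_algebra: "scalar_algebra (K(|carrier := k|)) A"
proof (intro scalar_algebra.intro scalar_algebra_axioms.intro A.A.ring_axioms)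
 show "field (K(|carrier := k|))" by (rule A.field_axioms)
 fix c b assume cb: "c : carrier (K(|carrier := k|))" "b : carrier A"
 then show "c \<odot>_A 1_A *_A b = b *_A (c \<odot>_A 1_A)"
  by (simp add: A_smult_left A_smult_right)
next
 fix c d assume "c : carrier (K(|carrier := k|))" "d : carrier (K(|carrier := k|))"
 then show "c \<otimes>\<^bsub>K(|carrier := k|)\<^esub> d \<odot>_A 1_A = c \<odot>_A 1_A *_A (d \<odot>_A 1_A)"
  using A.smult_assoc1[of c d "1_A"] by (simp add: A_smult_left A_smult_closed)
qed (use A.smult_closed A.smult_l_distr A.smult_one in auto)

text \<open>A module over the scalar extension is a \<open>K\<close>-space with a compatible action of \<open>A\<close>: such data
 define the action of the generators, hence of the free abelian group, and the relators act by zero.\<close>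

lemma AK_module_exists:
 fixes U :: "('x, 'v) module"
 assumes U: "abelian_group U"
  and cl: "!!x a u. [|x : carrier K; a : carrier A; u : carrier U|] ==> \<alpha> x a u : carrier U"
  and addu: "!!x a u v. [|x : carrier K; a : carrier A; u : carrier U; v : carrier U|] ==>
   \<alpha> x a (u +_U v) = \<alpha> x a u +_U \<alpha> x a v"
  and addx: "!!x y a u. [|x : carrier K; y : carrier K; a : carrier A; u : carrier U|] ==>
   \<alpha> (x +_K y) a u = \<alpha> x a u +_U \<alpha> y a u"
  and adda: "!!x a b u. [|x : carrier K; a : carrier A; b : carrier A; u : carrier U|] ==>
   \<alpha> x (a +_A b) u = \<alpha> x a u +_U \<alpha> x b u"
  and bal: "!!x c a u. [|x : carrier K; c : k; a : carrier A; u : carrier U|] ==>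
   \<alpha> (x *_K c) a u = \<alpha> x (c \<odot>_A a) u"
  and mult: "!!x a y b u. [|x : carrier K; a : carrier A; y : carrier K; b : carrier A; u : carrier U|] ==>
   \<alpha> x a (\<alpha> y b u) = \<alpha> (x *_K y) (a *_A b) u"
  and one: "!!u. u : carrier U ==> \<alpha> 1_K 1_A u = u"
 shows "EX act. left_module AK (|carrier = carrier U, monoid.mult = undefined, one = undefined,
   ring.zero = 0_U, ring.add = ring.add U, smult = act|) \<and>
  (ALL x:carrier K. ALL a:carrier A. ALL u:carrier U. act (t x a) u = \<alpha> x a u)"
proof -
 interpret U: abelian_group U by fact
 have cg: "comm_group (add_monoid U)" by (rule U.a_comm_group)
 have "EX h. h : hom G (add_monoid U) \<and> (ALL x:carrier K. ALL a:carrier A. h (frag_of (x, a)) = \<alpha> x a u)"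
  if u: "u : carrier U" for u
 proof -
  have "(%(x, a). \<alpha> x a u) ` (carrier K \<times> carrier A) <= carrier (add_monoid U)" using cl u by auto
  from comm_group.free_Abelian_group_universal[OF cg this]
  obtain h where "h : hom G (add_monoid U)" "!!z. z : carrier K \<times> carrier A ==> h (frag_of z) = (%(x, a). \<alpha> x a u) z"
   by blast
  then show ?thesis by (intro exI[of _ h]) auto
 qed
 then obtain H where H: "!!u. u : carrier U ==> H u : hom G (add_monoid U)"
  and Hg: "!!u x a. [|u : carrier U; x : carrier K; a : carrier A|] ==> H u (frag_of (x, a)) = \<alpha> x a u" by metis
 have Hc: "H u p : carrier U" if "u : carrier U" "p : carrier G" for u p
  using hom_in_carrier[OF H[OF that(1)] that(2)] by simp
 have Ha: "H u (p + q) = H u p +_U H u q" if "u : carrier U" "p : carrier G" "q : carrier G" for u p q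
  using hom_mult[OF H[OF that(1)] that(2,3)] by simp
 have H0: "H u 0 = 0_U" if "u : carrier U" for u
  using Ha[OF that G_closed(4) G_closed(4)] Hc[OF that G_closed(4)] by (metis U.add.l_cancel_one' add.right_neutral)
 have Hn: "H u (- p) = -_U H u p" if "u : carrier U" "p : carrier G" for u p
 proof -
  have "H u (- p) +_U H u p = 0_U" using Ha[OF that(1) G_closed(3)[OF that(2)] that(2)] H0[OF that(1)] by simp
  then show ?thesis using Hc[OF that(1) G_closed(3)[OF that(2)]] Hc[OF that] by (metis U.minus_equality)
 qed
 have Hd: "H u (p - q) = H u p -_U H u q" if "u : carrier U" "p : carrier G" "q : carrier G" for u p q
  using Ha[OF that(1,2) G_closed(3)[OF that(3)]] Hn[OF that(1,3)] by (simp add: U.minus_eq)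
 have aux: "p +_U q -_U p -_U q = 0_U" if "p : carrier U" "q : carrier U" for p q
  unfolding U.a_comm[OF that] U.minus_eq using that by (simp add: U.a_assoc U.r_neg)
 have HN: "H u n = 0_U" if u: "u : carrier U" and n: "n : N" for u n
  using n
 proof (induction n rule: generate.induct)
  case one
  then show ?case using H0[OF u] by simp
 next
  have rel: "H u r = 0_U" if "r : Rel" for r
   using that
  proof (rule Rel_cases)
   show "H u (frag_of (x +_K y, a) - frag_of (x, a) - frag_of (y, a)) = 0_U"
    if "x : carrier K" "y : carrier K" "a : carrier A" for x y a
   proof -
    note g = frag_G[OF that(1,3)] frag_G[OF that(2,3)] frag_G[OF K.a_closed[OF that(1,2)] that(3)]
    show ?thesis using that u cl[OF that(1,3) u] cl[OF that(2,3) u]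
     by (simp only: Hd[OF u G_closed(2)[OF g(3,1)] g(2)] Hd[OF u g(3,1)] Hg K.a_closed addx)
      (rule aux)
   qed
   show "H u (frag_of (x, a +_A b) - frag_of (x, a) - frag_of (x, b)) = 0_U"
    if "x : carrier K" "a : carrier A" "b : carrier A" for x a b
   proof -
    note g = frag_G[OF that(1,2)] frag_G[OF that(1,3)] frag_G[OF that(1) A.M.a_closed[OF that(2,3)]]
    show ?thesis using that u cl[OF that(1,2) u] cl[OF that(1,3) u]
     by (simp only: Hd[OF u G_closed(2)[OF g(3,1)] g(2)] Hd[OF u g(3,1)] Hg A.M.a_closed adda)
      (rule aux)
   qed
   show "H u (frag_of (x *_K c, a) - frag_of (x, c \<odot>_A a)) = 0_U"
    if "x : carrier K" "c : k" "a : carrier A" for x c a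
   proof -
    note g = frag_G[OF K.m_closed[OF that(1) kK[OF that(2)]] that(3)] frag_G[OF that(1) A_smult_closed[OF that(2,3)]]
    show ?thesis using that u cl[OF that(1) A_smult_closed[OF that(2,3)] u]
     by (simp only: Hd[OF u g] Hg K.m_closed kK A_smult_closed bal) (simp add: U.minus_eq U.r_neg)
   qed
  qed
  {
   case (incl h)
   then show ?case by (rule rel)
  next
   case (inv h)
   have "h : carrier G" using subsetD[OF Rel_G inv] .
   moreover from this have "inv\<^bsub>G\<^esub> h = - h" by simp
   ultimately show ?case using Hn[OF u, of h] rel[OF inv] by simp
  next
   case (eng g h)
   have "g : carrier G" "h : carrier G" using N_G eng(1,2) by blast+
   then show ?case using Ha[OF u, of g h] eng(3,4) by simp
  }
 qed
 have Heq: "H u p = H u q" if "u : carrier U" "p : carrier G" "q : cls p" for u p q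
 proof -
  have q: "q : carrier G" by (rule cls_G[OF that(2,3)])
  have "H u q -_U H u p = 0_U"
   using HN[OF that(1), of "q - p"] that(3) Hd[OF that(1) q that(2)] by (simp add: cls_mem)
  then show ?thesis using U.a_minus_eq_zero_iff[OF Hc[OF that(1) q] Hc[OF that(1,2)]] by simp
 qed
 define act where "act P u = H u (SOME p. p : P)" for P u
 have act: "act (cls p) u = H u p" if "p : carrier G" "u : carrier U" for p u
  unfolding act_def using Heq[OF that(2,1) someI[of "%q. q : cls p", OF cls_self]] by simp
 have car: "EX p:carrier G. x = cls p" if "x : carrier AK" for x using that unfolding AK_carrier by blast
 have Hu: "H (u +_U v) p = H u p +_U H v p" if u: "u : carrier U" "v : carrier U" and p: "p : carrier G" for u v p
  using p
 proof (induction p rule: G_induct)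
  case zero
  then show ?case using H0 u by simp
 next
  case (diff p q)
  note d = Hd[OF u(1) diff(1,2)] Hd[OF u(2) diff(1,2)] Hd[OF U.a_closed[OF u] diff(1,2)]
  show ?case unfolding d diff(3,4)
   using Hc[OF u(1) diff(1)] Hc[OF u(2) diff(1)] Hc[OF u(1) diff(2)] Hc[OF u(2) diff(2)]
   by (simp add: U.minus_eq U.minus_add U.a_ac)
 next
  case (gen x a)
  then show ?case using Hg u addu by simp
 qed
 have Hm: "H u (tm p q) = H (H u q) p" if u: "u : carrier U" and p: "p : carrier G" and q: "q : carrier G" for u p q
  using p
 proof (induction p rule: G_induct)
  case zero
  then show ?case using H0 Hc[OF u q] u by (simp add: tm_left)
 next
  case (diff p p')
  then show ?case
   unfolding tm_left Hd[OF u tm_closed[OF diff(1) q] tm_closed[OF diff(2) q]] Hd[OF Hc[OF u q] diff(1,2)] by simp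
 next
  case (gen x a)
  note xa = gen
  from q show ?case
  proof (induction q rule: G_induct)
   case zero
   have "\<alpha> x a 0_U = 0_U"
    by (rule additive_zero[OF U U]) (use xa cl addu in auto)
   then show ?case using H0 Hg u xa by (simp add: tm_right)
  next
   case (diff q q')
   note f = frag_G[OF xa]
   note c = Hc[OF u diff(1)] Hc[OF u diff(2)]
   have m: "\<alpha> x a (v -_U w) = \<alpha> x a v -_U \<alpha> x a w" if vw: "v : carrier U" "w : carrier U" for v w
   proof -
    have "\<alpha> x a (v -_U w) +_U \<alpha> x a w = \<alpha> x a v"
     using addu[OF xa, of "v -_U w" w] vw by (simp add: U.minus_eq U.a_assoc U.l_neg)
    then show ?thesis using cl[OF xa] vw by (metis U.add.inv_solve_right U.minus_eq U.minus_closed)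
   qed
   show ?case
    unfolding tm_right Hd[OF u tm_closed[OF f diff(1)] tm_closed[OF f diff(2)]] diff(3,4) Hd[OF u diff(1,2)]
    using m[OF c] Hg c xa by simp
  next
   case (gen y b)
   then show ?case using xa u Hg cl mult by simp
  qed
 qed
 let ?W = "(|carrier = carrier U, monoid.mult = undefined, one = undefined,
   ring.zero = 0_U, ring.add = ring.add U, smult = act|)"
 have "abelian_group ?W" by (rule abelian_groupI) (auto simp: U.a_ac intro: U.l_neg)
 moreover have "left_module_axioms AK ?W"
 proof (rule left_module_axioms.intro, simp_all)
  fix a u assume a: "a : carrier AK" and u: "u : carrier U"
  obtain p where p: "p : carrier G" "a = cls p" using car[OF a] by blast
  show "act a u : carrier U" unfolding p(2) act[OF p(1) u] by (rule Hc[OF u p(1)])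
  show "act (a \<oplus>\<^bsub>AK\<^esub> b) u = act a u +_U act b u" if b: "b : carrier AK" for b
  proof -
   obtain q where q: "q : carrier G" "b = cls q" using car[OF b] by blast
   show ?thesis unfolding p(2) q(2) AK_add act[OF p(1) u] act[OF q(1) u] act[OF G_closed(1)[OF p(1) q(1)] u]
    by (rule Ha[OF u p(1) q(1)])
  qed
  show "act a (u +_U v) = act a u +_U act a v" if v: "v : carrier U" for v
   unfolding p(2) act[OF p(1) u] act[OF p(1) v] act[OF p(1) U.a_closed[OF u v]] by (rule Hu[OF u v p(1)])
  show "act (a \<otimes>\<^bsub>AK\<^esub> b) u = act a (act b u)" if b: "b : carrier AK" for b
  proof -
   obtain q where q: "q : carrier G" "b = cls q" using car[OF b] by blast
   show ?thesis unfolding p(2) q(2) AK_mult[OF p(1) q(1)] act[OF q(1) u] act[OF tm_closed[OF p(1) q(1)] u] act[OF p(1) Hc[OF u q(1)]]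
    by (rule Hm[OF u p(1) q(1)])
  qed
 next
  fix u assume u: "u : carrier U"
  show "act \<one>\<^bsub>AK\<^esub> u = u" unfolding AK_one t_def act[OF frag_G[OF K.one_closed A.A.one_closed] u]
   using Hg[OF u] one[OF u] by simp
 qed
 ultimately have "left_module AK ?W" by (intro left_module.intro AK_ring)
 moreover have "act (t x a) u = \<alpha> x a u" if "x : carrier K" "a : carrier A" "u : carrier U" for x a u
  unfolding t_def act[OF frag_G[OF that(1,2)] that(3)] using Hg that by simp
 ultimately show ?thesis by blast
qed

end

section \<open>Scalar extension of modules\<close>

lemma (in scalar_algebra) finsum_underlying: "finsum (underlying_space B U) = finsum U"
 by (simp add: finsum_def finprod_def fun_eq_iff)

context scalar_ext
begin

abbreviation "kF \<equiv> K(|carrier := k|)"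

sublocale SA: scalar_algebra kF A by (rule A_scalar_algebra)
sublocale SB: scalar_algebra K AK by (rule AK_scalar_algebra)

lemma kF_field: "field kF" by (rule A.field_axioms)
lemma kF_abelian: "abelian_group kF" by (rule ring.axioms(1)[OF A.ring_axioms])

lemma k_zero: "0_K : k" and k_one: "1_K : k"
 using subringE(2,3)[OF subfieldE(1)[OF k_subfield]] by auto

lemmas kF_finsum_cong = abelian_monoid.finsum_cong'[OF abelian_group.axioms(1)[OF kF_abelian]]
 and kF_finsum_singleton = abelian_monoid.finsum_singleton[OF abelian_group.axioms(1)[OF kF_abelian]]

subsection \<open>Functionals on the extension field\<close>

definition kmod :: "('f, 'f) module" where
 "kmod = (|carrier = carrier K, monoid.mult = monoid.mult K, one = 1_K, ring.zero = 0_K,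
  ring.add = ring.add K, smult = monoid.mult K|)"

lemma kmod_simps [simp]:
 "carrier kmod = carrier K" "\<zero>\<^bsub>kmod\<^esub> = 0_K" "ring.add kmod = ring.add K" "smult kmod = monoid.mult K"
 unfolding kmod_def by simp_all

lemma kmod_vspace: "vspace kF kmod"
proof -
 have ag: "abelian_group kmod" by (rule abelian_groupI) (auto simp: K.a_ac intro: K.l_neg)
 have "module kF kmod"
  by (rule moduleI) (use ag kK A.is_cring in "auto simp: K.l_distr K.r_distr K.m_assoc")
 then show ?thesis unfolding vspace_def by (simp add: kF_field)
qed

sublocale KM: vspace kF kmod by (rule kmod_vspace)

abbreviation "\<Phi> \<equiv> lin_func kF kmod"

lemma Phi_closed: "[|\<phi> : \<Phi>; x : carrier K|] ==> \<phi> x : k"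
 and Phi_add: "[|\<phi> : \<Phi>; x : carrier K; y : carrier K|] ==> \<phi> (x +_K y) = \<phi> x +_K \<phi> y"
 and Phi_smult: "[|\<phi> : \<Phi>; c : k; x : carrier K|] ==> \<phi> (c *_K x) = c *_K \<phi> x"
 unfolding lin_func_def by auto

lemma Phi_closed_K: "[|\<phi> : \<Phi>; x : carrier K|] ==> \<phi> x : carrier K"
 using Phi_closed kK by blast

lemma Phi_zero: "\<phi> : \<Phi> ==> \<phi> 0_K = 0_K"
 using KM.lin_func_zero[of \<phi>] by simp

lemma Phi_scalar: "[|\<phi> : \<Phi>; c : k|] ==> \<phi> c = c *_K \<phi> 1_K"
 using Phi_smult[of \<phi> c "1_K"] kK by simp

lemma Phi_shift: "[|\<phi> : \<Phi>; x : carrier K|] ==> (%y. \<phi> (x *_K y)) : \<Phi>"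
 by (rule lin_funcI) (auto simp: Phi_closed Phi_add Phi_smult K.r_distr K.m_lcomm kK)

lemma Phi_separates:
 assumes "x : carrier K" "!!\<phi>. \<phi> : \<Phi> ==> \<phi> x = 0_K"
 shows "x = 0_K"
proof (rule ccontr)
 assume "x ~= 0_K"
 then obtain \<phi> where "\<phi> : \<Phi>" "\<phi> x = 1_K" using KM.lin_func_separates[of x] assms(1) by auto
 then show False using assms(2)[of \<phi>] K.one_not_zero by simp
qed

lemma Phi_eqI:
 assumes "x : carrier K" "y : carrier K" "!!\<phi>. \<phi> : \<Phi> ==> \<phi> x = \<phi> y"
 shows "x = y"
proof -
 have "\<phi> (x -_K y) = 0_K" if p: "\<phi> : \<Phi>" for \<phi>
 proof -
  have "\<phi> (x -_K y) +_K \<phi> y = \<phi> x"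
   using Phi_add[OF p, of "x -_K y" y] assms(1,2) by (simp add: K.minus_eq K.a_assoc K.l_neg)
  then show ?thesis using Phi_closed_K[OF p] assms p by (metis K.add.r_cancel_one' K.minus_closed)
 qed
 then show ?thesis using Phi_separates[of "x -_K y"] assms(1,2) K.a_minus_eq_zero_iff by simp
qed

lemma Phi_finsum: "[|\<phi> : \<Phi>; finite I; f : I \<rightarrow> carrier K|] ==> \<phi> (finsum K f I) = finsum kF (%i. \<phi> (f i)) I"
 by (rule additive_finsum[OF K.abelian_group_axioms kF_abelian]) (auto simp: Phi_closed Phi_add)

subsection \<open>Construction\<close>

text \<open>A module with chosen \<open>k\<close>-basis is extended to coordinate vectors over \<open>K\<close>, represented as
 functions that vanish beyond the dimension. A functional on \<open>K\<close>, applied to the coordinates,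
 maps the extension back to the module.\<close>

definition dbas :: "('a, nat => 'f) module => nat \<times> (nat => nat => 'f) \<times> (nat => (nat => 'f) => 'f)" where
 "dbas M = (SOME (d, m, c). vspace.dual_family kF (underlying_space A M) d m c \<and>
  (ALL x:carrier M. vspace.dual_proj (underlying_space A M) d m c x = x))"

definition bd where "bd M = fst (dbas M)"
definition bm where "bm M = fst (snd (dbas M))"
definition bc where "bc M = snd (snd (dbas M))"

text \<open>A functional applied to the coordinates, and the inclusion that sends \<open>m\<close> to \<open>1 \<otimes> m\<close>.\<close>

definition ph :: "('a, nat => 'f) module => ('f => 'f) => (nat => 'f) => (nat => 'f)" where
 "ph M \<phi> u = (finsum M (%j. SA.scl M (\<phi> (u j)) (bm M j)) {..<bd M})"

definition emb :: "('a, nat => 'f) module => (nat => 'f) => (nat => 'f)" where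
 "emb M m = (%j. if j < bd M then bc M j m else 0_K)"

definition cvec :: "('a, nat => 'f) module => (nat => 'f) set" where
 "cvec M = {u. (ALL j<bd M. u j : carrier K) \<and> (ALL j>=bd M. u j = 0_K)}"

definition cact :: "('a, nat => 'f) module => 'f => 'a => (nat => 'f) => (nat => 'f)" where
 "cact M x a u = (%l. if l < bd M then
  (finsum K (%j. (x *_K u j) *_K bc M l (a \<odot>_M bm M j)) {..<bd M}) else 0_K)"

definition ext :: "('a, nat => 'f) module => ((('f \<times> 'a) \<Rightarrow>\<^sub>0 int) set, nat => 'f) module" where
 "ext M = (|carrier = cvec M, monoid.mult = undefined, one = undefined,
  ring.zero = (%j. 0_K), ring.add = (%u v j. u j +_K v j),
  smult = (SOME act. left_module AK (|carrier = cvec M, monoid.mult = undefined, one = undefined,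
    ring.zero = (%j. 0_K), ring.add = (%u v j. u j +_K v j), smult = act|) \<and>
   (ALL x:carrier K. ALL a:carrier A. ALL u:cvec M. act (t x a) u = cact M x a u))|)"

lemma ext_simps [simp]:
 "carrier (ext M) = cvec M" "\<zero>\<^bsub>ext M\<^esub> = (%j. 0_K)" "u \<oplus>\<^bsub>ext M\<^esub> v = (%j. u j +_K v j)"
 unfolding ext_def by simp_all

lemma t_scl: "[|x : carrier K|] ==> SB.scl W x u = t x 1_A \<odot>_W u"
 unfolding SB.scl_def by (simp add: AK_smult_one)

lemma t_split: "[|x : carrier K; a : carrier A|] ==> t x a = t x 1_A \<otimes>\<^bsub>AK\<^esub> t 1_K a"
 by (simp add: t_mult)

lemma t_act_split: "[|left_module AK W; x : carrier K; a : carrier A; w : carrier W|] ==>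
  t x a \<odot>_W w = SB.scl W x (t 1_K a \<odot>_W w)"
 using left_module.act_assoc[of AK W "t x 1_A" "t 1_K a" w] by (simp add: t_scl t_closed t_split[symmetric])

text \<open>The generators determine the action, so linearity needs to be checked for \<open>K\<close> and \<open>A\<close> only.\<close>

lemma AK_homI:
 assumes U: "left_module AK U" and W: "left_module AK W"
  and f: "f : extensional (carrier U)" "!!u. u : carrier U ==> f u : carrier W"
   "!!u v. [|u : carrier U; v : carrier U|] ==> f (u +_U v) = f u +_W f v"
  and fK: "!!x u. [|x : carrier K; u : carrier U|] ==> f (SB.scl U x u) = SB.scl W x (f u)"
  and fA: "!!a u. [|a : carrier A; u : carrier U|] ==> f (t 1_K a \<odot>_U u) = t 1_K a \<odot>_W f u"
 shows "f : mod_hom AK U W"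
proof (rule homI[OF f])
 interpret U: left_module AK U by fact
 interpret W: left_module AK W by fact
 fix b u assume b: "b : carrier AK" and u: "u : carrier U"
 have f0: "f 0_U = 0_W"
  by (rule additive_zero[OF U.abelian_group_axioms W.abelian_group_axioms]) (use f in auto)
 have fn: "f (v -_U w) = f v -_W f w" if vw: "v : carrier U" "w : carrier U" for v w
 proof -
  have "f (v -_U w) +_W f w = f v"
   using f(3)[of "v -_U w" w] vw by (simp add: U.minus_eq U.a_assoc U.l_neg)
  then show ?thesis using f(2) vw by (metis W.add.inv_solve_right W.minus_eq U.minus_closed)
 qed
 show "f (b \<odot>_U u) = b \<odot>_W f u"
  using b
 proof (induction b rule: AK_induct)
  case zero
  then show ?case using U.zero_act[OF u] W.zero_act[OF f(2)[OF u]] f0 by simp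
 next
  case (diff b b')
  have m: "(b \<ominus>\<^bsub>AK\<^esub> b') \<odot>_V v = b \<odot>_V v -_V b' \<odot>_V v"
   if "left_module AK V" "v : carrier V" for V :: "((('f \<times> 'a) \<Rightarrow>\<^sub>0 int) set, 'z) module" and v
  proof -
   interpret V: left_module AK V by fact
   show ?thesis using that diff(1,2) by (simp add: a_minus_def V.act_l_distr V.neg_act)
  qed
  show ?case unfolding m[OF U u] m[OF W f(2)[OF u]]
   using fn[OF U.act_closed[OF diff(1) u] U.act_closed[OF diff(2) u]] diff(3,4) by simp
 next
  case (gen x a)
  have c: "t 1_K a : carrier AK" using gen t_closed by simp
  show ?case unfolding t_act_split[OF U gen u] t_act_split[OF W gen f(2)[OF u]]
   using fK[OF gen(1) U.act_closed[OF c u]] fA[OF gen(2) u] by simp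
 qed
qed

context
 fixes M :: "('a, nat => 'f) module"
 assumes M: "M : fd_mod kF A"
begin

lemma M_left: "left_module A M" by (rule SA.fd_mod_left[OF M])

interpretation M: left_module A M by (rule M_left)
interpretation MU: vspace kF "underlying_space A M" by (rule SA.underlying_vspace[OF M_left])

lemma dbas: "MU.dual_family (bd M) (bm M) (bc M)"
 and dbas_proj: "m : carrier M ==> MU.dual_proj (bd M) (bm M) (bc M) m = m"
proof -
 obtain d b c where D: "MU.dual_family d b c"
  and fx: "!!x. x : carrier (underlying_space A M) ==> MU.dual_proj d b c x = x"
  by (rule MU.fin_dim_dual_basis[OF SA.fd_mod_fin_dim[OF M]]) blast
 have "EX p. case p of (d :: nat, m :: nat => nat => 'f, c) => MU.dual_family d m c \<and> (ALL x:carrier M. MU.dual_proj d m c x = x)"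
  using D fx by (intro exI[of _ "(d, b, c)"]) simp
 from someI_ex[OF this, folded dbas_def]
 have *: "MU.dual_family (bd M) (bm M) (bc M) \<and> (ALL x:carrier M. MU.dual_proj (bd M) (bm M) (bc M) x = x)"
  unfolding bd_def bm_def bc_def by (simp add: case_prod_beta)
 then show "MU.dual_family (bd M) (bm M) (bc M)" by blast
 show "m : carrier M ==> MU.dual_proj (bd M) (bm M) (bc M) m = m" using * by blast
qed

lemma bm_closed: "j < bd M ==> bm M j : carrier M"
 using MU.dual_familyD(1)[OF dbas] by simp

lemma bc_lin: "j < bd M ==> bc M j : lin_func kF (underlying_space A M)"
 by (rule MU.dual_familyD(2)[OF dbas])

lemma bc_closed: "[|j < bd M; m : carrier M|] ==> bc M j m : k"
 using lin_func_closed[OF bc_lin, of j m] by simp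

lemma bc_closed_K: "[|j < bd M; m : carrier M|] ==> bc M j m : carrier K"
 using bc_closed kK by blast

lemma bc_add: "[|j < bd M; m : carrier M; m' : carrier M|] ==> bc M j (m +_M m') = bc M j m +_K bc M j m'"
 using lin_func_add[OF bc_lin, of j m m'] by simp

lemma bc_scl: "[|j < bd M; c : k; m : carrier M|] ==> bc M j (SA.scl M c m) = c *_K bc M j m"
 using lin_func_smult[OF bc_lin, of j c m] by simp

lemma bc_bm: "[|i < bd M; j < bd M|] ==> bc M i (bm M j) = (if i = j then 1_K else 0_K)"
 using MU.dual_familyD(3)[OF dbas, of i j] by simp

lemma M_expand: "m : carrier M ==> (finsum M (%j. SA.scl M (bc M j m) (bm M j)) {..<bd M}) = m"
 using dbas_proj[of m] unfolding MU.dual_proj_def SA.finsum_underlying by simp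

lemma M_eqI:
 assumes "m : carrier M" "m' : carrier M" "!!j. j < bd M ==> bc M j m = bc M j m'"
 shows "m = m'"
proof -
 have "(finsum M (%j. SA.scl M (bc M j m) (bm M j)) {..<bd M}) = (finsum M (%j. SA.scl M (bc M j m') (bm M j)) {..<bd M})"
  using assms bc_closed bm_closed SA.scl_closed[OF M_left] by (intro M.finsum_cong') auto
 then show ?thesis using M_expand assms by simp
qed

lemma bc_finsum: "[|l < bd M; finite I; f : I \<rightarrow> carrier M|] ==> bc M l (finsum M f I) = finsum kF (%i. bc M l (f i)) I"
 by (rule additive_finsum[OF M.abelian_group_axioms kF_abelian]) (auto simp: bc_closed bc_add)

lemma cvecD: "u : cvec M ==> u j : carrier K"
 unfolding cvec_def by (cases "j < bd M") auto

lemma ph_terms: "[|\<phi> : \<Phi>; u : cvec M|] ==> (%j. SA.scl M (\<phi> (u j)) (bm M j)) : {..<bd M} \<rightarrow> carrier M"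
 using SA.scl_closed[OF M_left] bm_closed Phi_closed cvecD by auto

lemma ph_closed: "[|\<phi> : \<Phi>; u : cvec M|] ==> ph M \<phi> u : carrier M"
 unfolding ph_def by (rule M.finsum_closed[OF ph_terms])

lemma bc_ph:
 assumes l: "l < bd M" and p: "\<phi> : \<Phi>" and u: "u : cvec M"
 shows "bc M l (ph M \<phi> u) = \<phi> (u l)"
proof -
 have pk: "\<phi> (u j) : k" for j using Phi_closed[OF p cvecD[OF u]] .
 have "bc M l (ph M \<phi> u) = finsum kF (%j. bc M l (SA.scl M (\<phi> (u j)) (bm M j))) {..<bd M}"
  unfolding ph_def by (rule bc_finsum[OF l _ ph_terms[OF p u]]) simp
 also have "... = finsum kF (%j. if l = j then \<phi> (u j) else \<zero>\<^bsub>kF\<^esub>) {..<bd M}"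
  using l pk kK bc_bm bm_closed k_zero by (intro kF_finsum_cong) (auto simp: bc_scl)
 also have "... = \<phi> (u l)" using kF_finsum_singleton[of l "{..<bd M}" "%j. \<phi> (u j)"] l pk by auto
 finally show ?thesis .
qed

lemma cvec_eqI:
 assumes "u : cvec M" "v : cvec M" "!!\<phi>. \<phi> : \<Phi> ==> ph M \<phi> u = ph M \<phi> v"
 shows "u = v"
proof
 fix j
 show "u j = v j"
 proof (cases "j < bd M")
  case True
  show ?thesis by (rule Phi_eqI) (use cvecD assms bc_ph[OF True] in metis)+
 next
  case False
  then show ?thesis using assms unfolding cvec_def by simp
 qed
qed

lemma cvec_zero: "(%j. 0_K) : cvec M"
 and cvec_add: "[|u : cvec M; v : cvec M|] ==> (%j. u j +_K v j) : cvec M"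
 and cvec_neg: "u : cvec M ==> (%j. -_K u j) : cvec M"
 unfolding cvec_def by auto

lemma cact_closed:
 assumes "x : carrier K" "a : carrier A" "u : cvec M"
 shows "cact M x a u : cvec M"
 unfolding cvec_def cact_def using assms cvecD M.act_closed bm_closed bc_closed_K
 by (auto intro!: K.finsum_closed)

lemma ph_add:
 assumes p: "\<phi> : \<Phi>" and u: "u : cvec M" and v: "v : cvec M"
 shows "ph M \<phi> (%j. u j +_K v j) = ph M \<phi> u +_M ph M \<phi> v"
 by (rule M_eqI) (use p u v in "simp_all add: ph_closed cvec_add bc_add bc_ph Phi_add cvecD")

lemma ph_cact:
 assumes p: "\<phi> : \<Phi>" and x: "x : carrier K" and a: "a : carrier A" and u: "u : cvec M"
 shows "ph M \<phi> (cact M x a u) = a \<odot>_M ph M (%y. \<phi> (x *_K y)) u"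
proof (rule M_eqI)
 note px = Phi_shift[OF p x]
 show "ph M \<phi> (cact M x a u) : carrier M" by (rule ph_closed[OF p cact_closed[OF x a u]])
 show "a \<odot>_M ph M (%y. \<phi> (x *_K y)) u : carrier M" by (rule M.act_closed[OF a ph_closed[OF px u]])
 fix l assume l: "l < bd M"
 have am: "a \<odot>_M bm M j : carrier M" if "j < bd M" for j by (rule M.act_closed[OF a bm_closed[OF that]])
 have uK: "u j : carrier K" for j by (rule cvecD[OF u])
 have xk: "\<phi> (x *_K u j) : k" for j by (rule Phi_closed[OF px uK])
 have terms: "(%j. a \<odot>_M SA.scl M (\<phi> (x *_K u j)) (bm M j)) : {..<bd M} \<rightarrow> carrier M"
  using ph_terms[OF px u] a M.act_closed by auto
 have "bc M l (ph M \<phi> (cact M x a u)) = \<phi> (cact M x a u l)" by (rule bc_ph[OF l p cact_closed[OF x a u]])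
 also have "... = \<phi> (finsum K (%j. (x *_K u j) *_K bc M l (a \<odot>_M bm M j)) {..<bd M})" unfolding cact_def using l by simp
 also have "... = finsum kF (%j. \<phi> ((x *_K u j) *_K bc M l (a \<odot>_M bm M j))) {..<bd M}"
  using uK x bc_closed_K[OF l am] by (intro Phi_finsum[OF p]) auto
 also have "... = finsum kF (%j. bc M l (a \<odot>_M SA.scl M (\<phi> (x *_K u j)) (bm M j))) {..<bd M}"
 proof (rule kF_finsum_cong)
  show "(%j. bc M l (a \<odot>_M SA.scl M (\<phi> (x *_K u j)) (bm M j))) : {..<bd M} \<rightarrow> carrier kF"
   using terms bc_closed[OF l] by (auto simp: Pi_iff)
  fix j assume "j : {..<bd M}"
  then have j: "j < bd M" by simp
  have "a \<odot>_M SA.scl M (\<phi> (x *_K u j)) (bm M j) = SA.scl M (\<phi> (x *_K u j)) (a \<odot>_M bm M j)"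
   using SA.scl_act[OF M_left _ a bm_closed[OF j]] xk by simp
  then have "bc M l (a \<odot>_M SA.scl M (\<phi> (x *_K u j)) (bm M j)) = \<phi> (x *_K u j) *_K bc M l (a \<odot>_M bm M j)"
   using bc_scl[OF l xk am[OF j]] by simp
  moreover have "\<phi> ((x *_K u j) *_K bc M l (a \<odot>_M bm M j)) = bc M l (a \<odot>_M bm M j) *_K \<phi> (x *_K u j)"
   using Phi_smult[OF p bc_closed[OF l am[OF j]], of "x *_K u j"] x uK[of j] bc_closed_K[OF l am[OF j]]
   by (simp add: K.m_comm)
  ultimately show "\<phi> ((x *_K u j) *_K bc M l (a \<odot>_M bm M j)) = bc M l (a \<odot>_M SA.scl M (\<phi> (x *_K u j)) (bm M j))"
   using xk[of j] bc_closed_K[OF l am[OF j]] kK by (simp add: K.m_comm)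
 qed simp
 also have "... = bc M l (finsum M (%j. a \<odot>_M SA.scl M (\<phi> (x *_K u j)) (bm M j)) {..<bd M})"
  by (rule bc_finsum[OF l _ terms, symmetric]) simp
 also have "(finsum M (%j. a \<odot>_M SA.scl M (\<phi> (x *_K u j)) (bm M j)) {..<bd M}) = a \<odot>_M ph M (%y. \<phi> (x *_K y)) u"
  unfolding ph_def
  by (rule additive_finsum[OF M.abelian_group_axioms M.abelian_group_axioms, symmetric])
   (use a M.act_closed M.act_r_distr ph_terms[OF px u] in auto)
 finally show "bc M l (ph M \<phi> (cact M x a u)) = bc M l (a \<odot>_M ph M (%y. \<phi> (x *_K y)) u)" .
qed

lemma ph_cong: "[|u : cvec M; \<phi> : \<Phi>; !!x. x : carrier K ==> \<phi>' x = \<phi> x|] ==> ph M \<phi>' u = ph M \<phi> u"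
 unfolding ph_def using ph_terms[of \<phi> u] cvecD by (intro M.finsum_cong') auto

lemma ph_fun_add:
 assumes u: "u : cvec M" and p: "\<phi> : \<Phi>" "\<psi> : \<Phi>" and e: "!!x. x : carrier K ==> \<chi> x = \<phi> x +_K \<psi> x" and c: "\<chi> : \<Phi>"
 shows "ph M \<chi> u = ph M \<phi> u +_M ph M \<psi> u"
 by (rule M_eqI) (use u p c in "simp_all add: ph_closed bc_add bc_ph e cvecD")

lemma ph_fun_scl:
 assumes u: "u : cvec M" and p: "\<phi> : \<Phi>" and d: "d : k" and e: "!!x. x : carrier K ==> \<chi> x = d *_K \<phi> x" and c: "\<chi> : \<Phi>"
 shows "ph M \<chi> u = SA.scl M d (ph M \<phi> u)"
 by (rule M_eqI) (use u p c d SA.scl_closed[OF M_left] in "simp_all add: ph_closed bc_scl bc_ph e cvecD")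

lemma ext_exists:
 "left_module AK (ext M) \<and> (ALL x:carrier K. ALL a:carrier A. ALL u:cvec M. t x a \<odot>\<^bsub>ext M\<^esub> u = cact M x a u)"
proof -
 let ?U = "(|carrier = cvec M, monoid.mult = undefined, one = undefined,
  ring.zero = (%j. 0_K), ring.add = (%u v j. u j +_K v j), smult = undefined|) :: ('a, nat => 'f) module"
 have ag: "abelian_group ?U"
 proof (rule abelian_groupI)
  fix u assume "u : carrier ?U"
  then show "EX v:carrier ?U. v +_?U u = 0_?U"
   using cvec_neg[of u] cvecD[of u] by (intro bexI[of _ "%j. -_K u j"]) (simp_all add: K.l_neg)
 qed (simp_all add: cvec_add cvec_zero cvecD K.a_ac)
 note S = Phi_shift
 have "EX act. left_module AK (|carrier = carrier ?U, monoid.mult = undefined, one = undefined,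
   ring.zero = 0_?U, ring.add = ring.add ?U, smult = act|) \<and>
  (ALL x:carrier K. ALL a:carrier A. ALL u:carrier ?U. act (t x a) u = cact M x a u)"
 proof (rule AK_module_exists[OF ag])
  show "cact M x a u : carrier ?U" if "x : carrier K" "a : carrier A" "u : carrier ?U" for x a u
   using that cact_closed by simp
  show "cact M x a (u +_?U v) = cact M x a u +_?U cact M x a v"
   if "x : carrier K" "a : carrier A" "u : carrier ?U" "v : carrier ?U" for x a u v
   by (simp, rule cvec_eqI) (use that in "simp_all add: cact_closed cvec_add ph_cact ph_add S ph_closed M.act_r_distr")
  show "cact M (x +_K y) a u = cact M x a u +_?U cact M y a u"
   if xy: "x : carrier K" "y : carrier K" "a : carrier A" "u : carrier ?U" for x y a u
  proof (simp, rule cvec_eqI)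
   have u: "u : cvec M" using xy by simp
   fix \<phi> assume p: "\<phi> : \<Phi>"
   have "ph M (%z. \<phi> ((x +_K y) *_K z)) u = ph M (%z. \<phi> (x *_K z)) u +_M ph M (%z. \<phi> (y *_K z)) u"
    by (rule ph_fun_add[OF u S[OF p xy(1)] S[OF p xy(2)] _ S[OF p K.a_closed[OF xy(1,2)]]])
     (use xy p in "simp add: K.l_distr Phi_add")
   then show "ph M \<phi> (cact M (x +_K y) a u) = ph M \<phi> (%j. cact M x a u j +_K cact M y a u j)"
    using xy u p by (simp add: ph_cact ph_add cact_closed M.act_r_distr ph_closed S)
  qed (use xy in "simp_all add: cact_closed cvec_add")
  show "cact M x (a +_A b) u = cact M x a u +_?U cact M x b u"
   if "x : carrier K" "a : carrier A" "b : carrier A" "u : carrier ?U" for x a b u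
   by (simp, rule cvec_eqI) (use that in "simp_all add: cact_closed cvec_add ph_cact ph_add S ph_closed M.act_l_distr")
  show "cact M (x *_K c) a u = cact M x (c \<odot>_A a) u"
   if xc: "x : carrier K" "c : k" "a : carrier A" "u : carrier ?U" for x c a u
  proof (rule cvec_eqI)
   have u: "u : cvec M" using xc by simp
   fix \<phi> assume p: "\<phi> : \<Phi>"
   have "ph M (%z. \<phi> ((x *_K c) *_K z)) u = SA.scl M c (ph M (%z. \<phi> (x *_K z)) u)"
   proof (rule ph_fun_scl[OF u S[OF p xc(1)] xc(2) _ S[OF p K.m_closed[OF xc(1) kK[OF xc(2)]]]])
    fix z assume z: "z : carrier K"
    have "(x *_K c) *_K z = c *_K (x *_K z)" using xc z kK by (simp add: K.m_ac)
    then show "\<phi> ((x *_K c) *_K z) = c *_K \<phi> (x *_K z)" using Phi_smult[OF p xc(2)] xc z by simp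
   qed
   moreover have "(c \<odot>_A a) \<odot>_M w = a \<odot>_M SA.scl M c w" if w: "w : carrier M" for w
   proof -
    have "c \<odot>_A a = (c \<odot>_A 1_A) *_A a" using xc by (simp add: A_smult_left)
    then have "(c \<odot>_A a) \<odot>_M w = SA.scl M c (a \<odot>_M w)" unfolding SA.scl_def
     using M.act_assoc[of "c \<odot>_A 1_A" a w] xc w A_smult_closed by simp
    then show ?thesis using SA.scl_act[OF M_left, of c a w] xc w by simp
   qed
   ultimately show "ph M \<phi> (cact M (x *_K c) a u) = ph M \<phi> (cact M x (c \<odot>_A a) u)"
    using xc u p kK A_smult_closed by (simp add: ph_cact ph_closed S)
  qed (use xc kK A_smult_closed in "simp_all add: cact_closed")
  show "cact M x a (cact M y b u) = cact M (x *_K y) (a *_A b) u"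
   if xy: "x : carrier K" "a : carrier A" "y : carrier K" "b : carrier A" "u : carrier ?U" for x a y b u
  proof (rule cvec_eqI)
   have u: "u : cvec M" using xy by simp
   fix \<phi> assume p: "\<phi> : \<Phi>"
   have "ph M (%z. \<phi> ((x *_K y) *_K z)) u = ph M (%z. \<phi> (x *_K (y *_K z))) u"
    by (rule ph_cong[OF u S[OF S[OF p xy(1)] xy(3)]]) (use xy in "simp add: K.m_assoc")
   then show "ph M \<phi> (cact M x a (cact M y b u)) = ph M \<phi> (cact M (x *_K y) (a *_A b) u)"
    using xy u p S[OF p xy(1)] S[OF S[OF p xy(1)] xy(3)]
    by (simp add: ph_cact cact_closed M.act_assoc ph_closed)
  qed (use xy in "simp_all add: cact_closed")
  show "cact M 1_K 1_A u = u" if u': "u : carrier ?U" for u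
  proof (rule cvec_eqI)
   have u: "u : cvec M" using u' by simp
   fix \<phi> assume p: "\<phi> : \<Phi>"
   have "ph M (%z. \<phi> (1_K *_K z)) u = ph M \<phi> u" by (rule ph_cong[OF u p]) simp
   then show "ph M \<phi> (cact M 1_K 1_A u) = ph M \<phi> u" using u p by (simp add: ph_cact M.act_one ph_closed)
  qed (use u' in "simp_all add: cact_closed")
 qed
 then have ex: "EX act. left_module AK (|carrier = cvec M, monoid.mult = undefined, one = undefined,
    ring.zero = (%j. 0_K), ring.add = (%u v j. u j +_K v j), smult = act|) \<and>
   (ALL x:carrier K. ALL a:carrier A. ALL u:cvec M. act (t x a) u = cact M x a u)" by simp
 show ?thesis using someI_ex[OF ex] unfolding ext_def by simp
qed

lemma ext_left: "left_module AK (ext M)" using ext_exists by blast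

interpretation E: left_module AK "ext M" by (rule ext_left)
interpretation EU: vspace K "underlying_space AK (ext M)" by (rule SB.underlying_vspace[OF ext_left])

lemma ext_act: "[|x : carrier K; a : carrier A; u : cvec M|] ==> t x a \<odot>\<^bsub>ext M\<^esub> u = cact M x a u"
 using ext_exists by blast

lemma ph_act: "[|\<phi> : \<Phi>; a : carrier A; u : cvec M|] ==> ph M \<phi> (t 1_K a \<odot>\<^bsub>ext M\<^esub> u) = a \<odot>_M ph M \<phi> u"
 using ph_cact[of \<phi> "1_K" a u] ph_cong[of u \<phi> "%y. \<phi> (1_K *_K y)"] by (simp add: ext_act)

lemma ph_scl: "[|\<phi> : \<Phi>; x : carrier K; u : cvec M|] ==>
  ph M \<phi> (SB.scl (ext M) x u) = ph M (%y. \<phi> (x *_K y)) u"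
 using ph_cact[of \<phi> x "1_A" u] by (simp add: t_scl ext_act M.act_one ph_closed Phi_shift)

lemma ext_scl_closed: "[|x : carrier K; u : cvec M|] ==> SB.scl (ext M) x u : cvec M"
 using SB.scl_closed[OF ext_left] by simp

lemma ext_scl:
 assumes x: "x : carrier K" and u: "u : cvec M"
 shows "SB.scl (ext M) x u = (%j. x *_K u j)"
proof (rule cvec_eqI)
 show xu: "(%j. x *_K u j) : cvec M" using x u unfolding cvec_def by auto
 show "SB.scl (ext M) x u : cvec M" by (rule ext_scl_closed[OF x u])
 show "ph M \<phi> (SB.scl (ext M) x u) = ph M \<phi> (%j. x *_K u j)" if "\<phi> : \<Phi>" for \<phi>
  unfolding ph_scl[OF that x u] by (simp add: ph_def)
qed

lemma emb_closed: "m : carrier M ==> emb M m : cvec M"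
 unfolding emb_def cvec_def by (simp add: bc_closed_K)

lemma emb_add: "[|m : carrier M; m' : carrier M|] ==> emb M (m +_M m') = (%j. emb M m j +_K emb M m' j)"
 unfolding emb_def by (auto simp: bc_add)

lemma ph_emb:
 assumes p: "\<phi> : \<Phi>" and m: "m : carrier M"
 shows "ph M \<phi> (emb M m) = SA.scl M (\<phi> 1_K) m"
proof (rule M_eqI)
 have p1: "\<phi> 1_K : k" using Phi_closed[OF p] by simp
 show "ph M \<phi> (emb M m) : carrier M" by (rule ph_closed[OF p emb_closed[OF m]])
 show "SA.scl M (\<phi> 1_K) m : carrier M" using SA.scl_closed[OF M_left] p1 m by simp
 fix l assume l: "l < bd M"
 show "bc M l (ph M \<phi> (emb M m)) = bc M l (SA.scl M (\<phi> 1_K) m)"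
  using bc_ph[OF l p emb_closed[OF m]] bc_scl[OF l p1 m] Phi_scalar[OF p bc_closed[OF l m]] kK[OF p1] bc_closed_K[OF l m] l
  by (simp add: emb_def K.m_comm)
qed

lemma emb_act:
 assumes a: "a : carrier A" and m: "m : carrier M"
 shows "emb M (a \<odot>_M m) = t 1_K a \<odot>\<^bsub>ext M\<^esub> emb M m"
proof (rule cvec_eqI)
 show "emb M (a \<odot>_M m) : cvec M" by (rule emb_closed[OF M.act_closed[OF a m]])
 show "t 1_K a \<odot>\<^bsub>ext M\<^esub> emb M m : cvec M" using cact_closed[OF _ a emb_closed[OF m]] ext_act[OF _ a emb_closed[OF m]] by simp
 fix \<phi> assume p: "\<phi> : \<Phi>"
 show "ph M \<phi> (emb M (a \<odot>_M m)) = ph M \<phi> (t 1_K a \<odot>\<^bsub>ext M\<^esub> emb M m)"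
  unfolding ph_act[OF p a emb_closed[OF m]] ph_emb[OF p m] ph_emb[OF p M.act_closed[OF a m]]
  using SA.scl_act[OF M_left _ a m] Phi_closed[OF p] by simp
qed

lemma ph_scl_emb:
 assumes "\<phi> : \<Phi>" "x : carrier K" "m : carrier M"
 shows "ph M \<phi> (SB.scl (ext M) x (emb M m)) = SA.scl M (\<phi> x) m"
 using ph_scl[OF assms(1,2) emb_closed[OF assms(3)]] ph_emb[OF Phi_shift[OF assms(1,2)] assms(3)] assms(2) by simp

lemma ph_finsum:
 assumes "\<phi> : \<Phi>" "finite I" "f : I \<rightarrow> cvec M"
 shows "ph M \<phi> (finsum (ext M) f I) = finsum M (%i. ph M \<phi> (f i)) I"
 by (rule additive_finsum[OF E.abelian_group_axioms M.abelian_group_axioms])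
  (use assms in "auto simp: ph_closed ph_add")

lemma ext_expand_basis:
 assumes u: "u : cvec M"
 shows "u = (finsum (ext M) (%j. SB.scl (ext M) (u j) (emb M (bm M j))) {..<bd M})"
proof (rule cvec_eqI[OF u])
 have terms: "(%j. SB.scl (ext M) (u j) (emb M (bm M j))) : {..<bd M} \<rightarrow> cvec M"
  using ext_scl_closed cvecD[OF u] emb_closed bm_closed by auto
 show "(finsum (ext M) (%j. SB.scl (ext M) (u j) (emb M (bm M j))) {..<bd M}) : cvec M"
  using E.finsum_closed[of "%j. SB.scl (ext M) (u j) (emb M (bm M j))" "{..<bd M}"] terms by simp
 fix \<phi> assume p: "\<phi> : \<Phi>"
 show "ph M \<phi> u = ph M \<phi> (finsum (ext M) (%j. SB.scl (ext M) (u j) (emb M (bm M j))) {..<bd M})"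
  unfolding ph_finsum[OF p finite_lessThan terms]
  unfolding ph_def[of M \<phi> u]
  using ph_scl_emb[OF p cvecD[OF u] bm_closed] ph_terms[OF p u] by (intro M.finsum_cong') auto
qed

lemma ext_generated:
 assumes H: "submodule H K (underlying_space AK (ext M))" "!!m. m : carrier M ==> emb M m : H"
  and u: "u : cvec M"
 shows "u : H"
proof -
 have "finsum (underlying_space AK (ext M)) (%j. SB.scl (ext M) (u j) (emb M (bm M j))) {..<bd M} : H"
  by (rule EU.submodule_finsum[OF H(1)])
   (use H cvecD[OF u] bm_closed in "auto simp: EU.submodule_iff")
 then show ?thesis unfolding SB.finsum_underlying using ext_expand_basis[OF u] by simp
qed

lemma ext_fd: "ext M : fd_mod K AK"
proof -
 let ?S = "(%j. emb M (bm M j)) ` {..<bd M}"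
 have S: "?S <= carrier (underlying_space AK (ext M))" using emb_closed bm_closed by auto
 note sm = EU.lin_span_submodule[OF S]
 have "u : lin_span K (underlying_space AK (ext M)) ?S" if u: "u : cvec M" for u
 proof -
  have "finsum (underlying_space AK (ext M)) (%j. SB.scl (ext M) (u j) (emb M (bm M j))) {..<bd M}
    : lin_span K (underlying_space AK (ext M)) ?S"
  proof (rule EU.submodule_finsum[OF sm])
   fix j assume "j : {..<bd M}"
   then have "emb M (bm M j) : lin_span K (underlying_space AK (ext M)) ?S" unfolding lin_span_def by blast
   then show "SB.scl (ext M) (u j) (emb M (bm M j)) : lin_span K (underlying_space AK (ext M)) ?S"
    using sm cvecD[OF u] by (simp add: EU.submodule_iff)
  qed simp
  then show ?thesis unfolding SB.finsum_underlying using ext_expand_basis[OF u] by simp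
 qed
 then have "lin_span K (underlying_space AK (ext M)) ?S = carrier (underlying_space AK (ext M))"
  using EU.submoduleE(1)[OF sm] by auto
 then have "fin_dim K (underlying_space AK (ext M))" unfolding fin_dim_def using S by blast
 then show ?thesis unfolding fd_mod_def using ext_left by simp
qed

text \<open>Finitely many elements of the extension have their coordinates in a finite-dimensional
 subspace of \<open>K\<close>, hence a common expansion in elements of the module.\<close>

lemma ext_expansion:
 assumes S: "finite S" "S <= cvec M"
 shows "EX n ls ps. KM.dual_family n ls ps \<and>
  (ALL u:S. u = (finsum (ext M) (%s. SB.scl (ext M) (ls s) (emb M (ph M (ps s) u))) {..<n}))"
proof -
 let ?X = "(%(u, j). u j) ` (S \<times> {..<bd M})"
 have X: "finite ?X" "?X <= carrier kmod" using S cvecD by auto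
 obtain n ls ps where D: "KM.dual_family n ls ps" and "n <= card ?X"
  and fx: "!!x. x : ?X ==> KM.dual_proj n ls ps x = x"
  and "!!H i. [|submodule H kF kmod; ?X <= H; i < n|] ==> ls i : H"
  by (rule KM.dual_family_exists[OF X]) blast
 have l: "ls s : carrier K" and p: "ps s : \<Phi>" if "s < n" for s
  using KM.dual_familyD(1,2)[OF D that] by simp_all
 have "u = (finsum (ext M) (%s. SB.scl (ext M) (ls s) (emb M (ph M (ps s) u))) {..<n})" if uS: "u : S" for u
 proof (rule cvec_eqI)
  show u: "u : cvec M" using uS S by blast
  have terms: "(%s. SB.scl (ext M) (ls s) (emb M (ph M (ps s) u))) : {..<n} \<rightarrow> cvec M"
   using ext_scl_closed l emb_closed ph_closed[OF p u] by auto
  show "(finsum (ext M) (%s. SB.scl (ext M) (ls s) (emb M (ph M (ps s) u))) {..<n}) : cvec M"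
   using E.finsum_closed[of "%s. SB.scl (ext M) (ls s) (emb M (ph M (ps s) u))" "{..<n}"] terms by simp
  fix \<psi> assume q: "\<psi> : \<Phi>"
  have terms2: "(%s. SA.scl M (\<psi> (ls s)) (ph M (ps s) u)) : {..<n} \<rightarrow> carrier M"
   using SA.scl_closed[OF M_left] Phi_closed[OF q l] ph_closed[OF p u] by auto
  have e: "ph M \<psi> (finsum (ext M) (%s. SB.scl (ext M) (ls s) (emb M (ph M (ps s) u))) {..<n}) =
    (finsum M (%s. SA.scl M (\<psi> (ls s)) (ph M (ps s) u)) {..<n})"
   unfolding ph_finsum[OF q finite_lessThan terms]
   using ph_scl_emb[OF q l ph_closed[OF p u]] terms2 by (intro M.finsum_cong') auto
  show "ph M \<psi> u = ph M \<psi> (finsum (ext M) (%s. SB.scl (ext M) (ls s) (emb M (ph M (ps s) u))) {..<n})"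
   unfolding e
  proof (rule M_eqI[OF ph_closed[OF q u] M.finsum_closed[OF terms2]])
   fix j assume j: "j < bd M"
   have uj: "u j : carrier K" by (rule cvecD[OF u])
   have "u j : ?X" using uS j by (intro image_eqI[of _ _ "(u, j)"]) auto
   then have "\<psi> (u j) = \<psi> (KM.dual_proj n ls ps (u j))" using fx by simp
   also have "... = finsum kF (%s. \<psi> (ps s (u j) \<odot>\<^bsub>kmod\<^esub> ls s)) {..<n}"
    unfolding KM.dual_proj_def by (rule KM.lin_func_finsum[OF q]) (use KM.dual_proj_terms[OF D] uj in auto)
   also have "... = finsum kF (%s. bc M j (SA.scl M (\<psi> (ls s)) (ph M (ps s) u))) {..<n}"
   proof (rule kF_finsum_cong)
    show "(%s. bc M j (SA.scl M (\<psi> (ls s)) (ph M (ps s) u))) : {..<n} \<rightarrow> carrier kF"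
     using terms2 bc_closed[OF j] by (auto simp: Pi_iff)
    fix s assume "s : {..<n}"
    then have s: "s < n" by simp
    have k1: "ps s (u j) : k" "\<psi> (ls s) : k" using Phi_closed p l q uj s by blast+
    then show "\<psi> (ps s (u j) \<odot>\<^bsub>kmod\<^esub> ls s) = bc M j (SA.scl M (\<psi> (ls s)) (ph M (ps s) u))"
     using bc_scl[OF j k1(2) ph_closed[OF p[OF s] u]] bc_ph[OF j p[OF s] u] Phi_smult[OF q k1(1) l[OF s]] kK
     by (simp add: K.m_comm)
   qed simp
   also have "... = bc M j (finsum M (%s. SA.scl M (\<psi> (ls s)) (ph M (ps s) u)) {..<n})"
    by (rule bc_finsum[OF j _ terms2, symmetric]) simp
   finally show "bc M j (ph M \<psi> u) = bc M j (finsum M (%s. SA.scl M (\<psi> (ls s)) (ph M (ps s) u)) {..<n})"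
    using bc_ph[OF j q u] by simp
  qed
 qed
 then show ?thesis using D by blast
qed

lemma ext_hom_eqI:
 assumes W: "left_module AK W" and g: "g : mod_hom AK (ext M) W" "g' : mod_hom AK (ext M) W"
  and e: "!!m. m : carrier M ==> g (emb M m) = g' (emb M m)"
 shows "g = g'"
proof (rule hom_eqI[OF g])
 fix u assume "u : carrier (ext M)"
 then have u: "u : cvec M" by simp
 let ?H = "{u : carrier (ext M). g u = g' u}"
 have "submodule ?H K (underlying_space AK (ext M))" unfolding EU.submodule_iff
  using SB.hom_zero[OF ext_left W g(1)] SB.hom_zero[OF ext_left W g(2)] hom_add[OF g(1)] hom_add[OF g(2)]
   SB.hom_scl[OF ext_left W g(1)] SB.hom_scl[OF ext_left W g(2)] E.zero_closed E.a_closed SB.scl_closed[OF ext_left]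
  by (auto simp del: ext_simps)
 then show "g u = g' u" using ext_generated[of ?H u] e emb_closed u by auto
qed

lemma ext_hom_exists:
 fixes W :: "((('f \<times> 'a) \<Rightarrow>\<^sub>0 int) set, 'w) module"
 assumes W: "left_module AK W" and h: "!!m. m : carrier M ==> h m : carrier W"
  "!!m m'. [|m : carrier M; m' : carrier M|] ==> h (m +_M m') = h m +_W h m'"
  "!!a m. [|a : carrier A; m : carrier M|] ==> h (a \<odot>_M m) = t 1_K a \<odot>_W h m"
 shows "EX g:mod_hom AK (ext M) W. ALL m:carrier M. g (emb M m) = h m"
proof -
 interpret W: left_module AK W by (rule W)
 note sW = SB.scl_closed[OF W]
 define g where "g = (\<lambda>u\<in>cvec M. \<Oplus>\<^bsub>W\<^esub>j\<in>{..<bd M}. SB.scl W (u j) (h (bm M j)))"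
 have terms: "(%j. SB.scl W (u j) (h (bm M j))) : {..<bd M} \<rightarrow> carrier W" if "u : cvec M" for u
  using sW cvecD[OF that] h(1) bm_closed by auto
 have gu: "g u = (finsum W (%j. SB.scl W (u j) (h (bm M j))) {..<bd M})" if "u : cvec M" for u
  unfolding g_def using that by simp
 have gc: "g u : carrier W" if "u : cvec M" for u unfolding gu[OF that] by (rule W.finsum_closed[OF terms[OF that]])
 have ga: "g (%j. u j +_K v j) = g u +_W g v" if "u : cvec M" "v : cvec M" for u v
 proof -
  have "g (%j. u j +_K v j) = (finsum W (%j. SB.scl W (u j) (h (bm M j)) +_W SB.scl W (v j) (h (bm M j))) {..<bd M})"
   unfolding gu[OF cvec_add[OF that]]
   using terms[OF that(1)] terms[OF that(2)] cvecD that h(1) bm_closed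
   by (intro W.finsum_cong') (auto simp: SB.scl_add[OF W])
  then show ?thesis using W.finsum_addf[OF terms[OF that(1)] terms[OF that(2)]] gu that by simp
 qed
 have gs: "g (SB.scl (ext M) x u) = SB.scl W x (g u)" if x: "x : carrier K" and u: "u : cvec M" for x u
 proof -
  have "SB.scl W x (g u) = (finsum W (%j. SB.scl W x (SB.scl W (u j) (h (bm M j)))) {..<bd M})"
   unfolding gu[OF u]
   by (rule additive_finsum[OF W.abelian_group_axioms W.abelian_group_axioms])
    (use x sW terms[OF u] in "auto simp: SB.scl_add_right[OF W]")
  also have "... = (finsum W (%j. SB.scl W (x *_K u j) (h (bm M j))) {..<bd M})"
   using x u cvecD h(1) bm_closed sW by (intro W.finsum_cong') (auto simp: SB.scl_mult[OF W])
  also have "... = g (SB.scl (ext M) x u)" unfolding gu[OF ext_scl_closed[OF x u]] by (simp add: ext_scl[OF x u])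
  finally show ?thesis by simp
 qed
 have hs: "h (SA.scl M c m) = SB.scl W c (h m)" if c: "c : k" and m: "m : carrier M" for c m
 proof -
  have "t 1_K (c \<odot>_A 1_A) = t c 1_A" using t_balanced[of "1_K" c "1_A"] c kK by simp
  then show ?thesis unfolding SA.scl_def t_scl[OF kK[OF c]] using h(3)[OF _ m] A_smult_closed[OF c] by simp
 qed
 have ge: "g (emb M m) = h m" if m: "m : carrier M" for m
 proof -
  have t1: "(%j. SA.scl M (bc M j m) (bm M j)) : {..<bd M} \<rightarrow> carrier M"
   using SA.scl_closed[OF M_left] bc_closed m bm_closed by auto
  have "h m = h (finsum M (%j. SA.scl M (bc M j m) (bm M j)) {..<bd M})" using M_expand[OF m] by simp
  also have "... = (finsum W (%j. h (SA.scl M (bc M j m) (bm M j))) {..<bd M})"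
   by (rule additive_finsum[OF M.abelian_group_axioms W.abelian_group_axioms]) (use h t1 in auto)
  also have "... = g (emb M m)"
   unfolding gu[OF emb_closed[OF m]]
   using hs bc_closed[OF _ m] bm_closed terms[OF emb_closed[OF m]] by (intro W.finsum_cong') (auto simp: emb_def)
  finally show ?thesis by simp
 qed
 have gA: "g (t 1_K a \<odot>\<^bsub>ext M\<^esub> u) = t 1_K a \<odot>_W g u" if a: "a : carrier A" and u: "u : cvec M" for a u
 proof -
  have ta: "t 1_K a : carrier AK" using t_closed a by simp
  have tc: "t 1_K a \<odot>\<^bsub>ext M\<^esub> v : cvec M" if "v : cvec M" for v using E.act_closed[OF ta] that by simp
  let ?H = "{u : cvec M. g (t 1_K a \<odot>\<^bsub>ext M\<^esub> u) = t 1_K a \<odot>_W g u}"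
  have "submodule ?H K (underlying_space AK (ext M))" unfolding EU.submodule_iff
  proof (intro conjI ballI)
   have g0: "g (%j. 0_K) = 0_W"
    using additive_zero[OF E.abelian_group_axioms W.abelian_group_axioms, of g] gc ga by auto
   show "\<zero>\<^bsub>underlying_space AK (ext M)\<^esub> : ?H"
    using g0 E.act_zero[OF ta] W.act_zero[OF ta] cvec_zero by simp
   fix v w assume "v : ?H" "w : ?H"
   then show "v \<oplus>\<^bsub>underlying_space AK (ext M)\<^esub> w : ?H"
    using E.act_r_distr[OF ta, of v w] W.act_r_distr[OF ta, of "g v" "g w"] tc gc cvec_add[of v w] by (simp add: ga)
  next
   fix x v assume "x : carrier K" "v : ?H"
   then show "x \<odot>\<^bsub>underlying_space AK (ext M)\<^esub> v : ?H"
    using SB.scl_act[OF ext_left _ ta, of x v] SB.scl_act[OF W _ ta, of x "g v"] tc gc ext_scl_closed[of x v]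
    by (simp add: gs) (metis gs)
  qed auto
  then show ?thesis using ext_generated[of ?H u] emb_closed ge h(3)[OF a] emb_act[OF a, symmetric] M.act_closed[OF a] u
   by auto
 qed
 have "g : mod_hom AK (ext M) W"
  by (rule AK_homI[OF ext_left W]) (use gc ga gs gA g_def in auto)
 then show ?thesis using ge by blast
qed

lemma ext_dual_basis:
 "EU.dual_family (bd M) (%j. emb M (bm M j)) (%j u. u j)"
 "u : cvec M ==> EU.dual_proj (bd M) (%j. emb M (bm M j)) (%j u. u j) u = u"
proof -
 show "EU.dual_family (bd M) (%j. emb M (bm M j)) (%j u. u j)"
  unfolding EU.dual_family_def
 proof (intro conjI allI impI)
  fix i assume i: "i < bd M"
  show "emb M (bm M i) : carrier (underlying_space AK (ext M))" using emb_closed[OF bm_closed[OF i]] by simp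
  show "(%u. u i) : lin_func K (underlying_space AK (ext M))"
   by (rule lin_funcI) (auto simp: cvecD ext_scl)
  fix j assume j: "j < bd M"
  show "emb M (bm M j) i = (if i = j then 1_K else 0_K)" using i j bc_bm by (simp add: emb_def)
 qed
 show "u : cvec M ==> EU.dual_proj (bd M) (%j. emb M (bm M j)) (%j u. u j) u = u"
  unfolding EU.dual_proj_def SB.finsum_underlying using ext_expand_basis by simp
qed

end

end

section \<open>The Frobenius map\<close>

lemma (in abelian_group) add_eq_right_imp_zero:
 assumes "a : carrier G" "b : carrier G" "a \<oplus> b = b"
 shows "a = \<zero>"
proof -
 have "a = (a \<oplus> b) \<oplus> (\<ominus> b)" using assms(1,2) by (simp add: a_assoc r_neg)
 also have "... = \<zero>" unfolding assms(3) by (rule r_neg[OF assms(2)])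
 finally show ?thesis .
qed

lemma (in ring) binomial_commuting:
 assumes a: "a : carrier R" and b: "b : carrier R" and ab: "a \<otimes> b = b \<otimes> a"
 shows "(a \<oplus> b) [^] n = (\<Oplus>i\<in>{..n}. [(n choose i)] \<cdot> (a [^] i \<otimes> b [^] (n - i)))"
proof (induction n)
 case 0
 then show ?case using a b by (simp add: add.nat_pow_eone)
next
 case (Suc n)
 define f where "f i = [(n choose i)] \<cdot> (a [^] i \<otimes> b [^] (n - i))" for i
 define h where "h i = [(n choose i)] \<cdot> (a [^] i \<otimes> b [^] (Suc n - i))" for i
 define g where "g i = [(n choose i)] \<cdot> (a [^] Suc i \<otimes> b [^] (n - i))" for i
 have c: "f i : carrier R" "h i : carrier R" "g i : carrier R" for i unfolding f_def h_def g_def using a b by auto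
 have bpa: "b [^] (j::nat) \<otimes> a = a \<otimes> b [^] j" for j
  using a b ab by (induction j) (simp_all add: m_assoc, metis m_assoc nat_pow_closed)
 have fa: "f i \<otimes> a = g i" for i
 proof -
  have "a [^] i \<otimes> b [^] (n - i) \<otimes> a = a [^] Suc i \<otimes> b [^] (n - i)"
   using a b bpa[of "n - i"] by (simp add: m_assoc)
  then show ?thesis unfolding f_def g_def using a b by (simp add: add_pow_ldistr)
 qed
 have fb: "f i \<otimes> b = h i" if "i <= n" for i
 proof -
  have "a [^] i \<otimes> b [^] (n - i) \<otimes> b = a [^] i \<otimes> b [^] (Suc n - i)"
   using a b that by (simp add: m_assoc Suc_diff_le)
  then show ?thesis unfolding f_def h_def using a b by (simp add: add_pow_ldistr)
 qed
 have "(a \<oplus> b) [^] Suc n = (\<Oplus>i\<in>{..n}. f i) \<otimes> (a \<oplus> b)" using Suc.IH unfolding f_def by simp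
 also have "... = (\<Oplus>i\<in>{..n}. f i) \<otimes> a \<oplus> (\<Oplus>i\<in>{..n}. f i) \<otimes> b"
  using a b c by (simp add: r_distr)
 also have "(\<Oplus>i\<in>{..n}. f i) \<otimes> a = (\<Oplus>i\<in>{..n}. g i)"
  using finsum_ldistr[of "{..n}" a f] a c fa by simp
 also have "(\<Oplus>i\<in>{..n}. f i) \<otimes> b = (\<Oplus>i\<in>{..n}. h i)"
 proof -
  have "(\<Oplus>i\<in>{..n}. f i) \<otimes> b = (\<Oplus>i\<in>{..n}. f i \<otimes> b)" using finsum_ldistr[of "{..n}" b f] b c by simp
  also have "... = (\<Oplus>i\<in>{..n}. h i)" using fb c by (intro finsum_cong') auto
  finally show ?thesis .
 qed
 also have "(\<Oplus>i\<in>{..n}. h i) = (\<Oplus>i\<in>{..Suc n}. h i)"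
 proof -
  have "h (Suc n) = \<zero>" unfolding h_def by (simp add: binomial_eq_0)
  then show ?thesis using finsum_Suc[of h n] c by simp
 qed
 also have "... = (\<Oplus>i\<in>{..n}. h (Suc i)) \<oplus> h 0" by (rule finsum_Suc2) (use c in auto)
 also have "(\<Oplus>i\<in>{..n}. g i) \<oplus> ((\<Oplus>i\<in>{..n}. h (Suc i)) \<oplus> h 0) = (\<Oplus>i\<in>{..n}. g i \<oplus> h (Suc i)) \<oplus> h 0"
  using finsum_addf[of g "{..n}" "%i. h (Suc i)"] c by (simp add: a_assoc)
 also have "(\<Oplus>i\<in>{..n}. g i \<oplus> h (Suc i)) = (\<Oplus>i\<in>{..n}. [(Suc n choose Suc i)] \<cdot> (a [^] Suc i \<otimes> b [^] (Suc n - Suc i)))"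
  using a b unfolding g_def h_def by (intro finsum_cong') (auto simp: add.nat_pow_mult)
 also have "h 0 = [(Suc n choose 0)] \<cdot> (a [^] (0::nat) \<otimes> b [^] (Suc n - 0))" unfolding h_def by simp
 also have "(\<Oplus>i\<in>{..n}. [(Suc n choose Suc i)] \<cdot> (a [^] Suc i \<otimes> b [^] (Suc n - Suc i))) \<oplus>
   [(Suc n choose 0)] \<cdot> (a [^] (0::nat) \<otimes> b [^] (Suc n - 0)) =
   (\<Oplus>i\<in>{..Suc n}. [(Suc n choose i)] \<cdot> (a [^] i \<otimes> b [^] (Suc n - i)))"
  by (rule finsum_Suc2[symmetric]) (use a b in auto)
 finally show ?case .
qed

lemma (in ring) char_annihilates:
 assumes "[p] \<cdot> \<one> = \<zero>" "p dvd q" "x : carrier R"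
 shows "[(q::nat)] \<cdot> x = \<zero>"
proof -
 obtain r where r: "q = p * r" using assms(2) by blast
 have "[p] \<cdot> y = \<zero>" if "y : carrier R" for y
  using add_pow_ldistr[of \<one> y p] assms(1) that by simp
 then show ?thesis using r assms(3) add.nat_pow_pow[of x r p] by (simp add: mult.commute)
qed

lemma (in ring) frobenius_add:
 assumes p: "Factorial_Ring.prime (p::nat)" "[p] \<cdot> \<one> = \<zero>"
  and a: "a : carrier R" and b: "b : carrier R" and ab: "a \<otimes> b = b \<otimes> a"
 shows "(a \<oplus> b) [^] p = a [^] p \<oplus> b [^] p"
proof -
 let ?f = "%i. [(p choose i)] \<cdot> (a [^] i \<otimes> b [^] (p - i))"
 have p1: "p > 1" using p(1) prime_gt_1_nat by blast
 have set: "{..p} = insert 0 (insert p {1..<p})" using p1 by auto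
 have z: "?f i = \<zero>" if i: "i : {1..<p}" for i
 proof -
  have "p dvd p choose i" using i p(1) by (intro dvd_choose_prime) auto
  then show ?thesis using char_annihilates[OF p(2)] a b by simp
 qed
 have "(a \<oplus> b) [^] p = finsum R ?f (insert 0 (insert p {1..<p}))"
  using binomial_commuting[OF a b ab, of p] unfolding set .
 also have "... = ?f 0 \<oplus> (?f p \<oplus> finsum R ?f {1..<p})"
  using p1 a b by (subst finsum_insert, simp, simp, simp, simp, subst finsum_insert) auto
 also have "finsum R ?f {1..<p} = finsum R (%_. \<zero>) {1..<p}" using z by (intro finsum_cong') auto
 also have "?f 0 = b [^] p" using b by (simp add: add.nat_pow_eone)
 also have "?f p = a [^] p" using a by (simp add: add.nat_pow_eone)
 finally show ?thesis using a b by (simp add: finsum_zero a_comm)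
qed

lemma (in ring) frobenius_finsum:
 assumes p: "Factorial_Ring.prime (p::nat)" "[p] \<cdot> \<one> = \<zero>" and I: "finite I"
  and f: "!!i. i : I ==> f i : carrier R"
  and comm: "!!i j. [|i : I; j : I|] ==> f i \<otimes> f j = f j \<otimes> f i"
 shows "(\<Oplus>i\<in>I. f i) [^] p = (\<Oplus>i\<in>I. f i [^] p)"
 using I f comm
proof (induction I rule: finite_induct)
 case empty
 have "p > 0" using p(1) prime_gt_0_nat by blast
 then show ?case by (simp add: nat_pow_zero)
next
 case (insert i I)
 have fI: "f : I \<rightarrow> carrier R" "f i : carrier R" using insert.prems by auto
 have "f i \<otimes> (\<Oplus>j\<in>I. f j) = (\<Oplus>j\<in>I. f j) \<otimes> f i"
 proof -
  have "f i \<otimes> (\<Oplus>j\<in>I. f j) = (\<Oplus>j\<in>I. f i \<otimes> f j)" by (rule finsum_rdistr) (use insert fI in auto)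
  also have "... = (\<Oplus>j\<in>I. f j \<otimes> f i)" using insert fI by (intro finsum_cong') auto
  also have "... = (\<Oplus>j\<in>I. f j) \<otimes> f i" by (rule finsum_ldistr[symmetric]) (use insert fI in auto)
  finally show ?thesis .
 qed
 then have "(f i \<oplus> (\<Oplus>j\<in>I. f j)) [^] p = f i [^] p \<oplus> (\<Oplus>j\<in>I. f j) [^] p"
  using frobenius_add[OF p fI(2) finsum_closed[OF fI(1)]] by simp
 moreover have "(\<Oplus>j\<in>I. f j) [^] p = (\<Oplus>j\<in>I. f j [^] p)" using insert by auto
 ultimately show ?case using insert.hyps fI by (simp add: Pi_iff)
qed

context scalar_ext
begin

lemma k_pow: "c : k ==> c [^]\<^bsub>K\<^esub> (n::nat) : k"
 by (induction n) (use subringE(6)[OF subfieldE(1)[OF k_subfield]] k_one in auto)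

text \<open>The index set is any finite set of numbers, so that terms can be dropped from an expansion.\<close>

definition dual_on :: "nat set => (nat => 'f) => (nat => 'f => 'f) => bool" where
 "dual_on I l q \<longleftrightarrow> finite I \<and> (ALL i:I. l i : carrier K \<and> q i : \<Phi>) \<and>
  (ALL i:I. ALL j:I. q i (l j) = (if i = j then 1_K else 0_K))"

lemma K_frobenius_add:
 assumes p: "Factorial_Ring.prime (p::nat)" "[p] \<cdot>\<^bsub>K\<^esub> 1_K = 0_K" and xy: "x : carrier K" "y : carrier K"
 shows "(x +_K y) [^]\<^bsub>K\<^esub> p = x [^]\<^bsub>K\<^esub> p +_K y [^]\<^bsub>K\<^esub> p"
 by (rule K.frobenius_add[OF p xy K.m_comm[OF xy]])

lemma K_reduced: "[|w : carrier K; w [^]\<^bsub>K\<^esub> (n::nat) = 0_K|] ==> w = 0_K"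
proof (induction n)
 case 0
 then show ?case using K.one_not_zero by simp
next
 case (Suc n)
 then show ?case using K.integral[of "w [^]\<^bsub>K\<^esub> n" w] by auto
qed

lemma K_frobenius_inj:
 assumes p: "Factorial_Ring.prime (p::nat)" "[p] \<cdot>\<^bsub>K\<^esub> 1_K = 0_K" and xy: "x : carrier K" "y : carrier K"
  and e: "x [^]\<^bsub>K\<^esub> p = y [^]\<^bsub>K\<^esub> p"
 shows "x = y"
proof -
 have d: "x -_K y : carrier K" using xy by simp
 have "(x -_K y) +_K y = x" using xy by (simp add: K.minus_eq K.a_assoc K.l_neg)
 then have "(x -_K y) [^]\<^bsub>K\<^esub> p +_K y [^]\<^bsub>K\<^esub> p = y [^]\<^bsub>K\<^esub> p"
  using K_frobenius_add[OF p d xy(2)] e by simp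
 then have "(x -_K y) [^]\<^bsub>K\<^esub> p = 0_K"
  by (rule K.add_eq_right_imp_zero[OF K.nat_pow_closed[OF d] K.nat_pow_closed[OF xy(2)]])
 then have "x -_K y = 0_K" by (rule K_reduced[OF d])
 then show ?thesis unfolding K.a_minus_eq_zero_iff[OF xy] .
qed

text \<open>Over a perfect field, Frobenius carries dual families to dual families: a functional is
 replaced by its conjugate under the Frobenius automorphism, which preserves the base field.\<close>

lemma dual_on_frobenius:
 assumes p: "Factorial_Ring.prime (p::nat)" "[p] \<cdot>\<^bsub>K\<^esub> 1_K = 0_K"
  and rk: "!!c. c : k ==> EX d:k. d [^]\<^bsub>K\<^esub> p = c"
  and rK: "!!x. x : carrier K ==> EX y:carrier K. y [^]\<^bsub>K\<^esub> p = x"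
  and D: "dual_on I l q"
 shows "EX q'. dual_on I (%i. l i [^]\<^bsub>K\<^esub> p) q'"
proof -
 have p0: "p > 0" using p(1) prime_gt_0_nat by blast
 obtain rt where rtc: "!!x. x : carrier K ==> rt x : carrier K"
  and rtp: "!!x. x : carrier K ==> rt x [^]\<^bsub>K\<^esub> p = x" using rK by metis
 have rt_eq: "rt x = y" if "x : carrier K" "y : carrier K" "y [^]\<^bsub>K\<^esub> p = x" for x y
  by (rule K_frobenius_inj[OF p rtc[OF that(1)] that(2)]) (simp only: rtp[OF that(1)] that(3))
 have rt_add: "rt (x +_K y) = rt x +_K rt y" if "x : carrier K" "y : carrier K" for x y
  by (rule rt_eq[OF K.a_closed[OF that] K.a_closed[OF rtc rtc]])
   (simp_all only: that K_frobenius_add[OF p rtc rtc] rtp)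
 have rt_mult: "rt (x *_K y) = rt x *_K rt y" if "x : carrier K" "y : carrier K" for x y
  by (rule rt_eq[OF K.m_closed[OF that] K.m_closed[OF rtc rtc]])
   (simp_all only: that K.nat_pow_distrib rtc rtp)
 have rt_k: "rt c : k" if c: "c : k" for c
 proof -
  obtain d where d: "d : k" "d [^]\<^bsub>K\<^esub> p = c" using rk[OF c] by blast
  show ?thesis unfolding rt_eq[OF kK[OF c] kK[OF d(1)] d(2)] by (rule d(1))
 qed
 define q' where "q' i x = q i (rt x) [^]\<^bsub>K\<^esub> p" for i x
 have qi: "q i : \<Phi>" and li: "l i : carrier K" if "i : I" for i using D that unfolding dual_on_def by simp_all
 have "q' i : \<Phi>" if i: "i : I" for i
 proof (rule lin_funcI)
  note qc = Phi_closed_K[OF qi[OF i]]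
  show "q' i x : carrier kF" if "x : carrier kmod" for x
   unfolding q'_def using k_pow[OF Phi_closed[OF qi[OF i] rtc[of x]]] that by simp
  show "q' i (x \<oplus>\<^bsub>kmod\<^esub> y) = q' i x \<oplus>\<^bsub>kF\<^esub> q' i y" if "x : carrier kmod" "y : carrier kmod" for x y
  proof -
   have xy: "x : carrier K" "y : carrier K" using that by simp_all
   show ?thesis unfolding q'_def
    using rt_add[OF xy] Phi_add[OF qi[OF i] rtc[OF xy(1)] rtc[OF xy(2)]]
     K_frobenius_add[OF p qc[OF rtc[OF xy(1)]] qc[OF rtc[OF xy(2)]]] by simp
  qed
  show "q' i (c \<odot>\<^bsub>kmod\<^esub> x) = c \<otimes>\<^bsub>kF\<^esub> q' i x" if "c : carrier kF" "x : carrier kmod" for c x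
  proof -
   have cx: "c : k" "c : carrier K" "x : carrier K" using that kK by simp_all
   show ?thesis unfolding q'_def
    using rt_mult[OF cx(2,3)] Phi_smult[OF qi[OF i] rt_k[OF cx(1)] rtc[OF cx(3)]]
     K.nat_pow_distrib[OF rtc[OF cx(2)] qc[OF rtc[OF cx(3)]], of p] rtp[OF cx(2)] by simp
  qed
 qed
 moreover have "q' i (l j [^]\<^bsub>K\<^esub> p) = (if i = j then 1_K else 0_K)" if ij: "i : I" "j : I" for i j
 proof -
  have qq: "q i (l j) = (if i = j then 1_K else 0_K)" using D ij unfolding dual_on_def by blast
  have "rt (l j [^]\<^bsub>K\<^esub> p) = l j" by (rule rt_eq[OF K.nat_pow_closed[OF li[OF ij(2)]] li[OF ij(2)] refl])
  then show ?thesis unfolding q'_def using qq p0 by (simp add: K.nat_pow_zero)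
 qed
 moreover have "finite I" using D unfolding dual_on_def by blast
 ultimately show ?thesis using K.nat_pow_closed[OF li] unfolding dual_on_def by (intro exI[of _ q']) simp
qed

end

text \<open>A ring \<open>S\<close> obtained from \<open>R\<close> by scalar extension, described by the two structure maps
 \<open>F\<close> and \<open>L\<close> and by the coefficient maps \<open>cm \<phi>\<close> induced by functionals \<open>\<phi>\<close> on \<open>K\<close>.\<close>

locale ring_ext = scalar_ext K k A + R: ring R + S: ring S
 for K :: "'f ring" and k and A :: "('f, 'a) module" and R :: "('r, 'x) ring_scheme" and S :: "('s, 'y) ring_scheme" +
 fixes F :: "'r => 's" and L :: "'f => 's" and cm :: "('f => 'f) => 's => 'r"
 assumes F_closed: "r : carrier R ==> F r : carrier S"
  and F_add: "[|r : carrier R; r' : carrier R|] ==> F (r +_R r') = F r +_S F r'"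
  and F_mult: "[|r : carrier R; r' : carrier R|] ==> F (r *_R r') = F r *_S F r'"
  and F_one: "F 1_R = 1_S"
  and L_closed: "x : carrier K ==> L x : carrier S"
  and L_mult: "[|x : carrier K; y : carrier K|] ==> L (x *_K y) = L x *_S L y"
  and L_one: "L 1_K = 1_S"
  and L_add: "[|x : carrier K; y : carrier K|] ==> L (x +_K y) = L x +_S L y"
  and L_central: "[|x : carrier K; s : carrier S|] ==> L x *_S s = s *_S L x"
  and cm_closed: "[|\<phi> : \<Phi>; s : carrier S|] ==> cm \<phi> s : carrier R"
  and cm_add: "[|\<phi> : \<Phi>; s : carrier S; s' : carrier S|] ==> cm \<phi> (s +_S s') = cm \<phi> s +_R cm \<phi> s'"
  and cm_right: "[|\<phi> : \<Phi>; r : carrier R; s : carrier S|] ==> cm \<phi> (s *_S F r) = cm \<phi> s *_R r"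
  and cm_L: "[|\<phi> : \<Phi>; x : carrier K; s : carrier S|] ==> cm \<phi> (L x *_S s) = cm (%y. \<phi> (x *_K y)) s"
  and cm_one: "[|\<phi> : \<Phi>; x : carrier K; \<phi> x = 1_K|] ==> cm \<phi> (L x) = 1_R"
  and cm_zero: "[|\<phi> : \<Phi>; x : carrier K; \<phi> x = 0_K|] ==> cm \<phi> (L x) = 0_R"
  and expand: "s : carrier S ==> EX I l q. dual_on I l q \<and> s = (finsum S (%i. L (l i) *_S F (cm (q i) s)) I)"
begin

lemma LF_closed: "[|x : carrier K; r : carrier R|] ==> L x *_S F r : carrier S"
 using L_closed F_closed by simp

lemma cm_LF_one: "[|\<phi> : \<Phi>; x : carrier K; r : carrier R; \<phi> x = 1_K|] ==> cm \<phi> (L x *_S F r) = r"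
 by (simp add: cm_right cm_one L_closed)

lemma cm_LF_zero: "[|\<phi> : \<Phi>; x : carrier K; r : carrier R; \<phi> x = 0_K|] ==> cm \<phi> (L x *_S F r) = 0_R"
 by (simp add: cm_right cm_zero L_closed)

lemma cm_finsum: "[|\<phi> : \<Phi>; finite I; f : I \<rightarrow> carrier S|] ==> cm \<phi> (finsum S f I) = finsum R (%i. cm \<phi> (f i)) I"
 by (rule additive_finsum[OF S.abelian_group_axioms R.abelian_group_axioms]) (auto simp: cm_closed cm_add)

lemma cm_S_zero: "\<phi> : \<Phi> ==> cm \<phi> 0_S = 0_R"
 by (rule additive_zero[OF S.abelian_group_axioms R.abelian_group_axioms]) (auto simp: cm_closed cm_add)

lemma cm_minus: "[|\<phi> : \<Phi>; s : carrier S; s' : carrier S|] ==> cm \<phi> (s -_S s') = cm \<phi> s -_R cm \<phi> s'"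
proof -
 assume a: "\<phi> : \<Phi>" "s : carrier S" "s' : carrier S"
 have "cm \<phi> (s -_S s') +_R cm \<phi> s' = cm \<phi> s"
  using cm_add[OF a(1), of "s -_S s'" s'] a by (simp add: S.minus_eq S.a_assoc S.l_neg)
 then show ?thesis using a cm_closed by (metis R.add.inv_solve_right R.minus_eq S.minus_closed)
qed

lemma cm_dual_sum:
 assumes D: "dual_on I l q" and r: "!!i. i : I ==> r i : carrier R" and j: "j : I"
 shows "cm (q j) (finsum S (%i. L (l i) *_S F (r i)) I) = r j"
proof -
 have D': "finite I" "!!i. i : I ==> l i : carrier K" "!!i. i : I ==> q i : \<Phi>"
  "!!i. i : I ==> q j (l i) = (if j = i then 1_K else 0_K)"
  using D j unfolding dual_on_def by auto
 have "cm (q j) (finsum S (%i. L (l i) *_S F (r i)) I) = finsum R (%i. cm (q j) (L (l i) *_S F (r i))) I"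
  by (rule cm_finsum[OF D'(3)[OF j] D'(1)]) (use LF_closed D' r in auto)
 also have "... = finsum R (%i. if j = i then r i else 0_R) I"
  using r D' j by (intro R.finsum_cong') (auto simp: cm_LF_one cm_LF_zero)
 also have "... = r j" using R.finsum_singleton[of j I r] j D'(1) r by auto
 finally show ?thesis .
qed

text \<open>In terms of tensor products, the ideal \<open>J \<otimes> K\<close>.\<close>

definition coeff_ideal :: "'r set => 's set" where
 "coeff_ideal J = {s : carrier S. ALL \<phi>:\<Phi>. cm \<phi> s : J}"

lemma coeff_ideal_ideal:
 assumes J: "ideal J R"
 shows "ideal (coeff_ideal J) S"
proof -
 interpret J: ideal J R by fact
 have neg: "cm \<phi> (-_S s) = -_R cm \<phi> s" if "\<phi> : \<Phi>" "s : carrier S" for \<phi> s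
  using cm_minus[OF that(1) S.zero_closed that(2)] cm_S_zero[OF that(1)] cm_closed[OF that] that
  by (simp add: S.minus_eq R.minus_eq)
 have fs: "finsum R f I : J" if "finite I" "!!i. i : I ==> f i : J" for f :: "nat => 'r" and I
  using that
 proof (induction I rule: finite_induct)
  case (insert i I)
  then have "f : I \<rightarrow> carrier R" "f i : carrier R" using J.a_subset by auto
  then show ?case using insert J.a_closed by simp
 qed simp
 have mem: "x *_S y : coeff_ideal J" if x: "x : carrier S" and y: "y : carrier S"
  and xy: "x : coeff_ideal J \<or> y : coeff_ideal J" for x y
 proof -
  have "cm \<phi> (x *_S y) : J" if p: "\<phi> : \<Phi>" for \<phi>
  proof -
   obtain I l q where D: "dual_on I l q" and e: "y = (finsum S (%i. L (l i) *_S F (cm (q i) y)) I)"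
    using expand[OF y] by blast
   have D': "finite I" "!!i. i : I ==> l i : carrier K" "!!i. i : I ==> q i : \<Phi>"
    using D unfolding dual_on_def by auto
   have tc: "L (l i) *_S F (cm (q i) y) : carrier S" if "i : I" for i
    using LF_closed D' cm_closed y that by simp
   have "x *_S y = (finsum S (%i. x *_S (L (l i) *_S F (cm (q i) y))) I)"
    by (subst e, rule S.finsum_rdistr) (use D' tc x in auto)
   then have "cm \<phi> (x *_S y) = finsum R (%i. cm \<phi> (x *_S (L (l i) *_S F (cm (q i) y)))) I"
    using cm_finsum[OF p D'(1)] x tc by simp
   also have "... : J"
   proof (rule fs[OF D'(1)])
    fix i assume i: "i : I"
    note c = L_closed[OF D'(2)[OF i]] F_closed[OF cm_closed[OF D'(3)[OF i] y]] cm_closed[OF D'(3)[OF i] y]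
    have "x *_S (L (l i) *_S F (cm (q i) y)) = (L (l i) *_S x) *_S F (cm (q i) y)"
     using x c L_central[OF D'(2)[OF i] x] by (simp add: S.m_assoc[symmetric])
    then have e2: "cm \<phi> (x *_S (L (l i) *_S F (cm (q i) y))) = cm (%z. \<phi> (l i *_K z)) x *_R cm (q i) y"
     using cm_right[OF p c(3)] cm_L[OF p D'(2)[OF i] x] x c by simp
    note ps = Phi_shift[OF p D'(2)[OF i]]
    show "cm \<phi> (x *_S (L (l i) *_S F (cm (q i) y))) : J"
     unfolding e2 using xy J.I_l_closed[OF _ cm_closed[OF ps x], of "cm (q i) y"] J.I_r_closed[OF _ c(3), of "cm (%z. \<phi> (l i *_K z)) x"]
      ps D'(3)[OF i] unfolding coeff_ideal_def by blast
   qed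
   finally show ?thesis .
  qed
  then show ?thesis unfolding coeff_ideal_def using x y by simp
 qed
 show ?thesis
 proof (rule idealI[OF S.ring_axioms])
  show "subgroup (coeff_ideal J) (add_monoid S)"
  proof (rule group.subgroupI[OF S.a_group])
   show "coeff_ideal J <= carrier (add_monoid S)" unfolding coeff_ideal_def by auto
   show "coeff_ideal J ~= {}" using cm_S_zero unfolding coeff_ideal_def by auto
   show "inv\<^bsub>add_monoid S\<^esub> s : coeff_ideal J" if "s : coeff_ideal J" for s
    using that neg J.a_inv_closed unfolding coeff_ideal_def a_inv_def[symmetric] by auto
   show "s \<otimes>\<^bsub>add_monoid S\<^esub> s' : coeff_ideal J" if "s : coeff_ideal J" "s' : coeff_ideal J" for s s'
    using that cm_add J.a_closed unfolding coeff_ideal_def by auto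
  qed
  fix a x assume "a : coeff_ideal J" "x : carrier S"
  then show "x *_S a : coeff_ideal J" "a *_S x : coeff_ideal J"
   using mem unfolding coeff_ideal_def by blast+
 qed
qed

end

context ring_ext
begin

lemma hom_pow:
 assumes "ring_hom_ring S Q h" "x : carrier S"
 shows "h (x [^]\<^bsub>S\<^esub> (n::nat)) = h x [^]\<^bsub>Q\<^esub> n"
proof -
 interpret h: ring_hom_ring S Q h by fact
 show ?thesis by (induction n) (use assms(2) in auto)
qed

lemma LF_pow:
 assumes x: "x : carrier K" and r: "r : carrier R"
 shows "(L x *_S F r) [^]\<^bsub>S\<^esub> (n::nat) = L (x [^]\<^bsub>K\<^esub> n) *_S F (r [^]\<^bsub>R\<^esub> n)"
proof -
 have L: "L (x [^]\<^bsub>K\<^esub> n) = L x [^]\<^bsub>S\<^esub> n"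
  by (induction n) (use x in "auto simp: L_one L_mult")
 have F: "F (r [^]\<^bsub>R\<^esub> n) = F r [^]\<^bsub>S\<^esub> n"
  by (induction n) (use r in "auto simp: F_one F_mult")
 show ?thesis unfolding L F
  by (rule S.pow_mult_distrib[OF L_central[OF x F_closed[OF r]] L_closed[OF x] F_closed[OF r]])
qed

lemma char_S:
 assumes "[(p::nat)] \<cdot>\<^bsub>K\<^esub> 1_K = 0_K"
 shows "[p] \<cdot>\<^bsub>S\<^esub> 1_S = 0_S"
proof -
 have z: "L 0_K = 0_S"
  by (rule additive_zero[OF K.abelian_group_axioms S.abelian_group_axioms]) (auto simp: L_closed L_add)
 have "L ([n] \<cdot>\<^bsub>K\<^esub> 1_K) = [n] \<cdot>\<^bsub>S\<^esub> 1_S" for n :: nat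
  by (induction n) (simp_all add: z L_one L_add)
 from this[of p] show ?thesis unfolding assms z by simp
qed

text \<open>Modulo the extension of \<open>J\<close>, an element with commuting coefficients is raised to the
 power \<open>p\<close> term by term; a coefficient 1 therefore survives every iterated \<open>p\<close>-th power, so that
 the element is not nilpotent.\<close>

lemma frobenius_tower:
 assumes J: "ideal J R" "1_R \<notin> J"
  and h: "ring_hom_ring S Q h" and ker: "!!s. s : carrier S ==> h s = 0_Q \<longleftrightarrow> s : coeff_ideal J"
  and p: "Factorial_Ring.prime (p::nat)" "[p] \<cdot>\<^bsub>K\<^esub> 1_K = 0_K"
  and rk: "!!c. c : k ==> EX d:k. d [^]\<^bsub>K\<^esub> p = c"
  and rK: "!!x. x : carrier K ==> EX y:carrier K. y [^]\<^bsub>K\<^esub> p = x"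
  and D: "dual_on I l q" and j0: "j0 : I" "w j0 = 1_R"
  and w: "!!i. i : I ==> w i : carrier R"
  and comm: "!!i j. [|i : I; j : I|] ==> h (F (w i)) *_Q h (F (w j)) = h (F (w j)) *_Q h (F (w i))"
  and x: "x : carrier S" "h x = finsum Q (%i. h (L (l i) *_S F (w i))) I"
 shows "h (x [^]\<^bsub>S\<^esub> (p ^ m)) ~= 0_Q"
 using D j0 w comm x
proof (induction m arbitrary: x l q w)
 interpret h: ring_hom_ring S Q h by fact
 case 0
 define y where "y = (finsum S (%i. L (l i) *_S F (w i)) I)"
 have fin: "finite I" and li: "!!i. i : I ==> l i : carrier K" and qj: "q j0 : \<Phi>"
  using 0(1,2) unfolding dual_on_def by auto
 have c: "(%i. L (l i) *_S F (w i)) : I \<rightarrow> carrier S" using LF_closed li 0(4) by blast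
 have y: "y : carrier S" unfolding y_def by (rule S.finsum_closed[OF c])
 have "h y = finsum Q (%i. h (L (l i) *_S F (w i))) I" unfolding y_def
  by (rule additive_finsum[OF S.abelian_group_axioms h.S.abelian_group_axioms _ _ fin c]) auto
 then have hy: "h y = h x" using 0(7) by simp
 have "cm (q j0) y = 1_R" unfolding y_def using cm_dual_sum[OF 0(1,4) 0(2)] 0(3) by simp
 then have "y \<notin> coeff_ideal J" using J(2) qj unfolding coeff_ideal_def by fastforce
 then have "h x ~= 0_Q" using ker[OF y] hy by simp
 then show ?case using 0(6) by (simp add: S.nat_pow_eone)
next
 interpret h: ring_hom_ring S Q h by fact
 case (Suc m)
 note D = Suc.prems(1) and j0 = Suc.prems(2,3) and w = Suc.prems(4) and comm = Suc.prems(5) and x = Suc.prems(6,7)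
 have fin: "finite I" and li: "!!i. i : I ==> l i : carrier K"
  using D unfolding dual_on_def by auto
 have Fw: "i : I ==> F (w i) : carrier S" and Ll: "i : I ==> L (l i) : carrier S" for i
  using F_closed[OF w] L_closed[OF li] by auto
 obtain q' where D': "dual_on I (%i. l i [^]\<^bsub>K\<^esub> p) q'" using dual_on_frobenius[OF p rk rK D] by blast
 have pQ: "[p] \<cdot>\<^bsub>Q\<^esub> 1_Q = 0_Q"
 proof -
  have "h ([n] \<cdot>\<^bsub>S\<^esub> 1_S) = [n] \<cdot>\<^bsub>Q\<^esub> 1_Q" for n :: nat by (induction n) simp_all
  from this[of p] show ?thesis unfolding char_S[OF p(2)] by simp
 qed
 let ?f = "%i. h (L (l i) *_S F (w i))"
 have fc: "?f i *_Q ?f j = ?f j *_Q ?f i" if i: "i : I" and j: "j : I" for i j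
 proof -
  have ex: "?f a *_Q ?f b = h (L (l a) *_S L (l b)) *_Q (h (F (w a)) *_Q h (F (w b)))" if a: "a : I" and b: "b : I" for a b
  proof -
   have "(L (l a) *_S F (w a)) *_S (L (l b) *_S F (w b)) = L (l a) *_S ((F (w a) *_S L (l b)) *_S F (w b))"
    using Fw[OF a] Fw[OF b] Ll[OF a] Ll[OF b] by (simp add: S.m_assoc)
   also have "... = (L (l a) *_S L (l b)) *_S (F (w a) *_S F (w b))"
    unfolding L_central[OF li[OF b] Fw[OF a], symmetric] using Fw[OF a] Fw[OF b] Ll[OF a] Ll[OF b] by (simp add: S.m_assoc)
   finally show ?thesis using Fw[OF a] Fw[OF b] Ll[OF a] Ll[OF b] by (simp flip: h.hom_mult)
  qed
  show ?thesis unfolding ex[OF i j] ex[OF j i] comm[OF i j] L_central[OF li[OF i] Ll[OF j]] ..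
 qed
 have "h (x [^]\<^bsub>S\<^esub> p) = finsum Q (%i. ?f i [^]\<^bsub>Q\<^esub> p) I"
  unfolding hom_pow[OF h x(1)] x(2)
  by (rule h.S.frobenius_finsum[OF p(1) pQ fin _ fc]) (use Fw Ll in auto)
 also have "... = finsum Q (%i. h (L (l i [^]\<^bsub>K\<^esub> p) *_S F (w i [^]\<^bsub>R\<^esub> p))) I"
 proof (rule h.S.finsum_cong'[OF refl])
  show "(%i. h (L (l i [^]\<^bsub>K\<^esub> p) *_S F (w i [^]\<^bsub>R\<^esub> p))) : I \<rightarrow> carrier Q"
   using LF_closed[OF K.nat_pow_closed[OF li] R.nat_pow_closed[OF w]] by auto
  fix i assume i: "i : I"
  show "?f i [^]\<^bsub>Q\<^esub> p = h (L (l i [^]\<^bsub>K\<^esub> p) *_S F (w i [^]\<^bsub>R\<^esub> p))"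
   unfolding LF_pow[OF li[OF i] w[OF i], symmetric] hom_pow[OF h LF_closed[OF li[OF i] w[OF i]]] ..
 qed
 finally have e: "h (x [^]\<^bsub>S\<^esub> p) = finsum Q (%i. h (L (l i [^]\<^bsub>K\<^esub> p) *_S F (w i [^]\<^bsub>R\<^esub> p))) I" .
 have Fp: "h (F (w i [^]\<^bsub>R\<^esub> p)) = h (F (w i)) [^]\<^bsub>Q\<^esub> p" if i: "i : I" for i
 proof -
  have "F (w i [^]\<^bsub>R\<^esub> (n::nat)) = F (w i) [^]\<^bsub>S\<^esub> n" for n
   by (induction n) (use w[OF i] in "auto simp: F_one F_mult")
  then show ?thesis using hom_pow[OF h Fw[OF i]] by simp
 qed
 have "h ((x [^]\<^bsub>S\<^esub> p) [^]\<^bsub>S\<^esub> (p ^ m)) ~= 0_Q"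
 proof (rule Suc.IH[OF D' j0(1) _ _ _ _ e])
  show "w j0 [^]\<^bsub>R\<^esub> p = 1_R" unfolding j0(2) by simp
  show "w i [^]\<^bsub>R\<^esub> p : carrier R" if "i : I" for i using w[OF that] by simp
  show "x [^]\<^bsub>S\<^esub> p : carrier S" using x(1) by simp
  fix i j assume i: "i : I" and j: "j : I"
  note c = h.hom_closed[OF Fw[OF i]] h.hom_closed[OF Fw[OF j]]
  show "h (F (w i [^]\<^bsub>R\<^esub> p)) *_Q h (F (w j [^]\<^bsub>R\<^esub> p)) = h (F (w j [^]\<^bsub>R\<^esub> p)) *_Q h (F (w i [^]\<^bsub>R\<^esub> p))"
   unfolding Fp[OF i] Fp[OF j]
   by (rule h.S.group_commutes_pow[OF h.S.group_commutes_pow[OF comm[OF j i] c(2,1), symmetric] c(1) h.S.nat_pow_closed[OF c(2)]])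
 qed
 then show ?case using x(1) by (simp add: S.nat_pow_pow)
qed

text \<open>A nil ideal of the scalar extension comes from the base, as soon as its coefficients are
 controlled by an ideal \<open>J\<close> whose complement is invertible. A counterexample expressed by the
 smallest number of terms may be normalised to have a coefficient 1; minimality, applied to its
 commutators with elements of \<open>R\<close>, makes its coefficients central modulo \<open>J\<close>.\<close>

lemma nil_ideal_subset_coeff_ideal:
 assumes J: "ideal J R" "1_R \<notin> J"
  and inv: "!!r. [|r : carrier R; r \<notin> J|] ==> EX r':carrier R. r' *_R r = 1_R"
  and NI: "ideal NI S" "!!x. x : NI ==> EX m::nat. x [^]\<^bsub>S\<^esub> m = 0_S" "coeff_ideal J <= NI"
  and p: "Factorial_Ring.prime (p::nat)" "[p] \<cdot>\<^bsub>K\<^esub> 1_K = 0_K"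
  and rk: "!!c. c : k ==> EX d:k. d [^]\<^bsub>K\<^esub> p = c"
  and rK: "!!x. x : carrier K ==> EX y:carrier K. y [^]\<^bsub>K\<^esub> p = x"
 shows "NI <= coeff_ideal J"
proof -
 interpret J: ideal J R by fact
 interpret NI: ideal NI S by fact
 interpret JK: ideal "coeff_ideal J" S by (rule coeff_ideal_ideal[OF J(1)])
 let ?JK = "coeff_ideal J"
 let ?Q = "S Quot ?JK" and ?h = "%s. ?JK +>\<^bsub>S\<^esub> s"
 have h: "ring_hom_ring S ?Q ?h" by (rule JK.rcos_ring_hom_ring)
 interpret h: ring_hom_ring S ?Q ?h by (rule h)
 have zQ: "0_?Q = ?JK" unfolding FactRing_def by simp
 have ker: "?h s = 0_?Q \<longleftrightarrow> s : ?JK" if s: "s : carrier S" for s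
  unfolding zQ
 proof
  assume "?h s = ?JK"
  then show "s : ?JK" using JK.rcos_const_imp_mem[OF s] by simp
 qed (rule S.a_rcos_zero[OF JK.ideal_axioms])
 have mem: "L x *_S F r : ?JK" if x: "x : carrier K" and r: "r : J" for x r
 proof -
  have "cm \<phi> (L x *_S F r) : J" if ph: "\<phi> : \<Phi>" for \<phi>
   unfolding cm_right[OF ph J.Icarr[OF r] L_closed[OF x]] by (rule J.I_l_closed[OF r cm_closed[OF ph L_closed[OF x]]])
  then show ?thesis unfolding coeff_ideal_def using LF_closed[OF x J.Icarr[OF r]] by simp
 qed
 have key: "ALL i:I. z i : J" if "dual_on I l q" "!!i. i : I ==> z i : carrier R" "(finsum S (%i. L (l i) *_S F (z i)) I) : NI" for I l q z
  using that
 proof (induction "card I" arbitrary: I l q z rule: less_induct)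
  case less
  note D = less.prems(1) and z = less.prems(2) and N' = less.prems(3)
  have fin: "finite I" and li: "!!i. i : I ==> l i : carrier K" using D unfolding dual_on_def by auto
  have Dsub: "dual_on (I - {i}) l q" for i using D unfolding dual_on_def by auto
  have IH: "ALL j:I - {i}. z' j : J" if "i : I" "!!j. j : I - {i} ==> z' j : carrier R"
   "(finsum S (%j. L (l j) *_S F (z' j)) (I - {i})) : NI" for i z'
   by (rule less.hyps[OF card_Diff1_less[OF fin that(1)] Dsub that(2,3)])
  have split: "(finsum S (%j. L (l j) *_S F (z' j)) I) = L (l i) *_S F (z' i) +_S (finsum S (%j. L (l j) *_S F (z' j)) (I - {i}))"
   if i: "i : I" and z': "!!j. j : I ==> z' j : carrier R" for i z'
   using S.finsum_insert[of "I - {i}" i "%j. L (l j) *_S F (z' j)"] fin i LF_closed[OF li z'] by (auto simp: insert_absorb)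
  have sumc: "(finsum S (%j. L (l j) *_S F (z' j)) (I - H)) : carrier S" if "!!j. j : I ==> z' j : carrier R" for z' H
   using LF_closed[OF li that] by (intro S.finsum_closed) auto
  have cancel: "b : NI" if "a +_S b : NI" "a : NI" "b : carrier S" for a b
  proof -
   have "-_S a +_S (a +_S b) = b" using that NI.Icarr by (simp add: S.a_assoc[symmetric] S.l_neg)
   then show ?thesis using NI.a_closed[OF NI.a_inv_closed[OF that(2)] that(1)] by simp
  qed
  show ?case
  proof (rule ccontr)
   assume "\<not> (ALL i:I. z i : J)"
   then obtain j0 where j0: "j0 : I" "z j0 \<notin> J" by blast
   obtain r' where r': "r' : carrier R" "r' *_R z j0 = 1_R" using inv[OF z[OF j0(1)] j0(2)] by blast
   define w where "w i = r' *_R z i" for i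
   have w: "!!i. i : I ==> w i : carrier R" unfolding w_def using z r' by simp
   define x where "x = (finsum S (%i. L (l i) *_S F (w i)) I)"
   have lc: "F r *_S (finsum S (%i. L (l i) *_S F (z' i)) I) = (finsum S (%i. L (l i) *_S F (r *_R z' i)) I)"
    if r: "r : carrier R" and z': "!!j. j : I ==> z' j : carrier R" for r z'
   proof -
    have "F r *_S (finsum S (%i. L (l i) *_S F (z' i)) I) = (finsum S (%i. F r *_S (L (l i) *_S F (z' i))) I)"
     by (rule S.finsum_rdistr[OF fin F_closed[OF r]]) (use LF_closed[OF li z'] in auto)
    also have "... = (finsum S (%i. L (l i) *_S F (r *_R z' i)) I)"
    proof (rule S.finsum_cong'[OF refl])
     show "(%i. L (l i) *_S F (r *_R z' i)) : I \<rightarrow> carrier S" using LF_closed[OF li R.m_closed[OF r z']] by blast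
     fix i assume i: "i : I"
     show "F r *_S (L (l i) *_S F (z' i)) = L (l i) *_S F (r *_R z' i)"
      unfolding F_mult[OF r z'[OF i]] S.m_assoc[OF L_closed[OF li[OF i]] F_closed[OF r] F_closed[OF z'[OF i]], symmetric]
       L_central[OF li[OF i] F_closed[OF r]]
      by (rule S.m_assoc[OF F_closed[OF r] L_closed[OF li[OF i]] F_closed[OF z'[OF i]], symmetric])
    qed
    finally show ?thesis .
   qed
   have rc: "(finsum S (%i. L (l i) *_S F (z' i)) I) *_S F r = (finsum S (%i. L (l i) *_S F (z' i *_R r)) I)"
    if r: "r : carrier R" and z': "!!j. j : I ==> z' j : carrier R" for r z'
   proof -
    have "(finsum S (%i. L (l i) *_S F (z' i)) I) *_S F r = (finsum S (%i. (L (l i) *_S F (z' i)) *_S F r) I)"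
     by (rule S.finsum_ldistr[OF fin F_closed[OF r]]) (use LF_closed[OF li z'] in auto)
    also have "... = (finsum S (%i. L (l i) *_S F (z' i *_R r)) I)"
    proof (rule S.finsum_cong'[OF refl])
     show "(%i. L (l i) *_S F (z' i *_R r)) : I \<rightarrow> carrier S" using LF_closed[OF li R.m_closed[OF z' r]] by blast
     fix i assume i: "i : I"
     show "(L (l i) *_S F (z' i)) *_S F r = L (l i) *_S F (z' i *_R r)"
      unfolding F_mult[OF z'[OF i] r] by (rule S.m_assoc[OF L_closed[OF li[OF i]] F_closed[OF z'[OF i]] F_closed[OF r]])
    qed
    finally show ?thesis .
   qed
   have xN: "x : NI" 
    using NI.I_l_closed[OF N' F_closed[OF r'(1)]] lc[OF r'(1) z] unfolding x_def w_def by simp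
   have central: "r *_R w i -_R w i *_R r : J" if r: "r : carrier R" and i: "i : I" for r i
   proof -
    \<comment> \<open>in commutators with \<open>r\<close> the term with coefficient \<open>1\<close> disappears\<close>
    define c where "c j = r *_R w j -_R w j *_R r" for j
    have cc: "c j : carrier R" if "j : I" for j unfolding c_def using r w[OF that] by simp
    have c0: "c j0 = 0_R" unfolding c_def w_def r'(2) using r by (simp add: R.minus_eq R.r_neg)
    have F0: "F 0_R = 0_S"
     by (rule additive_zero[OF R.abelian_group_axioms S.abelian_group_axioms]) (auto simp: F_closed F_add)
    have s: "(finsum S (%i. L (l i) *_S F (c i)) I) +_S (finsum S (%i. L (l i) *_S F (w i *_R r)) I) = (finsum S (%i. L (l i) *_S F (r *_R w i)) I)"
    proof -
     have e: "L (l i) *_S F (r *_R w i) = L (l i) *_S F (c i) +_S L (l i) *_S F (w i *_R r)" if i: "i : I" for i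
     proof -
      have "c i +_R w i *_R r = r *_R w i" unfolding c_def using r w[OF i] by (simp add: R.minus_eq R.a_assoc R.l_neg)
      then have "F (r *_R w i) = F (c i) +_S F (w i *_R r)" using F_add[OF cc[OF i] R.m_closed[OF w[OF i] r]] by simp
      then show ?thesis using S.r_distr[OF F_closed[OF cc[OF i]] F_closed[OF R.m_closed[OF w[OF i] r]] L_closed[OF li[OF i]]] by simp
     qed
     have c1: "(%i. L (l i) *_S F (c i)) : I \<rightarrow> carrier S" "(%i. L (l i) *_S F (w i *_R r)) : I \<rightarrow> carrier S"
      using LF_closed[OF li cc] LF_closed[OF li R.m_closed[OF w r]] by blast+
     show ?thesis unfolding S.finsum_addf[OF c1, symmetric]
      by (rule S.finsum_cong'[OF refl]) (use e LF_closed[OF li R.m_closed[OF r w]] in auto)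
    qed
    have N1: "F r *_S x : NI" "x *_S F r : NI"
     using NI.I_l_closed[OF xN F_closed[OF r]] NI.I_r_closed[OF xN F_closed[OF r]] .
    have cS: "(finsum S (%i. L (l i) *_S F (c i)) I) : carrier S" using sumc[of c "{}"] cc by simp
    have "(finsum S (%i. L (l i) *_S F (c i)) I) : NI"
    proof (rule cancel[OF _ N1(2) cS])
     show "x *_S F r +_S (finsum S (%i. L (l i) *_S F (c i)) I) : NI"
      using N1(1) s cS NI.Icarr[OF N1(2)] lc[OF r w] rc[OF r w] unfolding x_def by (simp add: S.a_comm)
    qed
    moreover have "L (l j0) *_S F (c j0) = 0_S" unfolding c0 F0 using L_closed[OF li[OF j0(1)]] by simp
    ultimately have "(finsum S (%i. L (l i) *_S F (c i)) (I - {j0})) : NI"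
     using split[of j0 c] j0(1) cc sumc[of c "{j0}"] by simp
    then have "ALL i:I - {j0}. c i : J" using IH[OF j0(1)] cc by simp
    then have "c i : J" using i c0 J.additive_subgroup_axioms additive_subgroup.zero_closed by (cases "i = j0") auto
    then show ?thesis unfolding c_def .
   qed
   have hx: "?h x = finsum ?Q (%i. ?h (L (l i) *_S F (w i))) I" unfolding x_def
    by (rule additive_finsum[OF S.abelian_group_axioms h.S.abelian_group_axioms _ _ fin])
     (use LF_closed[OF li w] in "auto simp del: FactRing_def")
   have comm: "?h (F (w i)) *_?Q ?h (F (w j)) = ?h (F (w j)) *_?Q ?h (F (w i))" if i: "i : I" and j: "j : I" for i j
   proof -
    note Fc = F_closed[OF w[OF i]] F_closed[OF w[OF j]]
    define c where "c = w i *_R w j -_R w j *_R w i"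
    have c: "c : J" "c : carrier R" unfolding c_def using central[OF w[OF i] j] J.Icarr by auto
    have "c +_R w j *_R w i = w i *_R w j" unfolding c_def using w[OF i] w[OF j] by (simp add: R.minus_eq R.a_assoc R.l_neg)
    then have e: "F (w i) *_S F (w j) = F c +_S F (w j) *_S F (w i)"
     using F_mult[OF w[OF i] w[OF j]] F_mult[OF w[OF j] w[OF i]] F_add[OF c(2) R.m_closed[OF w[OF j] w[OF i]]] by simp
    have "F c : ?JK" using mem[OF K.one_closed c(1)] L_one F_closed[OF c(2)] by simp
    then have "?h (F c) = 0_?Q" using ker[OF F_closed[OF c(2)]] by simp
    then have "?h (F (w i) *_S F (w j)) = ?h (F (w j) *_S F (w i))"
     unfolding e h.hom_add[OF F_closed[OF c(2)] S.m_closed[OF Fc(2,1)]] using h.hom_closed[OF S.m_closed[OF Fc(2,1)]] by simp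
    then show ?thesis unfolding h.hom_mult[OF Fc] h.hom_mult[OF Fc(2,1)] .
   qed
   have xS: "x : carrier S" by (rule NI.Icarr[OF xN])
   obtain n :: nat where n: "x [^]\<^bsub>S\<^esub> n = 0_S" using NI(2)[OF xN] by blast
   have "n < p ^ n" using prime_gt_1_nat[OF p(1)] by (intro power_gt_expt) simp
   then have "x [^]\<^bsub>S\<^esub> (p ^ n) = x [^]\<^bsub>S\<^esub> n *_S x [^]\<^bsub>S\<^esub> (p ^ n - n)" using S.nat_pow_mult[OF xS, of n "p ^ n - n"] by simp
   then have z0: "x [^]\<^bsub>S\<^esub> (p ^ n) = 0_S" using n xS by simp
   have "?h (x [^]\<^bsub>S\<^esub> (p ^ n)) ~= 0_?Q"
    by (rule frobenius_tower[OF J h ker p rk rK D j0(1) _ w comm xS hx]) (simp_all add: w_def r'(2))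
   then show False unfolding z0 using ker[OF S.zero_closed] JK.zero_closed by simp
  qed
 qed
 show ?thesis
 proof
  fix x assume x: "x : NI"
  obtain I l q where D: "dual_on I l q" and e: "x = (finsum S (%i. L (l i) *_S F (cm (q i) x)) I)"
   using expand[OF NI.Icarr[OF x]] by blast
  have D': "finite I" "!!i. i : I ==> l i : carrier K" "!!i. i : I ==> q i : \<Phi>"
   using D unfolding dual_on_def by auto
  have "ALL i:I. cm (q i) x : J"
   by (rule key[OF D]) (use cm_closed[OF D'(3) NI.Icarr[OF x]] x e in auto)
  then have m: "L (l i) *_S F (cm (q i) x) : ?JK" if "i : I" for i using mem D'(2) that by blast
  have fs: "finsum S f I' : ?JK" if "finite I'" "!!i. i : I' ==> f i : ?JK" for f :: "nat => 's" and I'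
   using that
  proof (induction I' rule: finite_induct)
   case empty
   show ?case using JK.zero_closed by simp
  next
   case (insert i I')
   have c: "f : I' \<rightarrow> carrier S" "f i : carrier S" using insert.prems JK.Icarr by blast+
   have "finsum S f I' : ?JK" "f i : ?JK" using insert by blast+
   then show ?case using S.finsum_insert[OF insert.hyps c] JK.a_closed by simp
  qed
  show "x : ?JK" by (subst e, rule fs[OF D'(1) m])
 qed
qed

end

section \<open>Coefficients of homomorphisms between extended modules\<close>

context scalar_algebra
begin

lemma hom_space_finsum_apply:
 assumes "left_module B U" "left_module B V" "finite I" "f : I \<rightarrow> mod_hom B U V" "u : carrier U"
 shows "finsum (hom_space B U V) f I u = finsum V (%i. f i u) I"
proof -
 interpret H: vspace F "hom_space B U V" by (rule hom_space_vspace[OF assms(1,2)])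
 interpret V: left_module B V by (rule assms(2))
 show ?thesis
  by (rule additive_finsum[OF H.M.abelian_group_axioms V.abelian_group_axioms, of "%f. f u"])
   (use assms hom_closed in auto)
qed

definition endo_ring :: "('a, 'v) module => ('v => 'v) set => ('v => 'v) ring" where
 "endo_ring U C = (|carrier = C, monoid.mult = compose (carrier U), one = (\<lambda>u\<in>carrier U. u),
  ring.zero = (\<lambda>u\<in>carrier U. 0_U), ring.add = (%f g. \<lambda>u\<in>carrier U. f u +_U g u)|)"

lemma endo_ring_simps [simp]:
 "carrier (endo_ring U C) = C" "f \<otimes>\<^bsub>endo_ring U C\<^esub> g = compose (carrier U) f g"
 "\<one>\<^bsub>endo_ring U C\<^esub> = (\<lambda>u\<in>carrier U. u)" "\<zero>\<^bsub>endo_ring U C\<^esub> = (\<lambda>u\<in>carrier U. 0_U)"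
 "f \<oplus>\<^bsub>endo_ring U C\<^esub> g = (\<lambda>u\<in>carrier U. f u +_U g u)"
 unfolding endo_ring_def by simp_all

context
 fixes U :: "('a, 'v) module" and C
 assumes U: "left_module B U" and C: "submodule C F (hom_space B U U)" "(\<lambda>u\<in>carrier U. u) : C"
  "!!f g. [|f : C; g : C|] ==> compose (carrier U) f g : C"
begin

lemma endo_ring_ring: "ring (endo_ring U C)"
proof -
 interpret U: left_module B U by (rule U)
 interpret H: vspace F "hom_space B U U" by (rule hom_space_vspace[OF U U])
 note C' = C(1)[unfolded H.submodule_iff]
 have CH: "f : mod_hom B U U" if "f : C" for f using C' that by auto
 have cl: "f u : carrier U" if "f : C" "u : carrier U" for f u by (rule hom_closed[OF CH[OF that(1)] that(2)])
 have ad: "f (u +_U v) = f u +_U f v" if "f : C" "u : carrier U" "v : carrier U" for f u v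
  by (rule hom_add[OF CH[OF that(1)] that(2,3)])
 have ex: "f : extensional (carrier U)" if "f : C" for f by (rule hom_ext[OF CH[OF that]])
 have addC: "(\<lambda>u\<in>carrier U. f u +_U g u) : C" if "f : C" "g : C" for f g using C' that by simp
 have zC: "(\<lambda>u\<in>carrier U. 0_U) : C" using C' by simp
 have sC: "(\<lambda>u\<in>carrier U. scl U c (f u)) : C" if "c : carrier F" "f : C" for c f using C' that by simp
 have "abelian_group (endo_ring U C)"
 proof (rule abelian_groupI)
  fix f assume f: "f : carrier (endo_ring U C)"
  then have fC: "f : C" by simp
  have m1: "\<ominus> \<one> : carrier F" by simp
  have "scl U (\<ominus> \<one>) u +_U u = 0_U" if u: "u : carrier U" for u
   using scl_add[OF U m1 F.one_closed u] scl_one[OF U u] U.zero_act[OF u] sc_add[OF m1 F.one_closed]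
   by (simp add: F.l_neg scl_def) (metis F.l_neg F.one_closed F.zero_closed F.l_zero sc_add sc_closed B.add.l_cancel_one' U.zero_act u)
  then show "EX g:carrier (endo_ring U C). g \<oplus>\<^bsub>endo_ring U C\<^esub> f = \<zero>\<^bsub>endo_ring U C\<^esub>"
   using cl[OF fC] by (intro bexI[of _ "\<lambda>u\<in>carrier U. scl U (\<ominus> \<one>) (f u)"]) (auto simp: sC[OF m1 fC] intro!: restrict_ext)
 next
  fix f assume "f : carrier (endo_ring U C)"
  then have fC: "f : C" by simp
  show "\<zero>\<^bsub>endo_ring U C\<^esub> \<oplus>\<^bsub>endo_ring U C\<^esub> f = f"
   by (rule extensionalityI[of _ "carrier U"]) (use cl[OF fC] ex[OF fC] in auto)
 qed (use addC zC cl in "auto intro!: restrict_ext simp: U.a_ac")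
 moreover have "monoid (endo_ring U C)"
 proof (rule monoidI)
  fix f g h assume "f : carrier (endo_ring U C)" "g : carrier (endo_ring U C)" "h : carrier (endo_ring U C)"
  then show "f \<otimes>\<^bsub>endo_ring U C\<^esub> g \<otimes>\<^bsub>endo_ring U C\<^esub> h = f \<otimes>\<^bsub>endo_ring U C\<^esub> (g \<otimes>\<^bsub>endo_ring U C\<^esub> h)"
   using cl by (auto simp: compose_def intro!: restrict_ext)
 next
  fix f assume "f : carrier (endo_ring U C)"
  then have fC: "f : C" by simp
  show "\<one>\<^bsub>endo_ring U C\<^esub> \<otimes>\<^bsub>endo_ring U C\<^esub> f = f" "f \<otimes>\<^bsub>endo_ring U C\<^esub> \<one>\<^bsub>endo_ring U C\<^esub> = f"
   by (rule extensionalityI[of _ "carrier U"]; use cl[OF fC] ex[OF fC] in "auto simp: compose_def")+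
 qed (use C(2,3) in auto)
 ultimately show ?thesis
  by (rule ringI) (use cl ad addC in "auto simp: compose_def intro!: restrict_ext")
qed

lemma endo_ring_finsum_apply:
 assumes "finite I" "f : I \<rightarrow> C" "u : carrier U"
 shows "finsum (endo_ring U C) f I u = finsum U (%i. f i u) I"
proof -
 interpret U: left_module B U by (rule U)
 interpret H: vspace F "hom_space B U U" by (rule hom_space_vspace[OF U U])
 interpret E: ring "endo_ring U C" by (rule endo_ring_ring)
 have "f : mod_hom B U U" if "f : C" for f using C(1)[unfolded H.submodule_iff] that by auto
 then show ?thesis
  by (intro additive_finsum[OF E.abelian_group_axioms U.abelian_group_axioms, of "%f. f u"])
   (use assms hom_closed[of _ B U U] in auto)
qed

lemma endo_ring_pow:
 assumes "f : C" "u : carrier U"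
 shows "(f [^]\<^bsub>endo_ring U C\<^esub> (n::nat)) u = (f ^^ n) u"
proof -
 interpret U: left_module B U by (rule U)
 interpret H: vspace F "hom_space B U U" by (rule hom_space_vspace[OF U U])
 have f: "f : mod_hom B U U" using C(1)[unfolded H.submodule_iff] assms(1) by auto
 show ?thesis using assms(2)
 proof (induction n arbitrary: u)
  case (Suc n)
  then show ?case using hom_closed[OF f Suc.prems] by (simp add: compose_eq funpow_Suc_right del: funpow.simps)
 qed simp
qed

end

end

context scalar_ext
begin

abbreviation "md \<equiv> fd_mod kF A"
abbreviation "HK M M' \<equiv> mod_hom AK (ext M) (ext M')"

text \<open>The coefficient of \<open>g\<close> at the functional \<open>\<phi>\<close>.\<close>

definition cmp :: "('a, nat => 'f) module => ('a, nat => 'f) module => ('f => 'f) =>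
  ((nat => 'f) => (nat => 'f)) => (nat => 'f) => (nat => 'f)" where
 "cmp M M' \<phi> g = (\<lambda>m\<in>carrier M. ph M' \<phi> (g (emb M m)))"

text \<open>The functor of scalar extension on homomorphisms.\<close>

definition Fm :: "('a, nat => 'f) module => ('a, nat => 'f) module =>
  ((nat => 'f) => (nat => 'f)) => (nat => 'f) => (nat => 'f)" where
 "Fm M M' f = (SOME g. g : HK M M' \<and> (ALL m:carrier M. g (emb M m) = emb M' (f m)))"

lemma HK_closed: "[|g : HK M M'; u : cvec M|] ==> g u : cvec M'"
 using hom_closed[of g AK "ext M" "ext M'" u] by simp

lemma HK_add: "[|g : HK M M'; u : cvec M; v : cvec M|] ==> g (%j. u j +_K v j) = (%j. g u j +_K g v j)"
 using hom_add[of g AK "ext M" "ext M'" u v] by simp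

lemma HK_scl: "[|M : md; M' : md; g : HK M M'; x : carrier K; u : cvec M|] ==>
  g (SB.scl (ext M) x u) = SB.scl (ext M') x (g u)"
 using SB.hom_scl[OF ext_left ext_left, of M M' g x u] by simp

lemma cmp_apply: "m : carrier M ==> cmp M M' \<phi> g m = ph M' \<phi> (g (emb M m))"
 unfolding cmp_def by simp

lemma cmp_hom:
 assumes M: "M : md" and M': "M' : md" and p: "\<phi> : \<Phi>" and g: "g : HK M M'"
 shows "cmp M M' \<phi> g : mod_hom A M M'"
proof -
 interpret M: left_module A M by (rule M_left[OF M])
 note gc = HK_closed[OF g emb_closed[OF M]]
 show ?thesis
 proof (rule homI)
  show "cmp M M' \<phi> g : extensional (carrier M)" unfolding cmp_def by simp
  show "cmp M M' \<phi> g m : carrier M'" if "m : carrier M" for m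
   unfolding cmp_apply[OF that] by (rule ph_closed[OF M' p gc[OF that]])
  show "cmp M M' \<phi> g (m +_M m') = cmp M M' \<phi> g m \<oplus>\<^bsub>M'\<^esub> cmp M M' \<phi> g m'" if "m : carrier M" "m' : carrier M" for m m'
   unfolding cmp_apply[OF that(1)] cmp_apply[OF that(2)] cmp_apply[OF M.a_closed[OF that]] emb_add[OF M that]
    HK_add[OF g emb_closed[OF M that(1)] emb_closed[OF M that(2)]] by (rule ph_add[OF M' p gc[OF that(1)] gc[OF that(2)]])
  show "cmp M M' \<phi> g (a \<odot>_M m) = a \<odot>\<^bsub>M'\<^esub> cmp M M' \<phi> g m" if a: "a : carrier A" and m: "m : carrier M" for a m
  proof -
   have "g (t 1_K a \<odot>\<^bsub>ext M\<^esub> emb M m) = t 1_K a \<odot>\<^bsub>ext M'\<^esub> g (emb M m)"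
    by (rule hom_act[OF g]) (use t_closed[OF K.one_closed a] emb_closed[OF M m] in simp_all)
   then show ?thesis unfolding cmp_apply[OF m] cmp_apply[OF M.act_closed[OF a m]] emb_act[OF M a m]
    using ph_act[OF M' p a gc[OF m]] by simp
  qed
 qed
qed

lemma cmp_eqI:
 assumes M: "M : md" and M': "M' : md" and g: "g : HK M M'" "g' : HK M M'"
  and e: "!!\<phi>. \<phi> : \<Phi> ==> cmp M M' \<phi> g = cmp M M' \<phi> g'"
 shows "g = g'"
proof (rule ext_hom_eqI[OF M ext_left[OF M'] g])
 fix m assume m: "m : carrier M"
 show "g (emb M m) = g' (emb M m)"
  by (rule cvec_eqI[OF M' HK_closed[OF g(1) emb_closed[OF M m]] HK_closed[OF g(2) emb_closed[OF M m]]])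
   (use e fun_cong cmp_apply[OF m] in metis)
qed

lemma ext_hom_eqI_basis:
 assumes M: "M : md" and W: "left_module AK W" and g: "g : mod_hom AK (ext M) W" "g' : mod_hom AK (ext M) W"
  and e: "!!j. j < bd M ==> g (emb M (bm M j)) = g' (emb M (bm M j))"
 shows "g = g'"
proof (rule hom_eqI[OF g])
 fix u assume "u : carrier (ext M)"
 then have u: "u : cvec M" by simp
 interpret W: left_module AK W by (rule W)
 note bc = emb_closed[OF M bm_closed[OF M]]
 have tc: "(%j. SB.scl (ext M) (u j) (emb M (bm M j))) : {..<bd M} \<rightarrow> carrier (ext M)"
  using ext_scl_closed[OF M cvecD[OF M u] bc] by simp
 have ex: "h u = (finsum W (%j. SB.scl W (u j) (h (emb M (bm M j)))) {..<bd M})" if h: "h : mod_hom AK (ext M) W" for h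
 proof -
  have "h u = (finsum W (%j. h (SB.scl (ext M) (u j) (emb M (bm M j)))) {..<bd M})"
   using SB.hom_finsum[OF ext_left[OF M] W h _ tc] ext_expand_basis[OF M u] by simp
  also have "... = (finsum W (%j. SB.scl W (u j) (h (emb M (bm M j)))) {..<bd M})"
  proof (rule W.finsum_cong'[OF refl])
   show "(%j. SB.scl W (u j) (h (emb M (bm M j)))) : {..<bd M} \<rightarrow> carrier W"
    using SB.scl_closed[OF W cvecD[OF M u]] hom_closed[OF h] bc by simp
   show "h (SB.scl (ext M) (u j) (emb M (bm M j))) = SB.scl W (u j) (h (emb M (bm M j)))" if "j : {..<bd M}" for j
    by (rule SB.hom_scl[OF ext_left[OF M] W h cvecD[OF M u]]) (use bc that in simp)
  qed
  finally show ?thesis .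
 qed
 show "g u = g' u" unfolding ex[OF g(1)] ex[OF g(2)]
  by (rule W.finsum_cong'[OF refl]) (use e SB.scl_closed[OF W cvecD[OF M u]] hom_closed[OF g(2)] bc in simp_all)
qed

context
 fixes M M' f
 assumes M: "M : md" and M': "M' : md" and f: "f : mod_hom A M M'"
begin

lemma Fm_hom: "Fm M M' f : HK M M'" and Fm_emb: "m : carrier M ==> Fm M M' f (emb M m) = emb M' (f m)"
proof -
 have "EX g:HK M M'. ALL m:carrier M. g (emb M m) = emb M' (f m)"
 proof (rule ext_hom_exists[OF M ext_left[OF M'], of "%m. emb M' (f m)"])
  show "emb M' (f m) : carrier (ext M')" if "m : carrier M" for m using emb_closed[OF M' hom_closed[OF f that]] by simp
  show "emb M' (f (m +_M m')) = emb M' (f m) \<oplus>\<^bsub>ext M'\<^esub> emb M' (f m')" if "m : carrier M" "m' : carrier M" for m m'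
   using emb_add[OF M' hom_closed[OF f that(1)] hom_closed[OF f that(2)]] hom_add[OF f that] by simp
  show "emb M' (f (a \<odot>_M m)) = t 1_K a \<odot>\<^bsub>ext M'\<^esub> emb M' (f m)" if "a : carrier A" "m : carrier M" for a m
   using emb_act[OF M' that(1) hom_closed[OF f that(2)]] hom_act[OF f that] by simp
 qed
 then have "EX g. g : HK M M' \<and> (ALL m:carrier M. g (emb M m) = emb M' (f m))" by blast
 then have "Fm M M' f : HK M M' \<and> (ALL m:carrier M. Fm M M' f (emb M m) = emb M' (f m))"
  unfolding Fm_def by (rule someI_ex)
 then show "Fm M M' f : HK M M'" "m : carrier M ==> Fm M M' f (emb M m) = emb M' (f m)" by blast+
qed

lemma ph_Fm:
 assumes u: "u : cvec M" and p: "\<phi> : \<Phi>"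
 shows "ph M' \<phi> (Fm M M' f u) = f (ph M \<phi> u)"
proof -
 interpret M: left_module A M by (rule M_left[OF M])
 interpret E: left_module AK "ext M" by (rule ext_left[OF M])
 interpret EU: vspace K "underlying_space AK (ext M)" by (rule SB.underlying_vspace[OF ext_left[OF M]])
 note Fc = HK_closed[OF Fm_hom]
 let ?H = "{u : cvec M. ALL \<phi>:\<Phi>. ph M' \<phi> (Fm M M' f u) = f (ph M \<phi> u)}"
 have "submodule ?H K (underlying_space AK (ext M))" unfolding EU.submodule_iff
 proof (intro conjI ballI)
  show "?H <= carrier (underlying_space AK (ext M))" by auto
  have z: "\<zero>\<^bsub>ext M\<^esub> = emb M 0_M"
  proof -
   have "emb M 0_M = emb M 0_M \<oplus>\<^bsub>ext M\<^esub> emb M 0_M" using emb_add[OF M M.zero_closed M.zero_closed] by simp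
   then show ?thesis using E.add_eq_right_imp_zero[of "emb M 0_M" "emb M 0_M"] emb_closed[OF M M.zero_closed]
    by (metis ext_simps(1))
  qed
  have em: "emb M m : ?H" if m: "m : carrier M" for m
   using ph_emb[OF M' _ hom_closed[OF f m]] ph_emb[OF M _ m] Fm_emb[OF m] emb_closed[OF M m]
    SA.hom_scl[OF M_left[OF M] M_left[OF M'] f _ m] Phi_closed by simp
  show "\<zero>\<^bsub>underlying_space AK (ext M)\<^esub> : ?H"
   using em[OF M.zero_closed] z by simp
  fix v w assume vw: "v : ?H" "w : ?H"
  then have v: "v : cvec M" and w: "w : cvec M" by auto
  have "ph M' \<phi> (Fm M M' f (%j. v j +_K w j)) = f (ph M \<phi> (%j. v j +_K w j))" if p: "\<phi> : \<Phi>" for \<phi>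
   unfolding HK_add[OF Fm_hom v w] ph_add[OF M p v w] ph_add[OF M' p Fc[OF v] Fc[OF w]]
    hom_add[OF f ph_closed[OF M p v] ph_closed[OF M p w]] using vw p by simp
  then show "v \<oplus>\<^bsub>underlying_space AK (ext M)\<^esub> w : ?H" using cvec_add[OF M v w] by simp
 next
  fix x v assume x: "x : carrier K" and v': "v : ?H"
  then have v: "v : cvec M" by auto
  have "ph M' \<phi> (Fm M M' f (SB.scl (ext M) x v)) = f (ph M \<phi> (SB.scl (ext M) x v))" if p: "\<phi> : \<Phi>" for \<phi>
   unfolding HK_scl[OF M M' Fm_hom x v] ph_scl[OF M p x v] ph_scl[OF M' p x Fc[OF v]]
   using v' Phi_shift[OF p x] by simp
  then show "x \<odot>\<^bsub>underlying_space AK (ext M)\<^esub> v : ?H" using ext_scl_closed[OF M x v] by simp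
 qed
 moreover have "emb M m : ?H" if m: "m : carrier M" for m
  using ph_emb[OF M' _ hom_closed[OF f m]] ph_emb[OF M _ m] Fm_emb[OF m] emb_closed[OF M m]
   SA.hom_scl[OF M_left[OF M] M_left[OF M'] f _ m] Phi_closed by simp
 ultimately have "u : ?H" using ext_generated[OF M _ _ u] by blast
 then show ?thesis using p by blast
qed

lemma cmp_Fm:
 assumes p: "\<phi> : \<Phi>"
 shows "cmp M M' \<phi> (Fm M M' f) = (\<lambda>m\<in>carrier M. SA.scl M' (\<phi> 1_K) (f m))"
 unfolding cmp_def by (rule restrict_ext) (simp add: Fm_emb ph_emb[OF M' p] hom_closed[OF f])

lemma cmp_Fm_right: "cmp M M'' \<phi> (compose (cvec M) g (Fm M M' f)) = compose (carrier M) (cmp M' M'' \<phi> g) f"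
 unfolding compose_def using emb_closed[OF M] by (auto simp: cmp_def Fm_emb hom_closed[OF f] intro!: restrict_ext)

lemma cmp_Fm_left:
 assumes L: "L : md" and p: "\<phi> : \<Phi>" and g: "g : HK L M"
 shows "cmp L M' \<phi> (compose (cvec L) (Fm M M' f) g) = compose (carrier L) f (cmp L M \<phi> g)"
 unfolding compose_def cmp_def
 by (rule restrict_ext) (simp add: emb_closed[OF L] ph_Fm[OF HK_closed[OF g] p])

end

lemma cmp_add:
 assumes M: "M : md" and M': "M' : md" and p: "\<phi> : \<Phi>" and g: "g : HK M M'" "h : HK M M'"
 shows "cmp M M' \<phi> (\<lambda>u\<in>cvec M. g u \<oplus>\<^bsub>ext M'\<^esub> h u) = (\<lambda>m\<in>carrier M. cmp M M' \<phi> g m \<oplus>\<^bsub>M'\<^esub> cmp M M' \<phi> h m)"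
 unfolding cmp_def
 by (rule restrict_ext) (simp add: emb_closed[OF M] ph_add[OF M' p HK_closed[OF g(1)] HK_closed[OF g(2)]])

lemma cmp_scl:
 assumes M: "M : md" and M': "M' : md" and p: "\<phi> : \<Phi>" and g: "g : HK M M'" and x: "x : carrier K"
 shows "cmp M M' \<phi> (\<lambda>u\<in>cvec M. SB.scl (ext M') x (g u)) = cmp M M' (%y. \<phi> (x *_K y)) g"
 unfolding cmp_def
 by (rule restrict_ext) (simp add: emb_closed[OF M] ph_scl[OF M' p x HK_closed[OF g]])

lemma cmp_scl_id:
 assumes M: "M : md" and p: "\<phi> : \<Phi>" and x: "x : carrier K"
 shows "cmp M M \<phi> (\<lambda>u\<in>cvec M. SB.scl (ext M) x u) = (\<lambda>m\<in>carrier M. SA.scl M (\<phi> x) m)"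
 unfolding cmp_def by (rule restrict_ext) (simp add: emb_closed[OF M] ph_scl_emb[OF M p x])

text \<open>The images of a basis have finitely many coordinates, which span a finite-dimensional subspace of \<open>K\<close>.\<close>

lemma ext_hom_expansion:
 assumes M: "M : md" and M': "M' : md" and g: "g : HK M M'"
 shows "EX n ls ps. KM.dual_family n ls ps \<and>
  (ALL u:cvec M. g u = (finsum (ext M') (%s. SB.scl (ext M') (ls s) (Fm M M' (cmp M M' (ps s) g) u)) {..<n}))"
proof -
 interpret E': left_module AK "ext M'" by (rule ext_left[OF M'])
 interpret H: vspace K "hom_space AK (ext M) (ext M')" by (rule SB.hom_space_vspace[OF ext_left[OF M] ext_left[OF M']])
 note bc = emb_closed[OF M bm_closed[OF M]]
 let ?S = "(%j. g (emb M (bm M j))) ` {..<bd M}"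
 have S: "finite ?S" "?S <= cvec M'" using HK_closed[OF g bc] by auto
 obtain n ls ps where D: "KM.dual_family n ls ps"
  and ex: "!!u. u : ?S ==> u = (finsum (ext M') (%s. SB.scl (ext M') (ls s) (emb M' (ph M' (ps s) u))) {..<n})"
  using ext_expansion[OF M' S] by blast
 have ls: "ls s : carrier K" and ps: "ps s : \<Phi>" if "s < n" for s using KM.dual_familyD[OF D that] by simp_all
 define T where "T s = (\<lambda>u\<in>cvec M. SB.scl (ext M') (ls s) (Fm M M' (cmp M M' (ps s) g) u))" for s
 have Fh: "Fm M M' (cmp M M' (ps s) g) : HK M M'" if "s < n" for s
  by (rule Fm_hom[OF M M' cmp_hom[OF M M' ps[OF that] g]])
 have T: "T : {..<n} \<rightarrow> HK M M'"
  unfolding T_def using SB.scale_hom[OF ext_left[OF M] ext_left[OF M'] Fh ls] by simp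
 have sum: "finsum (hom_space AK (ext M) (ext M')) T {..<n} u = (finsum (ext M') (%s. T s u) {..<n})" if "u : cvec M" for u
  by (rule SB.hom_space_finsum_apply[OF ext_left[OF M] ext_left[OF M'] _ T]) (use that in simp_all)
 have "g = finsum (hom_space AK (ext M) (ext M')) T {..<n}"
 proof (rule ext_hom_eqI_basis[OF M ext_left[OF M'] g])
  show "finsum (hom_space AK (ext M) (ext M')) T {..<n} : HK M M'" using H.M.finsum_closed[of T "{..<n}"] T by simp
  fix j assume j: "j < bd M"
  have "g (emb M (bm M j)) = (finsum (ext M') (%s. SB.scl (ext M') (ls s) (emb M' (ph M' (ps s) (g (emb M (bm M j)))))) {..<n})"
   by (rule ex) (use j in blast)
  also have "... = (finsum (ext M') (%s. T s (emb M (bm M j))) {..<n})"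
  proof (rule E'.finsum_cong'[OF refl])
   show "(%s. T s (emb M (bm M j))) : {..<n} \<rightarrow> carrier (ext M')" using T HK_closed[OF _ bc[OF j]] by auto
   fix s assume "s : {..<n}"
   then have s: "s < n" by simp
   show "SB.scl (ext M') (ls s) (emb M' (ph M' (ps s) (g (emb M (bm M j))))) = T s (emb M (bm M j))"
    unfolding T_def using bc[OF j] Fm_emb[OF M M' cmp_hom[OF M M' ps[OF s] g] bm_closed[OF M j]] cmp_apply[OF bm_closed[OF M j]] by simp
  qed
  finally show "g (emb M (bm M j)) = finsum (hom_space AK (ext M) (ext M')) T {..<n} (emb M (bm M j))"
   unfolding sum[OF bc[OF j]] .
 qed
 then have "g u = (finsum (ext M') (%s. SB.scl (ext M') (ls s) (Fm M M' (cmp M M' (ps s) g) u)) {..<n})" if u: "u : cvec M" for u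
  using sum[OF u] u unfolding T_def by simp
 then show ?thesis using D by blast
qed

lemma cmp_compose_expansion:
 assumes M: "M : md" and M': "M' : md" and M'': "M'' : md" and g: "g : HK M M'"
 shows "EX n ls ps. KM.dual_family n ls ps \<and> (ALL \<phi>:\<Phi>. ALL h:HK M' M''. ALL u:cvec M.
  ph M'' \<phi> (h (g u)) = (finsum (M'') (%s. ph M'' (%y. \<phi> (ls s *_K y)) (h (Fm M M' (cmp M M' (ps s) g) u))) {..<n}))"
proof -
 interpret E'': left_module AK "ext M''" by (rule ext_left[OF M''])
 interpret M'': left_module A M'' by (rule M_left[OF M''])
 obtain n ls ps where D: "KM.dual_family n ls ps"
  and ex: "!!u. u : cvec M ==> g u = (finsum (ext M') (%s. SB.scl (ext M') (ls s) (Fm M M' (cmp M M' (ps s) g) u)) {..<n})"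
  using ext_hom_expansion[OF M M' g] by blast
 have ls: "ls s : carrier K" and ps: "ps s : \<Phi>" if "s < n" for s using KM.dual_familyD[OF D that] by simp_all
 have "ph M'' \<phi> (h (g u)) = (finsum (M'') (%s. ph M'' (%y. \<phi> (ls s *_K y)) (h (Fm M M' (cmp M M' (ps s) g) u))) {..<n})"
  if p: "\<phi> : \<Phi>" and h: "h : HK M' M''" and u: "u : cvec M" for \<phi> h u
 proof -
  let ?v = "%s. Fm M M' (cmp M M' (ps s) g) u"
  have v: "?v s : cvec M'" if "s < n" for s
   by (rule HK_closed[OF Fm_hom[OF M M' cmp_hom[OF M M' ps[OF that] g]] u])
  have tc: "(%s. SB.scl (ext M') (ls s) (?v s)) : {..<n} \<rightarrow> carrier (ext M')" using ext_scl_closed[OF M' ls v] by simp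
  have hc: "(%s. h (SB.scl (ext M') (ls s) (?v s))) : {..<n} \<rightarrow> cvec M''" using HK_closed[OF h ext_scl_closed[OF M' ls v]] by simp
  have "h (g u) = (finsum (ext M'') (%s. h (SB.scl (ext M') (ls s) (?v s))) {..<n})"
   unfolding ex[OF u] by (rule SB.hom_finsum[OF ext_left[OF M'] ext_left[OF M''] h _ tc]) simp
  then have "ph M'' \<phi> (h (g u)) = (finsum (M'') (%s. ph M'' \<phi> (h (SB.scl (ext M') (ls s) (?v s)))) {..<n})"
   using ph_finsum[OF M'' p _ hc] by simp
  also have "... = (finsum (M'') (%s. ph M'' (%y. \<phi> (ls s *_K y)) (h (?v s))) {..<n})"
  proof (rule M''.finsum_cong'[OF refl])
   show "(%s. ph M'' (%y. \<phi> (ls s *_K y)) (h (?v s))) : {..<n} \<rightarrow> carrier M''"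
    using ph_closed[OF M'' Phi_shift[OF p ls] HK_closed[OF h v]] by simp
   fix s assume "s : {..<n}"
   then have s: "s < n" by simp
   show "ph M'' \<phi> (h (SB.scl (ext M') (ls s) (?v s))) = ph M'' (%y. \<phi> (ls s *_K y)) (h (?v s))"
    unfolding HK_scl[OF M' M'' h ls[OF s] v[OF s]] by (rule ph_scl[OF M'' p ls[OF s] HK_closed[OF h v[OF s]]])
  qed
  finally show ?thesis .
 qed
 then show ?thesis using D by blast
qed

text \<open>Coefficients of a composition are sums of compositions of coefficients.\<close>

lemma cmp_compose_mem:
 assumes M: "M : md" and M': "M' : md" and M'': "M'' : md" and g: "g : HK M M'" and h: "h : HK M' M''"
  and Y: "submodule Y kF (hom_space A M M'')"
  and mem: "!!\<phi> \<psi>. [|\<phi> : \<Phi>; \<psi> : \<Phi>|] ==> compose (carrier M) (cmp M' M'' \<phi> h) (cmp M M' \<psi> g) : Y" and p: "\<phi> : \<Phi>"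
 shows "cmp M M'' \<phi> (compose (cvec M) h g) : Y"
proof -
 interpret H: vspace kF "hom_space A M M''" by (rule SA.hom_space_vspace[OF M_left[OF M] M_left[OF M'']])
 obtain n ls ps where D: "KM.dual_family n ls ps" and ex: "!!\<phi> h u. [|\<phi> : \<Phi>; h : HK M' M''; u : cvec M|] ==>
  ph M'' \<phi> (h (g u)) = (finsum (M'') (%s. ph M'' (%y. \<phi> (ls s *_K y)) (h (Fm M M' (cmp M M' (ps s) g) u))) {..<n})"
  using cmp_compose_expansion[OF M M' M'' g] by blast
 have ls: "ls s : carrier K" and ps: "ps s : \<Phi>" if "s < n" for s using KM.dual_familyD[OF D that] by simp_all
 define T where "T s = compose (carrier M) (cmp M' M'' (%y. \<phi> (ls s *_K y)) h) (cmp M M' (ps s) g)" for s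
 have TY: "T s : Y" if "s < n" for s unfolding T_def by (rule mem[OF Phi_shift[OF p ls[OF that]] ps[OF that]])
 have YH: "Y <= mod_hom A M M''" using Y[unfolded H.submodule_iff] by simp
 have T: "T : {..<n} \<rightarrow> mod_hom A M M''" using TY YH by auto
 have sum: "finsum (hom_space A M M'') T {..<n} : Y" by (rule H.submodule_finsum[OF Y]) (use TY in auto)
 have "cmp M M'' \<phi> (compose (cvec M) h g) = finsum (hom_space A M M'') T {..<n}"
 proof (rule extensionalityI)
  show "cmp M M'' \<phi> (compose (cvec M) h g) : extensional (carrier M)" unfolding cmp_def by simp
  show "finsum (hom_space A M M'') T {..<n} : extensional (carrier M)" using sum YH hom_ext by blast
  fix m assume m: "m : carrier M"
  have e: "emb M m : cvec M" by (rule emb_closed[OF M m])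
  have gc: "cmp M M' (ps s) g m : carrier M'" if "s < n" for s by (rule hom_closed[OF cmp_hom[OF M M' ps[OF that] g] m])
  have "cmp M M'' \<phi> (compose (cvec M) h g) m = ph M'' \<phi> (h (g (emb M m)))" using m e by (simp add: cmp_apply compose_eq)
  also have "... = (finsum (M'') (%s. ph M'' (%y. \<phi> (ls s *_K y)) (h (Fm M M' (cmp M M' (ps s) g) (emb M m)))) {..<n})"
   by (rule ex[OF p h e])
  also have "... = (finsum (M'') (%s. T s m) {..<n})"
  proof -
   interpret M'': left_module A M'' by (rule M_left[OF M''])
   show ?thesis
   proof (rule M''.finsum_cong'[OF refl])
    show "(%s. T s m) : {..<n} \<rightarrow> carrier M''" using T hom_closed[OF _ m] by auto
    fix s assume "s : {..<n}"
    then have s: "s < n" by simp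
    show "ph M'' (%y. \<phi> (ls s *_K y)) (h (Fm M M' (cmp M M' (ps s) g) (emb M m))) = T s m"
     unfolding T_def Fm_emb[OF M M' cmp_hom[OF M M' ps[OF s] g] m] using m gc[OF s] by (simp add: compose_eq cmp_apply)
   qed
  qed
  also have "... = finsum (hom_space A M M'') T {..<n} m"
   by (rule SA.hom_space_finsum_apply[OF M_left[OF M] M_left[OF M''] _ T m, symmetric]) simp
  finally show "cmp M M'' \<phi> (compose (cvec M) h g) m = finsum (hom_space A M M'') T {..<n} m" .
 qed
 then show ?thesis using sum by simp
qed

end

section \<open>Radical homomorphisms and scalar extension\<close>

lemma (in scalar_algebra) rad_ideal:
 assumes U: "left_module B U"
 shows "ideal (rad B U U) (endo_ring U (mod_hom B U U))"
proof -
 interpret H: vspace F "hom_space B U U" by (rule hom_space_vspace[OF U U])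
 interpret U: left_module B U by (rule U)
 have C: "submodule (mod_hom B U U) F (hom_space B U U)" unfolding H.submodule_iff
  using H.M.zero_closed H.M.a_closed H.smult_closed by simp
 interpret E: ring "endo_ring U (mod_hom B U U)"
  by (rule endo_ring_ring[OF U C id_hom[OF U]]) (rule compose_hom[OF _ _ U])
 note r = rad_submodule[OF U U, unfolded H.submodule_iff]
 show ?thesis
 proof (rule idealI[OF E.ring_axioms])
  show "subgroup (rad B U U) (add_monoid (endo_ring U (mod_hom B U U)))"
  proof (rule group.subgroupI[OF E.a_group])
   show "rad B U U <= carrier (add_monoid (endo_ring U (mod_hom B U U)))" using rad_hom by auto
   show "rad B U U ~= {}" using rad_zero[OF U U] by blast
   fix f assume f: "f : rad B U U"
   have m1: "\<ominus> \<one> : carrier F" by simp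
   have s: "(\<lambda>u\<in>carrier U. scl U (\<ominus> \<one>) (f u)) : rad B U U" using r f m1 by auto
   have n: "scl U (\<ominus> \<one>) u +_U u = 0_U" if u: "u : carrier U" for u
   proof -
    have z: "scl U \<zero> u = 0_U"
    proof -
     have "scl U \<zero> u = scl U \<zero> u +_U scl U \<zero> u" using scl_add[OF U F.zero_closed F.zero_closed u] by simp
     then show ?thesis using U.add_eq_right_imp_zero[OF scl_closed[OF U F.zero_closed u] scl_closed[OF U F.zero_closed u]] by simp
    qed
    have "scl U (\<ominus> \<one>) u +_U scl U \<one> u = scl U \<zero> u" using scl_add[OF U m1 F.one_closed u] by (simp add: F.l_neg)
    then show ?thesis unfolding z scl_one[OF U u] .
   qed
   have e: "(\<lambda>u\<in>carrier U. scl U (\<ominus> \<one>) (f u)) = \<ominus>\<^bsub>endo_ring U (mod_hom B U U)\<^esub> f"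
   proof (rule E.minus_equality[symmetric])
    show "(\<lambda>u\<in>carrier U. scl U (\<ominus> \<one>) (f u)) \<oplus>\<^bsub>endo_ring U (mod_hom B U U)\<^esub> f = \<zero>\<^bsub>endo_ring U (mod_hom B U U)\<^esub>"
     using n hom_closed[OF rad_hom[OF f]] by (auto intro!: restrict_ext)
   qed (use rad_hom[OF f] rad_hom[OF s] in auto)
   show "inv\<^bsub>add_monoid (endo_ring U (mod_hom B U U))\<^esub> f : rad B U U"
    unfolding a_inv_def[symmetric] e[symmetric] by (rule s)
   fix g assume g: "g : rad B U U"
   show "f \<otimes>\<^bsub>add_monoid (endo_ring U (mod_hom B U U))\<^esub> g : rad B U U" using rad_add[OF U U f g] by simp
  qed
  fix f g assume "f : rad B U U" "g : carrier (endo_ring U (mod_hom B U U))"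
  then show "g \<otimes>\<^bsub>endo_ring U (mod_hom B U U)\<^esub> f : rad B U U" "f \<otimes>\<^bsub>endo_ring U (mod_hom B U U)\<^esub> g : rad B U U"
   using rad_left[OF U U U] rad_right[OF U U U] by simp_all
 qed
qed

lemma (in field) prime_char_exists:
 assumes "[(d::nat)] \<cdot> \<one> = \<zero>" "d > 0"
 shows "EX p. Factorial_Ring.prime (p::nat) \<and> [p] \<cdot> \<one> = \<zero>"
 using assms
proof (induction d rule: less_induct)
 case (less d)
 have "d ~= 1" using less.prems(1) one_not_zero by (auto simp: add.nat_pow_eone)
 then obtain p where p: "Factorial_Ring.prime p" "p dvd d" using prime_factor_nat by blast
 then obtain e where e: "d = p * e" by blast
 have "[p] \<cdot> \<one> \<otimes> [e] \<cdot> \<one> = [p] \<cdot> ([e] \<cdot> \<one>)" using add_pow_ldistr[of \<one> "[e] \<cdot> \<one>" p] by simp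
 also have "... = [d] \<cdot> \<one>" using add.nat_pow_pow[of \<one> p e] add.nat_pow_pow[of \<one> e p] e by (simp add: mult.commute)
 finally have "[p] \<cdot> \<one> = \<zero> \<or> [e] \<cdot> \<one> = \<zero>" using less.prems(1) integral[of "[p] \<cdot> \<one>" "[e] \<cdot> \<one>"] by simp
 then show ?case
 proof
  assume "[e] \<cdot> \<one> = \<zero>"
  moreover have "e > 0" "e < d" using less.prems(2) e prime_gt_1_nat[OF p(1)] by (auto intro: Nat.gr0I)
  ultimately show ?thesis using less.IH by blast
 qed (use p in blast)
qed

lemma (in abelian_monoid) finsum_const_lessThan:
 "x : carrier G ==> (\<Oplus>i\<in>{..<(n::nat)}. x) = [n] \<cdot> x"
proof (induction n)
 case (Suc n)
 have "(\<Oplus>i\<in>{..<Suc n}. x) = x \<oplus> (\<Oplus>i\<in>{..<n}. x)"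
  unfolding lessThan_Suc by (rule finsum_insert) (use Suc.prems in auto)
 then show ?case using Suc by (simp add: a_comm)
qed simp

context scalar_ext
begin

lemma ph_zero:
 assumes M: "M : md" and p: "\<phi> : \<Phi>"
 shows "ph M \<phi> (%j. 0_K) = 0_M"
proof -
 interpret M: left_module A M by (rule M_left[OF M])
 have c: "ph M \<phi> (%j. 0_K) : carrier M" by (rule ph_closed[OF M p cvec_zero[OF M]])
 have "ph M \<phi> (%j. 0_K) +_M ph M \<phi> (%j. 0_K) = ph M \<phi> (%j. 0_K)"
  using ph_add[OF M p cvec_zero[OF M] cvec_zero[OF M]] by simp
 then show ?thesis by (rule M.add_eq_right_imp_zero[OF c c])
qed

lemma cvec_zeroI:
 assumes M: "M : md" and u: "u : cvec M" and z: "!!\<phi>. \<phi> : \<Phi> ==> ph M \<phi> u = 0_M"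
 shows "u = (%j. 0_K)"
 by (rule cvec_eqI[OF M u cvec_zero[OF M]]) (simp add: z ph_zero[OF M])

text \<open>If an endomorphism has the identity as a coefficient, its trace has \<open>dim M\<close> as a value of a
 functional; but the trace of a nilpotent endomorphism is zero.\<close>

lemma nilpotent_identity_coefficient:
 assumes M: "M : md" and nz: "m0 : carrier M" "m0 ~= 0_M" and x: "x : HK M M"
  and nil: "!!u. u : cvec M ==> (x ^^ n) u = (%j. 0_K)"
  and p: "\<phi> : \<Phi>" and id: "!!m. m : carrier M ==> cmp M M \<phi> x m = m"
 shows "EX p. Factorial_Ring.prime (p::nat) \<and> [p] \<cdot>\<^bsub>K\<^esub> 1_K = 0_K"
proof -
 interpret M: left_module A M by (rule M_left[OF M])
 interpret E: left_module AK "ext M" by (rule ext_left[OF M])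
 interpret EU: vspace K "underlying_space AK (ext M)" by (rule SB.underlying_vspace[OF ext_left[OF M]])
 note bc = emb_closed[OF M bm_closed[OF M]]
 have fs: "EU.fin_separated" by (rule EU.fin_dim_imp_fin_separated[OF SB.fd_mod_fin_dim[OF ext_fd[OF M]]])
 have tr: "(finsum K (%j. x (emb M (bm M j)) j) {..<bd M}) = 0_K"
 proof (rule EU.trace_nilpotent[OF fs, where H = "cvec M" and m = n and f = x and w = "%j. emb M (bm M j)" and c = "%j u. u j"])
  show "x : carrier (underlying_space AK (ext M)) \<rightarrow> carrier (underlying_space AK (ext M))" using HK_closed[OF x] by simp
  show "x (u \<oplus>\<^bsub>underlying_space AK (ext M)\<^esub> v) = x u \<oplus>\<^bsub>underlying_space AK (ext M)\<^esub> x v"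
   if "u : carrier (underlying_space AK (ext M))" "v : carrier (underlying_space AK (ext M))" for u v
   using HK_add[OF x] that by simp
  show "x (d \<odot>\<^bsub>underlying_space AK (ext M)\<^esub> u) = d \<odot>\<^bsub>underlying_space AK (ext M)\<^esub> x u"
   if "d : carrier K" "u : carrier (underlying_space AK (ext M))" for d u
   using HK_scl[OF M M x] that by simp
  show "(x ^^ n) u = \<zero>\<^bsub>underlying_space AK (ext M)\<^esub>" if "u : carrier (underlying_space AK (ext M))" for u
   using nil that by simp
  show "submodule (cvec M) K (underlying_space AK (ext M))" unfolding EU.submodule_iff
   using cvec_zero[OF M] cvec_add[OF M] ext_scl_closed[OF M] by simp
  show "x ` cvec M <= cvec M" using HK_closed[OF x] by blast
  show "EU.dual_family (bd M) (%j. emb M (bm M j)) (%j u. u j)" by (rule ext_dual_basis(1)[OF M])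
  show "emb M (bm M i) : cvec M" if "i < bd M" for i by (rule bc[OF that])
  show "EU.dual_proj (bd M) (%j. emb M (bm M j)) (%j u. u j) h = h" if "h : cvec M" for h by (rule ext_dual_basis(2)[OF M that])
 qed
 have "\<phi> (finsum K (%j. x (emb M (bm M j)) j) {..<bd M}) = finsum kF (%j. \<phi> (x (emb M (bm M j)) j)) {..<bd M}"
  by (rule Phi_finsum[OF p]) (use cvecD[OF M HK_closed[OF x bc]] in auto)
 also have "... = finsum kF (%j. 1_K) {..<bd M}"
 proof (rule kF_finsum_cong[OF refl])
  fix j assume "j : {..<bd M}"
  then have j: "j < bd M" by simp
  have "\<phi> (x (emb M (bm M j)) j) = bc M j (ph M \<phi> (x (emb M (bm M j))))"
   by (rule bc_ph[OF M j p HK_closed[OF x bc[OF j]], symmetric])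
  also have "... = 1_K" using id[OF bm_closed[OF M j]] cmp_apply[OF bm_closed[OF M j]] bc_bm[OF M j j] by simp
  finally show "\<phi> (x (emb M (bm M j)) j) = 1_K" .
 qed (use k_one in simp)
 also have "... = add_pow kF (bd M) 1_K" by (rule abelian_monoid.finsum_const_lessThan[OF abelian_group.axioms(1)[OF kF_abelian]]) (use k_one in simp)
 finally have "add_pow kF (bd M) 1_K = 0_K" unfolding tr Phi_zero[OF p] by simp
 moreover have "add_pow kF n 1_K = [n] \<cdot>\<^bsub>K\<^esub> 1_K" for n :: nat
  by (induction n) (simp_all add: add_pow_def nat_pow_def)
 ultimately have "[bd M] \<cdot>\<^bsub>K\<^esub> 1_K = 0_K" by simp
 moreover have "bd M > 0"
 proof (rule ccontr)
  assume "\<not> bd M > 0"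
  then show False using M_expand[OF M nz(1)] nz(2) by simp
 qed
 ultimately show ?thesis by (rule K.prime_char_exists)
qed

lemma greatest_exists:
 fixes P :: "nat => bool"
 assumes "P a" "!!r. P r ==> r <= b"
 shows "EX r. P r \<and> (ALL r'. P r' --> r' <= r)"
 using GreatestI_nat[of P a b] Greatest_le_nat[of P _ b] assms by blast

text \<open>On a stable subspace \<open>Y\<close> of \<open>M\<close>, the radical maps into every maximal proper stable subspace; so the
 endomorphism moves the extension of \<open>Y\<close> into that of a smaller stable subspace.\<close>

lemma rad_coefficients_nilpotent:
 assumes M: "M : md" and z: "z : HK M M" and rd: "!!\<phi>. \<phi> : \<Phi> ==> cmp M M \<phi> z : rad A M M"
 shows "EX m. ALL u:cvec M. (z ^^ m) u = (%j. 0_K)"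
proof -
 interpret M: left_module A M by (rule M_left[OF M])
 interpret U: vspace kF "underlying_space A M" by (rule SA.underlying_vspace[OF M_left[OF M]])
 note LM = M_left[OF M]
 obtain rk :: "(nat => 'f) set => nat" and rb where
  rk: "!!H H'. [|submodule H kF (underlying_space A M); submodule H' kF (underlying_space A M); H \<subset> H'|] ==> rk H < rk H'"
  and rb: "!!H. rk H <= rb"
  by (rule U.subspace_rank[OF U.fin_dim_imp_fin_separated[OF SA.fd_mod_fin_dim[OF M]]]) blast
 define St where "St Y \<longleftrightarrow> submodule Y kF (underlying_space A M) \<and> (ALL s:mod_hom A M M. ALL y:Y. s y : Y)" for Y
 have StD: "Y <= carrier M" "0_M : Y" "!!x y. [|x : Y; y : Y|] ==> x +_M y : Y"
  "!!s y. [|s : mod_hom A M M; y : Y|] ==> s y : Y" "!!c y. [|c : k; y : Y|] ==> SA.scl M c y : Y" if "St Y" for Y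
  using that unfolding St_def U.submodule_iff by simp_all
 have StI: "St Y" if "Y <= carrier M" "0_M : Y" "!!x y. [|x : Y; y : Y|] ==> x +_M y : Y"
  "!!s y. [|s : mod_hom A M M; y : Y|] ==> s y : Y" for Y
 proof -
  have "SA.scl M c y : Y" if "c : k" "y : Y" for c y
   using \<open>!!s y. [|s : mod_hom A M M; y : Y|] ==> s y : Y\<close>[OF SA.scl_hom[OF LM, of c] that(2)] that \<open>Y <= carrier M\<close> by (simp add: subset_iff)
  then show ?thesis unfolding St_def U.submodule_iff using that by simp
 qed
 have St0: "St {0_M}" by (rule StI) (auto simp: SA.hom_zero[OF LM LM])
 have main: "EX m. ALL u:cvec M. (ALL \<phi>:\<Phi>. ph M \<phi> u : Y) --> (z ^^ m) u = (%j. 0_K)" if "St Y" for Y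
  using that
 proof (induction "rk Y" arbitrary: Y rule: less_induct)
  case less
  note Y = StD[OF less.prems]
  show ?case
  proof (cases "Y = {0_M}")
   case True
   have "(z ^^ 0) u = (%j. 0_K)" if "u : cvec M" "ALL \<phi>:\<Phi>. ph M \<phi> u : Y" for u
    using cvec_zeroI[OF M that(1)] that(2) True by simp
   then show ?thesis by blast
  next
   case False
   let ?P = "%r. EX X'. St X' \<and> X' \<subset> Y \<and> rk X' = r"
   have "?P (rk {0_M})" using St0 False Y(2) by (intro exI[of _ "{0_M}"]) auto
   moreover have "!!r. ?P r ==> r <= rb" using rb by (elim exE conjE) (erule subst)
   ultimately have ex: "EX r. ?P r \<and> (ALL r'. ?P r' --> r' <= r)" by (rule greatest_exists)
   from ex obtain r where r': "?P r \<and> (ALL r'. ?P r' --> r' <= r)" by (rule exE)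
   note r = conjunct1[OF r'] conjunct2[OF r']
   from r(1) obtain X' where X': "St X'" "X' \<subset> Y" "rk X' = r" by (elim exE conjE)
   have mx: "rk X'' <= rk X'" if "St X''" "X'' \<subset> Y" for X''
   proof -
    have "?P (rk X'')" by (intro exI[of _ X''] conjI refl that)
    then show ?thesis using r(2) unfolding X'(3) by simp
   qed
   note XD = StD[OF X'(1)]
   have JY: "r y : X'" if r: "r : rad A M M" and y: "y : Y" for r y
   proof (rule ccontr)
    assume no: "r y \<notin> X'"
    have yM: "y : carrier M" using y Y(1) by blast
    have ryM: "r y : carrier M" by (rule hom_closed[OF SA.rad_hom[OF r] yM])
    have ryY: "r y : Y" by (rule Y(4)[OF SA.rad_hom[OF r] y])
    \<comment> \<open>by maximality \<open>y\<close> is congruent to some \<open>s r y\<close> modulo \<open>X'\<close>, and \<open>1 - s r\<close> is invertible\<close>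
    define X2 where "X2 = {x +_M s (r y) | x s. x : X' \<and> s : mod_hom A M M}"
    have X2I: "x +_M s (r y) : X2" if "x : X'" "s : mod_hom A M M" for x s unfolding X2_def using that by blast
    have zh: "(\<lambda>u\<in>carrier M. 0_M) : mod_hom A M M" by (rule SA.zero_hom[OF LM LM])
    have X2Y: "X2 <= Y" unfolding X2_def using X'(2) Y(3)[OF _ Y(4)[OF _ ryY]] by auto
    have "X' <= X2"
    proof
     fix x assume x: "x : X'"
     then have "x : carrier M" using XD(1) by blast
     then show "x : X2" using X2I[OF x zh] ryM by simp
    qed
    moreover have "r y : X2" using X2I[OF XD(2) SA.id_hom[OF LM]] ryM by simp
    ultimately have ss: "X' \<subset> X2" using no by blast
    have St2: "St X2"
    proof (rule StI)
     show "X2 <= carrier M" using X2Y Y(1) by blast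
     show "0_M : X2" using ss XD(2) by blast
     show "v +_M w : X2" if vw: "v : X2" "w : X2" for v w
     proof -
      obtain x s where v: "v = x +_M s (r y)" "x : X'" "s : mod_hom A M M" using vw(1) unfolding X2_def by blast
      obtain x' s' where w: "w = x' +_M s' (r y)" "x' : X'" "s' : mod_hom A M M" using vw(2) unfolding X2_def by blast
      have cl: "x : carrier M" "x' : carrier M" "s (r y) : carrier M" "s' (r y) : carrier M"
       using v(2) w(2) XD(1) hom_closed[OF v(3) ryM] hom_closed[OF w(3) ryM] by auto
      have "v +_M w = (x +_M x') +_M (\<lambda>u\<in>carrier M. s u +_M s' u) (r y)"
       unfolding v(1) w(1) using cl ryM by (simp add: M.a_ac)
      then show ?thesis using X2I[OF XD(3)[OF v(2) w(2)] SA.add_hom[OF LM LM v(3) w(3)]] by simp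
     qed
     show "s' v : X2" if s': "s' : mod_hom A M M" and v': "v : X2" for s' v
     proof -
      obtain x s where v: "v = x +_M s (r y)" "x : X'" "s : mod_hom A M M" using v' unfolding X2_def by blast
      have "s' v = s' x +_M (compose (carrier M) s' s) (r y)"
       unfolding v(1) using hom_add[OF s' subsetD[OF XD(1) v(2)] hom_closed[OF v(3) ryM]] ryM by (simp add: compose_eq)
      then show ?thesis using X2I[OF XD(4)[OF s' v(2)] SA.compose_hom[OF v(3) s' LM]] by simp
     qed
    qed
    have "rk X' < rk X2" by (rule rk[OF _ _ ss]) (use X'(1) St2 St_def in auto)
    then have "X2 = Y" using mx[OF St2] X2Y by fastforce
    then obtain x s where xs: "y = x +_M s (r y)" "x : X'" "s : mod_hom A M M" using y unfolding X2_def by blast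
    let ?h = "\<lambda>m\<in>carrier M. m -_M s (r m)"
    have bij: "bij_betw ?h (carrier M) (carrier M)" by (rule SA.rad_bij[OF LM LM r xs(3)])
    have hh: "?h : mod_hom A M M"
     using SA.one_minus_hom[OF LM SA.compose_hom[OF SA.rad_hom[OF r] xs(3) LM]] by (simp add: compose_def cong: restrict_cong)
    obtain g where g: "g : mod_hom A M M" "!!u. u : carrier M ==> g (?h u) = u"
     using SA.hom_inverse_ex[OF LM LM hh bij] by blast
    have sM: "s (r y) : carrier M" by (rule hom_closed[OF xs(3) ryM])
    have xM: "x : carrier M" using xs(2) XD(1) by blast
    have "?h y = y -_M s (r y)" using yM by simp
    also have "... = (x +_M s (r y)) -_M s (r y)" using xs(1) by simp
    also have "... = x" using sM xM by (simp add: a_minus_def M.a_assoc M.r_neg)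
    finally have "y = g x" using g(2)[OF yM] by simp
    then have "y : X'" using XD(4)[OF g(1) xs(2)] by simp
    then show False using no XD(4)[OF SA.rad_hom[OF r]] by blast
   qed
   have zX: "ph M \<phi> (z u) : X'" if u: "u : cvec M" "ALL \<phi>:\<Phi>. ph M \<phi> u : Y" and p: "\<phi> : \<Phi>" for u \<phi>
   proof -
    obtain n ls ps where D: "KM.dual_family n ls ps" and ex: "!!\<phi> h u. [|\<phi> : \<Phi>; h : HK M M; u : cvec M|] ==>
     ph M \<phi> (h (z u)) = (finsum M (%s. ph M (%y. \<phi> (ls s *_K y)) (h (Fm M M (cmp M M (ps s) z) u))) {..<n})"
     using cmp_compose_expansion[OF M M M z] by blast
    have ls: "ls s : carrier K" and ps: "ps s : \<Phi>" if "s < n" for s using KM.dual_familyD[OF D that] by simp_all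
    have idh: "(\<lambda>u\<in>cvec M. u) : HK M M" using SB.id_hom[OF ext_left[OF M]] by simp
    have t: "ph M (%y. \<phi> (ls s *_K y)) (Fm M M (cmp M M (ps s) z) u) : X'"
     and f: "Fm M M (cmp M M (ps s) z) u : cvec M" if s: "s < n" for s
    proof -
     note q = Phi_shift[OF p ls[OF s]] and ch = cmp_hom[OF M M ps[OF s] z]
     show "ph M (%y. \<phi> (ls s *_K y)) (Fm M M (cmp M M (ps s) z) u) : X'"
      unfolding ph_Fm[OF M M ch u(1) q] by (rule JY[OF rd[OF ps[OF s]]]) (use u(2) q in blast)
     show "Fm M M (cmp M M (ps s) z) u : cvec M" by (rule HK_closed[OF Fm_hom[OF M M ch] u(1)])
    qed
    have "ph M \<phi> (z u) = (finsum M (%s. ph M (%y. \<phi> (ls s *_K y)) (Fm M M (cmp M M (ps s) z) u)) {..<n})"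
    proof -
     have "ph M \<phi> ((\<lambda>u\<in>cvec M. u) (z u)) = ph M \<phi> (z u)" using HK_closed[OF z u(1)] by simp
     moreover have "(finsum M (%s. ph M (%y. \<phi> (ls s *_K y)) ((\<lambda>u\<in>cvec M. u) (Fm M M (cmp M M (ps s) z) u))) {..<n})
      = (finsum M (%s. ph M (%y. \<phi> (ls s *_K y)) (Fm M M (cmp M M (ps s) z) u)) {..<n})"
      by (rule M.finsum_cong'[OF refl]) (use f t XD(1) in auto)
     ultimately show ?thesis using ex[OF p idh u(1)] by simp
    qed
    also have "... : X'"
     using U.submodule_finsum[of X' "{..<n}" "%s. ph M (%y. \<phi> (ls s *_K y)) (Fm M M (cmp M M (ps s) z) u)"] t X'(1)
     unfolding SA.finsum_underlying St_def by simp
    finally show ?thesis .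
   qed
   have "rk X' < rk Y" by (rule rk[OF _ _ X'(2)]) (use X'(1) less.prems St_def in auto)
   then obtain m where m: "!!u. [|u : cvec M; ALL \<phi>:\<Phi>. ph M \<phi> u : X'|] ==> (z ^^ m) u = (%j. 0_K)"
    using less.hyps[OF _ X'(1)] by blast
   have "(z ^^ Suc m) u = (%j. 0_K)" if u: "u : cvec M" "ALL \<phi>:\<Phi>. ph M \<phi> u : Y" for u
    unfolding funpow_Suc_right comp_apply by (rule m[OF HK_closed[OF z u(1)]]) (use zX[OF u] in blast)
   then show ?thesis by blast
  qed
 qed
 have "St (carrier M)" by (rule StI) (use hom_closed[of _ A M M] in auto)
 then obtain m where m: "!!u. [|u : cvec M; ALL \<phi>:\<Phi>. ph M \<phi> u : carrier M|] ==> (z ^^ m) u = (%j. 0_K)"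
  using main by blast
 show ?thesis using m ph_closed[OF M] by blast
qed

end

context scalar_ext
begin

text \<open>Endomorphisms of \<open>M\<close> in a subalgebra \<open>C\<close>, and the endomorphisms of the extended module with
 coefficients in \<open>C\<close>.\<close>

context
 fixes M :: "('a, nat => 'f) module" and C
 assumes M: "M : md" and C: "submodule C kF (hom_space A M M)" "(\<lambda>u\<in>carrier M. u) : C"
  "!!f g. [|f : C; g : C|] ==> compose (carrier M) f g : C"
begin

definition coeffs_in where "coeffs_in = {x : HK M M. ALL \<phi>:\<Phi>. cmp M M \<phi> x : C}"

lemma coeffs_in_iff: "x : coeffs_in \<longleftrightarrow> x : HK M M \<and> (ALL \<phi>:\<Phi>. cmp M M \<phi> x : C)"
 unfolding coeffs_in_def by blast

lemma C_hom: "f : C ==> f : mod_hom A M M"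
proof -
 interpret H: vspace kF "hom_space A M M" by (rule SA.hom_space_vspace[OF M_left[OF M] M_left[OF M]])
 show "f : C ==> f : mod_hom A M M" using C(1)[unfolded H.submodule_iff] by auto
qed

lemma C_closed: "[|f : C; g : C|] ==> (\<lambda>u\<in>carrier M. f u +_M g u) : C"
 "[|c : k; f : C|] ==> (\<lambda>u\<in>carrier M. SA.scl M c (f u)) : C" "(\<lambda>u\<in>carrier M. 0_M) : C"
proof -
 interpret H: vspace kF "hom_space A M M" by (rule SA.hom_space_vspace[OF M_left[OF M] M_left[OF M]])
 note C(1)[unfolded H.submodule_iff]
 then show "[|f : C; g : C|] ==> (\<lambda>u\<in>carrier M. f u +_M g u) : C"
  "[|c : k; f : C|] ==> (\<lambda>u\<in>carrier M. SA.scl M c (f u)) : C" "(\<lambda>u\<in>carrier M. 0_M) : C" by simp_all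
qed

lemma C_scalar: "c : k ==> (\<lambda>u\<in>carrier M. SA.scl M c u) : C"
 using C_closed(2)[OF _ C(2)] by (simp cong: restrict_cong)

lemma coeffs_in_submodule: "submodule coeffs_in K (hom_space AK (ext M) (ext M))"
proof -
 interpret H: vspace K "hom_space AK (ext M) (ext M)" by (rule SB.hom_space_vspace[OF ext_left[OF M] ext_left[OF M]])
 show ?thesis unfolding H.submodule_iff
 proof (intro conjI ballI)
  show "coeffs_in <= carrier (hom_space AK (ext M) (ext M))" unfolding coeffs_in_def by auto
  have z: "cmp M M \<phi> (\<lambda>u\<in>cvec M. %j. 0_K) = (\<lambda>u\<in>carrier M. 0_M)" if "\<phi> : \<Phi>" for \<phi>
   unfolding cmp_def by (rule restrict_ext) (simp add: emb_closed[OF M] ph_zero[OF M that])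
  show "\<zero>\<^bsub>hom_space AK (ext M) (ext M)\<^esub> : coeffs_in"
   unfolding coeffs_in_def using SB.zero_hom[OF ext_left[OF M] ext_left[OF M]] z C_closed(3) by simp
  show "x \<oplus>\<^bsub>hom_space AK (ext M) (ext M)\<^esub> y : coeffs_in" if "x : coeffs_in" "y : coeffs_in" for x y
   unfolding coeffs_in_def using SB.add_hom[OF ext_left[OF M] ext_left[OF M], of x y] cmp_add[OF M M, of _ x y] C_closed(1) that
   unfolding coeffs_in_def by simp
  show "c \<odot>\<^bsub>hom_space AK (ext M) (ext M)\<^esub> x : coeffs_in" if "c : carrier K" "x : coeffs_in" for c x
   unfolding coeffs_in_def using SB.scale_hom[OF ext_left[OF M] ext_left[OF M], of x c] cmp_scl[OF M M, of _ x c] Phi_shift that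
   unfolding coeffs_in_def by simp
 qed
qed

lemma coeffs_in_scalar: "x : carrier K ==> (\<lambda>u\<in>cvec M. SB.scl (ext M) x u) : coeffs_in"
 unfolding coeffs_in_def using SB.scl_hom[OF ext_left[OF M], of x] cmp_scl_id[OF M] C_scalar Phi_closed by simp

lemma coeffs_in_one: "(\<lambda>u\<in>cvec M. u) : coeffs_in"
proof -
 have "(\<lambda>u\<in>cvec M. SB.scl (ext M) 1_K u) = (\<lambda>u\<in>cvec M. u)"
  by (rule restrict_ext) (simp add: SB.scl_one[OF ext_left[OF M]])
 then show ?thesis using coeffs_in_scalar[OF K.one_closed] by simp
qed

lemma coeffs_in_compose:
 assumes "x : coeffs_in" "y : coeffs_in"
 shows "compose (cvec M) x y : coeffs_in"
proof -
 have h: "x : HK M M" "y : HK M M" and c: "!!\<phi>. \<phi> : \<Phi> ==> cmp M M \<phi> x : C" "!!\<phi>. \<phi> : \<Phi> ==> cmp M M \<phi> y : C"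
  using assms unfolding coeffs_in_def by auto
 have "compose (cvec M) x y : HK M M" using SB.compose_hom[OF h(2,1) ext_left[OF M]] by simp
 moreover have "cmp M M \<phi> (compose (cvec M) x y) : C" if "\<phi> : \<Phi>" for \<phi>
  by (rule cmp_compose_mem[OF M M M h(2,1) C(1) C(3)[OF c] that])
 ultimately show ?thesis unfolding coeffs_in_def by blast
qed

lemma coeffs_in_Fm:
 assumes "f : C"
 shows "Fm M M f : coeffs_in"
 unfolding coeffs_in_def using Fm_hom[OF M M C_hom[OF assms]] cmp_Fm[OF M M C_hom[OF assms]] C_closed(2)[OF Phi_closed assms] by simp

lemma endo_ring_ext:
 "ring_ext K k A (SA.endo_ring M C) (SB.endo_ring (ext M) coeffs_in) (Fm M M)
  (%x. \<lambda>u\<in>cvec M. SB.scl (ext M) x u) (cmp M M)"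
proof -
 interpret R: ring "SA.endo_ring M C" by (rule SA.endo_ring_ring[OF M_left[OF M] C])
 have co: "!!f g. [|f : coeffs_in; g : coeffs_in|] ==> compose (carrier (ext M)) f g : coeffs_in" using coeffs_in_compose by simp
 have on: "(\<lambda>u\<in>carrier (ext M). u) : coeffs_in" using coeffs_in_one by simp
 interpret S: ring "SB.endo_ring (ext M) coeffs_in"
  by (rule SB.endo_ring_ring[OF ext_left[OF M] coeffs_in_submodule on co])
 interpret E: left_module AK "ext M" by (rule ext_left[OF M])
 have xh: "x : HK M M" and xc: "\<phi> : \<Phi> ==> cmp M M \<phi> x : C" if "x : coeffs_in" for x \<phi>
  using that unfolding coeffs_in_def by auto
 note Fh = Fm_hom[OF M M C_hom]
 note Fe = Fm_emb[OF M M C_hom]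
 let ?L = "%x. \<lambda>u\<in>cvec M. SB.scl (ext M) x u"
 have Lh: "?L x : HK M M" if "x : carrier K" for x using SB.scl_hom[OF ext_left[OF M] that] by simp
 have eqI: "x = y" if "x : HK M M" "y : HK M M" "!!m. m : carrier M ==> x (emb M m) = y (emb M m)" for x y
  by (rule ext_hom_eqI[OF M ext_left[OF M] that])
 show ?thesis
 proof (unfold_locales, goal_cases)
  case (1 r)
  then show ?case using coeffs_in_Fm by simp
 next
  case (2 r r')
  then have c: "r : C" "r' : C" by simp_all
  have h: "(\<lambda>u\<in>cvec M. Fm M M r u \<oplus>\<^bsub>ext M\<^esub> Fm M M r' u) : HK M M"
   using SB.add_hom[OF ext_left[OF M] ext_left[OF M] Fh[OF c(1)] Fh[OF c(2)]] by simp
  have "Fm M M (\<lambda>u\<in>carrier M. r u +_M r' u) = (\<lambda>u\<in>cvec M. Fm M M r u \<oplus>\<^bsub>ext M\<^esub> Fm M M r' u)"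
   by (rule eqI[OF Fh[OF C_closed(1)[OF c]] h])
    (simp add: Fe c C_closed(1) emb_closed[OF M] emb_add[OF M] hom_closed[OF C_hom[OF c(1)]] hom_closed[OF C_hom[OF c(2)]])
  then show ?case by simp
 next
  case (3 r r')
  then have c: "r : C" "r' : C" by simp_all
  have h: "compose (cvec M) (Fm M M r) (Fm M M r') : HK M M"
   using SB.compose_hom[OF Fh[OF c(2)] Fh[OF c(1)] ext_left[OF M]] by simp
  have "Fm M M (compose (carrier M) r r') = compose (cvec M) (Fm M M r) (Fm M M r')"
   by (rule eqI[OF Fh[OF C(3)[OF c]] h])
    (simp add: Fe c C(3) emb_closed[OF M] hom_closed[OF C_hom[OF c(2)]] compose_eq)
  then show ?case by simp
 next
  case 4
  have "Fm M M (\<lambda>u\<in>carrier M. u) = (\<lambda>u\<in>cvec M. u)"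
   by (rule eqI[OF Fh[OF C(2)] xh[OF coeffs_in_one]]) (simp add: Fe C(2) emb_closed[OF M])
  then show ?case by simp
 next
  case (5 x)
  then show ?case using coeffs_in_scalar by simp
 next
  case (6 x y)
  have "?L (x *_K y) = compose (cvec M) (?L x) (?L y)" unfolding compose_def
   by (rule restrict_ext) (simp add: 6 SB.scl_mult[OF ext_left[OF M]] ext_scl_closed[OF M])
  then show ?case by simp
 next
  case 7
  show ?case using SB.scl_one[OF ext_left[OF M]] by (auto intro!: restrict_ext)
 next
  case (8 x y)
  have "?L (x +_K y) = (\<lambda>u\<in>cvec M. ?L x u \<oplus>\<^bsub>ext M\<^esub> ?L y u)"
   by (rule restrict_ext) (use 8 SB.scl_add[OF ext_left[OF M]] in simp)
  then show ?case by simp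
 next
  case (9 x s)
  then have s: "s : HK M M" using xh by simp
  have "compose (cvec M) (?L x) s = compose (cvec M) s (?L x)" unfolding compose_def
   by (rule restrict_ext) (simp add: HK_closed[OF s] HK_scl[OF M M s 9(1)] ext_scl_closed[OF M 9(1)])
  then show ?case by simp
 next
  case (10 \<phi> s)
  then show ?case using xc by simp
 next
  case (11 \<phi> s s')
  then show ?case using cmp_add[OF M M 11(1), of s s'] xh by simp
 next
  case (12 \<phi> r s)
  then show ?case using cmp_Fm_right[OF M M C_hom, of r M \<phi> s] by simp
 next
  case (13 \<phi> x s)
  then have s: "s : HK M M" using xh by simp
  have "compose (cvec M) (?L x) s = (\<lambda>u\<in>cvec M. SB.scl (ext M) x (s u))" unfolding compose_def
   by (rule restrict_ext) (simp add: HK_closed[OF s])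
  then show ?case using cmp_scl[OF M M 13(1) s 13(2)] by simp
 next
  case (14 \<phi> x)
  then show ?case using cmp_scl_id[OF M 14(1,2)] SA.scl_one[OF M_left[OF M]] by (auto intro!: restrict_ext)
 next
  case (15 \<phi> x)
  have z: "SA.scl M 0_K m = 0_M" if m: "m : carrier M" for m
  proof -
   have "ph M \<phi> (SB.scl (ext M) x (emb M m)) = 0_M" if "x = 0_K" "\<phi> : \<Phi>" for x \<phi>
    using ext_scl[OF M K.zero_closed emb_closed[OF M m]] cvecD[OF M emb_closed[OF M m]] ph_zero[OF M that(2)] that(1) by simp
   then show ?thesis using ph_scl_emb[OF M 15(1) K.zero_closed m] Phi_zero[OF 15(1)] 15(1) by simp
  qed
  show ?case using cmp_scl_id[OF M 15(1,2)] 15(3) z by (auto intro!: restrict_ext)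
 next
  case (16 s)
  then have sc: "s : coeffs_in" by simp
  then have s: "s : HK M M" using xh by simp
  obtain n ls ps where D: "KM.dual_family n ls ps"
   and ex: "!!u. u : cvec M ==> s u = (finsum (ext M) (%i. SB.scl (ext M) (ls i) (Fm M M (cmp M M (ps i) s) u)) {..<n})"
   using ext_hom_expansion[OF M M s] by blast
  have ls: "ls i : carrier K" and ps: "ps i : \<Phi>" if "i < n" for i using KM.dual_familyD[OF D that] by simp_all
  let ?T = "%i. compose (cvec M) (?L (ls i)) (Fm M M (cmp M M (ps i) s))"
  have Tc: "?T i : coeffs_in" if "i < n" for i
   by (rule coeffs_in_compose[OF coeffs_in_scalar[OF ls[OF that]] coeffs_in_Fm[OF xc[OF sc ps[OF that]]]])
  have D': "dual_on {..<n} ls ps"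
   using KM.dual_familyD[OF D] unfolding dual_on_def by simp
  have "s = finsum (SB.endo_ring (ext M) coeffs_in) ?T {..<n}"
  proof (rule hom_eqI[OF s])
   show "finsum (SB.endo_ring (ext M) coeffs_in) ?T {..<n} : HK M M"
    by (rule xh) (use S.finsum_closed[of ?T "{..<n}"] Tc in simp)
   fix u assume "u : carrier (ext M)"
   then have u: "u : cvec M" by simp
   have "finsum (SB.endo_ring (ext M) coeffs_in) ?T {..<n} u = (finsum (ext M) (%i. ?T i u) {..<n})"
    by (rule SB.endo_ring_finsum_apply[OF ext_left[OF M] coeffs_in_submodule on co]) (use Tc u in auto)
   also have "... = s u" unfolding ex[OF u]
   proof (rule E.finsum_cong'[OF refl])
    fix i assume "i : {..<n}"
    then have i: "i < n" by simp
    have fc: "Fm M M (cmp M M (ps i) s) u : cvec M" by (rule HK_closed[OF Fh[OF xc[OF sc ps[OF i]]] u])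
    show "?T i u = SB.scl (ext M) (ls i) (Fm M M (cmp M M (ps i) s) u)" using fc u by (simp add: compose_eq)
   next
    have fc: "Fm M M (cmp M M (ps i) s) u : cvec M" if i: "i < n" for i by (rule HK_closed[OF Fh[OF xc[OF sc ps[OF i]]] u])
    show "(%i. SB.scl (ext M) (ls i) (Fm M M (cmp M M (ps i) s) u)) : {..<n} \<rightarrow> carrier (ext M)"
     using ext_scl_closed[OF M ls fc] by simp
   qed
   finally show "s u = finsum (SB.endo_ring (ext M) coeffs_in) ?T {..<n} u" by simp
  qed
  then show ?case using D' by (intro exI[of _ "{..<n}"] exI[of _ ls] exI[of _ ps]) simp
 qed
qed

end

end

section \<open>Perfect base fields\<close>

locale perfect_ext = scalar_ext K k A for K :: "'f ring" and k and A :: "('f, 'a) module" +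
 assumes closure: "algebraic_closure K k" and perfect: "perfect_field (K(|carrier := k|))"
begin

sublocale AC: algebraic_closure K k by (rule closure)

lemma root_K:
 assumes p: "(p::nat) > 0" and x: "x : carrier K"
 shows "EX y:carrier K. y [^]\<^bsub>K\<^esub> p = x"
proof -
 let ?P = "(1_K # replicate (p - 1) 0_K) @ [-_K x]"
 have P: "?P : carrier (poly_ring K)"
  unfolding sym[OF univ_poly_carrier] polynomial_def using x K.one_not_zero by auto
 have len: "length ?P = Suc p" using p by simp
 have "size (K.roots ?P) = p" using AC.roots_over_carrier[OF P] len unfolding K.splitted_def by simp
 then obtain y where "y :# K.roots ?P" using p by (metis multiset_nonemptyE size_empty less_irrefl)
 then have "K.is_root ?P y" using K.roots_mem_iff_is_root[OF P] by simp
 then have y: "y : carrier K" "K.eval ?P y = 0_K" unfolding K.is_root_def by auto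
 have "K.eval ?P y = y [^]\<^bsub>K\<^esub> p +_K K.eval (replicate (p - 1) 0_K @ [-_K x]) y"
  using y(1) p by simp
 also have "K.eval (replicate (p - 1) 0_K @ [-_K x]) y = -_K x"
  using K.eval_replicate[of "[-_K x]" y "p - 1"] x y(1) by simp
 finally have "y [^]\<^bsub>K\<^esub> p -_K x = 0_K" using y(2) unfolding a_minus_def by simp
 then have "y [^]\<^bsub>K\<^esub> p = x" using K.a_minus_eq_zero_iff x y(1) by simp
 then show ?thesis using y(1) by blast
qed

lemma root_k:
 assumes p: "Factorial_Ring.prime (p::nat)" "[p] \<cdot>\<^bsub>K\<^esub> 1_K = 0_K" and c: "c : k"
 shows "EX d:k. d [^]\<^bsub>K\<^esub> p = c"
proof -
 have "add_pow kF n 1_K = [n] \<cdot>\<^bsub>K\<^esub> 1_K" for n :: nat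
  by (induction n) (simp_all add: add_pow_def nat_pow_def)
 moreover have "d [^]\<^bsub>kF\<^esub> n = d [^]\<^bsub>K\<^esub> n" for d and n :: nat
  by (induction n) (simp_all add: nat_pow_def)
 ultimately show ?thesis using perfect p c unfolding perfect_field_def by simp
qed

text \<open>After multiplication by an inverse, a coefficient outside the radical becomes the identity, which the
 trace excludes in characteristic zero. In positive characteristic the radical of the larger
 endomorphism ring is a nil ideal, and outside the radical of \<open>End M\<close> there are only units.\<close>

lemma rad_coefficients:
 assumes M: "M : md" "indecomposable A M" and x: "x : rad AK (ext M) (ext M)" and p: "\<phi> : \<Phi>"
 shows "cmp M M \<phi> x : rad A M M"
proof (rule ccontr)
 assume no: "cmp M M \<phi> x \<notin> rad A M M"
 note LM = M_left[OF M(1)] and LE = ext_left[OF M(1)]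
 interpret M: left_module A M by (rule LM)
 interpret H: vspace kF "hom_space A M M" by (rule SA.hom_space_vspace[OF LM LM])
 let ?C = "mod_hom A M M"
 have C: "submodule ?C kF (hom_space A M M)" unfolding H.submodule_iff
  using H.M.zero_closed H.M.a_closed H.smult_closed by simp
 note C2 = SA.id_hom[OF LM]
 have C3: "!!f g. [|f : ?C; g : ?C|] ==> compose (carrier M) f g : ?C" by (rule SA.compose_hom[OF _ _ LM])
 have S: "coeffs_in M ?C = HK M M"
  using coeffs_in_iff[OF M(1) C C2 C3] cmp_hom[OF M(1) M(1)] by blast
 interpret X: ring_ext K k A "SA.endo_ring M ?C" "SB.endo_ring (ext M) (HK M M)" "Fm M M"
  "%x. \<lambda>u\<in>cvec M. SB.scl (ext M) x u" "cmp M M"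
  using endo_ring_ext[OF M(1) C C2 C3] unfolding S .
 have HKs: "submodule (HK M M) K (hom_space AK (ext M) (ext M))" using coeffs_in_submodule[OF M(1) C C2 C3] unfolding S .
 note E2 = SB.id_hom[OF LE]
 have E3: "!!f g. [|f : HK M M; g : HK M M|] ==> compose (carrier (ext M)) f g : HK M M" by (rule SB.compose_hom[OF _ _ LE])
 note xh = SB.rad_hom[OF x]
 have ch: "cmp M M \<phi> x : ?C" by (rule cmp_hom[OF M(1) M(1) p xh])
 have inv: "EX r':?C. ALL m:carrier M. r' (r m) = m" if r: "r : ?C" "r \<notin> rad A M M" for r
  using SA.indecomposable_rad_or_bij[OF M r(1)] r(2) SA.hom_inverse_ex[OF LM LM r(1)] by blast
 obtain m0 where m0: "m0 : carrier M" "m0 ~= 0_M" using SA.indecomposable_nonzero[OF LM M(2)] by blast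
 have pow: "(y [^]\<^bsub>SB.endo_ring (ext M) (HK M M)\<^esub> n) u = (y ^^ n) u" if "y : HK M M" "u : cvec M" for y u and n :: nat
  by (rule SB.endo_ring_pow[OF LE HKs E2 E3]) (use that in simp_all)
 obtain q where q: "Factorial_Ring.prime (q::nat)" "[q] \<cdot>\<^bsub>K\<^esub> 1_K = 0_K"
 proof -
  obtain r' where r': "r' : ?C" "!!m. m : carrier M ==> r' (cmp M M \<phi> x m) = m" using inv[OF ch no] by blast
  let ?y = "compose (cvec M) (Fm M M r') x"
  have yr: "?y : rad AK (ext M) (ext M)"
   using SB.rad_left[OF LE LE LE x Fm_hom[OF M(1) M(1) r'(1)]] by simp
  obtain n where n: "!!u. u : cvec M ==> (?y ^^ n) u = (%j. 0_K)"
   using SB.rad_nilpotent[OF ext_fd[OF M(1)] yr] by auto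
  have "cmp M M \<phi> ?y m = m" if m: "m : carrier M" for m
   unfolding cmp_Fm_left[OF M(1) M(1) r'(1) M(1) p xh] using m r'(2)[OF m] by (simp add: compose_eq)
  then show ?thesis using nilpotent_identity_coefficient[OF M(1) m0 SB.rad_hom[OF yr] n p] that by blast
 qed
 have q0: "q > 0" using prime_gt_0_nat[OF q(1)] .
 have "rad AK (ext M) (ext M) <= X.coeff_ideal (rad A M M)"
 proof (rule X.nil_ideal_subset_coeff_ideal[OF SA.rad_ideal[OF LM] _ _ SB.rad_ideal[OF LE] _ _ q root_k[OF q] root_K[OF q0]])
  have "\<not> bij_betw (\<lambda>u\<in>carrier M. u) (carrier M) (carrier M)" if "(\<lambda>u\<in>carrier M. u) : rad A M M"
   by (rule SA.rad_not_bij[OF M that])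
  moreover have "bij_betw (\<lambda>u\<in>carrier M. u) (carrier M) (carrier M)" unfolding bij_betw_def inj_on_def by auto
  ultimately show "\<one>\<^bsub>SA.endo_ring M ?C\<^esub> \<notin> rad A M M" by auto
  fix r assume "r : carrier (SA.endo_ring M ?C)" "r \<notin> rad A M M"
  then obtain r' where r': "r' : ?C" "!!m. m : carrier M ==> r' (r m) = m" using inv[of r] by auto
  then show "EX r':carrier (SA.endo_ring M ?C). r' \<otimes>\<^bsub>SA.endo_ring M ?C\<^esub> r = \<one>\<^bsub>SA.endo_ring M ?C\<^esub>"
   by (intro bexI[of _ r']) (auto simp: compose_def intro!: restrict_ext)
 next
  fix y assume y: "y : rad AK (ext M) (ext M)"
  obtain n where n: "!!u. u : cvec M ==> (y ^^ n) u = (%j. 0_K)"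
   using SB.rad_nilpotent[OF ext_fd[OF M(1)] y] by auto
  have "y [^]\<^bsub>SB.endo_ring (ext M) (HK M M)\<^esub> n = \<zero>\<^bsub>SB.endo_ring (ext M) (HK M M)\<^esub>"
  proof (rule hom_eqI)
   show "y [^]\<^bsub>SB.endo_ring (ext M) (HK M M)\<^esub> n : HK M M" using X.S.nat_pow_closed[of y n] SB.rad_hom[OF y] by simp
   show "\<zero>\<^bsub>SB.endo_ring (ext M) (HK M M)\<^esub> : HK M M" using X.S.zero_closed by simp
   show "(y [^]\<^bsub>SB.endo_ring (ext M) (HK M M)\<^esub> n) u = \<zero>\<^bsub>SB.endo_ring (ext M) (HK M M)\<^esub> u" if "u : carrier (ext M)" for u
    using pow[OF SB.rad_hom[OF y], of u n] n[of u] that by simp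
  qed
  then show "EX m::nat. y [^]\<^bsub>SB.endo_ring (ext M) (HK M M)\<^esub> m = \<zero>\<^bsub>SB.endo_ring (ext M) (HK M M)\<^esub>" by blast
 next
  show "X.coeff_ideal (rad A M M) <= rad AK (ext M) (ext M)"
  proof
   fix y assume "y : X.coeff_ideal (rad A M M)"
   then have y: "y : HK M M" "!!\<phi>. \<phi> : \<Phi> ==> cmp M M \<phi> y : rad A M M" unfolding X.coeff_ideal_def by auto
   show "y : rad AK (ext M) (ext M)" unfolding SB.rad_iff[OF LE LE]
   proof (intro conjI ballI)
    fix g assume g: "g : HK M M"
    have gy: "compose (cvec M) g y : HK M M" using E3[OF g y(1)] by simp
    have "cmp M M \<psi> (compose (cvec M) g y) : rad A M M" if "\<psi> : \<Phi>" for \<psi>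
     by (rule cmp_compose_mem[OF M(1) M(1) M(1) y(1) g SA.rad_submodule[OF LM LM] SA.rad_left[OF LM LM LM y(2) cmp_hom[OF M(1) M(1) _ g]] that])
    then obtain n where n: "ALL u:cvec M. (compose (cvec M) g y ^^ n) u = (%j. 0_K)"
     using rad_coefficients_nilpotent[OF M(1) gy] by blast
    have "bij_betw (\<lambda>u\<in>carrier (ext M). u \<ominus>\<^bsub>ext M\<^esub> compose (cvec M) g y u) (carrier (ext M)) (carrier (ext M))"
     by (rule SB.nilpotent_one_minus_bij[OF LE gy, of n]) (use n in simp)
    then show "bij_betw (\<lambda>u\<in>carrier (ext M). u \<ominus>\<^bsub>ext M\<^esub> g (y u)) (carrier (ext M)) (carrier (ext M))"
     by (simp add: compose_def cong: restrict_cong)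
   qed (rule y(1))
  qed
 qed
 then show False using x no p unfolding X.coeff_ideal_def by blast
qed

end

lemma (in ring) commutes_finsum:
 assumes "finite I" "f : I \<rightarrow> carrier R" "x : carrier R" "!!i. i : I ==> x \<otimes> f i = f i \<otimes> x"
 shows "x \<otimes> finsum R f I = finsum R f I \<otimes> x"
proof -
 have "x \<otimes> finsum R f I = (\<Oplus>i\<in>I. x \<otimes> f i)" by (rule finsum_rdistr[OF assms(1,3,2)])
 also have "... = (\<Oplus>i\<in>I. f i \<otimes> x)" by (rule finsum_cong'[OF refl]) (use assms in auto)
 also have "... = finsum R f I \<otimes> x" by (rule finsum_ldistr[OF assms(1,3,2), symmetric])
 finally show ?thesis .
qed

lemma (in ring_ext) ext_commutative:
 assumes R: "!!r r'. [|r : carrier R; r' : carrier R|] ==> r *_R r' = r' *_R r"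
 shows "cring S"
proof -
 have comm_sum: "x *_S s = s *_S x" if x: "x : carrier S" and s: "s : carrier S"
  and xF: "!!r. r : carrier R ==> x *_S F r = F r *_S x" for x s
 proof -
  obtain I l q where D: "dual_on I l q" and e: "s = (finsum S (%i. L (l i) *_S F (cm (q i) s)) I)"
   using expand[OF s] by blast
  have fin: "finite I" and li: "!!i. i : I ==> l i : carrier K" and qi: "!!i. i : I ==> q i : \<Phi>"
   using D unfolding dual_on_def by auto
  have "x *_S (finsum S (%i. L (l i) *_S F (cm (q i) s)) I) = (finsum S (%i. L (l i) *_S F (cm (q i) s)) I) *_S x"
  proof (rule S.commutes_finsum[OF fin _ x])
   show "(%i. L (l i) *_S F (cm (q i) s)) : I \<rightarrow> carrier S" using LF_closed[OF li cm_closed[OF qi s]] by blast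
   fix i assume i: "i : I"
   note c = L_closed[OF li[OF i]] F_closed[OF cm_closed[OF qi[OF i] s]]
   have "x *_S (L (l i) *_S F (cm (q i) s)) = L (l i) *_S (x *_S F (cm (q i) s))"
    using L_central[OF li[OF i] x] c x by (simp add: S.m_assoc[symmetric])
   also have "... = L (l i) *_S F (cm (q i) s) *_S x" unfolding xF[OF cm_closed[OF qi[OF i] s]] using c x by (simp add: S.m_assoc)
   finally show "x *_S (L (l i) *_S F (cm (q i) s)) = L (l i) *_S F (cm (q i) s) *_S x" .
  qed
  then show ?thesis using e by simp
 qed
 have "F r *_S F r' = F r' *_S F r" if "r : carrier R" "r' : carrier R" for r r'
  using F_mult[OF that] F_mult[OF that(2,1)] R[OF that] by simp
 then have 1: "F r *_S s = s *_S F r" if "r : carrier R" "s : carrier S" for r s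
  using comm_sum[OF F_closed[OF that(1)] that(2)] that(1) by blast
 have "x *_S s = s *_S x" if "x : carrier S" "s : carrier S" for x s
  by (rule comm_sum[OF that]) (rule 1[OF _ that(1), symmetric])
 then show ?thesis
  by (intro cring.intro comm_monoid.intro comm_monoid_axioms.intro S.ring_axioms S.monoid_axioms) simp
qed

lemma (in scalar_algebra) additive_scl_finsum:
 assumes U: "left_module B U" and W: "left_module B W" and g: "!!u. u : carrier U ==> g u : carrier W"
  "!!u v. [|u : carrier U; v : carrier U|] ==> g (u +_U v) = g u +_W g v"
  "!!c u. [|c : carrier F; u : carrier U|] ==> g (scl U c u) = scl W c (g u)"
  and I: "finite I" and x: "!!i. i : I ==> x i : carrier F" "!!i. i : I ==> v i : carrier U"
 shows "g (finsum U (%i. scl U (x i) (v i)) I) = (finsum W (%i. scl W (x i) (g (v i))) I)"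
proof -
 interpret U: left_module B U by (rule U)
 interpret W: left_module B W by (rule W)
 have "g (finsum U (%i. scl U (x i) (v i)) I) = (finsum W (%i. g (scl U (x i) (v i))) I)"
  by (rule additive_finsum[OF U.abelian_group_axioms W.abelian_group_axioms _ _ I])
   (use g x scl_closed[OF U] in auto)
 also have "... = (finsum W (%i. scl W (x i) (g (v i))) I)"
  by (rule W.finsum_cong'[OF refl]) (use g x scl_closed[OF W] in auto)
 finally show ?thesis .
qed

context perfect_ext
begin

text \<open>A coefficient of \<open>f\<close>, followed by \<open>g\<close>, is a coefficient of a radical endomorphism of the extension of
 \<open>M\<close>, so the claim reduces to endomorphisms.\<close>

lemma rad_coefficients_from:
 assumes M: "M : md" "indecomposable A M" and V: "V : md" and f: "f : rad AK (ext M) (ext V)" and p: "\<phi> : \<Phi>"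
 shows "cmp M V \<phi> f : rad A M V"
proof -
 note LM = M_left[OF M(1)] and LV = M_left[OF V] and EM = ext_left[OF M(1)] and EV = ext_left[OF V]
 note fh = SB.rad_hom[OF f]
 show ?thesis unfolding SA.rad_iff[OF LM LV]
 proof (intro conjI ballI)
  show ch: "cmp M V \<phi> f : mod_hom A M V" by (rule cmp_hom[OF M(1) V p fh])
  fix g assume g: "g : mod_hom A V M"
  have a: "compose (cvec M) (Fm V M g) f : rad AK (ext M) (ext M)"
   using SB.rad_left[OF EM EV EM f Fm_hom[OF V M(1) g]] by simp
  have "compose (carrier M) g (cmp M V \<phi> f) : rad A M M"
   using rad_coefficients[OF M a p] unfolding cmp_Fm_left[OF V M(1) g M(1) p fh] .
  from SA.rad_bij[OF LM LM this SA.id_hom[OF LM]]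
  show "bij_betw (\<lambda>u\<in>carrier M. u -_M g (cmp M V \<phi> f u)) (carrier M) (carrier M)"
   using hom_closed[OF g] hom_closed[OF ch] by (simp add: compose_def cong: restrict_cong)
 qed
qed

lemma rad_coefficients_to:
 assumes M: "M : md" "indecomposable A M" and V: "V : md" and f: "f : rad AK (ext V) (ext M)" and p: "\<phi> : \<Phi>"
 shows "cmp V M \<phi> f : rad A V M"
proof -
 note LM = M_left[OF M(1)] and LV = M_left[OF V] and EM = ext_left[OF M(1)] and EV = ext_left[OF V]
 note fh = SB.rad_hom[OF f]
 show ?thesis unfolding SA.rad_iff[OF LV LM]
 proof (intro conjI ballI)
  show ch: "cmp V M \<phi> f : mod_hom A V M" by (rule cmp_hom[OF V M(1) p fh])
  fix g assume g: "g : mod_hom A M V"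
  have a: "compose (cvec M) f (Fm M V g) : rad AK (ext M) (ext M)"
   using SB.rad_right[OF EM EV EM f Fm_hom[OF M(1) V g]] by simp
  have "compose (carrier M) (cmp V M \<phi> f) g : rad A M M"
   using rad_coefficients[OF M a p] unfolding cmp_Fm_right[OF M(1) V g] .
  from SA.rad_bij[OF LM LM this SA.id_hom[OF LM]]
  have "bij_betw (\<lambda>u\<in>carrier M. u -_M cmp V M \<phi> f (g u)) (carrier M) (carrier M)"
   using hom_closed[OF g] hom_closed[OF ch] by (simp add: compose_def cong: restrict_cong)
  then show "bij_betw (\<lambda>u\<in>carrier V. u -_V g (cmp V M \<phi> f u)) (carrier V) (carrier V)"
   by (rule SA.one_minus_swap[OF LM LV g ch])
 qed
qed

lemma rad_coefficients_one_minus_bij: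
 assumes M: "M : md" and y: "y : HK M M" and c: "!!\<psi>. \<psi> : \<Phi> ==> cmp M M \<psi> y : rad A M M"
 shows "bij_betw (\<lambda>u\<in>cvec M. u \<ominus>\<^bsub>ext M\<^esub> y u) (cvec M) (cvec M)"
proof -
 obtain n where n: "ALL u:cvec M. (y ^^ n) u = (%j. 0_K)" using rad_coefficients_nilpotent[OF M y c] by blast
 have "bij_betw (\<lambda>u\<in>carrier (ext M). u \<ominus>\<^bsub>ext M\<^esub> y u) (carrier (ext M)) (carrier (ext M))"
  by (rule SB.nilpotent_one_minus_bij[OF ext_left[OF M] y, of n]) (use n in simp)
 then show ?thesis by simp
qed

lemma Fm_rad_from:
 assumes M: "M : md" and V: "V : md" and f: "f : rad A M V"
 shows "Fm M V f : rad AK (ext M) (ext V)"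
proof -
 note LM = M_left[OF M] and LV = M_left[OF V] and EM = ext_left[OF M] and EV = ext_left[OF V]
 note fh = SA.rad_hom[OF f]
 show ?thesis unfolding SB.rad_iff[OF EM EV]
 proof (intro conjI ballI)
  show Fh: "Fm M V f : HK M V" by (rule Fm_hom[OF M V fh])
  fix g assume g: "g : HK V M"
  have y: "compose (cvec M) g (Fm M V f) : HK M M" using SB.compose_hom[OF Fh g EM] by simp
  have "cmp M M \<psi> (compose (cvec M) g (Fm M V f)) : rad A M M" if "\<psi> : \<Phi>" for \<psi>
   unfolding cmp_Fm_right[OF M V fh] by (rule SA.rad_left[OF LM LV LM f cmp_hom[OF V M that g]])
  from rad_coefficients_one_minus_bij[OF M y this]
  show "bij_betw (\<lambda>u\<in>carrier (ext M). u \<ominus>\<^bsub>ext M\<^esub> g (Fm M V f u)) (carrier (ext M)) (carrier (ext M))"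
   by (simp add: compose_def cong: restrict_cong)
 qed
qed

text \<open>The last conjunct says that \<open>B\<close> spans \<open>L\<close> over \<open>k\<close>.\<close>

lemma finite_subextension:
 assumes S: "finite S" "S <= carrier K"
 shows "EX L B. subring L K \<and> k <= L \<and> S <= L \<and> (ALL y:L. y ~= 0_K --> inv\<^bsub>K\<^esub> y : L) \<and> finite B \<and> B <= L \<and>
  (ALL H. H <= carrier K \<and> 0_K : H \<and> (ALL x:H. ALL y:H. x +_K y : H) \<and> (ALL c:k. ALL x:H. c *_K x : H) \<and> B <= H --> L <= H)"
proof -
 obtain xs where xs: "set xs = S" using finite_list[OF S(1)] by blast
 then have xc: "set xs <= carrier K" using S(2) by simp
 note ks = subfieldE(1)[OF k_subfield]
 let ?L = "K.finite_extension k xs"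
 have al: "(K.algebraic over k) x" if "x : set xs" for x by (rule AC.algebraic_extension) (use that xc in blast)
 have sub: "subring ?L K" by (rule K.finite_extension_is_subring[OF ks xc])
 have Lc: "?L <= carrier K" by (rule subringE(1)[OF sub])
 have "K.finite_dimension k ?L" by (rule K.finite_extension_finite_dimension(1)[OF k_subfield xc al])
 then obtain n where "K.dimension n k ?L" unfolding K.finite_dimension_def by blast
 then obtain Us where Us: "set Us <= carrier K" "K.Span k Us = ?L" using K.exists_base[OF k_subfield] by blast
 have inv: "inv\<^bsub>K\<^esub> y : ?L" if y: "y : ?L" "y ~= 0_K" for y
 proof -
  have yc: "y : carrier K" using y(1) Lc by blast
  have sf: "subfield (K.simple_extension k y) K"
   using K.simple_extension_is_subfield[OF k_subfield yc] AC.algebraic_extension[OF yc] by blast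
  have "inv\<^bsub>K\<^esub> y : K.simple_extension k y"
   using K.subfield_m_inv(1)[OF sf] K.simple_extension_mem[OF ks yc] y(2) by blast
  moreover have "K.simple_extension k y <= ?L"
   by (rule K.simple_extension_subring_incl[OF sub K.finite_extension_incl[OF subringE(1)[OF ks] xc] y(1)])
  ultimately show ?thesis by blast
 qed
 have mn: "?L <= H" if H: "H <= carrier K" "0_K : H" "ALL x:H. ALL y:H. x +_K y : H" "ALL c:k. ALL x:H. c *_K x : H" "set Us <= H" for H
 proof -
  have m1: "-_K 1_K : k" by (rule subringE(5)[OF ks subringE(3)[OF ks]])
  have neg: "-_K x : H" if x: "x : H" for x
  proof -
   have "(-_K 1_K) *_K x = -_K x" using K.l_minus[of "1_K" x] H(1) x by auto
   then show ?thesis using H(4) m1 x by metis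
  qed
  have "subgroup H (add_monoid K)"
  proof (rule group.subgroupI[OF K.a_group])
   show "H <= carrier (add_monoid K)" using H(1) by simp
   show "H ~= {}" using H(2) by blast
   show "inv\<^bsub>add_monoid K\<^esub> x : H" if "x : H" for x using neg[OF that] unfolding a_inv_def .
   show "x \<otimes>\<^bsub>add_monoid K\<^esub> y : H" if "x : H" "y : H" for x y using H(3) that by simp
  qed
  then have "subalgebra k H K" using H(4) by (intro subalgebra.intro subalgebra_axioms.intro) auto
  then show ?thesis using K.subalgebra_Span_incl[OF k_subfield _ H(5)] Us(2) by simp
 qed
 have BL: "set Us <= ?L" using K.Span_base_incl[OF k_subfield Us(1)] Us(2) by simp
 show ?thesis
  by (rule exI[of _ ?L], rule exI[of _ "set Us"])
   (use sub K.finite_extension_incl[OF subringE(1)[OF ks] xc] K.finite_extension_mem[OF ks xc] xs inv BL mn in auto)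
qed

text \<open>The argument for radical endomorphisms, with a commutative field and its zero ideal in place of a local
 ring and its radical.\<close>

lemma reduced_coefficients:
 assumes V: "V : md" and C: "submodule C kF (hom_space A V V)" "(\<lambda>u\<in>carrier V. u) : C"
  "!!f g. [|f : C; g : C|] ==> compose (carrier V) f g : C"
  and comm: "!!f g. [|f : C; g : C|] ==> compose (carrier V) f g = compose (carrier V) g f"
  and inv: "!!f. [|f : C; f ~= (\<lambda>u\<in>carrier V. 0_V)|] ==> EX f':C. compose (carrier V) f' f = (\<lambda>u\<in>carrier V. u)"
  and x: "x : coeffs_in V C" and nil: "x [^]\<^bsub>SB.endo_ring (ext V) (coeffs_in V C)\<^esub> (n::nat) = \<zero>\<^bsub>SB.endo_ring (ext V) (coeffs_in V C)\<^esub>"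
 shows "x = \<zero>\<^bsub>SB.endo_ring (ext V) (coeffs_in V C)\<^esub>"
proof (rule ccontr)
 note LV = M_left[OF V] and EV = ext_left[OF V]
 let ?R = "SA.endo_ring V C" and ?S = "SB.endo_ring (ext V) (coeffs_in V C)"
 interpret X: ring_ext K k A ?R ?S "Fm V V" "%x. \<lambda>u\<in>cvec V. SB.scl (ext V) x u" "cmp V V"
  by (rule endo_ring_ext[OF V C])
 interpret S: cring ?S by (rule X.ext_commutative) (use comm in simp)
 note cs = coeffs_in_submodule[OF V C]
 have c1: "(\<lambda>u\<in>carrier (ext V). u) : coeffs_in V C" using coeffs_in_one[OF V C] by simp
 have c2: "!!f g. [|f : coeffs_in V C; g : coeffs_in V C|] ==> compose (carrier (ext V)) f g : coeffs_in V C"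
  using coeffs_in_compose[OF V C] by simp
 have hom: "y : HK V V" if "y : coeffs_in V C" for y using that coeffs_in_iff[OF V C] by blast
 have cc: "cmp V V \<psi> y : C" if "y : coeffs_in V C" "\<psi> : \<Phi>" for y \<psi> using that coeffs_in_iff[OF V C] by blast
 assume nz: "x ~= 0_?S"
 obtain \<phi> where p: "\<phi> : \<Phi>" "cmp V V \<phi> x ~= cmp V V \<phi> 0_?S"
  using cmp_eqI[OF V V hom[OF x] hom[of "0_?S"]] X.S.zero_closed nz by auto
 have z0: "cmp V V \<phi> 0_?S = (\<lambda>u\<in>carrier V. 0_V)" using X.cm_S_zero[OF p(1)] by simp
 let ?r = "cmp V V \<phi> x"
 have r: "?r : C" "?r ~= (\<lambda>u\<in>carrier V. 0_V)" using cc[OF x p(1)] p(2) z0 by auto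
 obtain r' where r': "r' : C" "compose (carrier V) r' ?r = (\<lambda>u\<in>carrier V. u)" using inv[OF r] by blast
 have "EX m:carrier V. ?r m ~= 0_V"
 proof (rule ccontr)
  assume no: "\<not> (EX m:carrier V. ?r m ~= 0_V)"
  have "?r = (\<lambda>u\<in>carrier V. 0_V)"
  proof (rule extensionalityI[of _ "carrier V"])
   show "?r : extensional (carrier V)" unfolding cmp_def by simp
   show "?r u = (\<lambda>u\<in>carrier V. 0_V) u" if "u : carrier V" for u using no that by auto
  qed simp
  then show False using r(2) by simp
 qed
 then obtain m where m: "m : carrier V" "?r m ~= 0_V" by blast
 have rm: "?r m : carrier V" by (rule hom_closed[OF C_hom[OF V C r(1)] m(1)])
 let ?y = "compose (cvec V) (Fm V V r') x"
 have Fr: "Fm V V r' : coeffs_in V C" by (rule coeffs_in_Fm[OF V C r'(1)])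
 have y: "?y : coeffs_in V C" by (rule coeffs_in_compose[OF V C Fr x])
 have xS: "x : carrier ?S" "Fm V V r' : carrier ?S" using x Fr by simp_all
 have ye: "?y = Fm V V r' *_?S x" by simp
 have "?y [^]\<^bsub>?S\<^esub> n = 0_?S"
  unfolding ye S.nat_pow_distrib[OF xS(2,1)] nil by (rule X.S.r_null) (rule X.S.nat_pow_closed[OF xS(2)])
 then have ny: "(?y ^^ n) u = (%j. 0_K)" if "u : cvec V" for u
  using SB.endo_ring_pow[OF EV cs c1 c2 y, of u n] that by simp
 have "cmp V V \<phi> ?y = compose (carrier V) r' ?r"
  by (rule cmp_Fm_left[OF V V C_hom[OF V C r'(1)] V p(1) hom[OF x]])
 then have idy: "cmp V V \<phi> ?y m = m" if "m : carrier V" for m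
  using fun_cong[OF r'(2), of m] that by simp
 obtain q where q: "Factorial_Ring.prime (q::nat)" "[q] \<cdot>\<^bsub>K\<^esub> 1_K = 0_K"
  using nilpotent_identity_coefficient[OF V rm m(2) hom[OF y] ny p(1) idy] by blast
 have "PIdl\<^bsub>?S\<^esub> x <= X.coeff_ideal {0_?R}"
 proof (rule X.nil_ideal_subset_coeff_ideal[OF X.R.zeroideal _ _ S.cgenideal_ideal[OF xS(1)] _ _ q root_k[OF q] root_K[OF prime_gt_0_nat[OF q(1)]]])
  show "1_?R \<notin> {0_?R}"
  proof
   assume "1_?R : {0_?R}"
   then have "(\<lambda>u\<in>carrier V. u) = (\<lambda>u\<in>carrier V. 0_V)" by simp
   from fun_cong[OF this, of "?r m"] show False using rm m(2) by simp
  qed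
  show "EX r':carrier ?R. r' *_?R r = 1_?R" if "r : carrier ?R" "r \<notin> {0_?R}" for r
   using inv[of r] that by simp
  fix z assume "z : PIdl\<^bsub>?S\<^esub> x"
  then obtain a where a: "a : carrier ?S" "z = a *_?S x" unfolding cgenideal_def by blast
  have "z [^]\<^bsub>?S\<^esub> n = 0_?S"
   unfolding a(2) S.nat_pow_distrib[OF a(1) xS(1)] nil by (rule X.S.r_null) (rule X.S.nat_pow_closed[OF a(1)])
  then show "EX m::nat. z [^]\<^bsub>?S\<^esub> m = 0_?S" by blast
 next
  show "X.coeff_ideal {0_?R} <= PIdl\<^bsub>?S\<^esub> x"
  proof
   fix z assume z: "z : X.coeff_ideal {0_?R}"
   then have zc: "z : coeffs_in V C" unfolding X.coeff_ideal_def by simp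
   have "z = 0_?S"
   proof (rule cmp_eqI[OF V V hom[OF zc] hom])
    show "0_?S : coeffs_in V C" using X.S.zero_closed by simp
    show "cmp V V \<psi> z = cmp V V \<psi> 0_?S" if "\<psi> : \<Phi>" for \<psi>
     using z that X.cm_S_zero[OF that] unfolding X.coeff_ideal_def by simp
   qed
   then show "z : PIdl\<^bsub>?S\<^esub> x"
    using additive_subgroup.zero_closed[OF ideal.axioms(1)[OF S.cgenideal_ideal[OF xS(1)]]] by simp
  qed
 qed
 then have "x : X.coeff_ideal {0_?R}" using X.S.cgenideal_self[OF xS(1)] by blast
 then show False using p(1) r(2) unfolding X.coeff_ideal_def by simp
qed

end

context perfect_ext
begin

text \<open>Every \<open>A_K\<close>-module \<open>W\<close> is defined over a finite extension \<open>L\<close> of \<open>k\<close>: it contains an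
 \<open>A\<close>-module \<open>V\<close>, an \<open>L\<close>-form of \<open>W\<close>. The extension of \<open>V\<close> to \<open>K\<close> maps onto \<open>W\<close>, and splits because
 the action of \<open>L\<close> on it, having reduced scalar extension, is diagonalisable.\<close>

lemma extended_summand:
 assumes W: "W : fd_mod K AK"
 shows "EX V:md. SB.summand W (ext V)"
proof -
 note LW = SB.fd_mod_left[OF W]
 interpret W: left_module AK W by (rule LW)
 interpret WU: vspace K "underlying_space AK W" by (rule SB.underlying_vspace[OF LW])
 obtain d :: nat and w c where D: "WU.dual_family d w c" and fx: "!!u. u : carrier (underlying_space AK W) ==> WU.dual_proj d w c u = u"
  by (rule WU.fin_dim_dual_basis[OF SB.fd_mod_fin_dim[OF W]]) blast
 have wc: "w j : carrier W" and cl: "c j : lin_func K (underlying_space AK W)" if "j < d" for j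
  using WU.dual_familyD[OF D that] by simp_all
 have cw: "c i (w j) = (if i = j then 1_K else 0_K)" if "i < d" "j < d" for i j using WU.dual_familyD(3)[OF D that] .
 have cc: "c j u : carrier K" if "j < d" "u : carrier W" for j u using WU.lf_closed[OF cl[OF that(1)]] that(2) by simp
 have ca: "c j (u +_W v) = c j u +_K c j v" if "j < d" "u : carrier W" "v : carrier W" for j u v
  using WU.lf_add[OF cl[OF that(1)]] that(2,3) by simp
 have csm: "c j (SB.scl W x u) = x *_K c j u" if "j < d" "x : carrier K" "u : carrier W" for j x u
  using WU.lf_smult[OF cl[OF that(1)]] that(2,3) by simp
 have cz: "c j 0_W = 0_K" if "j < d" for j using WU.lin_func_zero[OF cl[OF that]] by simp
 have cneg: "c j (-_W u) = -_K c j u" if "j < d" "u : carrier W" for j u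
  using WU.lin_func_minus[OF cl[OF that(1)]] that(2) by simp
 have ex: "(finsum W (%j. SB.scl W (c j u) (w j)) {..<d}) = u" if "u : carrier W" for u
  using fx[of u] that unfolding WU.dual_proj_def SB.finsum_underlying by simp
 note sW = SB.scl_closed[OF LW]
 have tA: "t 1_K a : carrier AK" if "a : carrier A" for a using t_closed that by simp
 have tW: "t 1_K a \<odot>_W u : carrier W" if "a : carrier A" "u : carrier W" for a u by (rule W.act_closed[OF tA[OF that(1)] that(2)])
 have tk: "t 1_K (x \<odot>_A a) \<odot>_W u = SB.scl W x (t 1_K a \<odot>_W u)" if x: "x : k" and a: "a : carrier A" and u: "u : carrier W" for x a u
 proof -
  have "t 1_K (x \<odot>_A a) = t x a" using t_balanced[of "1_K" x a] x a kK by simp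
  then show ?thesis using t_act_split[OF LW kK[OF x] a u] t_scl[OF kK[OF x]] by simp
 qed
 obtain S where S: "finite S" "S <= carrier A" "lin_span kF A S = carrier A" using A.fin_dim unfolding fin_dim_def by blast
 let ?T = "(%(a, i, j). c i (t 1_K a \<odot>_W w j)) ` (S \<times> {..<d} \<times> {..<d})"
 have T: "finite ?T" "?T <= carrier K" using S cc tW wc by auto
 obtain L B where L: "subring L K" "k <= L" "?T <= L" and Linv: "ALL y:L. y ~= 0_K --> inv\<^bsub>K\<^esub> y : L" and B: "finite B" "B <= L"
  and LB: "ALL H. H <= carrier K \<and> 0_K : H \<and> (ALL x:H. ALL y:H. x +_K y : H) \<and> (ALL c:k. ALL x:H. c *_K x : H) \<and> B <= H --> L <= H"
  using finite_subextension[OF T] by (elim exE conjE)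
 note Lr = subringE[OF L(1)]
 have Lc: "x : carrier K" if "x : L" for x using Lr(1) that by blast
 have Lsum: "finsum K f I : L" if "finite I" "!!i. i : I ==> f i : L" for f and I :: "nat set"
  using that
 proof (induction I rule: finite_induct)
  case (insert i I)
  have f: "f : I \<rightarrow> carrier K" "f i : carrier K" using insert.prems Lc by blast+
  have "f i : L" "finsum K f I : L" using insert by blast+
  then show ?case unfolding K.finsum_insert[OF insert.hyps f] by (rule Lr(7))
 qed (simp add: Lr(2))
 have Lco: "c i (t 1_K a \<odot>_W w j) : L" if a: "a : carrier A" and i: "i < d" and j: "j < d" for a i j
 proof -
  let ?H = "{a : carrier A. c i (t 1_K a \<odot>_W w j) : L}"
  have "submodule ?H kF A" unfolding module.submodule_iff[OF A.module_axioms]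
  proof (intro conjI ballI)
   have "t 1_K 0_A = \<zero>\<^bsub>AK\<^esub>"
    by (rule additive_zero[OF ring.axioms(1)[OF A.A.ring_axioms] ring.axioms(1)[OF AK_ring]]) (auto simp: t_closed t_add_right)
   then show "0_A : ?H" using W.zero_act[OF wc[OF j]] cz[OF i] Lr(2) by simp
   fix a b assume "a : ?H" "b : ?H"
   then show "a +_A b : ?H"
    using t_add_right[of "1_K" a b] W.act_l_distr[OF tA tA wc[OF j], of a b] ca[OF i tW tW, of a "w j" b "w j"] wc[OF j] Lr(7) by simp
  next
   fix x a assume "x : carrier kF" "a : ?H"
   then show "x \<odot>_A a : ?H"
    using tk[of x a "w j"] csm[OF i kK tW, of x a "w j"] wc[OF j] L(2) Lr(6) A_smult_closed by auto
  qed auto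
  moreover have "S <= ?H" using S(2) L(3) i j by force
  ultimately have "lin_span kF A S <= ?H" unfolding lin_span_def by blast
  then show ?thesis using a S(3) by blast
 qed
 \<comment> \<open>the \<open>L\<close>-span of the basis \<open>w\<close>\<close>
 define Vc where "Vc = {u : carrier W. ALL j<d. c j u : L}"
 define V :: "('a, nat => 'f) module" where
  "V = (|carrier = Vc, monoid.mult = undefined, one = undefined, ring.zero = 0_W, ring.add = ring.add W, smult = (%a u. t 1_K a \<odot>_W u)|)"
 have Vs [simp]: "carrier V = Vc" "0_V = 0_W" "u +_V v = u +_W v" "a \<odot>_V u = t 1_K a \<odot>_W u" for u v a
  unfolding V_def by simp_all
 have VW: "u : carrier W" if "u : Vc" for u using that unfolding Vc_def by simp
 have VL: "c j u : L" if "u : Vc" "j < d" for u j using that unfolding Vc_def by simp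
 have VI: "u : Vc" if "u : carrier W" "!!j. j < d ==> c j u : L" for u using that unfolding Vc_def by simp
 have wV: "w j : Vc" if "j < d" for j by (rule VI[OF wc[OF that]]) (use cw that Lr(2,3) in auto)
 have aV: "u +_W v : Vc" if "u : Vc" "v : Vc" for u v by (rule VI) (use that VW VL ca Lr(7) in auto)
 have sV: "SB.scl W x u : Vc" if "x : L" "u : Vc" for x u by (rule VI) (use that VW VL csm Lc sW Lr(6) in auto)
 have tsum: "t 1_K a \<odot>_W u = (finsum W (%j. SB.scl W (c j u) (t 1_K a \<odot>_W w j)) {..<d})" if a: "a : carrier A" and u: "u : carrier W" for a u
 proof -
  have "t 1_K a \<odot>_W (finsum W (%j. SB.scl W (c j u) (w j)) {..<d}) = (finsum W (%j. SB.scl W (c j u) (t 1_K a \<odot>_W w j)) {..<d})"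
   by (rule SB.additive_scl_finsum[OF LW LW, of "%u. t 1_K a \<odot>_W u"])
    (use tW a W.act_r_distr[OF tA[OF a]] SB.scl_act[OF LW _ tA[OF a]] cc u wc in auto)
  then show ?thesis unfolding ex[OF u] .
 qed
 have tV: "t 1_K a \<odot>_W u : Vc" if a: "a : carrier A" and u: "u : Vc" for a u
 proof (rule VI[OF tW[OF a VW[OF u]]])
  fix i assume i: "i < d"
  have tc: "(%j. SB.scl W (c j u) (t 1_K a \<odot>_W w j)) : {..<d} \<rightarrow> carrier W" using sW cc VW[OF u] tW a wc by auto
  have "c i (t 1_K a \<odot>_W u) = finsum K (%j. c i (SB.scl W (c j u) (t 1_K a \<odot>_W w j))) {..<d}"
   unfolding tsum[OF a VW[OF u]]
   by (rule additive_finsum[OF W.abelian_group_axioms K.abelian_group_axioms _ _ _ tc]) (use cc ca i in auto)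
  also have "... : L"
  proof (rule Lsum)
   fix j assume "j : {..<d}"
   then have j: "j < d" by simp
   show "c i (SB.scl W (c j u) (t 1_K a \<odot>_W w j)) : L"
    unfolding csm[OF i cc[OF j VW[OF u]] tW[OF a wc[OF j]]] by (rule Lr(6)[OF VL[OF u j] Lco[OF a i j]])
  qed simp
  finally show "c i (t 1_K a \<odot>_W u) : L" .
 qed
 have abV: "abelian_group V"
 proof (rule abelian_groupI)
  show "0_V : carrier V" using VI[of "0_W"] cz Lr(2) by simp
  fix u assume "u : carrier V"
  then have u: "u : Vc" by simp
  have "-_W u : Vc" by (rule VI) (use u VW VL cneg Lr(5) in auto)
  then show "EX v:carrier V. v +_V u = 0_V" using W.l_neg[OF VW[OF u]] by auto
 qed (use aV VW in "auto simp: W.a_ac")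
 have LV: "left_module A V"
 proof (intro left_module.intro abV A.A.ring_axioms left_module_axioms.intro)
  fix a b u assume a: "a : carrier A" and b: "b : carrier A" and "u : carrier V"
  then have u: "u : carrier W" using VW by simp
  show "(a +_A b) \<odot>_V u = a \<odot>_V u +_V b \<odot>_V u"
   using t_add_right[OF K.one_closed a b] W.act_l_distr[OF tA[OF a] tA[OF b] u] by simp
  show "(a *_A b) \<odot>_V u = a \<odot>_V (b \<odot>_V u)"
   using t_mult[OF K.one_closed a K.one_closed b] W.act_assoc[OF tA[OF a] tA[OF b] u] by simp
 next
  fix u assume "u : carrier V"
  then show "1_A \<odot>_V u = u" using W.act_one[of u] VW AK_one by simp
 qed (use tV VW W.act_r_distr tA in auto)
 interpret V: left_module A V by (rule LV)
 interpret VU: vspace kF "underlying_space A V" by (rule SA.underlying_vspace[OF LV])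
 have sclV: "SA.scl V x u = SB.scl W x u" if "x : k" "u : Vc" for x u
  unfolding SA.scl_def using tk[OF that(1) A.A.one_closed VW[OF that(2)]] W.act_one[OF VW[OF that(2)]] AK_one by simp
 have fd: "fin_dim kF (underlying_space A V)" unfolding fin_dim_def
 proof (intro exI conjI)
  let ?S = "(%(b, j). SB.scl W b (w j)) ` (B \<times> {..<d})"
  show "finite ?S" using B(1) by simp
  show S: "?S <= carrier (underlying_space A V)" using sV wV B(2) by auto
  have "u : H" if u: "u : Vc" and H: "submodule H kF (underlying_space A V)" "?S <= H" for u H
  proof -
   note H' = H(1)[unfolded VU.submodule_iff]
   have tH: "SB.scl W x (w j) : H" if j: "j < d" and x: "x : L" for x j
   proof -
    let ?H = "{x : L. SB.scl W x (w j) : H}"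
    have z: "SB.scl W 0_K (w j) = 0_W"
     by (rule W.add_eq_right_imp_zero[OF sW[OF K.zero_closed wc[OF j]] sW[OF K.zero_closed wc[OF j]]])
      (use SB.scl_add[OF LW K.zero_closed K.zero_closed wc[OF j]] in simp)
    have "L <= ?H"
    proof (rule LB[rule_format], intro conjI ballI)
     show "?H <= carrier K" using Lc by blast
     show "0_K : ?H" using z H' Lr(2) by simp
     show "B <= ?H" using B(2) H(2) j by auto
     show "x +_K y : ?H" if "x : ?H" "y : ?H" for x y
      using that SB.scl_add[OF LW Lc Lc wc[OF j], of x y] H' Lr(7) by simp
     show "q *_K x : ?H" if q: "q : k" and "x : ?H" for q x
     proof -
      have x: "x : L" "SB.scl W x (w j) : H" using that by auto
      have "SA.scl V q (SB.scl W x (w j)) : H" using H' q x(2) by simp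
      then have "SB.scl W (q *_K x) (w j) : H"
       unfolding SB.scl_mult[OF LW kK[OF q] Lc[OF x(1)] wc[OF j]] sclV[OF q sV[OF x(1) wV[OF j]]] .
      then show ?thesis using Lr(6)[OF subsetD[OF L(2) q] x(1)] by blast
     qed
    qed
    then show ?thesis using x by blast
   qed
   have "finsum W f I : H" if "finite I" "!!i. i : I ==> f i : H" for f and I :: "nat set"
    using that
   proof (induction I rule: finite_induct)
    case (insert i I)
    have HW: "H <= carrier W" using H' VW by auto
    have f: "f : I \<rightarrow> carrier W" "f i : carrier W" using insert.prems HW by blast+
    have "f i : H" "finsum W f I : H" using insert by blast+
    then show ?case unfolding W.finsum_insert[OF insert.hyps f] using H' by simp
   qed (use H' in simp)
   from this[of "{..<d}" "%j. SB.scl W (c j u) (w j)"] show ?thesis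
    unfolding ex[OF VW[OF u]] using tH VL[OF u] by blast
  qed
  moreover have "lin_span kF (underlying_space A V) ?S <= carrier (underlying_space A V)"
   using VU.lin_span_submodule[OF S] unfolding VU.submodule_iff by blast
  ultimately show "lin_span kF (underlying_space A V) ?S = carrier (underlying_space A V)"
   unfolding lin_span_def by auto
 qed
 have V: "V : md" unfolding fd_mod_def using LV fd by simp
 note EV = ext_left[OF V]
 interpret E: left_module AK "ext V" by (rule EV)
 \<comment> \<open>the action of \<open>L\<close> on \<open>V\<close>; on the extension of \<open>V\<close> there is the scalar action of \<open>L\<close> as well\<close>
 define hat where "hat x = (\<lambda>u\<in>Vc. SB.scl W x u)" for x
 have hat: "hat x u = SB.scl W x u" if "u : Vc" for x u unfolding hat_def using that by simp
 have hath: "hat x : mod_hom A V V" if x: "x : L" for x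
  by (rule homI) (use x hat sV aV tV VW SB.scl_add_right[OF LW Lc[OF x]] SB.scl_act[OF LW Lc[OF x] tA] in "auto simp: hat_def")
 define C where "C = hat ` L"
 interpret HV: vspace kF "hom_space A V V" by (rule SA.hom_space_vspace[OF LV LV])
 have h0: "(\<lambda>u\<in>carrier V. 0_V) = hat 0_K"
 proof -
  have "SB.scl W 0_K u = 0_W" if "u : carrier W" for u
   by (rule W.add_eq_right_imp_zero[OF sW[OF K.zero_closed that] sW[OF K.zero_closed that]])
    (use SB.scl_add[OF LW K.zero_closed K.zero_closed that] in simp)
  then show ?thesis unfolding hat_def by (auto simp: VW intro!: restrict_ext)
 qed
 have hadd: "(\<lambda>u\<in>carrier V. hat x u +_V hat y u) = hat (x +_K y)" if "x : L" "y : L" for x y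
  unfolding hat_def by (auto simp: VW SB.scl_add[OF LW Lc[OF that(1)] Lc[OF that(2)]] intro!: restrict_ext)
 have hmul: "compose (carrier V) (hat x) (hat y) = hat (x *_K y)" if "x : L" "y : L" for x y
  unfolding hat_def compose_def by (auto simp: VW sV[OF that(2)] SB.scl_mult[OF LW Lc[OF that(1)] Lc[OF that(2)]] intro!: restrict_ext)
 have hone: "(\<lambda>u\<in>carrier V. u) = hat 1_K"
  unfolding hat_def by (auto simp: VW SB.scl_one[OF LW] intro!: restrict_ext)
 have C1: "submodule C kF (hom_space A V V)" unfolding HV.submodule_iff
 proof (intro conjI ballI)
  show "C <= carrier (hom_space A V V)" unfolding C_def using hath by auto
  show "\<zero>\<^bsub>hom_space A V V\<^esub> : C" using h0 Lr(2) unfolding C_def by simp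
  fix f g assume "f : C" "g : C"
  then obtain x y where "f = hat x" "g = hat y" "x : L" "y : L" unfolding C_def by blast
  then show "f \<oplus>\<^bsub>hom_space A V V\<^esub> g : C" using hadd Lr(7) unfolding C_def by simp
 next
  fix q f assume q: "q : carrier kF" and "f : C"
  then obtain x where x: "f = hat x" "x : L" unfolding C_def by blast
  have qk: "q : k" using q by simp
  have "(\<lambda>u\<in>carrier V. SA.scl V q (f u)) = compose (carrier V) (hat q) (hat x)"
   unfolding x(1) compose_def by (rule restrict_ext) (simp add: hat sV[OF x(2)] sclV[OF qk])
  then show "q \<odot>\<^bsub>hom_space A V V\<^esub> f : C" using hmul[OF _ x(2), of q] L(2) qk Lr(6) x(2) unfolding C_def by auto
 qed
 have C2: "(\<lambda>u\<in>carrier V. u) : C" unfolding hone C_def using Lr(3) by blast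
 have C3: "compose (carrier V) f g : C" if "f : C" "g : C" for f g
  using that hmul Lr(6) unfolding C_def by (elim imageE) simp
 have Ccomm: "compose (carrier V) f g = compose (carrier V) g f" if "f : C" "g : C" for f g
  using that hmul K.m_comm Lc unfolding C_def by (elim imageE) simp
 have Cinv: "EX f':C. compose (carrier V) f' f = (\<lambda>u\<in>carrier V. u)" if f: "f : C" "f ~= (\<lambda>u\<in>carrier V. 0_V)" for f
 proof -
  obtain x where x: "f = hat x" "x : L" using f(1) unfolding C_def by blast
  then have x0: "x ~= 0_K" using f(2) h0 by auto
  then have xi: "inv\<^bsub>K\<^esub> x : L" using Linv x(2) by blast
  have "inv\<^bsub>K\<^esub> x *_K x = 1_K" using K.field_Units Lc[OF x(2)] x0 K.Units_l_inv by blast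
  then show ?thesis using hmul[OF xi x(2)] hone x(1) xi unfolding C_def by (intro bexI[of _ "hat (inv\<^bsub>K\<^esub> x)"]) auto
 qed
 let ?Q = "coeffs_in V C" and ?S = "SB.endo_ring (ext V) (coeffs_in V C)"
 let ?Lm = "%x. \<lambda>u\<in>cvec V. SB.scl (ext V) x u"
 interpret Z: ring_ext K k A "SA.endo_ring V C" ?S "Fm V V" ?Lm "cmp V V"
  by (rule endo_ring_ext[OF V C1 C2 C3])
 have Scr: "cring ?S" by (rule Z.ext_commutative) (use Ccomm in simp)
 have Scomm: "x *_?S y = y *_?S x" if "x : ?Q" "y : ?Q" for x y
  using comm_monoid.m_comm[OF cring.axioms(2)[OF Scr], of x y] that by simp
 have Qs: "submodule ?Q K (hom_space AK (ext V) (ext V))" by (rule coeffs_in_submodule[OF V C1 C2 C3])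
 have Q1: "(\<lambda>u\<in>carrier (ext V). u) : ?Q" using coeffs_in_one[OF V C1 C2 C3] by simp
 have Q2: "compose (carrier (ext V)) f g : ?Q" if "f : ?Q" "g : ?Q" for f g
  using coeffs_in_compose[OF V C1 C2 C3 that] by simp
 have Qh: "f : HK V V" if "f : ?Q" for f using that coeffs_in_iff[OF V C1 C2 C3] by blast
 have FQ: "Fm V V (hat x) : ?Q" if "x : L" for x
  by (rule coeffs_in_Fm[OF V C1 C2 C3]) (use that in "auto simp: C_def")
 have LQ: "?Lm x : ?Q" if "x : carrier K" for x by (rule coeffs_in_scalar[OF V C1 C2 C3 that])
 have Qc: "f u : cvec V" if "f : ?Q" "u : cvec V" for f u by (rule HK_closed[OF Qh[OF that(1)] that(2)])
 obtain \<mu> where mu: "\<mu> : mod_hom AK (ext V) W" and mue: "!!v. v : Vc ==> \<mu> (emb V v) = v"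
  using ext_hom_exists[OF V LW, of "%v. v"] VW by auto
 have mucl: "\<mu> u : carrier W" if "u : cvec V" for u using hom_closed[OF mu] that by simp
 have muadd: "\<mu> (u \<oplus>\<^bsub>ext V\<^esub> v) = \<mu> u +_W \<mu> v" if "u : cvec V" "v : cvec V" for u v using hom_add[OF mu] that by simp
 have muscl: "\<mu> (SB.scl (ext V) x u) = SB.scl W x (\<mu> u)" if "x : carrier K" "u : cvec V" for x u
  by (rule SB.hom_scl[OF EV LW mu that(1)]) (use that(2) in simp)
 have muF: "\<mu> (Fm V V (hat x) u) = SB.scl W x (\<mu> u)" if x: "x : L" and u: "u : cvec V" for x u
 proof -
  have 1: "compose (carrier (ext V)) \<mu> (Fm V V (hat x)) : mod_hom AK (ext V) W"
   by (rule SB.compose_hom[OF Qh[OF FQ[OF x]] mu EV])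
  have 2: "(\<lambda>u\<in>carrier (ext V). SB.scl W x (\<mu> u)) : mod_hom AK (ext V) W" by (rule SB.scale_hom[OF EV LW mu Lc[OF x]])
  have "compose (carrier (ext V)) \<mu> (Fm V V (hat x)) = (\<lambda>u\<in>carrier (ext V). SB.scl W x (\<mu> u))"
  proof (rule ext_hom_eqI[OF V LW 1 2])
   fix v assume "v : carrier V"
   then have v: "v : Vc" by simp
   have e: "emb V v : cvec V" by (rule emb_closed[OF V]) (use v in simp)
   have "Fm V V (hat x) (emb V v) = emb V (hat x v)" by (rule Fm_emb[OF V V hath[OF x]]) (use v in simp)
   then show "compose (carrier (ext V)) \<mu> (Fm V V (hat x)) (emb V v) = (\<lambda>u\<in>carrier (ext V). SB.scl W x (\<mu> u)) (emb V v)"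
    using e v mue[OF v] mue[OF sV[OF x v]] hat[OF v] by (simp add: compose_eq)
  qed
  from fun_cong[OF this, of u] show ?thesis using u by (simp add: compose_eq)
 qed
 \<comment> \<open>for one scalar \<open>x\<close> with difference \<open>y\<close> of the two actions: \<open>y\<^sup>n = y\<^sup>n y g\<close> makes \<open>y (1 - y g)\<close> nilpotent,
  hence zero\<close>
 have one: "EX e:?Q. (ALL u:cvec V. \<mu> (e u) = \<mu> u) \<and> Fm V V (hat x) *_?S e = ?Lm x *_?S e" if x: "x : L" for x
 proof -
  let ?F = "Fm V V (hat x)"
  define y where "y = ?F -_?S ?Lm x"
  have FS: "?F : carrier ?S" "?Lm x : carrier ?S" using FQ[OF x] LQ[OF Lc[OF x]] by simp_all
  have yS: "y : carrier ?S" unfolding y_def using FS by (rule Z.S.minus_closed)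
  then have yQ: "y : ?Q" by simp
  have yF: "y +_?S ?Lm x = ?F" unfolding y_def a_minus_def
   using FS by (simp only: Z.S.a_assoc Z.S.a_inv_closed Z.S.l_neg Z.S.r_zero)
  have muy: "\<mu> (y u) = 0_W" if u: "u : cvec V" for u
  proof -
   have yu: "y u : cvec V" by (rule Qc[OF yQ u])
   have "y u \<oplus>\<^bsub>ext V\<^esub> SB.scl (ext V) x u = ?F u" using fun_cong[OF yF, of u] u by simp
   then have "\<mu> (y u) +_W SB.scl W x (\<mu> u) = SB.scl W x (\<mu> u)"
    using muadd[OF yu ext_scl_closed[OF V Lc[OF x] u]] muscl[OF Lc[OF x] u] muF[OF x u] by simp
   then show ?thesis by (rule W.add_eq_right_imp_zero[OF mucl[OF yu] sW[OF Lc[OF x] mucl[OF u]]])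
  qed
  obtain n g where g: "g : ?Q" and ng: "!!u. u : carrier (ext V) ==> (y ^^ n) u = (y ^^ n) (y (g u))"
   using SB.power_stabilizes[OF ext_fd[OF V] Qh[OF yQ] Qs Q1 Q2[OF yQ]] by blast
  have gS: "g : carrier ?S" using g by simp
  define e where "e = 1_?S -_?S y *_?S g"
  have ygS: "y *_?S g : carrier ?S" by (rule Z.S.m_closed[OF yS gS])
  have eS: "e : carrier ?S" unfolding e_def by (rule Z.S.minus_closed[OF Z.S.one_closed ygS])
  then have eQ: "e : ?Q" by simp
  have e1: "e +_?S y *_?S g = 1_?S" unfolding e_def a_minus_def
   using ygS Z.S.one_closed by (simp only: Z.S.a_assoc Z.S.a_inv_closed Z.S.l_neg Z.S.r_zero)
  have mue': "\<mu> (e u) = \<mu> u" if u: "u : cvec V" for u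
  proof -
   have gu: "g u : cvec V" by (rule Qc[OF g u])
   have "e u \<oplus>\<^bsub>ext V\<^esub> y (g u) = u" using fun_cong[OF e1, of u] u by (simp add: compose_eq)
   then have "\<mu> (e u) +_W \<mu> (y (g u)) = \<mu> u" using muadd[OF Qc[OF eQ u] Qc[OF yQ gu]] by simp
   then show ?thesis using muy[OF gu] mucl[OF Qc[OF eQ u]] by simp
  qed
  let ?yn = "y [^]\<^bsub>?S\<^esub> n"
  have ynS: "?yn : carrier ?S" by (rule Z.S.nat_pow_closed[OF yS])
  have yn: "?yn = ?yn *_?S (y *_?S g)"
  proof (rule hom_eqI[OF Qh Qh])
   show "?yn : ?Q" using ynS by simp
   show "?yn *_?S (y *_?S g) : ?Q" using Z.S.m_closed[OF ynS ygS] by simp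
   fix u assume u: "u : carrier (ext V)"
   have pw: "?yn v = (y ^^ n) v" if "v : carrier (ext V)" for v by (rule SB.endo_ring_pow[OF EV Qs Q1 Q2 yQ that])
   have "y (g u) : carrier (ext V)" using Qc[OF yQ Qc[OF g]] u by simp
   then show "?yn u = (?yn *_?S (y *_?S g)) u" using pw[OF u] pw[of "y (g u)"] ng[OF u] u by (simp add: compose_eq)
  qed
  have "?yn *_?S e +_?S ?yn = ?yn"
  proof -
   have "?yn *_?S (e +_?S y *_?S g) = ?yn *_?S e +_?S ?yn *_?S (y *_?S g)" by (rule Z.S.r_distr[OF eS ygS ynS])
   then show ?thesis unfolding e1 yn[symmetric] Z.S.r_one[OF ynS] by simp
  qed
  then have yne: "?yn *_?S e = 0_?S" by (rule Z.S.add_eq_right_imp_zero[OF Z.S.m_closed[OF ynS eS] ynS])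
  have yeS: "y *_?S e : carrier ?S" by (rule Z.S.m_closed[OF yS eS])
  have nil: "(y *_?S e) [^]\<^bsub>?S\<^esub> Suc n = 0_?S"
  proof -
   have en: "e [^]\<^bsub>?S\<^esub> n : carrier ?S" by (rule Z.S.nat_pow_closed[OF eS])
   have "(y *_?S e) [^]\<^bsub>?S\<^esub> Suc n = (?yn *_?S e [^]\<^bsub>?S\<^esub> n) *_?S (y *_?S e)"
    unfolding Group.nat_pow_Suc Z.S.pow_mult_distrib[OF Scomm[OF yQ eQ] yS eS] ..
   also have "... = (?yn *_?S e [^]\<^bsub>?S\<^esub> n) *_?S (e *_?S y)" unfolding Scomm[OF yQ eQ] ..
   also have "... = (?yn *_?S (e [^]\<^bsub>?S\<^esub> n *_?S e)) *_?S y"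
    by (simp only: Z.S.m_assoc ynS en eS yS Z.S.m_closed)
   also have "e [^]\<^bsub>?S\<^esub> n *_?S e = e *_?S e [^]\<^bsub>?S\<^esub> n" by (rule Scomm) (use en eQ in simp_all)
   also have "?yn *_?S (e *_?S e [^]\<^bsub>?S\<^esub> n) = (?yn *_?S e) *_?S e [^]\<^bsub>?S\<^esub> n" by (rule Z.S.m_assoc[OF ynS eS en, symmetric])
   finally show ?thesis unfolding yne Z.S.l_null[OF en] Z.S.l_null[OF yS] .
  qed
  have ye: "y *_?S e = 0_?S"
   by (rule reduced_coefficients[OF V C1 C2 C3 Ccomm Cinv _ nil]) (use yeS in simp_all)
  have "?F *_?S e = y *_?S e +_?S ?Lm x *_?S e"
   using Z.S.l_distr[OF yS FS(2) eS] unfolding yF .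
  then have "?F *_?S e = ?Lm x *_?S e" unfolding ye Z.S.l_zero[OF Z.S.m_closed[OF FS(2) eS]] .
  then show ?thesis using eQ mue' by blast
 qed
 have many: "EX e:?Q. (ALL u:cvec V. \<mu> (e u) = \<mu> u) \<and> (ALL x:B'. Fm V V (hat x) *_?S e = ?Lm x *_?S e)" if "finite B'" "B' <= L" for B'
  using that
 proof (induction B' rule: finite_induct)
  case empty
  show ?case using Q1 by (intro bexI[of _ "\<lambda>u\<in>carrier (ext V). u"]) auto
 next
  case (insert x B')
  \<comment> \<open>the projection onto the part of the extension on which the two actions of \<open>L\<close> agree\<close>
 obtain e where e: "e : ?Q" "!!u. u : cvec V ==> \<mu> (e u) = \<mu> u" "!!x. x : B' ==> Fm V V (hat x) *_?S e = ?Lm x *_?S e"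
   using insert.IH insert.prems by blast
  have x: "x : L" using insert.prems by blast
  obtain e' where e': "e' : ?Q" "!!u. u : cvec V ==> \<mu> (e' u) = \<mu> u" "Fm V V (hat x) *_?S e' = ?Lm x *_?S e'"
   using one[OF x] by blast
  have S: "e : carrier ?S" "e' : carrier ?S" using e(1) e'(1) by simp_all
  have FS: "Fm V V (hat z) : carrier ?S" "?Lm z : carrier ?S" if "z : L" for z using FQ[OF that] LQ[OF Lc[OF that]] by simp_all
  have "Fm V V (hat z) *_?S (e *_?S e') = ?Lm z *_?S (e *_?S e')" if z: "z : insert x B'" for z
  proof (cases "z = x")
   case True
   show ?thesis unfolding Scomm[OF e(1) e'(1)] True Z.S.m_assoc[OF FS(1)[OF x] S(2,1), symmetric] e'(3)
    by (rule Z.S.m_assoc[OF FS(2)[OF x] S(2,1)])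
  next
   case False
   then have zB: "z : B'" "z : L" using z insert.prems by auto
   show ?thesis unfolding Z.S.m_assoc[OF FS(1)[OF zB(2)] S, symmetric] e(3)[OF zB(1)] by (rule Z.S.m_assoc[OF FS(2)[OF zB(2)] S])
  qed
  moreover have "e *_?S e' : ?Q" using Z.S.m_closed[OF S] by simp
  moreover have "\<mu> ((e *_?S e') u) = \<mu> u" if u: "u : cvec V" for u
   using e(2)[OF Qc[OF e'(1) u]] e'(2)[OF u] u by (simp add: compose_eq)
  ultimately show ?case by blast
 qed
 obtain e where e: "e : ?Q" "!!u. u : cvec V ==> \<mu> (e u) = \<mu> u" "!!x. x : B ==> Fm V V (hat x) *_?S e = ?Lm x *_?S e"
  using many[OF B] by blast
 have eS: "e : carrier ?S" using e(1) by simp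
 have Fk: "Fm V V (hat q) = ?Lm q" if q: "q : k" for q
 proof (rule ext_hom_eqI[OF V EV Qh[OF FQ] Qh[OF LQ]])
  show "q : L" "q : carrier K" using q L(2) kK by auto
  fix v assume "v : carrier V"
  then have v: "v : Vc" by simp
  have "hat q : mod_hom A V V" using hath q L(2) by blast
  then have "Fm V V (hat q) (emb V v) = emb V (SA.scl V q v)" using Fm_emb[OF V V, of "hat q" v] v hat[OF v] sclV[OF q v] by simp
  also have "... = (%j. q *_K emb V v j)" unfolding emb_def using bc_scl[OF V _ q, of _ v] v q kK by auto
  also have "... = SB.scl (ext V) q (emb V v)" by (rule ext_scl[OF V kK[OF q] emb_closed[OF V], symmetric]) (use v in simp)
  finally show "Fm V V (hat q) (emb V v) = ?Lm q (emb V v)" using emb_closed[OF V, of v] v by simp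
 qed
 have "L <= {x : L. Fm V V (hat x) *_?S e = ?Lm x *_?S e}"
 proof (rule LB[rule_format], intro conjI ballI)
  let ?H = "{x : L. Fm V V (hat x) *_?S e = ?Lm x *_?S e}"
  have FS: "Fm V V (hat z) : carrier ?S" "?Lm z : carrier ?S" "hat z : carrier (SA.endo_ring V C)" if "z : L" for z
   using FQ[OF that] LQ[OF Lc[OF that]] that by (auto simp: C_def)
  show "?H <= carrier K" using Lc by blast
  show "B <= ?H" using B(2) e(3) by blast
  show "0_K : ?H" using Fk[OF k_zero] Lr(2) by simp
  show "x +_K y : ?H" if "x : ?H" "y : ?H" for x y
  proof -
   have x: "x : L" "Fm V V (hat x) *_?S e = ?Lm x *_?S e" and y: "y : L" "Fm V V (hat y) *_?S e = ?Lm y *_?S e" using that by auto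
   have "Fm V V (hat (x +_K y)) = Fm V V (hat x) +_?S Fm V V (hat y)"
    using Z.F_add[OF FS(3)[OF x(1)] FS(3)[OF y(1)]] hadd[OF x(1) y(1)] by simp
   then have "Fm V V (hat (x +_K y)) *_?S e = ?Lm x *_?S e +_?S ?Lm y *_?S e"
    using Z.S.l_distr[OF FS(1)[OF x(1)] FS(1)[OF y(1)] eS] unfolding x(2) y(2) by simp
   also have "... = ?Lm (x +_K y) *_?S e"
    unfolding Z.L_add[OF Lc[OF x(1)] Lc[OF y(1)]] by (rule Z.S.l_distr[OF FS(2)[OF x(1)] FS(2)[OF y(1)] eS, symmetric])
   finally show ?thesis using Lr(7)[OF x(1) y(1)] by blast
  qed
  show "q *_K x : ?H" if q: "q : k" and "x : ?H" for q x
  proof -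
   have x: "x : L" "Fm V V (hat x) *_?S e = ?Lm x *_?S e" using that by auto
   have qL: "q : L" using q L(2) by blast
   have "Fm V V (hat (q *_K x)) = ?Lm q *_?S Fm V V (hat x)"
    using Z.F_mult[OF FS(3)[OF qL] FS(3)[OF x(1)]] hmul[OF qL x(1)] Fk[OF q] by simp
   then have "Fm V V (hat (q *_K x)) *_?S e = ?Lm q *_?S (?Lm x *_?S e)"
    using Z.S.m_assoc[OF FS(2)[OF qL] FS(1)[OF x(1)] eS] x(2) by simp
   also have "... = ?Lm (q *_K x) *_?S e"
    unfolding Z.L_mult[OF Lc[OF qL] Lc[OF x(1)]] by (rule Z.S.m_assoc[OF FS(2)[OF qL] FS(2)[OF x(1)] eS, symmetric])
   finally show ?thesis using Lr(6)[OF qL x(1)] by blast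
  qed
 qed
 then have Fe: "Fm V V (hat x) *_?S e = ?Lm x *_?S e" if "x : L" for x using that by blast
 have eFu: "e (Fm V V (hat x) u) = SB.scl (ext V) x (e u)" if x: "x : L" and u: "u : cvec V" for x u
 proof -
  have "e *_?S Fm V V (hat x) = ?Lm x *_?S e" using Scomm[OF e(1) FQ[OF x]] Fe[OF x] by simp
  from fun_cong[OF this, of u] show ?thesis using u Qc[OF e(1) u] by (simp add: compose_eq)
 qed
 have embV: "emb V v : cvec V" if "v : Vc" for v by (rule emb_closed[OF V]) (use that in simp)
 let ?b = "%j. e (emb V (w j))"
 have bE: "?b j : cvec V" if "j < d" for j by (rule Qc[OF e(1) embV[OF wV[OF that]]])
 \<comment> \<open>the section of \<open>\<mu>\<close>; on \<open>V\<close> it is \<open>e\<close>, which makes it \<open>A\<close>-linear\<close>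
 define s where "s = (\<lambda>u\<in>carrier W. \<Oplus>\<^bsub>ext V\<^esub>j\<in>{..<d}. SB.scl (ext V) (c j u) (?b j))"
 have su: "s u = (finsum (ext V) (%j. SB.scl (ext V) (c j u) (?b j)) {..<d})" if "u : carrier W" for u unfolding s_def using that by simp
 have st: "(%j. SB.scl (ext V) (c j u) (?b j)) : {..<d} \<rightarrow> carrier (ext V)" if "u : carrier W" for u
  using ext_scl_closed[OF V cc[OF _ that] bE] by simp
 have sc: "s u : carrier (ext V)" if "u : carrier W" for u unfolding su[OF that] by (rule E.finsum_closed[OF st[OF that]])
 have sa: "s (u +_W v) = s u \<oplus>\<^bsub>ext V\<^esub> s v" if u: "u : carrier W" and v: "v : carrier W" for u v
 proof -
  have "s (u +_W v) = (finsum (ext V) (%j. SB.scl (ext V) (c j u) (?b j) \<oplus>\<^bsub>ext V\<^esub> SB.scl (ext V) (c j v) (?b j)) {..<d})"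
   unfolding su[OF W.a_closed[OF u v]]
  proof (rule E.finsum_cong'[OF refl])
   show "(%j. SB.scl (ext V) (c j u) (?b j) \<oplus>\<^bsub>ext V\<^esub> SB.scl (ext V) (c j v) (?b j)) : {..<d} \<rightarrow> carrier (ext V)"
    using st[OF u] st[OF v] E.a_closed by (simp add: Pi_iff del: ext_simps)
   fix j assume "j : {..<d}"
   then have j: "j < d" by simp
   show "SB.scl (ext V) (c j (u +_W v)) (?b j) = SB.scl (ext V) (c j u) (?b j) \<oplus>\<^bsub>ext V\<^esub> SB.scl (ext V) (c j v) (?b j)"
    unfolding ca[OF j u v] by (rule SB.scl_add[OF EV cc[OF j u] cc[OF j v]]) (use bE[OF j] in simp)
  qed
  then show ?thesis using E.finsum_addf[OF st[OF u] st[OF v]] su[OF u] su[OF v] by simp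
 qed
 have ss: "s (SB.scl W x u) = SB.scl (ext V) x (s u)" if x: "x : carrier K" and u: "u : carrier W" for x u
 proof -
  have "SB.scl (ext V) x (s u) = (finsum (ext V) (%j. SB.scl (ext V) x (SB.scl (ext V) (c j u) (?b j))) {..<d})"
   unfolding su[OF u]
   by (rule additive_finsum[OF E.abelian_group_axioms E.abelian_group_axioms _ _ _ st[OF u]])
    (use SB.scl_closed[OF EV x] SB.scl_add_right[OF EV x] in "auto simp del: ext_simps")
  also have "... = s (SB.scl W x u)" unfolding su[OF sW[OF x u]]
  proof (rule E.finsum_cong'[OF refl _])
   show "(%j. SB.scl (ext V) (c j (SB.scl W x u)) (?b j)) : {..<d} \<rightarrow> carrier (ext V)" by (rule st[OF sW[OF x u]])
   fix j assume "j : {..<d}"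
   then have j: "j < d" by simp
   show "SB.scl (ext V) x (SB.scl (ext V) (c j u) (?b j)) = SB.scl (ext V) (c j (SB.scl W x u)) (?b j)"
    unfolding csm[OF j x u] by (rule SB.scl_mult[OF EV x cc[OF j u], symmetric]) (use bE[OF j] in simp)
  qed
  finally show ?thesis by simp
 qed
 have sv: "s v = e (emb V v)" if v: "v : Vc" for v
 proof -
  let ?f = "%j. SB.scl W (c j v) (w j)"
  have fV: "?f : {..<d} \<rightarrow> carrier V" using sV[OF VL[OF v] wV] by simp
  have "finsum V ?f {..<d} = finsum W ?f {..<d}"
   by (rule additive_finsum[OF abV W.abelian_group_axioms, of "%u. u"]) (use VW fV in auto)
  then have "finsum V ?f {..<d} = v" unfolding ex[OF VW[OF v]] .
  moreover have "e (emb V (finsum V ?f {..<d})) = (finsum (ext V) (%j. e (emb V (?f j))) {..<d})"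
  proof (rule additive_finsum[OF abV E.abelian_group_axioms, of "%v. e (emb V v)"])
   show "(%v. e (emb V v)) : carrier V \<rightarrow> carrier (ext V)" using Qc[OF e(1) embV] by simp
   show "e (emb V (x +_V y)) = e (emb V x) \<oplus>\<^bsub>ext V\<^esub> e (emb V y)" if "x : carrier V" "y : carrier V" for x y
    unfolding emb_add[OF V that] using HK_add[OF Qh[OF e(1)] emb_closed[OF V that(1)] emb_closed[OF V that(2)]] by simp
  qed (use fV in auto)
  moreover have "(finsum (ext V) (%j. e (emb V (?f j))) {..<d}) = s v" unfolding su[OF VW[OF v]]
  proof (rule E.finsum_cong'[OF refl st[OF VW[OF v]]])
   fix j assume "j : {..<d}"
   then have j: "j < d" by simp
   have x: "c j v : L" by (rule VL[OF v j])
   have "emb V (?f j) = Fm V V (hat (c j v)) (emb V (w j))" using Fm_emb[OF V V hath[OF x], of "w j"] wV[OF j] hat[OF wV[OF j]] by simp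
   then show "e (emb V (?f j)) = SB.scl (ext V) (c j v) (?b j)" using eFu[OF x embV[OF wV[OF j]]] by simp
  qed
  ultimately show ?thesis by simp
 qed
 have sh: "s : mod_hom AK W (ext V)"
 proof (rule AK_homI[OF LW EV])
  show "s u : carrier (ext V)" if "u : carrier W" for u by (rule sc[OF that])
  show "s (u +_W v) = s u \<oplus>\<^bsub>ext V\<^esub> s v" if "u : carrier W" "v : carrier W" for u v by (rule sa[OF that])
  show "s (SB.scl W x u) = SB.scl (ext V) x (s u)" if "x : carrier K" "u : carrier W" for x u by (rule ss[OF that])
  show "s : extensional (carrier W)" unfolding s_def by simp
 next
  fix a u assume a: "a : carrier A" and u: "u : carrier W"
  have "s (t 1_K a \<odot>_W u) = (finsum (ext V) (%j. SB.scl (ext V) (c j u) (s (t 1_K a \<odot>_W w j))) {..<d})"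
   unfolding tsum[OF a u]
   by (rule SB.additive_scl_finsum[OF LW EV, of s]) (use sc sa ss cc u tW a wc in "auto simp del: ext_simps")
  also have "... = (finsum (ext V) (%j. SB.scl (ext V) (c j u) (t 1_K a \<odot>\<^bsub>ext V\<^esub> ?b j)) {..<d})"
  proof (rule E.finsum_cong'[OF refl])
   show "(%j. SB.scl (ext V) (c j u) (t 1_K a \<odot>\<^bsub>ext V\<^esub> ?b j)) : {..<d} \<rightarrow> carrier (ext V)"
    using SB.scl_closed[OF EV cc[OF _ u]] E.act_closed[OF tA[OF a]] bE by simp
   fix j assume "j : {..<d}"
   then have j: "j < d" by simp
   have "s (t 1_K a \<odot>_W w j) = e (emb V (a \<odot>_V w j))" using sv[OF tV[OF a wV[OF j]]] by simp
   also have "... = e (t 1_K a \<odot>\<^bsub>ext V\<^esub> emb V (w j))" using emb_act[OF V a, of "w j"] wV[OF j] by simp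
   also have "... = t 1_K a \<odot>\<^bsub>ext V\<^esub> ?b j" by (rule hom_act[OF Qh[OF e(1)] tA[OF a]]) (use embV[OF wV[OF j]] in simp)
   finally show "SB.scl (ext V) (c j u) (s (t 1_K a \<odot>_W w j)) = SB.scl (ext V) (c j u) (t 1_K a \<odot>\<^bsub>ext V\<^esub> ?b j)" by simp
  qed
  also have "... = t 1_K a \<odot>\<^bsub>ext V\<^esub> s u" unfolding su[OF u]
   by (rule SB.additive_scl_finsum[OF EV EV, of "%u. t 1_K a \<odot>\<^bsub>ext V\<^esub> u", symmetric])
    (use E.act_closed[OF tA[OF a]] E.act_r_distr[OF tA[OF a]] SB.scl_act[OF EV _ tA[OF a]] cc u bE in "auto simp del: ext_simps(2,3)")
  finally show "s (t 1_K a \<odot>_W u) = t 1_K a \<odot>\<^bsub>ext V\<^esub> s u" .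
 qed
 have "\<mu> (s u) = u" if u: "u : carrier W" for u
 proof -
  have "\<mu> (s u) = (finsum W (%j. SB.scl W (c j u) (\<mu> (?b j))) {..<d})" unfolding su[OF u]
   by (rule SB.additive_scl_finsum[OF EV LW]) (use mucl muadd muscl cc u bE in "auto simp del: ext_simps(2,3)")
  also have "... = (finsum W (%j. SB.scl W (c j u) (w j)) {..<d})"
   by (rule W.finsum_cong'[OF refl]) (use sW cc u wc e(2)[OF embV[OF wV]] mue[OF wV] in auto)
  finally show ?thesis unfolding ex[OF u] .
 qed
 then have "SB.summand W (ext V)" unfolding SB.summand_def using sh mu by blast
 then show ?thesis using V by blast
qed

end

section \<open>Arrows of the Auslander-Reiten quivers\<close>

context perfect_ext
begin

text \<open>A product of radical homomorphisms through \<open>W\<close> is one through an extended module having \<open>W\<close> as a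
 summand, so its coefficients are sums of products of radical coefficients.\<close>

lemma rad2_coefficients:
 assumes M: "M : md" "indecomposable A M" and M': "M' : md" "indecomposable A M'"
  and g: "g : rad2 K AK (ext M) (ext M')" and p: "\<phi> : \<Phi>"
 shows "cmp M M' \<phi> g : rad2 kF A M M'"
proof -
 note LM = M_left[OF M(1)] and LM' = M_left[OF M'(1)] and EM = ext_left[OF M(1)] and EM' = ext_left[OF M'(1)]
 interpret HA: vspace kF "hom_space A M M'" by (rule SA.hom_space_vspace[OF LM LM'])
 interpret HE: vspace K "hom_space AK (ext M) (ext M')" by (rule SB.hom_space_vspace[OF EM EM'])
 interpret M': left_module A M' by (rule LM')
 note r2 = SA.rad2_submodule[OF LM LM'] and r2' = SA.rad2_submodule[OF LM LM', unfolded HA.submodule_iff]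
 let ?H = "{g : HK M M'. ALL \<phi>:\<Phi>. cmp M M' \<phi> g : rad2 kF A M M'}"
 have H: "submodule ?H K (hom_space AK (ext M) (ext M'))" unfolding HE.submodule_iff
 proof (intro conjI ballI)
  show "?H <= carrier (hom_space AK (ext M) (ext M'))" by auto
  have z: "cmp M M' \<phi> (\<lambda>u\<in>cvec M. %j. 0_K) = (\<lambda>u\<in>carrier M. \<zero>\<^bsub>M'\<^esub>)" if "\<phi> : \<Phi>" for \<phi>
   unfolding cmp_def by (rule restrict_ext) (simp add: emb_closed[OF M(1)] ph_zero[OF M'(1) that])
  show "\<zero>\<^bsub>hom_space AK (ext M) (ext M')\<^esub> : ?H"
   using SB.zero_hom[OF EM EM'] z r2' by simp
  show "x \<oplus>\<^bsub>hom_space AK (ext M) (ext M')\<^esub> y : ?H" if "x : ?H" "y : ?H" for x y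
   using SB.add_hom[OF EM EM', of x y] cmp_add[OF M(1) M'(1), of _ x y] r2' that by simp
  show "c \<odot>\<^bsub>hom_space AK (ext M) (ext M')\<^esub> x : ?H" if "c : carrier K" "x : ?H" for c x
   using SB.scale_hom[OF EM EM', of x c] cmp_scl[OF M(1) M'(1), of _ x c] Phi_shift that by simp
 qed
 have "rad2 K AK (ext M) (ext M') <= ?H"
 proof (rule SB.rad2_least[OF H])
  fix W f g assume W: "W : fd_mod K AK" and f: "f : rad AK (ext M) W" and g: "g : rad AK W (ext M')"
  note LW = SB.fd_mod_left[OF W]
  obtain V where V: "V : md" "SB.summand W (ext V)" using extended_summand[OF W] by blast
  note EV = ext_left[OF V(1)]
  obtain i q where iq: "i : mod_hom AK W (ext V)" "q : mod_hom AK (ext V) W" "!!x. x : carrier W ==> q (i x) = x"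
   using V(2) unfolding SB.summand_def by blast
  let ?f = "compose (carrier (ext M)) i f" and ?g = "compose (carrier (ext V)) g q"
  have fr: "?f : rad AK (ext M) (ext V)" by (rule SB.rad_left[OF EM LW EV f iq(1)])
  have gr: "?g : rad AK (ext V) (ext M')" by (rule SB.rad_right[OF EV LW EM' g iq(2)])
  have fc: "f u : carrier W" if "u : cvec M" for u using hom_closed[OF SB.rad_hom[OF f]] that by simp
  have ic: "i (f u) : cvec V" if "u : cvec M" for u using hom_closed[OF iq(1) fc[OF that]] by simp
  have e: "compose (carrier (ext M)) g f = compose (cvec M) ?g ?f"
   unfolding compose_def by (auto simp: iq(3)[OF fc] ic intro!: restrict_ext)
  have "compose (carrier (ext M)) g f : HK M M'" by (rule SB.compose_hom[OF SB.rad_hom[OF f] SB.rad_hom[OF g] EM])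
  moreover have "cmp M M' \<phi> (compose (cvec M) ?g ?f) : rad2 kF A M M'" if "\<phi> : \<Phi>" for \<phi>
  proof (rule cmp_compose_mem[OF M(1) V(1) M'(1) SB.rad_hom[OF fr] SB.rad_hom[OF gr] r2 _ that])
   fix \<phi> \<psi> assume "\<phi> : \<Phi>" "\<psi> : \<Phi>"
   then show "compose (carrier M) (cmp V M' \<phi> ?g) (cmp M V \<psi> ?f) : rad2 kF A M M'"
    by (intro SA.rad2I[OF V(1)] rad_coefficients_from[OF M V(1) fr] rad_coefficients_to[OF M' V(1) gr])
  qed
  ultimately show "compose (carrier (ext M)) g f : ?H" using e by simp
 qed
 then show ?thesis using g p by blast
qed

lemma summand_ext:
 assumes M: "M : md" and U: "U : md" and s: "SA.summand M U"
 shows "SB.summand (ext M) (ext U)"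
proof -
 obtain i p where ip: "i : mod_hom A M U" "p : mod_hom A U M" "!!x. x : carrier M ==> p (i x) = x"
  using s unfolding SA.summand_def by blast
 note Fi = Fm_hom[OF M U ip(1)] and Fp = Fm_hom[OF U M ip(2)]
 have "Fm U M p (Fm M U i u) = u" if u: "u : cvec M" for u
 proof (rule cvec_eqI[OF M _ u])
  have iu: "Fm M U i u : cvec U" by (rule HK_closed[OF Fi u])
  show "Fm U M p (Fm M U i u) : cvec M" by (rule HK_closed[OF Fp iu])
  fix \<phi> assume ph: "\<phi> : \<Phi>"
  show "ph M \<phi> (Fm U M p (Fm M U i u)) = ph M \<phi> u"
   unfolding ph_Fm[OF U M ip(2) iu ph] ph_Fm[OF M U ip(1) u ph] by (rule ip(3)[OF ph_closed[OF M ph u]])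
 qed
 then show ?thesis unfolding SB.summand_def using Fi Fp by auto
qed

lemma splits_ext:
 assumes U: "U : md" and P: "P : md" and Q: "Q : md" and s: "SA.splits U P Q i p j q"
 shows "EX i' p' j' q'. SB.splits (ext U) (ext P) (ext Q) i' p' j' q'"
proof -
 have h: "i : mod_hom A P U" "p : mod_hom A U P" "j : mod_hom A Q U" "q : mod_hom A U Q"
  and e: "!!x. x : carrier P ==> p (i x) = x" "!!x. x : carrier Q ==> q (j x) = x"
   "!!u. u : carrier U ==> i (p u) +_U j (q u) = u" using s unfolding SA.splits_def by auto
 note Fi = Fm_hom[OF P U h(1)] and Fp = Fm_hom[OF U P h(2)] and Fj = Fm_hom[OF Q U h(3)] and Fq = Fm_hom[OF U Q h(4)]
 have 1: "Fm U P p (Fm P U i u) = u" if u: "u : cvec P" for u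
 proof (rule cvec_eqI[OF P HK_closed[OF Fp HK_closed[OF Fi u]] u])
  fix \<phi> assume ph: "\<phi> : \<Phi>"
  show "ph P \<phi> (Fm U P p (Fm P U i u)) = ph P \<phi> u"
   unfolding ph_Fm[OF U P h(2) HK_closed[OF Fi u] ph] ph_Fm[OF P U h(1) u ph] by (rule e(1)[OF ph_closed[OF P ph u]])
 qed
 have 2: "Fm U Q q (Fm Q U j u) = u" if u: "u : cvec Q" for u
 proof (rule cvec_eqI[OF Q HK_closed[OF Fq HK_closed[OF Fj u]] u])
  fix \<phi> assume ph: "\<phi> : \<Phi>"
  show "ph Q \<phi> (Fm U Q q (Fm Q U j u)) = ph Q \<phi> u"
   unfolding ph_Fm[OF U Q h(4) HK_closed[OF Fj u] ph] ph_Fm[OF Q U h(3) u ph] by (rule e(2)[OF ph_closed[OF Q ph u]])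
 qed
 have 3: "(%n. Fm P U i (Fm U P p u) n +_K Fm Q U j (Fm U Q q u) n) = u" if u: "u : cvec U" for u
 proof (rule cvec_eqI[OF U _ u])
  note c = HK_closed[OF Fi HK_closed[OF Fp u]] HK_closed[OF Fj HK_closed[OF Fq u]]
  show "(%n. Fm P U i (Fm U P p u) n +_K Fm Q U j (Fm U Q q u) n) : cvec U" by (rule cvec_add[OF U c])
  fix \<phi> assume ph: "\<phi> : \<Phi>"
  show "ph U \<phi> (%n. Fm P U i (Fm U P p u) n +_K Fm Q U j (Fm U Q q u) n) = ph U \<phi> u"
   unfolding ph_add[OF U ph c] ph_Fm[OF P U h(1) HK_closed[OF Fp u] ph] ph_Fm[OF Q U h(3) HK_closed[OF Fq u] ph]
    ph_Fm[OF U P h(2) u ph] ph_Fm[OF U Q h(4) u ph] by (rule e(3)[OF ph_closed[OF U ph u]])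
 qed
 have "SB.splits (ext U) (ext P) (ext Q) (Fm P U i) (Fm U P p) (Fm Q U j) (Fm U Q q)"
  unfolding SB.splits_def using Fi Fp Fj Fq 1 2 3 by simp
 then show ?thesis by blast
qed

lemma indecomposable_summand_of_extension:
 assumes Y: "Y : fd_mod K AK" "indecomposable AK Y"
 shows "EX M:md. indecomposable A M \<and> SB.summand Y (ext M)"
proof -
 note LN = SB.fd_mod_left[OF Y(1)]
 obtain V where V: "V : md" "SB.summand Y (ext V)" using extended_summand[OF Y(1)] by blast
 have "SB.summand Y (ext V) --> (EX M:md. indecomposable A M \<and> SB.summand Y (ext M))"
  using V(1)
 proof (induction V rule: SA.fd_mod_induct)
  case (zero V)
  note EV = ext_left[OF zero(1)]
  show ?case
  proof
   assume "SB.summand Y (ext V)"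
   then obtain i p where ip: "i : mod_hom AK Y (ext V)" "p : mod_hom AK (ext V) Y" "!!x. x : carrier Y ==> p (i x) = x"
    unfolding SB.summand_def by blast
   obtain x where x: "x : carrier Y" "x ~= 0_Y" using SB.indecomposable_nonzero[OF LN Y(2)] by blast
   have ix: "i x : cvec V" using hom_closed[OF ip(1) x(1)] by simp
   have "i x = \<zero>\<^bsub>ext V\<^esub>" using cvec_zeroI[OF zero(1) ix] ph_closed[OF zero(1) _ ix] zero(2) by simp
   then have "p (i x) = 0_Y" using SB.hom_zero[OF EV LN ip(2)] by simp
   then show "EX M:md. indecomposable A M \<and> SB.summand Y (ext M)" using ip(3)[OF x(1)] x(2) by simp
  qed
 next
  case (indec V)
  then show ?case by blast
 next
  case (split V P Q i p j q)
  obtain i' p' j' q' where "SB.splits (ext V) (ext P) (ext Q) i' p' j' q'" using splits_ext[OF split(1-4)] by blast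
  from SB.indecomposable_summand_of_split[OF Y ext_left[OF split(1)] ext_left[OF split(2)] ext_left[OF split(3)] this]
  show ?case using split(5,6) by blast
 qed
 then show ?thesis using V(2) by blast
qed

text \<open>The projection onto a nonzero summand has an invertible coefficient, since it is not nilpotent.\<close>

lemma summand_projection_coefficient:
 assumes M: "M : md" "indecomposable A M" and Y: "Y : fd_mod K AK" "indecomposable AK Y"
  and ip: "i : mod_hom AK Y (ext M)" "p : mod_hom AK (ext M) Y" "!!x. x : carrier Y ==> p (i x) = x"
 shows "EX \<phi>:\<Phi>. EX r:mod_hom A M M. (ALL m:carrier M. r (cmp M M \<phi> (compose (cvec M) i p) m) = m) \<and>
  (ALL m:carrier M. cmp M M \<phi> (compose (cvec M) i p) (r m) = m)"
proof (rule ccontr)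
 assume no: "\<not> ?thesis"
 note LM = M_left[OF M(1)] and EM = ext_left[OF M(1)] and LN = SB.fd_mod_left[OF Y(1)]
 let ?e = "compose (cvec M) i p"
 have e: "?e : HK M M" using SB.compose_hom[OF ip(2,1) EM] by simp
 have "cmp M M \<phi> ?e : rad A M M" if p: "\<phi> : \<Phi>" for \<phi>
 proof (rule ccontr)
  assume "cmp M M \<phi> ?e \<notin> rad A M M"
  then have "bij_betw (cmp M M \<phi> ?e) (carrier M) (carrier M)"
   using SA.indecomposable_rad_or_bij[OF M cmp_hom[OF M(1) M(1) p e]] by blast
  then show False using SA.hom_inverse_ex[OF LM LM cmp_hom[OF M(1) M(1) p e]] no p by blast
 qed
 then obtain m where m: "ALL u:cvec M. (?e ^^ m) u = (%j. 0_K)" using rad_coefficients_nilpotent[OF M(1) e] by blast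
 obtain x where x: "x : carrier Y" "x ~= 0_Y" using SB.indecomposable_nonzero[OF LN Y(2)] by blast
 have ix: "i x : cvec M" using hom_closed[OF ip(1) x(1)] by simp
 have "?e (i x) = i x" using ix ip(3)[OF x(1)] by (simp add: compose_eq)
 then have "(?e ^^ m) (i x) = i x" by (induction m) simp_all
 then have "i x = \<zero>\<^bsub>ext M\<^esub>" using m ix by simp
 then have "p (i x) = 0_Y" using SB.hom_zero[OF EM LN ip(2)] by simp
 then show False using ip(3)[OF x(1)] x(2) by simp
qed

text \<open>If no arrow left \<open>Y\<close> towards the indecomposable summands of the extension of \<open>M'\<close>, the coefficients of
 \<open>f e\<close>, for the projection \<open>e\<close> onto \<open>Y\<close>, would lie in the square of the radical; one of them
 is \<open>f\<close> up to an automorphism.\<close>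

lemma arrow_from_summand:
 assumes M: "M : md" "indecomposable A M" and M': "M' : md" "indecomposable A M'"
  and arr: "\<not> rad A M M' <= rad2 kF A M M'"
  and Y: "Y : fd_mod K AK" "indecomposable AK Y" "SB.summand Y (ext M)"
 shows "EX N':fd_mod K AK. indecomposable AK N' \<and> SB.summand N' (ext M') \<and> \<not> rad AK Y N' <= rad2 K AK Y N'"
proof (rule ccontr)
 assume no: "\<not> ?thesis"
 note LM = M_left[OF M(1)] and LM' = M_left[OF M'(1)] and EM = ext_left[OF M(1)] and EM' = ext_left[OF M'(1)]
  and LN = SB.fd_mod_left[OF Y(1)]
 obtain f where f: "f : rad A M M'" "f \<notin> rad2 kF A M M'" using arr by blast
 obtain i p where ip: "i : mod_hom AK Y (ext M)" "p : mod_hom AK (ext M) Y" "!!x. x : carrier Y ==> p (i x) = x"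
  using Y(3) unfolding SB.summand_def by blast
 have sub: "rad AK Y (ext M') <= rad2 K AK Y (ext M')"
  by (rule SB.rad_subset_rad2_into[OF Y(1) ext_fd[OF M'(1)]]) (use no in blast)
 let ?F = "Fm M M' f" and ?e = "compose (cvec M) i p"
 note fh = SA.rad_hom[OF f(1)]
 have e: "?e : HK M M" using SB.compose_hom[OF ip(2,1) EM] by simp
 have "compose (carrier Y) ?F i : rad2 K AK Y (ext M')"
  using sub SB.rad_right[OF LN EM EM' Fm_rad_from[OF M(1) M'(1) f(1)] ip(1)] by blast
 then have "compose (carrier (ext M)) (compose (carrier Y) ?F i) p : rad2 K AK (ext M) (ext M')"
  by (rule SB.rad2_right[OF EM LN EM' ip(2)])
 moreover have "compose (carrier (ext M)) (compose (carrier Y) ?F i) p = compose (cvec M) ?F ?e"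
 proof -
  have "p u : carrier Y" if "u : cvec M" for u using hom_closed[OF ip(2)] that by simp
  then show ?thesis by (auto simp: compose_def intro!: restrict_ext)
 qed
 ultimately have r2: "compose (cvec M) ?F ?e : rad2 K AK (ext M) (ext M')" by simp
 obtain \<phi> r where ph: "\<phi> : \<Phi>" and r: "r : mod_hom A M M" "!!m. m : carrier M ==> cmp M M \<phi> ?e (r m) = m"
  using summand_projection_coefficient[OF M Y(1,2) ip] by blast
 have "compose (carrier M) f (cmp M M \<phi> ?e) : rad2 kF A M M'"
  using rad2_coefficients[OF M M' r2 ph] unfolding cmp_Fm_left[OF M(1) M'(1) fh M(1) ph e] .
 then have "compose (carrier M) (compose (carrier M) f (cmp M M \<phi> ?e)) r : rad2 kF A M M'"
  by (rule SA.rad2_right[OF LM LM LM' r(1)])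
 moreover have "compose (carrier M) (compose (carrier M) f (cmp M M \<phi> ?e)) r = f"
  by (rule extensionalityI[of _ "carrier M"]) (use hom_ext[OF fh] r hom_closed[OF r(1)] in "auto simp: compose_def")
 ultimately show False using f(2) by simp
qed

lemma arrow_to_summand:
 assumes M: "M : md" "indecomposable A M" and M': "M' : md" "indecomposable A M'"
  and arr: "\<not> rad A M M' <= rad2 kF A M M'"
  and Y: "Y : fd_mod K AK" "indecomposable AK Y" "SB.summand Y (ext M')"
 shows "EX N':fd_mod K AK. indecomposable AK N' \<and> SB.summand N' (ext M) \<and> \<not> rad AK N' Y <= rad2 K AK N' Y"
proof (rule ccontr)
 assume no: "\<not> ?thesis"
 note LM = M_left[OF M(1)] and LM' = M_left[OF M'(1)] and EM = ext_left[OF M(1)] and EM' = ext_left[OF M'(1)]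
  and LN = SB.fd_mod_left[OF Y(1)]
 obtain f where f: "f : rad A M M'" "f \<notin> rad2 kF A M M'" using arr by blast
 obtain i p where ip: "i : mod_hom AK Y (ext M')" "p : mod_hom AK (ext M') Y" "!!x. x : carrier Y ==> p (i x) = x"
  using Y(3) unfolding SB.summand_def by blast
 have sub: "rad AK (ext M) Y <= rad2 K AK (ext M) Y"
  by (rule SB.rad_subset_rad2_from[OF Y(1) ext_fd[OF M(1)]]) (use no in blast)
 let ?F = "Fm M M' f" and ?e = "compose (cvec M') i p"
 note fh = SA.rad_hom[OF f(1)]
 note Fh = Fm_hom[OF M(1) M'(1) fh]
 have "compose (carrier (ext M)) p ?F : rad2 K AK (ext M) Y"
  using sub SB.rad_left[OF EM EM' LN Fm_rad_from[OF M(1) M'(1) f(1)] ip(2)] by blast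
 then have "compose (carrier (ext M)) i (compose (carrier (ext M)) p ?F) : rad2 K AK (ext M) (ext M')"
  by (rule SB.rad2_left[OF EM LN EM' ip(1)])
 moreover have "compose (carrier (ext M)) i (compose (carrier (ext M)) p ?F) = compose (cvec M) ?e ?F"
  using HK_closed[OF Fh] by (auto simp: compose_def intro!: restrict_ext)
 ultimately have r2: "compose (cvec M) ?e ?F : rad2 K AK (ext M) (ext M')" by simp
 obtain \<phi> r where ph: "\<phi> : \<Phi>" and r: "r : mod_hom A M' M'" "!!m. m : carrier M' ==> r (cmp M' M' \<phi> ?e m) = m"
  using summand_projection_coefficient[OF M' Y(1,2) ip] by blast
 have "compose (carrier M) (cmp M' M' \<phi> ?e) f : rad2 kF A M M'"
  using rad2_coefficients[OF M M' r2 ph] unfolding cmp_Fm_right[OF M(1) M'(1) fh] .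
 then have "compose (carrier M) r (compose (carrier M) (cmp M' M' \<phi> ?e) f) : rad2 kF A M M'"
  by (rule SA.rad2_left[OF LM LM' LM' r(1)])
 moreover have "compose (carrier M) r (compose (carrier M) (cmp M' M' \<phi> ?e) f) = f"
  by (rule extensionalityI[of _ "carrier M"]) (use hom_ext[OF fh] r hom_closed[OF fh] in "auto simp: compose_def")
 ultimately show False using f(2) by simp
qed

end

section \<open>Connected components\<close>

lemma component_representatives:
 assumes "finite (connected_components (V, E))"
 shows "EX R. finite R \<and> R <= V \<and> (ALL x:V. EX r:R. (x, r) : (E \<union> E\<inverse>)\<^sup>*)"
proof -
 let ?T = "Restr ((E \<union> E\<inverse>)\<^sup>*) V"
 let ?R = "(%C. SOME y. y : C) ` connected_components (V, E)"
 have some: "(SOME y. y : ?T `` {x}) : ?T `` {x}" if "x : V" for x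
  by (rule someI[of _ x]) (use that in auto)
 have RV: "?R <= V" using some unfolding connected_components_def quotient_def by auto
 have ex: "EX r:?R. (x, r) : (E \<union> E\<inverse>)\<^sup>*" if x: "x : V" for x
 proof -
  have "?T `` {x} : connected_components (V, E)" unfolding connected_components_def quotient_def using x by auto
  then have "(SOME y. y : ?T `` {x}) : ?R" by (rule imageI)
  then show ?thesis using some[OF x] by (intro bexI[of _ "SOME y. y : ?T `` {x}"]) auto
 qed
 show ?thesis
  by (rule exI[of _ ?R], intro conjI ballI finite_imageI assms RV) (rule ex)
qed

lemma finite_components:
 assumes R: "finite R" and cover: "!!x. x : V ==> EX r:R. r : V \<and> (x, r) : (E \<union> E\<inverse>)\<^sup>*"
 shows "finite (connected_components (V, E))"
proof -
 let ?T = "Restr ((E \<union> E\<inverse>)\<^sup>*) V"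
 have sym: "sym ((E \<union> E\<inverse>)\<^sup>*)" by (rule sym_rtrancl[OF sym_Un_converse])
 have "connected_components (V, E) <= (%r. ?T `` {r}) ` R"
 proof
  fix C assume "C : connected_components (V, E)"
  then obtain x where x: "x : V" "C = ?T `` {x}" unfolding connected_components_def fst_conv snd_conv by (rule quotientE)
  obtain r where r: "r : R" "r : V" "(x, r) : (E \<union> E\<inverse>)\<^sup>*" using cover[OF x(1)] by (elim bexE conjE)
  have rx: "(r, x) : (E \<union> E\<inverse>)\<^sup>*" by (rule symD[OF sym r(3)])
  have "?T `` {x} = ?T `` {r}"
  proof (intro equalityI subsetI)
   show "y : ?T `` {r}" if "y : ?T `` {x}" for y using that r(2) rtrancl_trans[OF rx, of y] by simp
   show "y : ?T `` {x}" if "y : ?T `` {r}" for y using that x(1) rtrancl_trans[OF r(3), of y] by simp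
  qed
  then show "C : (%r. ?T `` {r}) ` R" unfolding x(2) by (rule image_eqI) (rule r(1))
 qed
 then show ?thesis by (rule finite_subset) (rule finite_imageI[OF R])
qed

context perfect_ext
begin

abbreviation "indA \<equiv> {M : md. indecomposable A M}"
abbreviation "indK \<equiv> {Y : fd_mod K AK. indecomposable AK Y}"
abbreviation "clsA \<equiv> iso_class kF A"
abbreviation "clsK \<equiv> iso_class K AK"

definition "arrA = {(clsA U, clsA V) | U V. U : indA \<and> V : indA \<and> \<not> rad A U V <= rad2 kF A U V}"
definition "arrK = {(clsK U, clsK V) | U V. U : indK \<and> V : indK \<and> \<not> rad AK U V <= rad2 K AK U V}"

lemma AR_quiver_A: "AR_quiver kF A = (clsA ` indA, arrA)"
proof -
 have "(carrier (Defs.Irr kF A U V) ~= {\<one>\<^bsub>Defs.Irr kF A U V\<^esub>}) = (\<not> rad A U V <= rad2 kF A U V)" if "U : md" "V : md" for U V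
  by (rule SA.irr_nonzero_iff[OF M_left[OF that(1)] M_left[OF that(2)]])
 then show ?thesis unfolding AR_quiver_def arrA_def Let_def
  by (intro arg_cong2[where f = Pair] refl Collect_cong ex_cong1 conj_cong) simp_all
qed

lemma AR_quiver_K: "AR_quiver K AK = (clsK ` indK, arrK)"
proof -
 have "(carrier (Defs.Irr K AK U V) ~= {\<one>\<^bsub>Defs.Irr K AK U V\<^esub>}) = (\<not> rad AK U V <= rad2 K AK U V)"
  if "U : fd_mod K AK" "V : fd_mod K AK" for U V
  by (rule SB.irr_nonzero_iff[OF SB.fd_mod_left[OF that(1)] SB.fd_mod_left[OF that(2)]])
 then show ?thesis unfolding AR_quiver_def arrK_def Let_def
  by (intro arg_cong2[where f = Pair] refl Collect_cong ex_cong1 conj_cong) simp_all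
qed

text \<open>Arrows are lifted one at a time. The claim is made for all modules in the class \<open>c\<close>, because two
 consecutive arrows meet in a class, not in a module.\<close>

lemma walk_lift:
 assumes M: "M : indA" and Y: "Y : indK" "SB.summand Y (ext M)"
  and w: "(clsA M, c) : (arrA \<union> arrA\<inverse>)\<^sup>*"
 shows "ALL M':indA. clsA M' = c --> (EX N':indK. SB.summand N' (ext M') \<and> (clsK Y, clsK N') : (arrK \<union> arrK\<inverse>)\<^sup>*)"
 using w
proof (induction rule: rtrancl_induct)
 have trans: "SB.summand N' (ext M'')" if "N' : indK" "SB.summand N' (ext M')" "M' : indA" "M'' : indA" "clsA M'' = clsA M'" for N' M' M''
 proof -
  have m: "M' : md" "M'' : md" using that by simp_all
  have "SA.summand M' M''" by (rule SA.iso_class_eq_summand[OF m that(5)[symmetric]])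
  then have "SB.summand (ext M') (ext M'')" by (rule summand_ext[OF m])
  then show ?thesis using SB.summand_trans[OF SB.fd_mod_left ext_left[OF m(2)] that(2)] that(1) by blast
 qed
 {
  case base
  show ?case using trans[OF Y M] Y(1) by blast
 next
  case (step c d)
  show ?case
  proof (intro ballI impI)
   fix M' assume M': "M' : indA" "clsA M' = d"
   from step.hyps(2) consider "(c, d) : arrA" | "(d, c) : arrA" by blast
   then show "EX N':indK. SB.summand N' (ext M') \<and> (clsK Y, clsK N') : (arrK \<union> arrK\<inverse>)\<^sup>*"
   proof cases
    case 1
    then obtain U V where UV: "c = clsA U" "d = clsA V" "U : indA" "V : indA" "\<not> rad A U V <= rad2 kF A U V" unfolding arrA_def by blast
    obtain N1 where N1: "N1 : indK" "SB.summand N1 (ext U)" "(clsK Y, clsK N1) : (arrK \<union> arrK\<inverse>)\<^sup>*"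
     using step.IH UV(1,3) by blast
    have u: "U : md" "indecomposable A U" "V : md" "indecomposable A V" "N1 : fd_mod K AK" "indecomposable AK N1" using UV(3,4) N1(1) by simp_all
    obtain N2 where N2: "N2 : fd_mod K AK" "indecomposable AK N2" "SB.summand N2 (ext V)" "\<not> rad AK N1 N2 <= rad2 K AK N1 N2"
     using arrow_from_summand[OF u(1-4) UV(5) u(5,6) N1(2)] by blast
    then have "(clsK N1, clsK N2) : arrK" unfolding arrK_def using N1(1) by blast
    then have "(clsK Y, clsK N2) : (arrK \<union> arrK\<inverse>)\<^sup>*" using N1(3) by (blast intro: rtrancl.rtrancl_into_rtrancl)
    then show ?thesis using trans[of N2 V M'] N2 UV(2,4) M' by blast
   next
    case 2
    then obtain U V where UV: "d = clsA U" "c = clsA V" "U : indA" "V : indA" "\<not> rad A U V <= rad2 kF A U V" unfolding arrA_def by blast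
    obtain N1 where N1: "N1 : indK" "SB.summand N1 (ext V)" "(clsK Y, clsK N1) : (arrK \<union> arrK\<inverse>)\<^sup>*"
     using step.IH UV(2,4) by blast
    have u: "U : md" "indecomposable A U" "V : md" "indecomposable A V" "N1 : fd_mod K AK" "indecomposable AK N1" using UV(3,4) N1(1) by simp_all
    obtain N2 where N2: "N2 : fd_mod K AK" "indecomposable AK N2" "SB.summand N2 (ext U)" "\<not> rad AK N2 N1 <= rad2 K AK N2 N1"
     using arrow_to_summand[OF u(1-4) UV(5) u(5,6) N1(2)] by blast
    then have "(clsK N2, clsK N1) : arrK" unfolding arrK_def using N1(1) by blast
    then have "(clsK Y, clsK N2) : (arrK \<union> arrK\<inverse>)\<^sup>*" using N1(3) by (blast intro: rtrancl.rtrancl_into_rtrancl)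
    then show ?thesis using trans[of N2 U M'] N2 UV(1,3) M' by blast
   qed
  qed
 }
qed

lemma finite_components_extension:
 assumes "finite (connected_components (AR_quiver kF A))"
 shows "finite (connected_components (AR_quiver K AK))"
proof -
 obtain R where R': "finite R \<and> R <= clsA ` indA \<and> (ALL x:clsA ` indA. EX r:R. (x, r) : (arrA \<union> arrA\<inverse>)\<^sup>*)"
  by (rule exE[OF component_representatives[OF assms[unfolded AR_quiver_A]]])
 note R = conjunct1[OF R'] conjunct1[OF conjunct2[OF R']] bspec[OF conjunct2[OF conjunct2[OF R']]]
 define rep where "rep r = (SOME M. M : indA \<and> clsA M = r)" for r
 have rep: "rep r : indA \<and> clsA (rep r) = r" if r: "r : R" for r
 proof -
  from subsetD[OF R(2) r] obtain M where "r = clsA M" "M : indA" by (rule imageE)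
  then have "M : indA \<and> clsA M = r" by simp
  then show ?thesis unfolding rep_def by (rule someI)
 qed
 have repA: "rep r : md" if "r : R" for r using conjunct1[OF rep[OF that]] by simp
 have "EX fin. ALL r:R. finite (fin r) \<and> (ALL Y. Y : fd_mod K AK --> indecomposable AK Y --> SB.summand Y (ext (rep r)) --> clsK Y : fin r)"
  by (rule bchoice, rule ballI, rule SB.finitely_many_indecomposable_summands, rule ext_fd, rule repA)
 then obtain fin where fin': "ALL r:R. finite (fin r) \<and> (ALL Y. Y : fd_mod K AK --> indecomposable AK Y --> SB.summand Y (ext (rep r)) --> clsK Y : fin r)"
  by (rule exE)
 have fin: "finite (fin r)" "[|Y : indK; SB.summand Y (ext (rep r))|] ==> clsK Y : fin r" if "r : R" for r Y
  using bspec[OF fin' that] by simp_all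
 show ?thesis unfolding AR_quiver_K
 proof (rule finite_components)
  show "finite (\<Union>r\<in>R. fin r)" by (rule finite_UN_I[OF R(1) fin(1)])
  fix x assume "x : clsK ` indK"
  then obtain Y where Y: "x = clsK Y" "Y : indK" by (rule imageE)
  then have N': "Y : fd_mod K AK" "indecomposable AK Y" by simp_all
  obtain M where M: "M : md" "indecomposable A M" "SB.summand Y (ext M)"
   using indecomposable_summand_of_extension[OF N'] by blast
  have MA: "M : indA" using M by simp
  obtain r where r: "r : R" "(clsA M, r) : (arrA \<union> arrA\<inverse>)\<^sup>*" using R(3)[OF imageI[OF MA]] by (elim bexE)
  obtain N2 where N2: "N2 : indK" "SB.summand N2 (ext (rep r))" "(clsK Y, clsK N2) : (arrK \<union> arrK\<inverse>)\<^sup>*"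
   using walk_lift[OF MA Y(2) M(3) r(2), rule_format, OF conjunct1[OF rep[OF r(1)]] conjunct2[OF rep[OF r(1)]]]
   by (elim bexE conjE)
  have "clsK N2 : (\<Union>r\<in>R. fin r)" by (rule UN_I[OF r(1)]) (rule fin(2)[OF r(1) N2(1,2)])
  then show "EX r:(\<Union>r\<in>R. fin r). r : clsK ` indK \<and> (x, r) : (arrK \<union> arrK\<inverse>)\<^sup>*"
   unfolding Y(1) by (rule bexI[rotated]) (rule conjI[OF imageI[OF N2(1)] N2(3)])
 qed
qed

end

theorem proposition5p7:
  fixes K :: "'f ring" and k :: "'f set" and A :: "('f, 'a) module"
  assumes "algebraic_closure K k"
    and "perfect_field (K\<lparr>carrier := k\<rparr>)"
    and "fin_dim_algebra (K\<lparr>carrier := k\<rparr>) A"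
    and "finite (connected_components (AR_quiver (K\<lparr>carrier := k\<rparr>) A))"
  shows "finite (connected_components (AR_quiver K (scalar_extension K k A)))"
proof -
  interpret AC: algebraic_closure K k by (rule assms(1))
  have sub: "subfield k K" by (rule AC.subfield_axioms)
  interpret perfect_ext K k A
    by (intro perfect_ext.intro scalar_ext.intro scalar_ext_axioms.intro perfect_ext_axioms.intro)
       (rule AC.field_axioms assms(1-3) sub)+
  show ?thesis by (rule finite_components_extension[OF assms(4)])
qed

end
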